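(* Let $\alpha,\beta,\mu,\lambda\in\mathbb{R}$ with $\alpha\neq 0$, let $\sigma_0>0$, and let $a:\mathbb{R}\to\mathbb{R}$ be a smooth function (independent of time) such that (A1) there exists $\gamma>0$ with $a(x)\ge\gamma>0$ for all $x\in\mathbb{R}$ (fix such a $\gamma$); (A2) $\displaystyle\sum_{k=0}^{\infty}(k+1)^{\frac14}\frac{\sigma_0^k}{k!}\,\|\partial_x^k a\|_{L^\infty}<\infty$. Let $u_0\in G^{\sigma_0}(\mathbb{R})$ be real-valued. Then there exists a number $\tilde\sigma_0>0$, depending on $\|u_0\|_{G^{\sigma_0}}$ and $\sigma_0$ (and on the fixed equation data $\alpha,\beta,\mu,\lambda,a,\gamma$) but not on $T$, such that for any $T>0$ the initial value problem $$\partial_t u+\alpha\partial_x^5u+\beta\partial_x^3u+\mu\partial_x u^2+\lambda\partial_x u^3+a(x)u=0,\qquad u(x,0)=u_0(x),$$ has a solution $u\in C([0,T];G^{\tilde\sigma_0}(\mathbb{R}))$. Moreover, there is a constant $C>0$, independent of $t$ and $T$, such that $$\|u(t)\|_{G^{\tilde\sigma_0}}\le C e^{-\frac{\gamma t}{2}}\qquad\text{for all } t\ge 0 .$$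
   Context: For $\sigma>0$, $G^\sigma(\mathbb{R})$ is the space of functions with finite norm $\|f\|_{G^\sigma}=\left(\int_{\mathbb{R}}e^{2\sigma|\xi|}|\hat f(\xi)|^2\,d\xi\right)^{1/2}$, where $\hat f(\xi)=\int_{\mathbb{R}} f(x)e^{-ix\xi}\,dx$. A solution on $[0,T]$ in $C([0,T];G^{\sigma}(\mathbb{R}))$ is understood in the sense of the Duhamel formula $u(t)=S(t)u_0-\int_0^tS(t-t')\left[\mu\partial_x(u^2)+\lambda\partial_x(u^3)+au\right](t')\,dt'$, where $\widehat{S(t)f}(\xi)=e^{-it(\alpha\xi^5-\beta\xi^3)}\hat f(\xi)$. *)

theory Defs
  imports "HOL-Analysis.Analysis" "HOL-Probability.Essential_Supremum"
begin

text \<open>Functions on the line represent their classes modulo Lebesgue null sets: every notion below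
  depends on them only up to equality almost everywhere, except smoothness of the coefficient and
  of test functions.\<close>

definition L2 :: "(real \<Rightarrow> complex) set" where
  "L2 = {f \<in> borel_measurable lborel. integrable lborel (\<lambda>x. (norm (f x))\<^sup>2)}"

text \<open>Squared \<open>L\<^sup>2\<close>-distance, possibly infinite.\<close>

definition L2_sqdist :: "(real \<Rightarrow> complex) \<Rightarrow> (real \<Rightarrow> complex) \<Rightarrow> ennreal" where
  "L2_sqdist f g = (\<integral>\<^sup>+ x. ennreal ((norm (f x - g x))\<^sup>2) \<partial>lborel)"

text \<open>The integral \<open>\<integral> f(x) exp(-i x \<xi>) dx\<close> need not converge absolutely for square integrable
  \<open>f\<close>; it is read, as usual (Plancherel), as the \<open>L\<^sup>2\<close>-limit of the integrals over \<open>[-n, n]\<close>.\<close>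

definition has_fourier :: "(real \<Rightarrow> complex) \<Rightarrow> (real \<Rightarrow> complex) \<Rightarrow> bool" where
  "has_fourier f g \<longleftrightarrow> f \<in> L2 \<and> g \<in> L2 \<and>
     (\<lambda>n. L2_sqdist (\<lambda>\<xi>. LINT x:{-real n..real n}|lborel. f x * exp (- \<i> * of_real (x * \<xi>))) g)
       \<longlonglongrightarrow> 0"

definition fourier :: "(real \<Rightarrow> complex) \<Rightarrow> real \<Rightarrow> complex" where
  "fourier f = (SOME g. has_fourier f g)"

definition G_space :: "real \<Rightarrow> (real \<Rightarrow> complex) set" where
  "G_space \<sigma> = {f \<in> L2. integrable lborel (\<lambda>\<xi>. exp (2 * \<sigma> * \<bar>\<xi>\<bar>) * (norm (fourier f \<xi>))\<^sup>2)}"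

definition G_norm :: "real \<Rightarrow> (real \<Rightarrow> complex) \<Rightarrow> real" where
  "G_norm \<sigma> f = sqrt (LINT \<xi>|lborel. exp (2 * \<sigma> * \<bar>\<xi>\<bar>) * (norm (fourier f \<xi>))\<^sup>2)"

definition smooth :: "(real \<Rightarrow> real) \<Rightarrow> bool" where
  "smooth f \<longleftrightarrow> (\<forall>k. (deriv ^^ k) f differentiable_on UNIV)"

definition Linf_norm :: "(real \<Rightarrow> real) \<Rightarrow> ennreal" where
  "Linf_norm f = esssup lborel (\<lambda>x. ennreal \<bar>f x\<bar>)"

text \<open>The distributional derivative, for functions where it is square integrable.\<close>

definition partial_x :: "(real \<Rightarrow> complex) \<Rightarrow> real \<Rightarrow> complex" where
  "partial_x f = (SOME g. g \<in> L2 \<and>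
     (\<forall>\<phi>. smooth \<phi> \<and> (\<exists>r. \<forall>x. \<bar>x\<bar> > r \<longrightarrow> \<phi> x = 0) \<longrightarrow>
       (LINT x|lborel. f x * of_real (deriv \<phi> x)) = - (LINT x|lborel. g x * of_real (\<phi> x))))"

text \<open>The linear propagator \<open>S(t)\<close>.\<close>

definition S_op :: "real \<Rightarrow> real \<Rightarrow> real \<Rightarrow> (real \<Rightarrow> complex) \<Rightarrow> real \<Rightarrow> complex" where
  "S_op \<alpha> \<beta> t f =
     (SOME g. has_fourier g (\<lambda>\<xi>. exp (- \<i> * of_real (t * (\<alpha> * \<xi>^5 - \<beta> * \<xi>^3))) * fourier f \<xi>))"

text \<open>The integral over \<open>[s, t]\<close> of an \<open>L\<^sup>2\<close>-valued function: \<open>has_integral\<close> with convergence of the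
  Riemann sums taken in \<open>L\<^sup>2\<close>. For continuous \<open>L\<^sup>2\<close>-valued integrands, the only ones occurring in
  the Duhamel formula, this is the Riemann (and Bochner) integral.\<close>

definition has_L2_integral ::
    "(real \<Rightarrow> real \<Rightarrow> complex) \<Rightarrow> (real \<Rightarrow> complex) \<Rightarrow> real \<Rightarrow> real \<Rightarrow> bool" where
  "has_L2_integral F I s t \<longleftrightarrow> (\<forall>r\<in>{s..t}. F r \<in> L2) \<and> I \<in> L2 \<and>
     ((\<lambda>p. L2_sqdist (\<lambda>x. \<Sum>(r, K)\<in>p. measure lborel K *\<^sub>R F r x) I) \<longlongrightarrow> 0) (division_filter (cbox s t))"

definition C_G :: "real \<Rightarrow> real \<Rightarrow> (real \<Rightarrow> real \<Rightarrow> complex) set" where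
  "C_G T \<sigma> = {u. (\<forall>t\<in>{0..T}. u t \<in> G_space \<sigma>) \<and>
     (\<forall>t\<in>{0..T}. ((\<lambda>s. G_norm \<sigma> (\<lambda>x. u s x - u t x)) \<longlongrightarrow> 0) (at t within {0..T}))}"

text \<open>Solutions on \<open>[0, T]\<close> in \<open>C([0, T]; G\<^sup>\<sigma>)\<close> of
  \<open>u\<^sub>t + \<alpha> u\<^sub>x\<^sub>x\<^sub>x\<^sub>x\<^sub>x + \<beta> u\<^sub>x\<^sub>x\<^sub>x + \<mu> (u\<^sup>2)\<^sub>x + \<nu> (u\<^sup>3)\<^sub>x + a(x) u = 0\<close>, \<open>u(0) = u\<^sub>0\<close>,
  in the sense of the Duhamel formula; \<open>\<nu>\<close> stands for the coefficient \<open>\<lambda>\<close> of the cubic term.\<close>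

definition solution ::
    "real \<Rightarrow> real \<Rightarrow> real \<Rightarrow> real \<Rightarrow> (real \<Rightarrow> real) \<Rightarrow> (real \<Rightarrow> complex) \<Rightarrow> real \<Rightarrow> real \<Rightarrow>
     (real \<Rightarrow> real \<Rightarrow> complex) \<Rightarrow> bool" where
  "solution \<alpha> \<beta> \<mu> \<nu> a u0 \<sigma> T u \<longleftrightarrow> u \<in> C_G T \<sigma> \<and>
     (\<forall>t\<in>{0..T}. \<exists>I.
        has_L2_integral
          (\<lambda>t'. S_op \<alpha> \<beta> (t - t')
             (\<lambda>x. of_real \<mu> * partial_x (\<lambda>y. (u t' y)\<^sup>2) x
                + of_real \<nu> * partial_x (\<lambda>y. (u t' y)^3) x
                + of_real (a x) * u t' x))
          I 0 t \<and>
        (AE x in lborel. u t x = S_op \<alpha> \<beta> t u0 x - I x))"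

end

theory Submission
  imports Defs "HOL-Probability.Probability"
begin

text \<open>The equation is truncated to frequencies \<open>\<bar>\<xi>\<bar> \<le> N\<close>, which turns it into an ordinary differential equation
  in \<open>L\<^sup>2\<close>. The damping gives \<open>\<parallel>u\<parallel> \<le> exp(-\<gamma>t)\<parallel>u\<^sub>0\<parallel>\<close>; since \<open>\<alpha> \<noteq> 0\<close>, the Hamiltonian bounds
  \<open>\<parallel>u\<^sub>x\<^sub>x\<parallel>\<close> for all times, and interpolation makes \<open>\<parallel>u\<^sub>x\<parallel>\<close> and the suprema of \<open>u\<close> and \<open>u\<^sub>x\<close>
  decay exponentially.

  Analyticity is measured by \<open>Y = \<Sum>\<^sub>k (\<rho>\<^sup>k\<^sup>-\<^sup>2 (k+1)\<^sup>3/k! \<parallel>\<partial>\<^sup>k u\<parallel>)\<^sup>2\<close>. In \<open>Y'\<close> the quasilinear terms lose half a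
  derivative twice, that is, a factor \<open>k\<close>, multiplied by the supremum of \<open>u\<^sub>x\<close> plus a small multiple of
  \<open>sqrt Y\<close>.
  A radius with \<open>\<rho>' = -\<Lambda> exp(-\<delta>t) \<rho>\<close> compensates this loss and, because the exponential is integrable in time,
  stays above a positive number depending only on the norm of the data. The damping absorbs the remaining terms,
  so a continuity argument bounds \<open>Y\<close> uniformly in \<open>N\<close> and \<open>t\<close>.

  With these bounds the truncations form a Cauchy sequence in \<open>L\<^sup>2\<close>, locally uniformly in time, and the Duhamel
  formula passes to the limit. Finally \<open>\<parallel>u\<parallel>\<close> and the norm of radius \<open>2\<sigma>\<close> interpolate to the norm of radius
  \<open>\<sigma>\<close>, which yields continuity and the decay rate \<open>\<gamma>/2\<close>.\<close>

text \<open>Analyticity is measured by derivatives, not by the Fourier weight, because the Leibniz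
  rule and sup bounds from Agmon's inequality then treat the products and the variable coefficient
  alike. The dispersive operators have odd order, hence are skew and vanish from every energy
  estimate; they act only through the Hamiltonian and in the Duhamel formula.

  The obstacle is circularity: the lost derivatives are paid by a shrinking radius, and its total
  shrinkage must not depend on the bound being proved. This is why the second-order bound comes
  first. Sup norms of order at most one are then controlled independently of \<open>Y\<close>, and
  whatever \<open>Y\<close> contributes to the higher ones carries a spare power of
  \<open>\<rho>\<close>. So the constants can be chosen one after another: the second-order bound
  fixes \<open>\<Lambda>\<close> and the forcing, these fix the size of \<open>Y\<close>, and only
  then is the initial radius made small relative to that size. The shrinking gains nothing at orders
  up to two; there the loss is absorbed by the damping and by the decay in time of the low
  norms.\<close>

section \<open>Closure properties of the square integrable functions\<close>

lemma L2_measurable [measurable_dest]: "f \<in> L2 \<Longrightarrow> f \<in> borel_measurable borel"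
  by (simp add: L2_def)

lemma L2_integrable: "f \<in> L2 \<Longrightarrow> integrable lborel (\<lambda>x. (norm (f x))\<^sup>2)"
  by (simp add: L2_def)

lemma L2I_bound:
  assumes [measurable]: "f \<in> borel_measurable borel" and "integrable lborel g"
    and "\<And>x. (norm (f x))\<^sup>2 \<le> g x"
  shows "f \<in> L2"
proof -
  have "integrable lborel (\<lambda>x. (norm (f x))\<^sup>2)"
    by (rule Bochner_Integration.integrable_bound[OF assms(2)])
      (use assms(3) order_trans[OF assms(3) abs_ge_self] in auto)
  then show ?thesis by (simp add: L2_def)
qed

lemma L2I_mult:
  assumes "f \<in> L2" and [measurable]: "g \<in> borel_measurable borel"
    and "\<And>x. norm (g x) \<le> C * norm (f x)"
  shows "g \<in> L2"
proof (rule L2I_bound)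
  show "integrable lborel (\<lambda>x. C\<^sup>2 * (norm (f x))\<^sup>2)"
    using L2_integrable[OF assms(1)] by simp
  show "(norm (g x))\<^sup>2 \<le> C\<^sup>2 * (norm (f x))\<^sup>2" for x
    using power_mono[OF assms(3), of x 2] by (simp add: power_mult_distrib)
qed simp

lemma L2_add: "f \<in> L2 \<Longrightarrow> g \<in> L2 \<Longrightarrow> (\<lambda>x. f x + g x) \<in> L2"
proof (rule L2I_bound)
  assume f: "f \<in> L2" and g: "g \<in> L2"
  show "integrable lborel (\<lambda>x. 2 * (norm (f x))\<^sup>2 + 2 * (norm (g x))\<^sup>2)"
    using L2_integrable[OF f] L2_integrable[OF g] by simp
  show "(norm (f x + g x))\<^sup>2 \<le> 2 * (norm (f x))\<^sup>2 + 2 * (norm (g x))\<^sup>2" for x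
  proof -
    have "(norm (f x + g x))\<^sup>2 \<le> (norm (f x) + norm (g x))\<^sup>2"
      by (intro power_mono norm_triangle_ineq) simp
    also have "\<dots> \<le> 2 * (norm (f x))\<^sup>2 + 2 * (norm (g x))\<^sup>2"
      using zero_le_power2[of "norm (f x) - norm (g x)"] by (simp add: power2_eq_square algebra_simps)
    finally show ?thesis .
  qed
qed auto

lemma L2_cmult: "f \<in> L2 \<Longrightarrow> (\<lambda>x. c * f x) \<in> L2"
  by (rule L2I_mult[where f=f and C="norm c"]) (auto simp: norm_mult)

lemma L2_scaleR: "f \<in> L2 \<Longrightarrow> (\<lambda>x. r *\<^sub>R f x) \<in> L2" for r :: real
  by (rule L2I_mult[where f=f and C="\<bar>r\<bar>"]) auto

lemma L2_uminus: "f \<in> L2 \<Longrightarrow> (\<lambda>x. - f x) \<in> L2"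
  by (rule L2I_mult[where f=f and C=1]) auto

lemma L2_diff: "f \<in> L2 \<Longrightarrow> g \<in> L2 \<Longrightarrow> (\<lambda>x. f x - g x) \<in> L2"
  using L2_add[OF _ L2_uminus, of f g] by simp

lemma L2_zero: "(\<lambda>x. 0) \<in> L2"
  by (simp add: L2_def)

lemma L2_sum: "(\<And>i. i \<in> A \<Longrightarrow> f i \<in> L2) \<Longrightarrow> (\<lambda>x. \<Sum>i\<in>A. f i x) \<in> L2"
  by (induction A rule: infinite_finite_induct) (auto intro: L2_add L2_zero)

lemma L2_bounded_mult:
  assumes "f \<in> L2" and [measurable]: "m \<in> borel_measurable borel" and "\<And>x. norm (m x) \<le> C"
  shows "(\<lambda>x. m x * f x) \<in> L2"
proof (rule L2I_mult[OF assms(1), where C=C])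
  show "norm (m x * f x) \<le> C * norm (f x)" for x
    using assms(3)[of x] by (simp add: norm_mult mult_right_mono)
qed (use assms(1) in measurable)

lemma L2_AE:
  assumes "f \<in> L2" "AE x in lborel. g x = f x" "g \<in> borel_measurable borel"
  shows "g \<in> L2"
proof -
  have "integrable lborel (\<lambda>x. (norm (g x))\<^sup>2) \<longleftrightarrow> integrable lborel (\<lambda>x. (norm (f x))\<^sup>2)"
    using assms L2_measurable[OF assms(1)] by (intro integrable_cong_AE) auto
  then show ?thesis using assms by (simp add: L2_def)
qed

lemma L2_mult_integrable:
  assumes f: "f \<in> L2" and g: "g \<in> L2"
  shows "integrable lborel (\<lambda>x. f x * g x)"
proof (rule Bochner_Integration.integrable_bound)
  show "integrable lborel (\<lambda>x. (norm (f x))\<^sup>2 + (norm (g x))\<^sup>2)"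
    using L2_integrable[OF f] L2_integrable[OF g] by simp
  show "AE x in lborel. norm (f x * g x) \<le> norm ((norm (f x))\<^sup>2 + (norm (g x))\<^sup>2)"
  proof (intro AE_I2)
    fix x
    have "norm (f x) * norm (g x) * 2 \<le> (norm (f x))\<^sup>2 + (norm (g x))\<^sup>2"
      using zero_le_power2[of "norm (f x) - norm (g x)"] by (simp add: power2_eq_square algebra_simps)
    then have "norm (f x) * norm (g x) \<le> (norm (f x))\<^sup>2 + (norm (g x))\<^sup>2"
      by (smt (verit) mult_nonneg_nonneg norm_ge_zero)
    then show "norm (f x * g x) \<le> norm ((norm (f x))\<^sup>2 + (norm (g x))\<^sup>2)"
      by (simp add: norm_mult)
  qed
qed (use f g in measurable)

lemma cnj_measurable [measurable]: "cnj \<in> borel_measurable borel"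
  by (intro borel_measurable_continuous_onI continuous_intros)

lemma L2_cnj: "f \<in> L2 \<Longrightarrow> (\<lambda>x. cnj (f x)) \<in> L2"
  by (rule L2I_mult[where f=f and C=1]) auto

lemma L2_inner_integrable:
  assumes f: "f \<in> L2" and g: "g \<in> L2"
  shows "integrable lborel (\<lambda>x. f x \<bullet> g x)"
proof -
  have "integrable lborel (\<lambda>x. Re (f x * cnj (g x)))"
    by (intro integrable_Re L2_mult_integrable f L2_cnj g)
  then show ?thesis by (simp add: inner_complex_def)
qed

text \<open>Fatou's lemma for the squares. It needs only an almost everywhere limit and eventually
  bounded norms, which is what completeness, the Bessel inequality, the limit of the truncated
  solutions and the exponential weight each supply.\<close>

lemma L2_fatou:
  assumes f: "\<And>n. f n \<in> L2" and [measurable]: "g \<in> borel_measurable borel"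
    and lim: "AE x in lborel. (\<lambda>n. f n x) \<longlonglongrightarrow> g x"
    and bnd: "eventually (\<lambda>n. (LINT x|lborel. (norm (f n x))\<^sup>2) \<le> C) sequentially"
  shows "g \<in> L2" "(LINT x|lborel. (norm (g x))\<^sup>2) \<le> C"
proof -
  have [measurable]: "f n \<in> borel_measurable borel" for n using f by (rule L2_measurable)
  obtain n where "(LINT x|lborel. (norm (f n x))\<^sup>2) \<le> C"
    using eventually_happens[OF bnd] by auto
  moreover have "0 \<le> (LINT x|lborel. (norm (f n x))\<^sup>2)" by simp
  ultimately have C: "C \<ge> 0" by linarith
  have eq: "(\<integral>\<^sup>+ x. ennreal ((norm (f n x))\<^sup>2) \<partial>lborel) = ennreal (LINT x|lborel. (norm (f n x))\<^sup>2)" for n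
    by (intro nn_integral_eq_integral L2_integrable f) auto
  have "(\<integral>\<^sup>+ x. ennreal ((norm (g x))\<^sup>2) \<partial>lborel)
      = (\<integral>\<^sup>+ x. liminf (\<lambda>n. ennreal ((norm (f n x))\<^sup>2)) \<partial>lborel)"
  proof (intro nn_integral_cong_AE, use lim in eventually_elim)
    fix x assume "(\<lambda>n. f n x) \<longlonglongrightarrow> g x"
    then have "(\<lambda>n. ennreal ((norm (f n x))\<^sup>2)) \<longlonglongrightarrow> ennreal ((norm (g x))\<^sup>2)"
      by (intro tendsto_intros) auto
    then show "ennreal ((norm (g x))\<^sup>2) = liminf (\<lambda>n. ennreal ((norm (f n x))\<^sup>2))"
      by (rule lim_imp_Liminf[OF trivial_limit_sequentially, symmetric])
  qed
  also have "\<dots> \<le> liminf (\<lambda>n. \<integral>\<^sup>+ x. ennreal ((norm (f n x))\<^sup>2) \<partial>lborel)"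
    by (intro nn_integral_liminf) auto
  also have "\<dots> \<le> ennreal C"
  proof (rule Liminf_le)
    show "\<forall>\<^sub>F n in sequentially. (\<integral>\<^sup>+ x. ennreal ((norm (f n x))\<^sup>2) \<partial>lborel) \<le> ennreal C"
      using bnd by eventually_elim (simp add: eq ennreal_leI)
  qed simp
  finally have le: "(\<integral>\<^sup>+ x. ennreal ((norm (g x))\<^sup>2) \<partial>lborel) \<le> ennreal C" .
  then have int: "integrable lborel (\<lambda>x. (norm (g x))\<^sup>2)"
    by (intro integrableI_bounded) (auto simp: less_top[symmetric] top_unique intro: le_less_trans)
  then show "g \<in> L2" by (simp add: L2_def)
  show "(LINT x|lborel. (norm (g x))\<^sup>2) \<le> C"
    using le nn_integral_eq_integral[OF int] C by (simp add: ennreal_le_iff)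
qed

subsection \<open>The Hilbert space of square integrable functions\<close>

definition eq_L2 :: "(real \<Rightarrow> complex) \<Rightarrow> (real \<Rightarrow> complex) \<Rightarrow> bool" where
  "eq_L2 f g \<longleftrightarrow> f \<in> L2 \<and> g \<in> L2 \<and> (AE x in lborel. f x = g x)"

lemma part_equivp_eq_L2: "part_equivp eq_L2"
proof (rule part_equivpI)
  show "\<exists>x. eq_L2 x x" by (rule exI[of _ "\<lambda>x. 0"]) (simp add: eq_L2_def L2_zero)
  show "symp eq_L2" by (rule sympI) (auto simp: eq_L2_def)
  show "transp eq_L2" by (rule transpI) (auto simp: eq_L2_def elim: eventually_elim2)
qed

\<comment> \<open>The quotient is partial, so functions outside \<open>L2\<close> have no class. As
  a type, the space gets vector-valued derivatives, integrals and uniform limits from the type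
  classes instantiated below.\<close>
quotient_type l2 = "real \<Rightarrow> complex" / partial: eq_L2
  by (rule part_equivp_eq_L2)

lemma rep_L2 [simp]: "rep_l2 u \<in> L2"
  using Quotient_rep_reflp[OF Quotient_l2, of u] by (simp add: eq_L2_def)

lemma abs_rep [simp]: "abs_l2 (rep_l2 u) = u"
  by (rule Quotient_abs_rep[OF Quotient_l2])

lemma abs_eq_iff: "f \<in> L2 \<Longrightarrow> g \<in> L2 \<Longrightarrow> abs_l2 f = abs_l2 g \<longleftrightarrow> (AE x in lborel. f x = g x)"
  using Quotient_rel[OF Quotient_l2, of f g] by (auto simp: eq_L2_def)

lemma rep_abs: "f \<in> L2 \<Longrightarrow> AE x in lborel. rep_l2 (abs_l2 f) x = f x"
  using abs_eq_iff[of "rep_l2 (abs_l2 f)" f] by simp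

lemma rep_measurable [measurable]: "rep_l2 u \<in> borel_measurable borel"
  by (rule L2_measurable) simp

instantiation l2 :: real_vector
begin
lift_definition zero_l2 :: l2 is "\<lambda>x. 0" by (simp add: eq_L2_def L2_zero)
lift_definition plus_l2 :: "l2 \<Rightarrow> l2 \<Rightarrow> l2" is "\<lambda>f g x. f x + g x"
  by (auto simp: eq_L2_def L2_add elim: eventually_elim2)
lift_definition minus_l2 :: "l2 \<Rightarrow> l2 \<Rightarrow> l2" is "\<lambda>f g x. f x - g x"
  by (auto simp: eq_L2_def L2_diff elim: eventually_elim2)
lift_definition uminus_l2 :: "l2 \<Rightarrow> l2" is "\<lambda>f x. - f x"
  by (auto simp: eq_L2_def L2_uminus elim: eventually_mono)
lift_definition scaleR_l2 :: "real \<Rightarrow> l2 \<Rightarrow> l2" is "\<lambda>r f x. r *\<^sub>R f x"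
  by (auto simp: eq_L2_def L2_scaleR simp del: scaleR_conv_of_real elim: eventually_mono)
instance
  by (standard; transfer; simp add: eq_L2_def L2_add L2_zero L2_diff L2_uminus L2_scaleR algebra_simps)
end

lemma integral_inner_cong:
  assumes "eq_L2 f f'" "eq_L2 g g'"
  shows "(LINT x|lborel. f x \<bullet> g x) = (LINT x|lborel. f' x \<bullet> g' x)"
  using assms unfolding eq_L2_def
  by (intro integral_cong_AE) (auto dest!: L2_measurable elim: eventually_elim2)

text \<open>On complex numbers \<open>inner\<close> is \<open>Re (z * cnj w)\<close>, so this is the
  real part of the Hermitian product. That suffices for energy identities; where the full product
  matters, a second test with a factor \<open>\<i>\<close> is made.\<close>

instantiation l2 :: real_inner
begin
lift_definition inner_l2 :: "l2 \<Rightarrow> l2 \<Rightarrow> real" is "\<lambda>f g. LINT x|lborel. f x \<bullet> g x"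
  by (rule integral_inner_cong)
definition norm_l2 :: "l2 \<Rightarrow> real" where "norm_l2 u = sqrt (u \<bullet> u)"
definition sgn_l2 :: "l2 \<Rightarrow> l2" where "sgn_l2 u = u /\<^sub>R norm u"
definition dist_l2 :: "l2 \<Rightarrow> l2 \<Rightarrow> real" where "dist_l2 u v = norm (u - v)"
definition uniformity_l2 :: "(l2 \<times> l2) filter" where
  "uniformity_l2 = (INF e\<in>{0<..}. principal {(u, v). dist u v < e})"
definition open_l2 :: "l2 set \<Rightarrow> bool" where
  "open_l2 U \<longleftrightarrow> (\<forall>x\<in>U. \<forall>\<^sub>F (x', y) in uniformity. x' = x \<longrightarrow> y \<in> U)"
instance
proof
  fix x y z :: l2 and r :: real
  show "x \<bullet> y = y \<bullet> x" by transfer (simp add: inner_commute)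
  show "(x + y) \<bullet> z = x \<bullet> z + y \<bullet> z"
    by transfer (simp add: inner_add_left eq_L2_def L2_inner_integrable)
  show "(r *\<^sub>R x) \<bullet> y = r * (x \<bullet> y)"
    by transfer (simp add: eq_L2_def)
  show "0 \<le> x \<bullet> x" by transfer simp
  show "x \<bullet> x = 0 \<longleftrightarrow> x = 0"
  proof transfer
    fix f assume f: "eq_L2 f f"
    have "((LINT x|lborel. f x \<bullet> f x) = 0) \<longleftrightarrow> (AE x in lborel. f x \<bullet> f x = 0)"
      using f by (intro integral_nonneg_eq_0_iff_AE) (auto simp: eq_L2_def L2_inner_integrable)
    then show "((LINT x|lborel. f x \<bullet> f x) = 0) \<longleftrightarrow> eq_L2 f (\<lambda>x. 0)"
      using f by (simp add: eq_L2_def L2_zero)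
  qed
qed (simp_all add: norm_l2_def sgn_l2_def dist_l2_def uniformity_l2_def open_l2_def)
end

lemma abs_add: "f \<in> L2 \<Longrightarrow> g \<in> L2 \<Longrightarrow> abs_l2 (\<lambda>x. f x + g x) = abs_l2 f + abs_l2 g"
  by (simp add: plus_l2.abs_eq eq_L2_def)
lemma abs_diff: "f \<in> L2 \<Longrightarrow> g \<in> L2 \<Longrightarrow> abs_l2 (\<lambda>x. f x - g x) = abs_l2 f - abs_l2 g"
  by (simp add: minus_l2.abs_eq eq_L2_def)
lemma abs_scaleR: "f \<in> L2 \<Longrightarrow> abs_l2 (\<lambda>x. r *\<^sub>R f x) = r *\<^sub>R abs_l2 f"
  by (simp add: scaleR_l2.abs_eq eq_L2_def)
lemma abs_zero: "abs_l2 (\<lambda>x. 0) = 0"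
  by (simp add: zero_l2.abs_eq)

lemma abs_sum: "(\<And>i. i \<in> A \<Longrightarrow> f i \<in> L2) \<Longrightarrow> abs_l2 (\<lambda>x. \<Sum>i\<in>A. f i x) = (\<Sum>i\<in>A. abs_l2 (f i))"
  by (induction A rule: infinite_finite_induct) (auto simp: abs_zero abs_add L2_sum)

lemma inner_abs: "f \<in> L2 \<Longrightarrow> g \<in> L2 \<Longrightarrow> abs_l2 f \<bullet> abs_l2 g = (LINT x|lborel. f x \<bullet> g x)"
  by (simp add: inner_l2.abs_eq eq_L2_def)

lemma norm_abs_sq: "f \<in> L2 \<Longrightarrow> (norm (abs_l2 f))\<^sup>2 = (LINT x|lborel. (norm (f x))\<^sup>2)"
  by (simp add: power2_norm_eq_inner inner_abs)

lemma norm_abs: "f \<in> L2 \<Longrightarrow> norm (abs_l2 f) = sqrt (LINT x|lborel. (norm (f x))\<^sup>2)"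
  by (metis norm_abs_sq norm_ge_zero real_sqrt_abs abs_of_nonneg)

lemma norm_sq_rep: "(norm u)\<^sup>2 = (LINT x|lborel. (norm (rep_l2 u x))\<^sup>2)"
  using norm_abs_sq[of "rep_l2 u"] by simp

lemma norm_abs_le:
  assumes "f \<in> L2" "g \<in> L2" "\<And>x. norm (f x) \<le> C * norm (g x)" "C \<ge> 0"
  shows "norm (abs_l2 f) \<le> C * norm (abs_l2 g)"
proof (rule power2_le_imp_le)
  have "(norm (abs_l2 f))\<^sup>2 \<le> (LINT x|lborel. C\<^sup>2 * (norm (g x))\<^sup>2)"
    unfolding norm_abs_sq[OF assms(1)]
    using assms power_mono[OF assms(3), of _ 2]
    by (intro integral_mono) (auto simp: L2_integrable power_mult_distrib)
  then show "(norm (abs_l2 f))\<^sup>2 \<le> (C * norm (abs_l2 g))\<^sup>2"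
    by (simp add: norm_abs_sq[OF assms(2)] power_mult_distrib)
qed (use assms in simp)

lemma L2_sqdist_eq: "f \<in> L2 \<Longrightarrow> g \<in> L2 \<Longrightarrow> L2_sqdist f g = ennreal ((norm (abs_l2 f - abs_l2 g))\<^sup>2)"
  unfolding L2_sqdist_def
  by (simp add: abs_diff[symmetric] norm_abs_sq L2_diff nn_integral_eq_integral L2_integrable)

lemma L2_sqdist_tendsto_iff:
  assumes "eventually (\<lambda>n. f n \<in> L2) F" "g \<in> L2"
  shows "((\<lambda>n. L2_sqdist (f n) g) \<longlongrightarrow> 0) F \<longleftrightarrow> ((\<lambda>n. abs_l2 (f n)) \<longlongrightarrow> abs_l2 g) F"
proof -
  have "((\<lambda>n. L2_sqdist (f n) g) \<longlongrightarrow> 0) F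
      \<longleftrightarrow> ((\<lambda>n. ennreal ((norm (abs_l2 (f n) - abs_l2 g))\<^sup>2)) \<longlongrightarrow> ennreal 0) F"
    using assms by (intro filterlim_cong) (auto simp: L2_sqdist_eq elim: eventually_mono)
  also have "\<dots> \<longleftrightarrow> ((\<lambda>n. (norm (abs_l2 (f n) - abs_l2 g))\<^sup>2) \<longlongrightarrow> 0) F"
    by (intro tendsto_ennreal_iff) auto
  also have "\<dots> \<longleftrightarrow> ((\<lambda>n. norm (abs_l2 (f n) - abs_l2 g)) \<longlongrightarrow> 0) F"
    using tendsto_power[of "\<lambda>n. norm (abs_l2 (f n) - abs_l2 g)" 0 F 2]
      tendsto_real_sqrt[of "\<lambda>n. (norm (abs_l2 (f n) - abs_l2 g))\<^sup>2" 0 F] by auto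
  also have "\<dots> \<longleftrightarrow> ((\<lambda>n. abs_l2 (f n)) \<longlongrightarrow> abs_l2 g) F"
    by (simp add: tendsto_norm_zero_iff LIM_zero_iff)
  finally show ?thesis .
qed

text \<open>Taking classes commutes with Riemann sums, so the integral used to state the Duhamel
  formula is the gauge integral of an \<open>l2\<close>-valued function.\<close>

lemma has_L2_integral_iff:
  assumes F: "\<And>r. r \<in> {s..t} \<Longrightarrow> F r \<in> L2" and I: "I \<in> L2"
  shows "has_L2_integral F I s t \<longleftrightarrow> ((\<lambda>r. abs_l2 (F r)) has_integral abs_l2 I) {s..t}"
proof -
  let ?sum = "\<lambda>p x. \<Sum>(r, K)\<in>p. measure lborel K *\<^sub>R F r x"
  have *: "?sum p \<in> L2 \<and> abs_l2 (?sum p) = (\<Sum>(r, K)\<in>p. measure lborel K *\<^sub>R abs_l2 (F r))"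
    if "p tagged_division_of cbox s t" for p
  proof -
    have "F r \<in> L2" if "(r, K) \<in> p" for r K
      using F tag_in_interval[OF \<open>p tagged_division_of _\<close> that] by auto
    then show ?thesis
      unfolding split_def
      by (subst abs_sum) (auto intro!: L2_sum L2_scaleR sum.cong abs_scaleR simp del: scaleR_conv_of_real)
  qed
  have ev: "eventually (\<lambda>p. p tagged_division_of cbox s t) (division_filter (cbox s t))"
    by (rule eventually_division_filter_tagged_division)
  have "has_L2_integral F I s t \<longleftrightarrow> ((\<lambda>p. abs_l2 (?sum p)) \<longlongrightarrow> abs_l2 I) (division_filter (cbox s t))"
    unfolding has_L2_integral_def using F I
    by (subst L2_sqdist_tendsto_iff[OF eventually_mono[OF ev] I, of ?sum]) (use * in auto)
  also have "\<dots> \<longleftrightarrow> ((\<lambda>p. \<Sum>(r, K)\<in>p. measure lborel K *\<^sub>R abs_l2 (F r)) \<longlongrightarrow> abs_l2 I) (division_filter (cbox s t))"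
    using ev by (intro filterlim_cong) (auto elim!: eventually_mono simp: *)
  also have "\<dots> \<longleftrightarrow> ((\<lambda>r. abs_l2 (F r)) has_integral abs_l2 I) (cbox s t)"
    by (rule has_integral_cbox[symmetric])
  finally show ?thesis by simp
qed

text \<open>Riesz-Fischer. Along a subsequence with increments of norm below \<open>(1/2)^n\<close>
  the sums \<open>S k\<close> of absolute increments have norm at most 2; by monotone convergence
  their supremum is finite almost everywhere, so the subsequence converges pointwise.
  \<open>L2_fatou\<close> turns this into convergence in norm.\<close>

instance l2 :: complete_space
proof
  fix X :: "nat \<Rightarrow> l2" assume C: "Cauchy X"
  define F where "F n = rep_l2 (X n)" for n
  have F[simp]: "F n \<in> L2" for n by (simp add: F_def)
  have [measurable]: "F n \<in> borel_measurable borel" for n by (simp add: F_def)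
  have XF: "X n = abs_l2 (F n)" for n by (simp add: F_def)
  have "\<exists>r. strict_mono r \<and> (\<forall>n. \<forall>m\<ge>r n. norm (X m - X (r n)) < (1/2)^n)"
  proof -
    have "\<forall>n. \<exists>M. \<forall>m\<ge>M. \<forall>k\<ge>M. norm (X m - X k) < (1/2)^n"
      using C unfolding Cauchy_iff by simp
    then obtain M where M: "\<And>n m k. m \<ge> M n \<Longrightarrow> k \<ge> M n \<Longrightarrow> norm (X m - X k) < (1/2)^n"
      by metis
    define r where "r n = (\<Sum>i\<le>n. M i) + n" for n
    have "strict_mono r" by (rule strict_monoI_Suc) (simp add: r_def)
    moreover have "r n \<ge> M n" for n
      using member_le_sum[of n "{..n}" M] by (simp add: r_def)
    ultimately show ?thesis using M by (metis order_trans order_refl)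
  qed
  then obtain r where r: "strict_mono r" "\<And>n m. m \<ge> r n \<Longrightarrow> norm (X m - X (r n)) < (1/2)^n" by blast
  define S where "S k x = (\<Sum>n<k. norm (F (r (Suc n)) x - F (r n) x))" for k x
  have [measurable]: "S k \<in> borel_measurable borel" for k by (simp add: S_def[abs_def])
  have SL2: "(\<lambda>x. complex_of_real (S k x)) \<in> L2 \<and> norm (abs_l2 (\<lambda>x. complex_of_real (S k x))) \<le> 2" for k
  proof -
    let ?d = "\<lambda>n x. complex_of_real (norm (F (r (Suc n)) x - F (r n) x))"
    have d: "?d n \<in> L2" for n
      by (rule L2I_mult[where C=1 and f="\<lambda>x. F (r (Suc n)) x - F (r n) x"]) (auto intro: L2_diff)
    have nd: "norm (abs_l2 (?d n)) \<le> (1/2)^n" for n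
    proof -
      have "norm (abs_l2 (?d n)) = norm (X (r (Suc n)) - X (r n))"
        by (simp add: XF abs_diff[symmetric] norm_abs d L2_diff)
      also have "\<dots> \<le> (1/2)^n"
        using r(2)[of n "r (Suc n)"] strict_mono_less_eq[OF r(1), of n "Suc n"] by simp
      finally show ?thesis .
    qed
    have eq: "(\<lambda>x. complex_of_real (S k x)) = (\<lambda>x. \<Sum>n<k. ?d n x)" by (simp add: S_def)
    have "norm (abs_l2 (\<lambda>x. complex_of_real (S k x))) \<le> (\<Sum>n<k. (1/2)^n)"
      unfolding eq abs_sum[OF d] by (rule order_trans[OF norm_sum]) (intro sum_mono nd)
    also have "\<dots> \<le> (\<Sum>n. (1/2)^n)" by (intro sum_le_suminf) auto
    also have "\<dots> = 2" by (simp add: suminf_geometric)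
    finally show ?thesis unfolding eq using d by (auto intro: L2_sum)
  qed
  have "AE x in lborel. (SUP k. ennreal ((S k x)\<^sup>2)) \<noteq> \<infinity>"
  proof (rule nn_integral_PInf_AE)
    have mono: "incseq (\<lambda>k x. ennreal ((S k x)\<^sup>2))"
      by (intro incseq_SucI le_funI ennreal_leI power_mono) (auto simp: S_def sum_nonneg)
    have "(\<integral>\<^sup>+ x. (SUP k. ennreal ((S k x)\<^sup>2)) \<partial>lborel) = (SUP k. \<integral>\<^sup>+ x. ennreal ((S k x)\<^sup>2) \<partial>lborel)"
      by (rule nn_integral_monotone_convergence_SUP[OF mono]) simp
    also have "\<dots> \<le> ennreal 4"
    proof (rule SUP_least)
      fix k
      have "(\<integral>\<^sup>+ x. ennreal ((S k x)\<^sup>2) \<partial>lborel) = ennreal ((norm (abs_l2 (\<lambda>x. complex_of_real (S k x))))\<^sup>2)"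
        using SL2[of k] by (subst norm_abs_sq) (auto dest: L2_integrable simp: nn_integral_eq_integral)
      also have "\<dots> \<le> ennreal 4"
        using SL2[of k] power_mono[of "norm (abs_l2 (\<lambda>x. complex_of_real (S k x)))" 2 2]
        by (intro ennreal_leI) auto
      finally show "(\<integral>\<^sup>+ x. ennreal ((S k x)\<^sup>2) \<partial>lborel) \<le> ennreal 4" .
    qed
    finally show "(\<integral>\<^sup>+ x. (SUP k. ennreal ((S k x)\<^sup>2)) \<partial>lborel) \<noteq> \<infinity>" by (auto simp: top_unique)
  qed simp
  then have conv: "AE x in lborel. convergent (\<lambda>n. F (r n) x)"
  proof eventually_elim
    fix x assume "(SUP k. ennreal ((S k x)\<^sup>2)) \<noteq> \<infinity>"
    then obtain B where B: "(SUP k. ennreal ((S k x)\<^sup>2)) = ennreal B" "B \<ge> 0"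
      by (cases "SUP k. ennreal ((S k x)\<^sup>2)") auto
    have "S k x \<le> sqrt B" for k
    proof -
      have "ennreal ((S k x)\<^sup>2) \<le> ennreal B" unfolding B(1)[symmetric] by (rule SUP_upper) simp
      then show ?thesis using B(2) by (simp add: ennreal_le_iff real_le_rsqrt)
    qed
    then have "summable (\<lambda>n. norm (F (r (Suc n)) x - F (r n) x))"
      unfolding S_def by (intro summableI_nonneg_bounded[where x="sqrt B"]) auto
    then have "summable (\<lambda>n. F (r (Suc n)) x - F (r n) x)" by (rule summable_norm_cancel)
    then have "convergent (\<lambda>k. \<Sum>n<k. (F (r (Suc n)) x - F (r n) x))"
      by (simp add: summable_iff_convergent)
    then have "convergent (\<lambda>k. F (r k) x - F (r 0) x)"
      by (simp add: sum_lessThan_telescope[of "\<lambda>n. F (r n) x"])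
    from convergent_add[OF this convergent_const[of "F (r 0) x"]] show "convergent (\<lambda>n. F (r n) x)" by simp
  qed
  define g where "g x = lim (\<lambda>n. F (r n) x)" for x
  have [measurable]: "g \<in> borel_measurable borel" unfolding g_def by measurable
  have lim: "AE x in lborel. (\<lambda>n. F (r n) x) \<longlonglongrightarrow> g x"
    using conv by eventually_elim (simp add: g_def convergent_LIMSEQ_iff)
  have main: "(\<lambda>x. g x - F (r n) x) \<in> L2 \<and> (LINT x|lborel. (norm (g x - F (r n) x))\<^sup>2) \<le> ((1/2)^n)\<^sup>2" for n
  proof -
    have d: "(\<lambda>x. F (r m) x - F (r n) x) \<in> L2" for m by (simp add: L2_diff)
    have "eventually (\<lambda>m. (LINT x|lborel. (norm (F (r m) x - F (r n) x))\<^sup>2) \<le> ((1/2)^n)\<^sup>2) sequentially"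
      using eventually_ge_at_top[of n]
    proof eventually_elim
      fix m assume "n \<le> m"
      then have "norm (X (r m) - X (r n)) < (1/2)^n" using r by (simp add: strict_mono_less_eq)
      then show "(LINT x|lborel. (norm (F (r m) x - F (r n) x))\<^sup>2) \<le> ((1/2)^n)\<^sup>2"
        by (simp add: XF abs_diff[symmetric] norm_abs_sq[symmetric] L2_diff power_mono)
    qed
    moreover have "AE x in lborel. (\<lambda>m. F (r m) x - F (r n) x) \<longlonglongrightarrow> g x - F (r n) x"
      using lim by eventually_elim (intro tendsto_intros)
    ultimately show ?thesis using L2_fatou[OF d, where g="\<lambda>x. g x - F (r n) x"] by simp
  qed
  have gL2: "g \<in> L2" using L2_add[OF conjunct1[OF main[of 0]] F[of "r 0"]] by simp
  have "norm (X (r n) - abs_l2 g) \<le> (1/2)^n" for n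
  proof (rule power2_le_imp_le)
    show "(norm (X (r n) - abs_l2 g))\<^sup>2 \<le> ((1/2)^n)\<^sup>2"
      using main[of n] gL2 by (subst norm_minus_commute) (simp add: XF abs_diff[symmetric] norm_abs_sq)
  qed simp
  then have "(\<lambda>n. X (r n)) \<longlonglongrightarrow> abs_l2 g"
    by - (rule LIM_zero_cancel, rule Lim_null_comparison[OF always_eventually[OF allI]
        LIMSEQ_power_zero[of "1/2 :: real"]], auto)
  then have "(X \<circ> r) \<longlonglongrightarrow> abs_l2 g" by (simp add: comp_def)
  then have "X \<longlonglongrightarrow> abs_l2 g" by (rule Cauchy_converges_subseq[OF C r(1)])
  then show "convergent X" by (rule convergentI)
qed

instance l2 :: banach ..

text \<open>Dominated convergence in norm. The pointwise limit inherits the majorant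
  \<open>g\<close>, so the squared differences are dominated by \<open>4 * g^2\<close>.\<close>

lemma L2_dominated:
  assumes [measurable]: "\<And>n. f n \<in> borel_measurable borel" "h \<in> borel_measurable borel"
    and g: "integrable lborel (\<lambda>x. (g x :: real)\<^sup>2)"
    and lim: "AE x in lborel. (\<lambda>n. f n x) \<longlonglongrightarrow> h x"
    and bnd: "\<And>n x. norm (f n x) \<le> g x"
  shows "\<And>n. f n \<in> L2" "h \<in> L2" "(\<lambda>n. abs_l2 (f n)) \<longlonglongrightarrow> abs_l2 h"
proof -
  show fL: "f n \<in> L2" for n
    by (rule L2I_bound[OF _ g]) (auto intro: power_mono bnd)
  have "(LINT x|lborel. (norm (f n x))\<^sup>2) \<le> (LINT x|lborel. (g x)\<^sup>2)" for n
    by (intro integral_mono L2_integrable fL g power_mono bnd) simp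
  then show hL: "h \<in> L2"
    by (intro L2_fatou(1)[OF fL assms(2) lim always_eventually[OF allI]])
  have hb: "AE x in lborel. norm (h x) \<le> g x"
    using lim by eventually_elim (rule tendsto_upperbound[OF tendsto_norm], auto simp: bnd)
  have "(\<lambda>n. LINT x|lborel. (norm (f n x - h x))\<^sup>2) \<longlonglongrightarrow> (LINT x::real|lborel. 0)"
  proof (rule integral_dominated_convergence[where w="\<lambda>x. 4 * (g x)\<^sup>2"])
    show "integrable lborel (\<lambda>x. 4 * (g x)\<^sup>2)" using g by simp
    show "AE x in lborel. (\<lambda>n. (norm (f n x - h x))\<^sup>2) \<longlonglongrightarrow> 0"
      using lim
    proof eventually_elim
      fix x assume "(\<lambda>n. f n x) \<longlonglongrightarrow> h x"
      then have "(\<lambda>n. (norm (f n x - h x))\<^sup>2) \<longlonglongrightarrow> (norm (h x - h x))\<^sup>2"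
        by (intro tendsto_intros)
      then show "(\<lambda>n. (norm (f n x - h x))\<^sup>2) \<longlonglongrightarrow> 0" by simp
    qed
    show "AE x in lborel. norm ((norm (f n x - h x))\<^sup>2) \<le> 4 * (g x)\<^sup>2" for n
      using hb
    proof eventually_elim
      fix x assume "norm (h x) \<le> g x"
      then have "norm (f n x - h x) \<le> 2 * g x" using bnd[of n x] norm_triangle_ineq4[of "f n x" "h x"] by linarith
      then show "norm ((norm (f n x - h x))\<^sup>2) \<le> 4 * (g x)\<^sup>2"
        using power_mono[of "norm (f n x - h x)" "2 * g x" 2] by (simp add: power_mult_distrib)
    qed
  qed auto
  then have "(\<lambda>n. sqrt ((norm (abs_l2 (f n) - abs_l2 h))\<^sup>2)) \<longlonglongrightarrow> sqrt 0"
    by (intro tendsto_real_sqrt) (simp add: abs_diff[symmetric] norm_abs_sq fL hL L2_diff)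
  then show "(\<lambda>n. abs_l2 (f n)) \<longlonglongrightarrow> abs_l2 h"
    by (simp add: tendsto_norm_zero_iff LIM_zero_iff)
qed

subsection \<open>Multiplication operators, conjugation and reflection\<close>

definition bmul :: "(real \<Rightarrow> complex) \<Rightarrow> bool" where
  "bmul m \<longleftrightarrow> m \<in> borel_measurable borel \<and> (\<exists>C. \<forall>x. norm (m x) \<le> C)"

lemma bmulI: "m \<in> borel_measurable borel \<Longrightarrow> (\<And>x. norm (m x) \<le> C) \<Longrightarrow> bmul m"
  by (auto simp: bmul_def)

lemma bmul_const [simp]: "bmul (\<lambda>x. c)"
  by (rule bmulI[where C="norm c"]) auto

lemma bmul_mult: "bmul m \<Longrightarrow> bmul m' \<Longrightarrow> bmul (\<lambda>x. m x * m' x)"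
  unfolding bmul_def
proof safe
  fix C D assume C: "\<forall>x. norm (m x) \<le> C" and D: "\<forall>x. norm (m' x) \<le> D"
  show "\<exists>E. \<forall>x. norm (m x * m' x) \<le> E"
    by (rule exI[of _ "C * D"]) (use C D in \<open>auto simp: norm_mult intro!: mult_mono order_trans[OF norm_ge_zero]\<close>)
qed auto

lemma bmul_add: "bmul m \<Longrightarrow> bmul m' \<Longrightarrow> bmul (\<lambda>x. m x + m' x)"
  unfolding bmul_def
proof safe
  fix C D assume C: "\<forall>x. norm (m x) \<le> C" and D: "\<forall>x. norm (m' x) \<le> D"
  show "\<exists>E. \<forall>x. norm (m x + m' x) \<le> E"
    by (rule exI[of _ "C + D"]) (use C D in \<open>auto intro!: norm_triangle_le add_mono\<close>)
qed auto

lemma bmul_cnj: "bmul m \<Longrightarrow> bmul (\<lambda>x. cnj (m x))"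
  by (auto simp: bmul_def)

lemma bmul_reflect: "bmul m \<Longrightarrow> bmul (\<lambda>x. m (- x))"
  by (auto simp: bmul_def)

lemma bmul_L2: "bmul m \<Longrightarrow> f \<in> L2 \<Longrightarrow> (\<lambda>x. m x * f x) \<in> L2"
  by (auto simp: bmul_def intro: L2_bounded_mult)

text \<open>The value zero for inadmissible multipliers makes \<open>mul m\<close> a bounded linear
  operator for every \<open>m\<close>, so linearity carries no side condition.\<close>

lift_definition mul :: "(real \<Rightarrow> complex) \<Rightarrow> l2 \<Rightarrow> l2"
  is "\<lambda>m f. if bmul m then (\<lambda>x. m x * f x) else (\<lambda>x. 0)"
  by (auto simp: eq_L2_def L2_zero bmul_L2 elim: eventually_mono)

lemma mul_abs: "bmul m \<Longrightarrow> f \<in> L2 \<Longrightarrow> mul m (abs_l2 f) = abs_l2 (\<lambda>x. m x * f x)"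
  by (simp add: mul.abs_eq eq_L2_def)

lemma mul_rep: "bmul m \<Longrightarrow> mul m u = abs_l2 (\<lambda>x. m x * rep_l2 u x)"
  using mul_abs[of m "rep_l2 u"] by simp

lemma mul_add_right: "mul m (u + v) = mul m u + mul m v"
  by transfer (auto simp: eq_L2_def L2_zero L2_add bmul_L2 algebra_simps)

lemma mul_scaleR_right: "mul m (r *\<^sub>R u) = r *\<^sub>R mul m u"
  by transfer (auto simp: eq_L2_def L2_zero L2_scaleR bmul_L2 simp del: scaleR_conv_of_real)

lemma mul_add_left: "bmul m \<Longrightarrow> bmul m' \<Longrightarrow> mul (\<lambda>x. m x + m' x) u = mul m u + mul m' u"
  by (simp add: mul_rep bmul_add abs_add[symmetric] bmul_L2 algebra_simps)

lemma mul_mul: "bmul m \<Longrightarrow> bmul m' \<Longrightarrow> mul m (mul m' u) = mul (\<lambda>x. m x * m' x) u"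
  by (simp add: mul_rep[of m' u] mul_rep[of "\<lambda>x. m x * m' x" u] bmul_mult mul_abs bmul_L2 algebra_simps)

lemma mul_norm: 
  assumes "m \<in> borel_measurable borel" "\<And>x. norm (m x) \<le> C"
  shows "norm (mul m u) \<le> C * norm u"
proof -
  have C: "C \<ge> 0" using assms(2)[of 0] norm_ge_zero order_trans by blast
  have "norm (abs_l2 (\<lambda>x. m x * rep_l2 u x)) \<le> C * norm (abs_l2 (rep_l2 u))"
    by (intro norm_abs_le bmul_L2 bmulI[of m C] assms C) (auto simp: norm_mult assms mult_right_mono)
  then show ?thesis by (simp add: mul_rep bmulI[OF assms])
qed

lemma mul_one [simp]: "mul (\<lambda>x. 1) u = u"
  by (simp add: mul_rep)

lemma bounded_linear_mul: "bounded_linear (mul m)"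
proof (cases "bmul m")
  case True
  then obtain C where "\<And>x. norm (m x) \<le> C" "m \<in> borel_measurable borel" by (auto simp: bmul_def)
  then show ?thesis
    by (intro bounded_linear_intro[where K=C])
      (auto simp: mul_add_right mul_scaleR_right mult.commute[of _ C] intro: mul_norm)
next
  case False
  then have "mul m = (\<lambda>u. 0)" by (intro ext) (transfer, simp add: eq_L2_def L2_zero)
  then show ?thesis by simp
qed

lemma inner_mul_left:
  assumes "bmul m"
  shows "mul m u \<bullet> v = u \<bullet> mul (\<lambda>x. cnj (m x)) v"
proof -
  have "(m x * a) \<bullet> b = a \<bullet> (cnj (m x) * b)" for x a b
    by (simp add: inner_complex_def algebra_simps)
  then show ?thesis
    using assms by (transfer fixing: m) (simp add: bmul_cnj)
qed

lemma AE_reflect: "AE x in lborel. P x \<Longrightarrow> AE x in lborel. P (- x :: real)"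
proof -
  assume P: "AE x in lborel. P x"
  then obtain N where N: "{x. \<not> P x} \<subseteq> N" "N \<in> null_sets lborel" by (auto simp: eventually_ae_filter)
  have "AE x in distr lborel borel (uminus :: real \<Rightarrow> real). x \<notin> N"
    unfolding lborel_distr_uminus using N(2) by (rule AE_not_in)
  then have "AE x in lborel. - x \<notin> N" using N(2) by (subst (asm) AE_distr_iff) auto
  then show ?thesis by eventually_elim (use N in auto)
qed

lemma integral_reflect: "(LINT x|lborel. f (- x)) = (LINT x|lborel. f (x::real))" for f :: "real \<Rightarrow> 'a :: {banach, second_countable_topology}"
  using lborel_integral_real_affine[of "-1" f 0] by simp

lemma L2_reflect: "f \<in> L2 \<Longrightarrow> (\<lambda>x. f (- x)) \<in> L2"
  using lborel_integrable_real_affine[of "\<lambda>x. (norm (f x))\<^sup>2" "-1" 0] by (auto simp: L2_def)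

lift_definition rf :: "l2 \<Rightarrow> l2" is "\<lambda>f x. f (- x)"
  unfolding eq_L2_def by (intro conjI L2_reflect; elim conjE; (drule AE_reflect)?; assumption)

lift_definition cj :: "l2 \<Rightarrow> l2" is "\<lambda>f x. cnj (f x)"
  by (auto simp: eq_L2_def L2_cnj elim: eventually_mono)

lemma rf_abs: "f \<in> L2 \<Longrightarrow> rf (abs_l2 f) = abs_l2 (\<lambda>x. f (- x))"
  by (simp add: rf.abs_eq eq_L2_def)

lemma cj_abs: "f \<in> L2 \<Longrightarrow> cj (abs_l2 f) = abs_l2 (\<lambda>x. cnj (f x))"
  by (simp add: cj.abs_eq eq_L2_def)

lemma norm_rf [simp]: "norm (rf u) = norm u"
  unfolding norm_eq_sqrt_inner by (transfer, simp add: integral_reflect[of "\<lambda>x. _ x \<bullet> _ x"])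

lemma norm_cj [simp]: "norm (cj u) = norm u"
  unfolding norm_eq_sqrt_inner by (transfer, simp add: inner_complex_def)

lemma bounded_linear_rf: "bounded_linear rf"
proof (rule bounded_linear_intro[where K=1])
  show "rf (u + v) = rf u + rf v" for u v
    by transfer (simp add: eq_L2_def L2_reflect L2_add)
  show "rf (r *\<^sub>R u) = r *\<^sub>R rf u" for u r
    by transfer (simp add: eq_L2_def L2_reflect L2_scaleR del: scaleR_conv_of_real)
qed simp

lemma bounded_linear_cj: "bounded_linear cj"
proof (rule bounded_linear_intro[where K=1])
  show "cj (u + v) = cj u + cj v" for u v
    by transfer (simp add: eq_L2_def L2_cnj L2_add)
  show "cj (r *\<^sub>R u) = r *\<^sub>R cj u" for u r
    by transfer (simp add: eq_L2_def L2_cnj L2_scaleR del: scaleR_conv_of_real)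
qed simp

lemma cj_cj [simp]: "cj (cj u) = u" by transfer (simp add: eq_L2_def)

lemma cj_mul: "bmul m \<Longrightarrow> cj (mul m u) = mul (\<lambda>x. cnj (m x)) (cj u)"
  by (transfer fixing: m) (auto simp: eq_L2_def bmul_cnj bmul_L2 L2_cnj)

lemma rf_mul: "bmul m \<Longrightarrow> rf (mul m u) = mul (\<lambda>x. m (- x)) (rf u)"
  by (transfer fixing: m) (auto simp: eq_L2_def bmul_reflect bmul_L2 L2_reflect)

subsection \<open>Square integrable functions with vanishing integrals\<close>

definition ind :: "real \<Rightarrow> real \<Rightarrow> real \<Rightarrow> complex" where
  "ind a b x = indicator {a..b} x"

lemma ind_measurable [measurable]: "ind a b \<in> borel_measurable borel"
  unfolding ind_def by measurable

lemma ind_integrable: "integrable lborel (ind a b)"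
proof -
  have "integrable lborel (\<lambda>x. complex_of_real (indicator {a..b} x))"
    by (intro integrable_of_real) (simp add: emeasure_lborel_Icc_eq)
  moreover have "complex_of_real (indicator {a..b} x) = ind a b x" for x by (auto simp: ind_def indicator_def)
  ultimately show ?thesis by simp
qed

lemma ind_L2: "ind a b \<in> L2"
proof (rule L2I_bound)
  show "integrable lborel (\<lambda>x. indicator {a..b} x :: real)" by (simp add: emeasure_lborel_Icc_eq)
qed (auto simp: ind_def indicator_def)

lemma bmul_ind: "bmul (ind a b)"
  by (rule bmulI[where C=1]) (auto simp: ind_def indicator_def)

lemma ind_mult_L2: "f \<in> L2 \<Longrightarrow> (\<lambda>x. ind a b x * f x) \<in> L2"
  by (intro bmul_L2 bmul_ind)

lemma ind_mult_integrable: "f \<in> L2 \<Longrightarrow> integrable lborel (\<lambda>x. ind a b x * f x)"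
  by (intro L2_mult_integrable ind_L2)

text \<open>The half-lines \<open>{..a}\<close> are an intersection-stable generator of the Borel
  sets, so vanishing integrals over intervals propagate to all Borel sets. Truncation to
  \<open>[-n, n]\<close> makes the function integrable first.\<close>

lemma L2_null:
  assumes f: "f \<in> L2" and null: "\<And>a b. (LINT x|lborel. ind a b x * f x) = 0"
  shows "AE x in lborel. f x = 0"
proof -
  have "AE x in lborel. ind (- real n) (real n) x * f x = 0" for n :: nat
  proof (rule sigma_finite_measure.density_zero[OF lborel.sigma_finite_measure_axioms])
    let ?h = "\<lambda>x. ind (- real n) (real n) x * f x"
    show h: "integrable lborel ?h" by (rule ind_mult_integrable[OF f])
    have si: "set_integrable lborel A ?h" if "A \<in> sets borel" for A
      unfolding set_integrable_def using that h by (intro integrable_mult_indicator) auto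
    fix A :: "real set" assume "A \<in> sets lborel"
    then have A: "A \<in> sigma_sets UNIV (range (\<lambda>a. {..a}))"
      by (simp add: borel_eq_atMost)
    have "Int_stable (range (\<lambda>a::real. {..a}))" "range (\<lambda>a::real. {..a}) \<subseteq> Pow UNIV"
      by (auto simp: Int_stable_def)
    from this A show "set_lebesgue_integral lborel A ?h = 0"
    proof (induction rule: sigma_sets_induct_disjoint)
      case (basic A)
      then obtain a where A: "A = {..a}" by auto
      have "indicator A x *\<^sub>R ?h x = ind (- real n) (min a (real n)) x * f x" for x
        by (auto simp: A ind_def indicator_def)
      then show ?case by (simp add: set_lebesgue_integral_def null)
    next
      case empty
      then show ?case by (simp add: set_lebesgue_integral_def)
    next
      case (compl A)
      then have [measurable]: "A \<in> sets borel" by (simp add: borel_eq_atMost)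
      have "set_lebesgue_integral lborel (UNIV - A) ?h
          = (LINT x|lborel. ?h x) - set_lebesgue_integral lborel A ?h"
      proof -
        have "indicator (UNIV - A) x *\<^sub>R ?h x = ?h x - indicator A x *\<^sub>R ?h x" for x
          by (simp add: indicator_def)
        then show ?thesis
          unfolding set_lebesgue_integral_def using h si[of A]
          by (simp only: Bochner_Integration.integral_diff set_integrable_def compl) simp
      qed
      then show ?case using compl null by simp
    next
      case (union A)
      then have [measurable]: "A i \<in> sets borel" for i by (auto simp: borel_eq_atMost)
      have "set_lebesgue_integral lborel (\<Union>i. A i) ?h = (\<Sum>i. set_lebesgue_integral lborel (A i) ?h)"
        using union(1) by (intro lebesgue_integral_countable_add si) (auto simp: disjoint_family_on_def)
      then show ?case using union by simp
    qed
  qed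
  then have "AE x in lborel. \<forall>n::nat. ind (- real n) (real n) x * f x = 0"
    by (subst AE_all_countable) blast
  then show ?thesis
  proof eventually_elim
    fix x assume *: "\<forall>n::nat. ind (- real n) (real n) x * f x = 0"
    obtain n :: nat where "\<bar>x\<bar> \<le> real n" using real_arch_simple by blast
    then have "ind (- real n) (real n) x = 1" by (auto simp: ind_def indicator_def)
    then show "f x = 0" using * by (metis mult_1)
  qed
qed

text \<open>The product is only a real part, so the indicators see the real part of the integrals
  and their multiples by \<open>\<i>\<close> the imaginary part.\<close>

lemma l2_eq_zeroI:
  assumes "\<And>a b. u \<bullet> abs_l2 (ind a b) = 0" "\<And>a b. u \<bullet> abs_l2 (\<lambda>x. \<i> * ind a b x) = 0"
  shows "u = 0"
proof -
  have "(LINT x|lborel. ind a b x * rep_l2 u x) = 0" for a b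
  proof (rule complex_eqI)
    have i: "integrable lborel (\<lambda>x. ind a b x * rep_l2 u x)" by (rule ind_mult_integrable) simp
    have "u \<bullet> abs_l2 (ind a b) = (LINT x|lborel. Re (ind a b x * rep_l2 u x))"
      using inner_abs[of "rep_l2 u" "ind a b"] ind_L2
      by (auto simp: inner_complex_def ind_def indicator_def intro!: Bochner_Integration.integral_cong)
    then show "Re (LINT x|lborel. ind a b x * rep_l2 u x) = Re 0"
      using assms(1) i by (simp del: times_complex.sel)
    have "u \<bullet> abs_l2 (\<lambda>x. \<i> * ind a b x) = (LINT x|lborel. Im (ind a b x * rep_l2 u x))"
      using inner_abs[of "rep_l2 u" "\<lambda>x. \<i> * ind a b x"] L2_cmult[OF ind_L2]
      by (auto simp: inner_complex_def ind_def indicator_def intro!: Bochner_Integration.integral_cong)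
    then show "Im (LINT x|lborel. ind a b x * rep_l2 u x) = Im 0"
      using assms(2) i by (simp del: times_complex.sel)
  qed
  from L2_null[OF _ this] have "abs_l2 (rep_l2 u) = abs_l2 (\<lambda>x. 0)"
    by (subst abs_eq_iff) (auto simp: L2_zero)
  then show ?thesis by (simp add: abs_zero)
qed

subsection \<open>The Fourier transform\<close>

definition ft :: "(real \<Rightarrow> complex) \<Rightarrow> real \<Rightarrow> complex" where
  "ft f \<xi> = (LINT x|lborel. f x * exp (- \<i> * of_real (x * \<xi>)))"

lemma norm_exp_i [simp]: "norm (exp (- (\<i> * complex_of_real t))) = 1" "norm (exp (\<i> * complex_of_real t)) = 1"
  by (simp_all add: norm_exp_eq_Re)

lemma ft_integrable: "integrable lborel f \<Longrightarrow> integrable lborel (\<lambda>x. f x * exp (- \<i> * of_real (x * \<xi>)))"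
  by (rule Bochner_Integration.integrable_bound[of _ f]) (auto simp: norm_mult)

lemma ft_measurable [measurable]:
  assumes [measurable]: "f \<in> borel_measurable borel"
  shows "ft f \<in> borel_measurable borel"
  unfolding ft_def[abs_def] by measurable

lemma ft_bound: "integrable lborel f \<Longrightarrow> norm (ft f \<xi>) \<le> (LINT x|lborel. norm (f x))"
  unfolding ft_def by (rule order_trans[OF integral_norm_bound]) (simp add: norm_mult)

lemma ft_diff: "integrable lborel f \<Longrightarrow> integrable lborel g \<Longrightarrow> ft (\<lambda>x. f x - g x) \<xi> = ft f \<xi> - ft g \<xi>"
  unfolding ft_def using ft_integrable[of f \<xi>] ft_integrable[of g \<xi>]
  by (simp add: left_diff_distrib)

lemma ft_add: "integrable lborel f \<Longrightarrow> integrable lborel g \<Longrightarrow> ft (\<lambda>x. f x + g x) \<xi> = ft f \<xi> + ft g \<xi>"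
  unfolding ft_def using ft_integrable[of f \<xi>] ft_integrable[of g \<xi>]
  by (simp add: distrib_right)

lemma ft_cmult: "ft (\<lambda>x. c * f x) \<xi> = c * ft f \<xi>"
  unfolding ft_def by (simp add: mult.assoc)

lemma ft_cnj: "ft (\<lambda>x. cnj (f x)) \<xi> = cnj (ft f (- \<xi>))"
  unfolding ft_def by (subst Bochner_Integration.integral_cnj[symmetric]) (simp add: exp_cnj)

lemma ft_reflect: "ft (\<lambda>x. f (- x)) \<xi> = ft f (- \<xi>)"
  unfolding ft_def using integral_reflect[of "\<lambda>x. f x * exp (\<i> * of_real (x * \<xi>))"] by simp

text \<open>Rescaled characteristic function of the standard normal distribution. The transform of
  the weight is \<open>2 * pi\<close> times a normal density of width \<open>\<epsilon>\<close>, an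
  approximate identity as \<open>\<epsilon>\<close> tends to zero.\<close>

lemma gauss_ft:
  assumes "\<epsilon> > 0"
  shows "integrable lborel (\<lambda>\<xi>. exp (- (\<epsilon>\<^sup>2 * \<xi>\<^sup>2 / 2)))"
    "(LINT \<xi>|lborel. complex_of_real (exp (- (\<epsilon>\<^sup>2 * \<xi>\<^sup>2 / 2))) * exp (- \<i> * of_real (z * \<xi>)))
     = of_real (2 * pi * normal_density 0 \<epsilon> z)"
proof -
  have *: "(LINT x|lborel. std_normal_density x *\<^sub>R exp (\<i> * of_real (t * x))) = exp (- (t\<^sup>2) / 2)" for t
    using char_std_normal_distribution[THEN fun_cong, of t]
    by (simp add: char_def integral_density)
  have "integrable lborel std_normal_density" by simp
  from lborel_integrable_real_affine[OF this, of \<epsilon> 0] assms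
  have "integrable lborel (\<lambda>\<xi>. sqrt (2 * pi) * std_normal_density (\<epsilon> * \<xi>))" by auto
  then show "integrable lborel (\<lambda>\<xi>. exp (- (\<epsilon>\<^sup>2 * \<xi>\<^sup>2 / 2)))"
    by (simp add: std_normal_density_def power_mult_distrib)
  have "exp (- ((- z / \<epsilon>)\<^sup>2) / 2) = (LINT x|lborel. std_normal_density x *\<^sub>R exp (\<i> * of_real ((- z / \<epsilon>) * x)))"
    using *[of "- z / \<epsilon>"] by simp
  also have "\<dots> = \<epsilon> *\<^sub>R (LINT x|lborel. std_normal_density (\<epsilon> * x) *\<^sub>R exp (\<i> * of_real ((- z / \<epsilon>) * (\<epsilon> * x))))"
    using lborel_integral_real_affine[of \<epsilon> "\<lambda>x. std_normal_density x *\<^sub>R exp (\<i> * of_real ((- z / \<epsilon>) * x))" 0] assms by simp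
  also have "(LINT x|lborel. std_normal_density (\<epsilon> * x) *\<^sub>R exp (\<i> * of_real ((- z / \<epsilon>) * (\<epsilon> * x))))
    = (LINT x|lborel. of_real (1 / sqrt (2 * pi)) * (complex_of_real (exp (- (\<epsilon>\<^sup>2 * x\<^sup>2 / 2))) * exp (- \<i> * of_real (z * x))))"
    using assms by (intro Bochner_Integration.integral_cong refl)
      (simp add: std_normal_density_def scaleR_conv_of_real power_mult_distrib)
  finally have "complex_of_real (exp (- ((- z / \<epsilon>)\<^sup>2) / 2)) = of_real (\<epsilon> / sqrt (2 * pi)) *
     (LINT x|lborel. complex_of_real (exp (- (\<epsilon>\<^sup>2 * x\<^sup>2 / 2))) * exp (- \<i> * of_real (z * x)))"
    by (simp add: scaleR_conv_of_real)
  then have "(LINT x|lborel. complex_of_real (exp (- (\<epsilon>\<^sup>2 * x\<^sup>2 / 2))) * exp (- \<i> * of_real (z * x)))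
     = of_real (sqrt (2 * pi) / \<epsilon> * exp (- ((- z / \<epsilon>)\<^sup>2) / 2))"
    using assms by (simp add: field_simps)
  also have "sqrt (2 * pi) / \<epsilon> * exp (- ((- z / \<epsilon>)\<^sup>2) / 2) = 2 * pi * normal_density 0 \<epsilon> z"
  proof -
    have "2 * pi = sqrt (2 * pi) * sqrt (2 * pi)" by simp
    then have "2 * pi / sqrt (2 * pi * \<epsilon>\<^sup>2) = sqrt (2 * pi) / \<epsilon>"
      using assms by (simp add: real_sqrt_mult divide_simps)
    then have "sqrt (2 * pi) / \<epsilon> * exp (- ((- z / \<epsilon>)\<^sup>2) / 2)
        = (2 * pi / sqrt (2 * pi * \<epsilon>\<^sup>2)) * exp (- ((- z / \<epsilon>)\<^sup>2) / 2)" by (simp only:)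
    also have "\<dots> = 2 * pi * normal_density 0 \<epsilon> z"
      by (simp add: normal_density_def power_divide mult.commute)
    finally show ?thesis .
  qed
  finally show "(LINT \<xi>|lborel. complex_of_real (exp (- (\<epsilon>\<^sup>2 * \<xi>\<^sup>2 / 2))) * exp (- \<i> * of_real (z * \<xi>)))
     = of_real (2 * pi * normal_density 0 \<epsilon> z)" .
qed

lemma integrable_tensor:
  fixes f g :: "real \<Rightarrow> complex"
  assumes f: "integrable lborel f" and g: "integrable lborel g"
  shows "integrable lborel (\<lambda>(x, y). f x * g y)"
proof -
  have [measurable]: "f \<in> borel_measurable borel" "g \<in> borel_measurable borel" using f g by auto
  have "integrable (lborel \<Otimes>\<^sub>M lborel) (\<lambda>(x, y). f x * g y)"
    by (rule lborel_pair.Fubini_integrable) (use f g in \<open>auto simp: norm_mult\<close>)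
  then show ?thesis by (simp add: lborel_prod)
qed

text \<open>A regularised Parseval identity: the Gaussian weight makes the triple integral
  absolutely convergent, so the frequency integral can be taken first, and \<open>gauss_ft\<close>
  evaluates it.\<close>

lemma ft_gauss_product:
  fixes f g :: "real \<Rightarrow> complex"
  assumes e: "\<epsilon> > 0" and f: "integrable lborel f" and g: "integrable lborel g"
  shows "(LINT \<xi>|lborel. complex_of_real (exp (- (\<epsilon>\<^sup>2 * \<xi>\<^sup>2 / 2))) * (ft f \<xi> * cnj (ft g \<xi>)))
    = of_real (2 * pi) * (LINT p|lborel. f (fst p) * cnj (g (snd p)) * of_real (normal_density 0 \<epsilon> (fst p - snd p)))"
proof -
  have [measurable]: "f \<in> borel_measurable borel" "g \<in> borel_measurable borel" using f g by auto
  define w where "w \<xi> = complex_of_real (exp (- (\<epsilon>\<^sup>2 * \<xi>\<^sup>2 / 2)))" for \<xi>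
  define H where "H p = f (fst p) * cnj (g (snd p))" for p
  have [measurable]: "w \<in> borel_measurable borel" unfolding w_def by measurable
  have [measurable]: "H \<in> borel_measurable borel" unfolding H_def
    by (subst borel_prod[symmetric]) measurable
  have H: "integrable lborel H"
    using integrable_tensor[OF f integrable_cnj[OF g]] by (simp add: H_def[abs_def] split_def)
  have wi: "integrable lborel w"
    using integrable_of_real[OF gauss_ft(1)[OF e], where 'a=complex] by (simp add: w_def[abs_def])
  have prod: "ft f \<xi> * cnj (ft g \<xi>) = (LINT p|lborel. H p * exp (- \<i> * of_real ((fst p - snd p) * \<xi>)))" for \<xi>
  proof -
    let ?f = "\<lambda>x. f x * exp (- \<i> * of_real (x * \<xi>))" and ?g = "\<lambda>x. cnj (g x * exp (- \<i> * of_real (x * \<xi>)))"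
    have i: "integrable lborel ?f" "integrable lborel ?g"
      using ft_integrable[OF f, of \<xi>] integrable_cnj[OF ft_integrable[OF g, of \<xi>]] by blast+
    have "ft f \<xi> * cnj (ft g \<xi>) = (LINT x|lborel. ?f x) * (LINT y|lborel. ?g y)"
      unfolding ft_def by (simp only: Bochner_Integration.integral_cnj)
    also have "\<dots> = (LINT x|lborel. (LINT y|lborel. ?f x * ?g y))" by simp
    also have "\<dots> = (LINT p|(lborel \<Otimes>\<^sub>M lborel). (\<lambda>(x, y). ?f x * ?g y) p)"
      using lborel_pair.integral_fst'[of "\<lambda>(x, y). ?f x * ?g y"] integrable_tensor[OF i]
      by (simp add: lborel_prod)
    also have "\<dots> = (LINT p|lborel. H p * exp (- \<i> * of_real ((fst p - snd p) * \<xi>)))"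
      unfolding lborel_prod
      by (intro Bochner_Integration.integral_cong refl)
        (auto simp: H_def split_def exp_cnj exp_diff exp_minus algebra_simps exp_add[symmetric] divide_inverse)
    finally show ?thesis .
  qed
  have int: "integrable (lborel \<Otimes>\<^sub>M lborel) (\<lambda>(\<xi>, p). w \<xi> * (H p * exp (- \<i> * of_real ((fst p - snd p) * \<xi>))))"
  proof (rule lborel_pair.Fubini_integrable)
    have [measurable]: "fst \<in> borel_measurable (borel :: (real \<times> real) measure)"
      "snd \<in> borel_measurable (borel :: (real \<times> real) measure)"
      by (auto intro!: borel_measurable_continuous_onI continuous_intros)
    show "(\<lambda>(\<xi>, p). w \<xi> * (H p * exp (- \<i> * of_real ((fst p - snd p) * \<xi>)))) \<in> borel_measurable (lborel \<Otimes>\<^sub>M lborel)"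
      unfolding split_def by measurable
    show "integrable lborel (\<lambda>\<xi>. LINT p|lborel. norm (case (\<xi>, p) of (\<xi>, p) \<Rightarrow> w \<xi> * (H p * exp (- \<i> * of_real ((fst p - snd p) * \<xi>)))))"
      using wi by (simp add: norm_mult)
    show "AE \<xi> in lborel. integrable lborel (\<lambda>p. case (\<xi>, p) of (\<xi>, p) \<Rightarrow> w \<xi> * (H p * exp (- \<i> * of_real ((fst p - snd p) * \<xi>))))"
    proof (intro AE_I2)
      fix \<xi>
      have "integrable lborel (\<lambda>p. H p * exp (- \<i> * of_real ((fst p - snd p) * \<xi>)))"
        by (rule Bochner_Integration.integrable_bound[OF H]) (auto simp: norm_mult)
      then show "integrable lborel (\<lambda>p. case (\<xi>, p) of (\<xi>, p) \<Rightarrow> w \<xi> * (H p * exp (- \<i> * of_real ((fst p - snd p) * \<xi>))))"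
        by simp
    qed
  qed
  have "(LINT \<xi>|lborel. w \<xi> * (ft f \<xi> * cnj (ft g \<xi>)))
     = (LINT \<xi>|lborel. (LINT p|lborel. w \<xi> * (H p * exp (- \<i> * of_real ((fst p - snd p) * \<xi>)))))"
    unfolding prod by simp
  also have "\<dots> = (LINT p|lborel. (LINT \<xi>|lborel. w \<xi> * (H p * exp (- \<i> * of_real ((fst p - snd p) * \<xi>)))))"
    by (rule lborel_pair.Fubini_integral[OF int, symmetric])
  also have "\<dots> = (LINT p|lborel. H p * (LINT \<xi>|lborel. w \<xi> * exp (- \<i> * of_real ((fst p - snd p) * \<xi>))))"
    by (simp add: mult.left_commute)
  also have "\<dots> = (LINT p|lborel. of_real (2 * pi) * (H p * of_real (normal_density 0 \<epsilon> (fst p - snd p))))"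
    unfolding w_def gauss_ft(2)[OF e] by (simp add: mult_ac)
  finally show ?thesis by (simp add: w_def H_def)
qed

lemma normal_density_shift:
  assumes e: "\<epsilon> > 0"
  shows "integrable lborel (\<lambda>y. normal_density 0 \<epsilon> (x - y))" "(LINT y|lborel. normal_density 0 \<epsilon> (x - y)) = 1"
  using lborel_integrable_real_affine[of "normal_density 0 \<epsilon>" "-1" x]
    lborel_integral_real_affine[of "-1" "normal_density 0 \<epsilon>" x] e by auto

lemma normal_density_sym: "normal_density 0 \<epsilon> (x - y) = normal_density 0 \<epsilon> (y - x)"
  by (simp add: normal_density_def power2_commute)

text \<open>The kernel has mass one in each variable separately. These two marginals are the input
  of Schur's bound and of the passage to the limit.\<close>

lemma tensor_normal:
  fixes g :: "real \<Rightarrow> real"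
  assumes e: "\<epsilon> > 0" and g: "integrable lborel g"
  shows "integrable lborel (\<lambda>p. g (fst p) * normal_density 0 \<epsilon> (fst p - snd p))"
    "(LINT p|lborel. g (fst p) * normal_density 0 \<epsilon> (fst p - snd p)) = (LINT x|lborel. g x)"
    "integrable lborel (\<lambda>p. g (snd p) * normal_density 0 \<epsilon> (fst p - snd p))"
    "(LINT p|lborel. g (snd p) * normal_density 0 \<epsilon> (fst p - snd p)) = (LINT x|lborel. g x)"
proof -
  have [measurable]: "g \<in> borel_measurable borel" using g by auto
  let ?F = "\<lambda>(x, y). g x * normal_density 0 \<epsilon> (x - y)"
  have int: "integrable (lborel \<Otimes>\<^sub>M lborel) ?F"
  proof (rule lborel_pair.Fubini_integrable)
    show "integrable lborel (\<lambda>x. LINT y|lborel. norm (case (x, y) of (x, y) \<Rightarrow> g x * normal_density 0 \<epsilon> (x - y)))"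
      using g normal_density_shift[OF e] by (simp add: abs_mult)
  qed (use normal_density_shift[OF e] in auto)
  then show "integrable lborel (\<lambda>p. g (fst p) * normal_density 0 \<epsilon> (fst p - snd p))"
    by (simp add: lborel_prod split_def)
  have "integral\<^sup>L (lborel \<Otimes>\<^sub>M lborel) ?F = (LINT x|lborel. (LINT y|lborel. ?F (x, y)))"
    using lborel_pair.integral_fst'[OF int] by simp
  also have "\<dots> = (LINT x|lborel. g x)" using normal_density_shift[OF e] by simp
  finally have I: "integral\<^sup>L (lborel \<Otimes>\<^sub>M lborel) ?F = (LINT x|lborel. g x)" .
  then show "(LINT p|lborel. g (fst p) * normal_density 0 \<epsilon> (fst p - snd p)) = (LINT x|lborel. g x)"
    by (simp add: lborel_prod split_def)
  have sw: "(\<lambda>(x, y). ?F (y, x)) = (\<lambda>p. g (snd p) * normal_density 0 \<epsilon> (fst p - snd p))"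
    by (auto simp: normal_density_sym[of \<epsilon> "fst _"])
  show "integrable lborel (\<lambda>p. g (snd p) * normal_density 0 \<epsilon> (fst p - snd p))"
    using lborel_pair.integrable_product_swap[OF int] by (simp only: sw lborel_prod)
  have "?F \<in> borel_measurable (lborel \<Otimes>\<^sub>M lborel)" using int by auto
  from lborel_pair.integral_product_swap[OF this]
  show "(LINT p|lborel. g (snd p) * normal_density 0 \<epsilon> (fst p - snd p)) = (LINT x|lborel. g x)"
    using I by (simp only: sw lborel_prod)
qed

lemma eps_seq: "(\<lambda>n. 1 / (real n + 1)) \<longlonglongrightarrow> 0" "1 / (real n + 1) > 0"
  using LIMSEQ_inverse_real_of_nat by (simp_all add: inverse_eq_divide add.commute)

text \<open>A Gaussian weight makes the double integral absolutely convergent; its transform is a probability density,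
  and Schur's bound for this kernel is uniform in the width.\<close>

lemma bessel:
  assumes f: "f \<in> L2" "integrable lborel f"
  shows "ft f \<in> L2" "(LINT \<xi>|lborel. (norm (ft f \<xi>))\<^sup>2) \<le> 2 * pi * (LINT x|lborel. (norm (f x))\<^sup>2)"
proof -
  have [measurable]: "f \<in> borel_measurable borel" using f by auto
  \<comment> \<open>Denominator 4 instead of 2: the square of \<open>F n\<close> then carries
    exactly the weight of \<open>ft_gauss_product\<close>.\<close>
  define F where "F n \<xi> = complex_of_real (exp (- ((1 / (real n + 1))\<^sup>2 * \<xi>\<^sup>2 / 4))) * ft f \<xi>" for n \<xi>
  have [measurable]: "F n \<in> borel_measurable borel" for n unfolding F_def by measurable
  have nF: "(norm (F n \<xi>))\<^sup>2 = exp (- ((1 / (real n + 1))\<^sup>2 * \<xi>\<^sup>2 / 2)) * (norm (ft f \<xi>))\<^sup>2" for n \<xi>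
  proof -
    have "(exp (- ((1 / (real n + 1))\<^sup>2 * \<xi>\<^sup>2 / 4)))\<^sup>2 = exp (- ((1 / (real n + 1))\<^sup>2 * \<xi>\<^sup>2 / 2))"
      by (simp add: exp_double[symmetric])
    then show ?thesis by (simp add: F_def norm_mult power_mult_distrib)
  qed
  have FL: "F n \<in> L2" for n
  proof (rule L2I_bound)
    show "integrable lborel (\<lambda>\<xi>. exp (- ((1 / (real n + 1))\<^sup>2 * \<xi>\<^sup>2 / 2)) * (LINT x|lborel. norm (f x))\<^sup>2)"
      using gauss_ft(1)[OF eps_seq(2)] by (intro integrable_mult_left)
    show "(norm (F n \<xi>))\<^sup>2 \<le> exp (- ((1 / (real n + 1))\<^sup>2 * \<xi>\<^sup>2 / 2)) * (LINT x|lborel. norm (f x))\<^sup>2" for \<xi>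
      unfolding nF using ft_bound[OF f(2)] by (intro mult_left_mono power_mono) auto
  qed simp
  have bnd: "(LINT \<xi>|lborel. (norm (F n \<xi>))\<^sup>2) \<le> 2 * pi * (LINT x|lborel. (norm (f x))\<^sup>2)" for n
  proof -
    let ?e = "1 / (real n + 1)"
    let ?H = "\<lambda>p. f (fst p) * cnj (f (snd p)) * of_real (normal_density 0 ?e (fst p - snd p))"
    have "complex_of_real (LINT \<xi>|lborel. (norm (F n \<xi>))\<^sup>2)
        = (LINT \<xi>|lborel. complex_of_real (exp (- (?e\<^sup>2 * \<xi>\<^sup>2 / 2))) * (ft f \<xi> * cnj (ft f \<xi>)))"
      unfolding nF integral_complex_of_real[symmetric] of_real_mult
      by (simp only: complex_norm_square)
    also have "\<dots> = of_real (2 * pi) * (LINT p|lborel. ?H p)"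
      by (rule ft_gauss_product[OF eps_seq(2) f(2) f(2)])
    finally have "norm (complex_of_real (LINT \<xi>|lborel. (norm (F n \<xi>))\<^sup>2)) = norm (of_real (2 * pi) * (LINT p|lborel. ?H p))"
      by (rule arg_cong)
    then have "(LINT \<xi>|lborel. (norm (F n \<xi>))\<^sup>2) = 2 * pi * norm (LINT p|lborel. ?H p)"
      by (simp add: norm_mult)
    also have "norm (LINT p|lborel. ?H p) \<le> (LINT p|lborel. norm (?H p))"
      by (rule integral_norm_bound)
    also have "\<dots> \<le> (LINT p|lborel. (1/2 * (norm (f (fst p)))\<^sup>2) * normal_density 0 ?e (fst p - snd p)
        + (1/2 * (norm (f (snd p)))\<^sup>2) * normal_density 0 ?e (fst p - snd p))"
    proof (rule integral_mono')
      show "integrable lborel (\<lambda>p. (1/2 * (norm (f (fst p)))\<^sup>2) * normal_density 0 ?e (fst p - snd p)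
        + (1/2 * (norm (f (snd p)))\<^sup>2) * normal_density 0 ?e (fst p - snd p))"
        using tensor_normal(1,3)[OF eps_seq(2)[of n], of "\<lambda>x. 1/2 * (norm (f x))\<^sup>2"] L2_integrable[OF f(1)]
        by (intro Bochner_Integration.integrable_add) auto
      fix p
      have "2 * (norm (f (fst p)) * norm (f (snd p))) \<le> (norm (f (fst p)))\<^sup>2 + (norm (f (snd p)))\<^sup>2"
        using zero_le_power2[of "norm (f (fst p)) - norm (f (snd p))"] by (simp add: power2_eq_square algebra_simps)
      then have "norm (f (fst p)) * norm (f (snd p)) * normal_density 0 ?e (fst p - snd p)
         \<le> (1/2 * (norm (f (fst p)))\<^sup>2 + 1/2 * (norm (f (snd p)))\<^sup>2) * normal_density 0 ?e (fst p - snd p)"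
        by (intro mult_right_mono) auto
      then show "norm (?H p) \<le> (1/2 * (norm (f (fst p)))\<^sup>2) * normal_density 0 ?e (fst p - snd p)
        + (1/2 * (norm (f (snd p)))\<^sup>2) * normal_density 0 ?e (fst p - snd p)"
        by (simp add: norm_mult distrib_right)
    qed auto
    also have "\<dots> = (LINT x|lborel. (norm (f x))\<^sup>2)"
      using tensor_normal[OF eps_seq(2)[of n], of "\<lambda>x. 1/2 * (norm (f x))\<^sup>2"] L2_integrable[OF f(1)]
      by (subst Bochner_Integration.integral_add) auto
    finally show ?thesis by simp
  qed
  have lim: "(\<lambda>n. F n \<xi>) \<longlonglongrightarrow> ft f \<xi>" for \<xi>
  proof -
    have "(\<lambda>n. complex_of_real (exp (- ((1 / (real n + 1))\<^sup>2 * \<xi>\<^sup>2 / 4))) * ft f \<xi>)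
       \<longlonglongrightarrow> complex_of_real (exp (- (0\<^sup>2 * \<xi>\<^sup>2 / 4))) * ft f \<xi>"
      by (intro tendsto_intros eps_seq(1)) simp
    then show ?thesis by (simp add: F_def)
  qed
  show "ft f \<in> L2" "(LINT \<xi>|lborel. (norm (ft f \<xi>))\<^sup>2) \<le> 2 * pi * (LINT x|lborel. (norm (f x))\<^sup>2)"
    using L2_fatou[OF FL _ AE_I2[OF lim] always_eventually[OF allI[OF bnd]]] by auto
qed

section \<open>Extension of the transform to square integrable functions, and its inversion\<close>

definition tr :: "nat \<Rightarrow> (real \<Rightarrow> complex) \<Rightarrow> real \<Rightarrow> complex" where
  "tr n f x = ind (- real n) (real n) x * f x"

lemma tr_L2: "f \<in> L2 \<Longrightarrow> tr n f \<in> L2" unfolding tr_def[abs_def] by (rule ind_mult_L2)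
lemma tr_integrable: "f \<in> L2 \<Longrightarrow> integrable lborel (tr n f)" unfolding tr_def[abs_def] by (rule ind_mult_integrable)

lemma tr_pointwise: "eventually (\<lambda>n. tr n f x = f x) sequentially"
proof -
  obtain N :: nat where "\<bar>x\<bar> \<le> real N" using real_arch_simple by blast
  then show ?thesis
    by (intro eventually_sequentiallyI[of N]) (auto simp: tr_def ind_def indicator_def)
qed

lemma tr_tendsto: 
  assumes "f \<in> L2"
  shows "(\<lambda>n. abs_l2 (tr n f)) \<longlonglongrightarrow> abs_l2 f"
proof (rule L2_dominated(3))
  show "integrable lborel (\<lambda>x. (norm (f x))\<^sup>2)" by (rule L2_integrable[OF assms])
  show "tr n f \<in> borel_measurable borel" for n using tr_L2[OF assms] by (rule L2_measurable)
  show "AE x in lborel. (\<lambda>n. tr n f x) \<longlonglongrightarrow> f x"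
    using tr_pointwise by (intro AE_I2 tendsto_eventually)
qed (use assms in \<open>auto simp: tr_def ind_def indicator_def\<close>)

lemma ft_norm: "f \<in> L2 \<Longrightarrow> integrable lborel f \<Longrightarrow> norm (abs_l2 (ft f)) \<le> sqrt (2 * pi) * norm (abs_l2 f)"
  using bessel(2)[of f] by (simp add: norm_abs bessel(1) real_sqrt_mult[symmetric])

lemma ft_norm_diff:
  assumes "f \<in> L2" "integrable lborel f" "g \<in> L2" "integrable lborel g"
  shows "norm (abs_l2 (ft f) - abs_l2 (ft g)) \<le> sqrt (2 * pi) * norm (abs_l2 f - abs_l2 g)"
proof -
  have "ft (\<lambda>x. f x - g x) = (\<lambda>\<xi>. ft f \<xi> - ft g \<xi>)" using assms ft_diff by blast
  with ft_norm[of "\<lambda>x. f x - g x"] show ?thesis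
    using assms by (simp add: abs_diff L2_diff bessel(1))
qed

text \<open>The continuous extension of \<open>ft\<close> along the truncations \<open>tr\<close>.
  These are the same truncations as in \<open>has_fourier\<close>, so the two notions of transform
  agree by uniqueness of limits.\<close>

definition Fop :: "l2 \<Rightarrow> l2" where
  "Fop u = lim (\<lambda>n. abs_l2 (ft (tr n (rep_l2 u))))"

lemma Fop_tendsto:
  assumes f: "f \<in> L2"
  shows "(\<lambda>n. abs_l2 (ft (tr n f))) \<longlonglongrightarrow> Fop (abs_l2 f)"
proof -
  let ?f = "rep_l2 (abs_l2 f)"
  have "ft (tr n ?f) = ft (tr n f)" for n
    unfolding ft_def tr_def using rep_abs[OF f] f
    by (intro ext integral_cong_AE) (auto dest: L2_measurable)
  moreover have "Cauchy (\<lambda>n. abs_l2 (ft (tr n f)))"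
  proof (rule metric_CauchyI)
    fix e :: real assume e: "e > 0"
    have "Cauchy (\<lambda>n. abs_l2 (tr n f))" using tr_tendsto[OF f] by (rule LIMSEQ_imp_Cauchy)
    from metric_CauchyD[OF this, of "e / sqrt (2 * pi)"] e obtain M
      where M: "\<And>m n. m \<ge> M \<Longrightarrow> n \<ge> M \<Longrightarrow> norm (abs_l2 (tr m f) - abs_l2 (tr n f)) < e / sqrt (2 * pi)"
      by (auto simp: dist_norm)
    have "norm (abs_l2 (ft (tr m f)) - abs_l2 (ft (tr n f))) < e" if "m \<ge> M" "n \<ge> M" for m n
      using ft_norm_diff[OF tr_L2[OF f] tr_integrable[OF f] tr_L2[OF f] tr_integrable[OF f], of m n] M[OF that]
      by (simp add: field_simps)
    then show "\<exists>M. \<forall>m\<ge>M. \<forall>n\<ge>M. dist (abs_l2 (ft (tr m f))) (abs_l2 (ft (tr n f))) < e"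
      by (auto simp: dist_norm)
  qed
  ultimately show ?thesis
    unfolding Fop_def by (simp add: Cauchy_convergent_iff convergent_LIMSEQ_iff)
qed

lemma Fop_abs:
  assumes "f \<in> L2" "integrable lborel f"
  shows "Fop (abs_l2 f) = abs_l2 (ft f)"
proof -
  have "(\<lambda>n. sqrt (2 * pi) * norm (abs_l2 (tr n f) - abs_l2 f)) \<longlonglongrightarrow> sqrt (2 * pi) * norm (abs_l2 f - abs_l2 f)"
    by (intro tendsto_intros tr_tendsto assms)
  then have "(\<lambda>n. abs_l2 (ft (tr n f)) - abs_l2 (ft f)) \<longlonglongrightarrow> 0"
    by (intro Lim_null_comparison[OF always_eventually[OF allI[OF ft_norm_diff]]] tr_L2 tr_integrable assms) simp
  then have "(\<lambda>n. abs_l2 (ft (tr n f))) \<longlonglongrightarrow> abs_l2 (ft f)" by (rule LIM_zero_cancel)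
  then show ?thesis using Fop_tendsto[OF assms(1)] LIMSEQ_unique by blast
qed

lemma Fop_tr: "f \<in> L2 \<Longrightarrow> Fop (abs_l2 (tr n f)) = abs_l2 (ft (tr n f))"
  by (intro Fop_abs tr_L2 tr_integrable)

lemma bounded_linear_Fop: "bounded_linear Fop"
proof (rule bounded_linear_intro[where K="sqrt (2 * pi)"])
  fix u v :: l2 and r :: real
  let ?f = "rep_l2 u" and ?g = "rep_l2 v"
  have U: "(\<lambda>n. abs_l2 (ft (tr n (rep_l2 u)))) \<longlonglongrightarrow> Fop u" for u
    using Fop_tendsto[of "rep_l2 u"] by simp
  have "abs_l2 (ft (tr n (\<lambda>x. ?f x + ?g x))) = abs_l2 (ft (tr n ?f)) + abs_l2 (ft (tr n ?g))" for n
  proof -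
    have "ft (tr n (\<lambda>x. ?f x + ?g x)) = (\<lambda>\<xi>. ft (tr n ?f) \<xi> + ft (tr n ?g) \<xi>)"
      using ft_add[OF tr_integrable tr_integrable, of ?f ?g n n] by (auto simp: tr_def[abs_def] distrib_left)
    then show ?thesis by (simp add: abs_add bessel(1) tr_L2 tr_integrable)
  qed
  then have "(\<lambda>n. abs_l2 (ft (tr n ?f)) + abs_l2 (ft (tr n ?g))) \<longlonglongrightarrow> Fop (u + v)"
    using Fop_tendsto[of "\<lambda>x. ?f x + ?g x"] by (simp add: L2_add abs_add)
  then show "Fop (u + v) = Fop u + Fop v"
    using tendsto_add[OF U[of u] U[of v]] LIMSEQ_unique by blast
  have "abs_l2 (ft (tr n (\<lambda>x. r *\<^sub>R ?f x))) = r *\<^sub>R abs_l2 (ft (tr n ?f))" for n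
  proof -
    have "ft (tr n (\<lambda>x. r *\<^sub>R ?f x)) = (\<lambda>\<xi>. r *\<^sub>R ft (tr n ?f) \<xi>)"
      using ft_cmult[of "of_real r" "tr n ?f"] by (auto simp: tr_def[abs_def] scaleR_conv_of_real mult.left_commute)
    then show ?thesis by (simp add: abs_scaleR bessel(1) tr_L2 tr_integrable del: scaleR_conv_of_real)
  qed
  then have "(\<lambda>n. r *\<^sub>R abs_l2 (ft (tr n ?f))) \<longlonglongrightarrow> Fop (r *\<^sub>R u)"
    using Fop_tendsto[of "\<lambda>x. r *\<^sub>R ?f x"] by (simp add: L2_scaleR abs_scaleR del: scaleR_conv_of_real)
  then show "Fop (r *\<^sub>R u) = r *\<^sub>R Fop u"
    using tendsto_scaleR[OF tendsto_const U[of u], of r] LIMSEQ_unique by blast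
  have "norm (abs_l2 (ft (tr n ?f))) \<le> norm u * sqrt (2 * pi)" for n
  proof -
    have "norm (abs_l2 (ft (tr n ?f))) \<le> sqrt (2 * pi) * norm (abs_l2 (tr n ?f))"
      by (intro ft_norm tr_L2 tr_integrable) simp_all
    also have "norm (abs_l2 (tr n ?f)) \<le> 1 * norm (abs_l2 ?f)"
      by (intro norm_abs_le tr_L2) (auto simp: tr_def ind_def indicator_def)
    finally show ?thesis by (simp add: mult.commute)
  qed
  then show "norm (Fop u) \<le> norm u * sqrt (2 * pi)"
    by (intro tendsto_upperbound[OF tendsto_norm[OF U[of u]]]) auto
qed

text \<open>Fubini for integrable functions, then density. The kernel is symmetric in its two
  variables and the product conjugates one side, so conjugating the kernel shows up as the
  reflection \<open>rf\<close>.\<close>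

lemma Fop_adjoint: "Fop u \<bullet> v = u \<bullet> rf (Fop v)"
proof -
  have base: "abs_l2 (ft f) \<bullet> abs_l2 g = abs_l2 f \<bullet> rf (abs_l2 (ft g))"
    if f: "f \<in> L2" "integrable lborel f" and g: "g \<in> L2" "integrable lborel g" for f g
  proof -
    have [measurable]: "f \<in> borel_measurable borel" "g \<in> borel_measurable borel" using f g by auto
    have gi: "integrable lborel (\<lambda>x. cnj (g x))" using g by auto
    have int: "integrable (lborel \<Otimes>\<^sub>M lborel) (\<lambda>(x, \<xi>). f x * cnj (g \<xi>) * exp (- \<i> * of_real (x * \<xi>)))"
      by (rule Bochner_Integration.integrable_bound[OF integrable_tensor[OF f(2) gi, unfolded lborel_prod[symmetric]]])
        (auto simp: norm_mult)
    have "(LINT \<xi>|lborel. ft f \<xi> * cnj (g \<xi>)) = (LINT \<xi>|lborel. (LINT x|lborel. f x * cnj (g \<xi>) * exp (- \<i> * of_real (x * \<xi>))))"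
    proof (intro Bochner_Integration.integral_cong refl)
      fix \<xi>
      have "ft f \<xi> * cnj (g \<xi>) = (LINT x|lborel. (f x * exp (- \<i> * of_real (x * \<xi>))) * cnj (g \<xi>))"
        unfolding ft_def by (rule integral_mult_left_zero[symmetric])
      also have "\<dots> = (LINT x|lborel. f x * cnj (g \<xi>) * exp (- \<i> * of_real (x * \<xi>)))"
        by (simp only: mult_ac)
      finally show "ft f \<xi> * cnj (g \<xi>) = (LINT x|lborel. f x * cnj (g \<xi>) * exp (- \<i> * of_real (x * \<xi>)))" .
    qed
    also have "\<dots> = (LINT x|lborel. (LINT \<xi>|lborel. f x * cnj (g \<xi>) * exp (- \<i> * of_real (x * \<xi>))))"
      by (rule lborel_pair.Fubini_integral[OF int])
    also have "\<dots> = (LINT x|lborel. f x * ft (\<lambda>x. cnj (g x)) x)"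
      unfolding ft_def by (simp add: mult_ac)
    also have "\<dots> = (LINT x|lborel. f x * cnj (ft g (- x)))" by (simp add: ft_cnj)
    finally have eq: "(LINT \<xi>|lborel. ft f \<xi> * cnj (g \<xi>)) = (LINT x|lborel. f x * cnj (ft g (- x)))" .
    have "abs_l2 (ft f) \<bullet> abs_l2 g = Re (LINT \<xi>|lborel. ft f \<xi> * cnj (g \<xi>))"
      using bessel(1)[OF f] g
      by (subst integral_Re[symmetric]) (auto simp: inner_abs inner_complex_def intro!: L2_mult_integrable L2_cnj)
    moreover have "abs_l2 f \<bullet> rf (abs_l2 (ft g)) = Re (LINT x|lborel. f x * cnj (ft g (- x)))"
      using bessel(1)[OF g] f
      by (subst integral_Re[symmetric])
        (auto simp: rf_abs inner_abs L2_reflect inner_complex_def intro!: L2_mult_integrable L2_cnj L2_reflect[of "ft g"])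
    ultimately show ?thesis using eq by simp
  qed
  let ?f = "rep_l2 u" and ?g = "rep_l2 v"
  note lin = bounded_linear.tendsto[OF bounded_linear_Fop] bounded_linear.tendsto[OF bounded_linear_rf]
  have T: "(\<lambda>n. abs_l2 (tr n (rep_l2 w))) \<longlonglongrightarrow> w" for w
    using tr_tendsto[of "rep_l2 w"] by simp
  have "(\<lambda>n. Fop (abs_l2 (tr n ?f)) \<bullet> abs_l2 (tr n ?g)) \<longlonglongrightarrow> Fop u \<bullet> v"
    by (intro tendsto_inner lin T)
  moreover have "(\<lambda>n. abs_l2 (tr n ?f) \<bullet> rf (Fop (abs_l2 (tr n ?g)))) \<longlonglongrightarrow> u \<bullet> rf (Fop v)"
    by (intro tendsto_inner lin T)
  moreover have "Fop (abs_l2 (tr n ?f)) \<bullet> abs_l2 (tr n ?g) = abs_l2 (tr n ?f) \<bullet> rf (Fop (abs_l2 (tr n ?g)))" for n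
    by (simp add: Fop_tr base tr_L2 tr_integrable)
  ultimately show ?thesis using LIMSEQ_unique by auto
qed

text \<open>After rescaling to the standard density, \<open>ind a b (x - e * s)\<close> is
  eventually constant in \<open>n\<close> unless \<open>x\<close> is an endpoint; dominated
  convergence does the rest.\<close>

lemma normal_density_window:
  assumes x: "x \<noteq> a" "x \<noteq> b"
  shows "(\<lambda>n. LINT y|lborel. ind a b y * of_real (normal_density 0 (1 / (real n + 1)) (x - y))) \<longlonglongrightarrow> ind a b x"
proof -
  let ?e = "\<lambda>n::nat. 1 / (real n + 1)"
  have sub: "(LINT y|lborel. ind a b y * of_real (normal_density 0 (?e n) (x - y)))
     = (LINT s|lborel. ind a b (x - ?e n * s) * of_real (std_normal_density s))" for n
  proof -
    have e: "?e n > 0" by (rule eps_seq)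
    have nd: "std_normal_density s = normal_density 0 d (d * s) * d" if "d > 0" for d s :: real
      using that unfolding normal_density_def by (simp add: real_sqrt_mult power_mult_distrib)
    have "(LINT y|lborel. ind a b y * of_real (normal_density 0 (?e n) (x - y)))
      = \<bar>- ?e n\<bar> *\<^sub>R (LINT s|lborel. ind a b (x + (- ?e n) * s) * of_real (normal_density 0 (?e n) (x - (x + (- ?e n) * s))))"
      by (rule lborel_integral_real_affine) (use e in simp)
    also have "\<dots> = (LINT s|lborel. ?e n *\<^sub>R (ind a b (x - ?e n * s) * of_real (normal_density 0 (?e n) (?e n * s))))"
      by (subst Bochner_Integration.integral_scaleR_right) simp
    also have "\<dots> = (LINT s|lborel. ind a b (x - ?e n * s) * of_real (std_normal_density s))"
      unfolding nd[OF e] by (simp only: scaleR_conv_of_real of_real_mult mult_ac)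
    finally show ?thesis .
  qed
  have "(\<lambda>n. LINT s|lborel. ind a b (x - ?e n * s) * of_real (std_normal_density s))
    \<longlonglongrightarrow> (LINT s|lborel. ind a b x * of_real (std_normal_density s))"
  proof (rule integral_dominated_convergence[where w=std_normal_density])
    show "AE s in lborel. (\<lambda>n. ind a b (x - ?e n * s) * of_real (std_normal_density s))
       \<longlonglongrightarrow> ind a b x * of_real (std_normal_density s)"
    proof (intro AE_I2 tendsto_mult tendsto_const tendsto_eventually)
      fix s
      have lim: "(\<lambda>n. x - ?e n * s) \<longlonglongrightarrow> x - 0 * s" by (intro tendsto_intros eps_seq)
      consider "x < a" | "b < x" | "a < x" "x < b" using x by linarith
      then show "\<forall>\<^sub>F n in sequentially. ind a b (x - ?e n * s) = ind a b x"
      proof cases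
        case 1
        then have "\<forall>\<^sub>F n in sequentially. x - ?e n * s < a" using order_tendstoD(2)[OF lim] by simp
        then show ?thesis by eventually_elim (use 1 in \<open>simp add: ind_def indicator_def\<close>)
      next
        case 2
        then have "\<forall>\<^sub>F n in sequentially. b < x - ?e n * s" using order_tendstoD(1)[OF lim] by simp
        then show ?thesis by eventually_elim (use 2 in \<open>simp add: ind_def indicator_def\<close>)
      next
        case 3
        then have "\<forall>\<^sub>F n in sequentially. a < x - ?e n * s" "\<forall>\<^sub>F n in sequentially. x - ?e n * s < b"
          using order_tendstoD[OF lim] by simp_all
        then show ?thesis by eventually_elim (use 3 in \<open>simp add: ind_def indicator_def\<close>)
      qed
    qed
    show "AE s in lborel. norm (ind a b (x - ?e n * s) * of_real (std_normal_density s)) \<le> std_normal_density s" for n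
      by (intro AE_I2) (auto simp: ind_def indicator_def norm_mult)
  qed auto
  then show ?thesis unfolding sub by simp
qed

text \<open>The limit of the regularised Parseval identity. One factor is a multiple of an
  indicator, whose mollification is bounded by one and converges off two points; indicators are
  enough because they separate elements of \<open>l2\<close>.\<close>

lemma plancherel_ind:
  assumes f: "f \<in> L2" "integrable lborel f"
  shows "abs_l2 (ft f) \<bullet> Fop (abs_l2 (\<lambda>x. c * ind a b x)) = 2 * pi * (abs_l2 f \<bullet> abs_l2 (\<lambda>x. c * ind a b x))"
proof -
  have [measurable]: "f \<in> borel_measurable borel" using f by auto
  define g where "g = (\<lambda>x. c * ind a b x)"
  have g: "g \<in> L2" "integrable lborel g" unfolding g_def using ind_L2 ind_integrable by (auto intro: L2_cmult)
  have [measurable]: "g \<in> borel_measurable borel" using g by auto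
  let ?e = "\<lambda>n::nat. 1 / (real n + 1)"
  let ?N = "\<lambda>n. normal_density 0 (?e n)"
  have ftL: "ft f \<in> L2" "ft g \<in> L2" using bessel(1) f g by auto
  have int1: "integrable lborel (\<lambda>\<xi>. ft f \<xi> * cnj (ft g \<xi>))" by (intro L2_mult_integrable ftL L2_cnj)
  have lhs: "(\<lambda>n. LINT \<xi>|lborel. complex_of_real (exp (- ((?e n)\<^sup>2 * \<xi>\<^sup>2 / 2))) * (ft f \<xi> * cnj (ft g \<xi>)))
     \<longlonglongrightarrow> (LINT \<xi>|lborel. ft f \<xi> * cnj (ft g \<xi>))"
  proof (rule integral_dominated_convergence[where w="\<lambda>\<xi>. norm (ft f \<xi> * cnj (ft g \<xi>))"])
    show "AE \<xi> in lborel. (\<lambda>n. complex_of_real (exp (- ((?e n)\<^sup>2 * \<xi>\<^sup>2 / 2))) * (ft f \<xi> * cnj (ft g \<xi>)))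
       \<longlonglongrightarrow> ft f \<xi> * cnj (ft g \<xi>)"
    proof (intro AE_I2)
      fix \<xi>
      have "(\<lambda>n. complex_of_real (exp (- ((?e n)\<^sup>2 * \<xi>\<^sup>2 / 2))) * (ft f \<xi> * cnj (ft g \<xi>)))
        \<longlonglongrightarrow> complex_of_real (exp (- (0\<^sup>2 * \<xi>\<^sup>2 / 2))) * (ft f \<xi> * cnj (ft g \<xi>))"
        by (intro tendsto_intros eps_seq(1)) simp
      then show "(\<lambda>n. complex_of_real (exp (- ((?e n)\<^sup>2 * \<xi>\<^sup>2 / 2))) * (ft f \<xi> * cnj (ft g \<xi>)))
       \<longlonglongrightarrow> ft f \<xi> * cnj (ft g \<xi>)" by simp
    qed
    show "AE \<xi> in lborel. norm (complex_of_real (exp (- ((?e n)\<^sup>2 * \<xi>\<^sup>2 / 2))) * (ft f \<xi> * cnj (ft g \<xi>)))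
      \<le> norm (ft f \<xi> * cnj (ft g \<xi>))" for n
    proof (intro AE_I2)
      fix \<xi>
      have "norm (complex_of_real (exp (- ((?e n)\<^sup>2 * \<xi>\<^sup>2 / 2)))) \<le> 1" by simp
      from mult_right_mono[OF this norm_ge_zero, of "ft f \<xi> * cnj (ft g \<xi>)"]
      show "norm (complex_of_real (exp (- ((?e n)\<^sup>2 * \<xi>\<^sup>2 / 2))) * (ft f \<xi> * cnj (ft g \<xi>)))
      \<le> norm (ft f \<xi> * cnj (ft g \<xi>))" by (simp only: norm_mult[of "complex_of_real _"] mult_1)
    qed
  qed (use int1 in auto)
  let ?J = "\<lambda>n x. LINT y|lborel. ind a b y * of_real (?N n (x - y))"
  have rhs_eq: "(LINT p|lborel. f (fst p) * cnj (g (snd p)) * of_real (?N n (fst p - snd p)))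
     = (LINT x|lborel. f x * cnj c * ?J n x)" for n
  proof -
    have e: "?e n > 0" by (rule eps_seq)
    have cg: "integrable lborel (\<lambda>x. cnj (g x))" using g by auto
    have bnd: "?N n z \<le> 1 / sqrt (2 * pi * (?e n)\<^sup>2)" for z
      using e unfolding normal_density_def by (auto intro: divide_right_mono)
    have int: "integrable (lborel \<Otimes>\<^sub>M lborel) (\<lambda>(x, y). f x * cnj (g y) * of_real (?N n (x - y)))"
    proof (rule Bochner_Integration.integrable_bound)
      show "integrable (lborel \<Otimes>\<^sub>M lborel) (\<lambda>(x, y). of_real (1 / sqrt (2 * pi * (?e n)\<^sup>2)) * (f x * cnj (g y)))"
        using integrable_mult_right[OF integrable_tensor[OF f(2) cg], of "of_real (1 / sqrt (2 * pi * (?e n)\<^sup>2))"]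
        by (simp add: lborel_prod split_def)
      show "AE p in lborel \<Otimes>\<^sub>M lborel. norm (case p of (x, y) \<Rightarrow> f x * cnj (g y) * of_real (?N n (x - y)))
        \<le> norm (case p of (x, y) \<Rightarrow> of_real (1 / sqrt (2 * pi * (?e n)\<^sup>2)) * (f x * cnj (g y)))"
      proof (intro AE_I2)
        fix p :: "real \<times> real"
        have "norm (complex_of_real (?N n (fst p - snd p))) \<le> norm (complex_of_real (1 / sqrt (2 * pi * (?e n)\<^sup>2)))"
          using bnd[of "fst p - snd p"] by (simp only: norm_of_real) simp
        from mult_left_mono[OF this norm_ge_zero[of "f (fst p) * cnj (g (snd p))"]]
        show "norm (case p of (x, y) \<Rightarrow> f x * cnj (g y) * of_real (?N n (x - y)))
        \<le> norm (case p of (x, y) \<Rightarrow> of_real (1 / sqrt (2 * pi * (?e n)\<^sup>2)) * (f x * cnj (g y)))"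
          unfolding split_def norm_mult by (simp only: mult_ac)
      qed
    qed measurable
    have "(LINT p|lborel. f (fst p) * cnj (g (snd p)) * of_real (?N n (fst p - snd p)))
      = (LINT x|lborel. LINT y|lborel. f x * cnj (g y) * of_real (?N n (x - y)))"
      using lborel_pair.integral_fst'[OF int] by (simp add: lborel_prod split_def)
    also have "\<dots> = (LINT x|lborel. LINT y|lborel. (f x * cnj c) * (ind a b y * of_real (?N n (x - y))))"
      by (intro Bochner_Integration.integral_cong refl) (auto simp: g_def ind_def indicator_def)
    finally show ?thesis by simp
  qed
  have Jb: "norm (?J n x) \<le> 1" for n x
  proof -
    have "norm (?J n x) \<le> (LINT y|lborel. norm (ind a b y * complex_of_real (?N n (x - y))))"
      by (rule integral_norm_bound)
    also have "\<dots> \<le> (LINT y|lborel. ?N n (x - y))"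
      by (intro integral_mono' normal_density_shift eps_seq) (auto simp: ind_def indicator_def norm_mult)
    finally show ?thesis using normal_density_shift(2)[OF eps_seq(2)[of n]] by simp
  qed
  have rhs: "(\<lambda>n. LINT x|lborel. f x * cnj c * ?J n x) \<longlonglongrightarrow> (LINT x|lborel. f x * cnj c * ind a b x)"
  proof (rule integral_dominated_convergence[where w="\<lambda>x. norm (f x * cnj c)"])
    show "AE x in lborel. (\<lambda>n. f x * cnj c * ?J n x) \<longlonglongrightarrow> f x * cnj c * ind a b x"
      using AE_lborel_singleton[of a] AE_lborel_singleton[of b]
      by eventually_elim (intro tendsto_mult tendsto_const normal_density_window)
    show "AE x in lborel. norm (f x * cnj c * ?J n x) \<le> norm (f x * cnj c)" for n
      using mult_left_mono[OF Jb norm_ge_zero] by (intro AE_I2) (simp add: norm_mult[of "_ * cnj c"])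
  qed (use f in auto)
  have "(LINT \<xi>|lborel. ft f \<xi> * cnj (ft g \<xi>)) = of_real (2 * pi) * (LINT x|lborel. f x * cnj c * ind a b x)"
    using tendsto_mult[OF tendsto_const rhs, of "of_real (2 * pi)"]
    unfolding rhs_eq[symmetric] ft_gauss_product[OF eps_seq(2) f(2) g(2), symmetric]
    by (rule LIMSEQ_unique[OF lhs])
  also have "(LINT x|lborel. f x * cnj c * ind a b x) = (LINT x|lborel. f x * cnj (g x))"
    by (intro Bochner_Integration.integral_cong refl) (auto simp: g_def ind_def indicator_def)
  finally have eq: "Re (LINT \<xi>|lborel. ft f \<xi> * cnj (ft g \<xi>)) = 2 * pi * Re (LINT x|lborel. f x * cnj (g x))"
    by simp
  have ip: "abs_l2 h \<bullet> abs_l2 k = Re (LINT x|lborel. h x * cnj (k x))" if "h \<in> L2" "k \<in> L2" for h k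
    using that by (subst integral_Re[symmetric]) (auto simp: inner_abs inner_complex_def intro!: L2_mult_integrable L2_cnj)
  show ?thesis unfolding g_def[symmetric] Fop_abs[OF g] ip[OF ftL] ip[OF f(1) g(1)] by (rule eq)
qed

text \<open>The adjoint formula turns Plancherel against indicators into inversion; Plancherel for
  arbitrary pairs then follows from inversion.\<close>

theorem Fop_Fop: "rf (Fop (Fop u)) = (2 * pi) *\<^sub>R u"
proof -
  have T: "(\<lambda>n. abs_l2 (tr n (rep_l2 u))) \<longlonglongrightarrow> u"
    using tr_tendsto[of "rep_l2 u"] by simp
  have key: "(rf (Fop (Fop u)) - (2 * pi) *\<^sub>R u) \<bullet> abs_l2 (\<lambda>x. c * ind a b x) = 0" (is "_ \<bullet> ?v = 0") for a b c
  proof -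
    have "(\<lambda>n. Fop (abs_l2 (tr n (rep_l2 u))) \<bullet> Fop ?v) \<longlonglongrightarrow> Fop u \<bullet> Fop ?v"
      by (intro tendsto_inner tendsto_const bounded_linear.tendsto[OF bounded_linear_Fop] T)
    moreover have "(\<lambda>n. 2 * pi * (abs_l2 (tr n (rep_l2 u)) \<bullet> ?v)) \<longlonglongrightarrow> 2 * pi * (u \<bullet> ?v)"
      by (intro tendsto_inner tendsto_mult tendsto_const T)
    moreover have "Fop (abs_l2 (tr n (rep_l2 u))) \<bullet> Fop ?v = 2 * pi * (abs_l2 (tr n (rep_l2 u)) \<bullet> ?v)" for n
      by (simp only: Fop_tr rep_L2 plancherel_ind tr_L2 tr_integrable)
    ultimately have "Fop u \<bullet> Fop ?v = 2 * pi * (u \<bullet> ?v)" by (simp only: LIMSEQ_unique)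
    then have "Fop ?v \<bullet> Fop u = 2 * pi * (u \<bullet> ?v)" by (simp add: inner_commute)
    then have "rf (Fop (Fop u)) \<bullet> ?v = 2 * pi * (u \<bullet> ?v)"
      unfolding Fop_adjoint by (simp add: inner_commute)
    then show ?thesis by (simp add: inner_diff_left)
  qed
  have "rf (Fop (Fop u)) - (2 * pi) *\<^sub>R u = 0"
    using key[of 1] key[of \<i>] by (intro l2_eq_zeroI) simp_all
  then show ?thesis by simp
qed

theorem plancherel: "Fop u \<bullet> Fop v = 2 * pi * (u \<bullet> v)"
  using Fop_adjoint[of u "Fop v"] by (simp add: Fop_Fop)

lemma norm_Fop: "norm (Fop u) = sqrt (2 * pi) * norm u"
  by (simp add: norm_eq_sqrt_inner plancherel real_sqrt_mult)

lemma Fop_dense: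
  assumes P: "\<And>f. f \<in> L2 \<Longrightarrow> integrable lborel f \<Longrightarrow> A (abs_l2 f) = B (abs_l2 f)"
    and A: "bounded_linear A" and B: "bounded_linear B"
  shows "A u = B u"
proof -
  have T: "(\<lambda>n. abs_l2 (tr n (rep_l2 u))) \<longlonglongrightarrow> u"
    using tr_tendsto[of "rep_l2 u"] by simp
  from bounded_linear.tendsto[OF A T] bounded_linear.tendsto[OF B T] show ?thesis
    by (simp add: P tr_L2 tr_integrable LIMSEQ_unique)
qed

lemma integrable_reflect: "integrable lborel f \<Longrightarrow> integrable lborel (\<lambda>x. f (- x :: real) :: complex)"
  using lborel_integrable_real_affine[of f "-1" 0] by simp

lemma Fop_rf: "Fop (rf u) = rf (Fop u)"
proof (rule Fop_dense[where A="\<lambda>u. Fop (rf u)" and B="\<lambda>u. rf (Fop u)"])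
  show "bounded_linear (\<lambda>u. Fop (rf u))" "bounded_linear (\<lambda>u. rf (Fop u))"
    by (intro bounded_linear_compose[OF bounded_linear_Fop bounded_linear_rf]
        bounded_linear_compose[OF bounded_linear_rf bounded_linear_Fop])+
qed (simp add: rf_abs Fop_abs L2_reflect integrable_reflect bessel(1) ft_reflect[abs_def])

lemma Fop_cj: "Fop (cj u) = cj (rf (Fop u))"
proof (rule Fop_dense[where A="\<lambda>u. Fop (cj u)" and B="\<lambda>u. cj (rf (Fop u))"])
  show "bounded_linear (\<lambda>u. Fop (cj u))" "bounded_linear (\<lambda>u. cj (rf (Fop u)))"
    by (intro bounded_linear_compose[OF bounded_linear_Fop bounded_linear_cj]
        bounded_linear_compose[OF bounded_linear_cj bounded_linear_compose[OF bounded_linear_rf bounded_linear_Fop]])+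
qed (simp add: rf_abs cj_abs Fop_abs L2_reflect L2_cnj bessel(1) ft_cnj[abs_def])

definition Fi :: "l2 \<Rightarrow> l2" where
  "Fi v = (1 / (2 * pi)) *\<^sub>R rf (Fop v)"

lemma Fi_Fop [simp]: "Fi (Fop u) = u"
  by (simp add: Fi_def Fop_Fop)

lemma Fop_Fi [simp]: "Fop (Fi v) = v"
  unfolding Fi_def linear_scale[OF bounded_linear.linear[OF bounded_linear_Fop]]
  by (simp add: Fop_rf Fop_Fop)

lemma bounded_linear_Fi: "bounded_linear Fi"
  unfolding Fi_def[abs_def]
  by (intro bounded_linear_compose[OF bounded_linear_scaleR_right]
      bounded_linear_compose[OF bounded_linear_rf bounded_linear_Fop])

lemma Fop_eq_iff: "Fop u = Fop v \<longleftrightarrow> u = v"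
  by (metis Fi_Fop)

subsection \<open>Fourier multipliers\<close>

definition mlt :: "(real \<Rightarrow> complex) \<Rightarrow> l2 \<Rightarrow> l2" where
  "mlt m u = Fi (mul m (Fop u))"

lemma Fop_mlt [simp]: "Fop (mlt m u) = mul m (Fop u)"
  by (simp add: mlt_def)

lemma bounded_linear_mlt: "bounded_linear (mlt m)"
  unfolding mlt_def[abs_def]
  by (intro bounded_linear_compose[OF bounded_linear_Fi] bounded_linear_compose[OF bounded_linear_mul bounded_linear_Fop])

lemma mlt_mlt: "bmul m \<Longrightarrow> bmul m' \<Longrightarrow> mlt m (mlt m' u) = mlt (\<lambda>x. m x * m' x) u"
  by (simp add: mlt_def mul_mul)

lemma mlt_add_left: "bmul m \<Longrightarrow> bmul m' \<Longrightarrow> mlt (\<lambda>x. m x + m' x) u = mlt m u + mlt m' u"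
  by (rule Fop_eq_iff[THEN iffD1]) (simp add: mul_add_left linear_add[OF bounded_linear.linear[OF bounded_linear_Fop]])

lemma mlt_norm:
  assumes "m \<in> borel_measurable borel" "\<And>x. norm (m x) \<le> C"
  shows "norm (mlt m u) \<le> C * norm u"
proof -
  have "sqrt (2 * pi) * norm (mlt m u) \<le> C * (sqrt (2 * pi) * norm u)"
    unfolding norm_Fop[symmetric] Fop_mlt by (rule mul_norm[OF assms])
  then have "sqrt (2 * pi) * norm (mlt m u) \<le> sqrt (2 * pi) * (C * norm u)" by argo
  then show ?thesis by (rule mult_left_le_imp_le) simp
qed

lemma inner_Fop: "u \<bullet> v = (Fop u \<bullet> Fop v) / (2 * pi)"
  by (simp add: plancherel)

lemma inner_mlt_left: "bmul m \<Longrightarrow> mlt m u \<bullet> v = u \<bullet> mlt (\<lambda>x. cnj (m x)) v"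
  unfolding inner_Fop[of "mlt m u"] inner_Fop[of u] by (simp add: inner_mul_left)

lemma mlt_cj: "bmul m \<Longrightarrow> cj (mlt m u) = mlt (\<lambda>x. cnj (m (- x))) (cj u)"
  using bmul_reflect[of m] by - (rule Fop_eq_iff[THEN iffD1], simp add: Fop_cj rf_mul cj_mul)

lemma has_fourier_iff:
  assumes f: "f \<in> L2" and g: "g \<in> L2"
  shows "has_fourier f g \<longleftrightarrow> Fop (abs_l2 f) = abs_l2 g"
proof -
  have eq: "(LINT x:{-real n..real n}|lborel. f x * exp (- \<i> * of_real (x * \<xi>))) = ft (tr n f) \<xi>" for n \<xi>
    unfolding set_lebesgue_integral_def ft_def
    by (intro Bochner_Integration.integral_cong refl) (auto simp: tr_def ind_def indicator_def)
  have "has_fourier f g \<longleftrightarrow> (\<lambda>n. L2_sqdist (ft (tr n f)) g) \<longlonglongrightarrow> 0"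
    unfolding has_fourier_def eq using f g by simp
  also have "\<dots> \<longleftrightarrow> (\<lambda>n. abs_l2 (ft (tr n f))) \<longlonglongrightarrow> abs_l2 g"
    using f g by (intro L2_sqdist_tendsto_iff) (auto intro!: always_eventually bessel(1) tr_L2 tr_integrable)
  also have "\<dots> \<longleftrightarrow> Fop (abs_l2 f) = abs_l2 g"
    using Fop_tendsto[OF f] LIMSEQ_unique by metis
  finally show ?thesis .
qed

lemma fourier_L2: "f \<in> L2 \<Longrightarrow> fourier f \<in> L2"
  and abs_fourier: "f \<in> L2 \<Longrightarrow> abs_l2 (fourier f) = Fop (abs_l2 f)"
proof -
  assume f: "f \<in> L2"
  have "has_fourier f (rep_l2 (Fop (abs_l2 f)))" using f by (simp add: has_fourier_iff)
  then have *: "has_fourier f (fourier f)" unfolding fourier_def by (rule someI[of "has_fourier f"])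
  then show "fourier f \<in> L2" by (simp add: has_fourier_def)
  with * f show "abs_l2 (fourier f) = Fop (abs_l2 f)" by (simp add: has_fourier_iff)
qed

subsection \<open>Smooth square integrable functions\<close>

text \<open>The estimates run on real functions, where real differential calculus applies;
  \<open>cl\<close> carries their results into \<open>l2\<close>.\<close>

definition rl2 :: "(real \<Rightarrow> real) \<Rightarrow> bool" where
  "rl2 f \<longleftrightarrow> (\<lambda>x. complex_of_real (f x)) \<in> L2"

definition cl :: "(real \<Rightarrow> real) \<Rightarrow> l2" where
  "cl f = abs_l2 (\<lambda>x. complex_of_real (f x))"

lemma rl2_measurable: "rl2 f \<Longrightarrow> f \<in> borel_measurable borel"
proof -
  assume "rl2 f"
  then have [measurable]: "(\<lambda>x. complex_of_real (f x)) \<in> borel_measurable borel"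
    unfolding rl2_def by (rule L2_measurable)
  have "(\<lambda>x. Re (complex_of_real (f x))) \<in> borel_measurable borel" by measurable
  then show ?thesis by simp
qed

lemma rl2_add: "rl2 f \<Longrightarrow> rl2 g \<Longrightarrow> rl2 (\<lambda>x. f x + g x)"
  unfolding rl2_def by (simp add: L2_add)

lemma rl2_cmult: "rl2 f \<Longrightarrow> rl2 (\<lambda>x. c * f x)"
  unfolding rl2_def by (simp add: L2_cmult)

lemma rl2_diff: "rl2 f \<Longrightarrow> rl2 g \<Longrightarrow> rl2 (\<lambda>x. f x - g x)"
  unfolding rl2_def by (simp add: L2_diff)

lemma rl2_bmult:
  assumes "rl2 f" "g \<in> borel_measurable borel" "\<And>x. \<bar>g x\<bar> \<le> C"
  shows "rl2 (\<lambda>x. g x * f x)"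
  unfolding rl2_def of_real_mult
  by (rule L2_bounded_mult[where C=C]) (use assms in \<open>auto simp: rl2_def\<close>)

lemma cl_add: "rl2 f \<Longrightarrow> rl2 g \<Longrightarrow> cl (\<lambda>x. f x + g x) = cl f + cl g"
  unfolding rl2_def cl_def by (simp add: abs_add)

lemma cl_diff: "rl2 f \<Longrightarrow> rl2 g \<Longrightarrow> cl (\<lambda>x. f x - g x) = cl f - cl g"
  unfolding rl2_def cl_def by (simp add: abs_diff)

lemma cl_cmult: "rl2 f \<Longrightarrow> cl (\<lambda>x. c * f x) = c *\<^sub>R cl f"
  unfolding rl2_def cl_def using abs_scaleR[of _ c] by (simp add: scaleR_conv_of_real)

lemma rl2_integrable: "rl2 f \<Longrightarrow> rl2 g \<Longrightarrow> integrable lborel (\<lambda>x. f x * g x)"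
  using L2_inner_integrable[of "\<lambda>x. complex_of_real (f x)" "\<lambda>x. complex_of_real (g x)"]
  by (simp add: rl2_def inner_complex_def)

lemma inner_cl: "rl2 f \<Longrightarrow> rl2 g \<Longrightarrow> cl f \<bullet> cl g = (LINT x|lborel. f x * g x)"
  by (simp add: cl_def rl2_def inner_abs inner_complex_def)

lemma cj_cl [simp]: "rl2 f \<Longrightarrow> cj (cl f) = cl f"
  by (simp add: cl_def rl2_def cj_abs)

lemma norm_cl_le:
  assumes "rl2 f" "rl2 g" "\<And>x. \<bar>f x\<bar> \<le> C * \<bar>g x\<bar>" "C \<ge> 0"
  shows "norm (cl f) \<le> C * norm (cl g)"
  unfolding cl_def by (rule norm_abs_le) (use assms in \<open>auto simp: rl2_def\<close>)

lemma norm_cl_mult_le: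
  assumes "rl2 f" "g \<in> borel_measurable borel" "\<And>x. \<bar>g x\<bar> \<le> C"
  shows "norm (cl (\<lambda>x. g x * f x)) \<le> C * norm (cl f)"
proof (rule norm_cl_le)
  show "C \<ge> 0" using assms(3)[of 0] by linarith
qed (use assms in \<open>auto simp: abs_mult intro: rl2_bmult mult_right_mono\<close>)

lemma inner_cl_mult: 
  assumes "rl2 f" "rl2 h" "g \<in> borel_measurable borel" "\<And>x. \<bar>g x\<bar> \<le> C"
  shows "cl (\<lambda>x. g x * f x) \<bullet> cl h = cl f \<bullet> cl (\<lambda>x. g x * h x)"
  using rl2_bmult[OF assms(1,3,4)] rl2_bmult[OF assms(2,3,4)] assms by (simp add: inner_cl mult_ac)

text \<open>Stands in for a limit at infinity, which an integrable function need not have.\<close>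

lemma integrable_small:
  fixes k :: "real \<Rightarrow> real"
  assumes k: "integrable lborel k" and c: "c > 0"
  shows "\<exists>x\<ge>X. \<bar>k x\<bar> < c"
proof (rule ccontr)
  assume "\<not> ?thesis"
  then have ge: "c \<le> \<bar>k x\<bar>" if "x \<ge> X" for x using that by force
  have "c * real n \<le> (LINT x|lborel. \<bar>k x\<bar>)" for n :: nat
  proof -
    have "c * real n = (LINT x|lborel. c * indicator {X..X + real n} x)" by simp
    also have "\<dots> \<le> (LINT x|lborel. \<bar>k x\<bar>)"
    proof (rule integral_mono)
      show "integrable lborel (\<lambda>x. c * indicator {X..X + real n} x)"
        by (simp add: emeasure_lborel_Icc_eq)
      show "c * indicator {X..X + real n} x \<le> \<bar>k x\<bar>" for x
        using ge[of x] c by (auto simp: indicator_def)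
    qed (use k in simp)
    finally show ?thesis .
  qed
  moreover obtain n :: nat where "(LINT x|lborel. \<bar>k x\<bar>) < real n * c"
    using reals_Archimedean3[OF c] by blast
  ultimately show False by (metis mult.commute not_less)
qed

lemma FTC_abs_le:
  assumes d: "\<And>x. (h has_real_derivative h' x) (at x)" and c: "\<And>x. isCont h' x" and i: "integrable lborel h'"
  shows "\<bar>h b - h a\<bar> \<le> (LINT x|lborel. \<bar>h' x\<bar>)"
proof -
  have *: "\<bar>h b - h a\<bar> \<le> (LINT x|lborel. \<bar>h' x\<bar>)" if "a \<le> b" for a b
  proof -
    have "h b - h a = (LINT x|lborel. h' x * indicator {a..b} x)"
      using integral_FTC_Icc_real[OF that, of h h'] d c by simp
    also have "\<bar>\<dots>\<bar> \<le> (LINT x|lborel. \<bar>h' x * indicator {a..b} x\<bar>)" by (rule integral_abs_bound)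
    also have "\<dots> \<le> (LINT x|lborel. \<bar>h' x\<bar>)"
      using i by (intro integral_mono') (auto simp: indicator_def)
    finally show ?thesis .
  qed
  from *[of a b] *[of b a] show ?thesis by (cases "a \<le> b") (auto simp: abs_minus_commute)
qed

text \<open>The integral over \<open>[-t, t]\<close> is \<open>h t - h (- t)\<close>. It tends to
  the full integral, and as an integrable function of \<open>t\<close> it is small at arbitrarily
  large \<open>t\<close>, so the limit is zero.\<close>

lemma integral_deriv_zero:
  assumes d: "\<And>x. (h has_real_derivative h' x) (at x)" and c: "\<And>x. isCont h' x"
    and i: "integrable lborel h'" "integrable lborel h"
  shows "(LINT x|lborel. h' x) = 0"
proof -
  define I where "I = (LINT x|lborel. h' x)"
  define k where "k x = h x - h (- x)" for x
  have ki: "integrable lborel k"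
    unfolding k_def using i(2) lborel_integrable_real_affine[of h "-1" 0] by auto
  have "((\<lambda>t. LINT x|lborel. h' x * indicator {-t..t} x) \<longlongrightarrow> I) at_top"
    unfolding I_def
  proof (rule integral_dominated_convergence_at_top[where w="\<lambda>x. \<bar>h' x\<bar>"])
    show "AE x in lborel. ((\<lambda>t. h' x * indicator {-t..t} x) \<longlongrightarrow> h' x) at_top"
    proof (intro AE_I2 tendsto_eventually)
      fix x
      show "\<forall>\<^sub>F t in at_top. h' x * indicator {-t..t} x = h' x"
        using eventually_ge_at_top[of "\<bar>x\<bar>"] by eventually_elim (auto simp: indicator_def)
    qed
  qed (use i in \<open>auto simp: indicator_def intro!: always_eventually\<close>)
  moreover have "\<forall>\<^sub>F t in at_top. (LINT x|lborel. h' x * indicator {-t..t} x) = k t"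
    using eventually_ge_at_top[of 0]
  proof eventually_elim
    case (elim t)
    then show ?case using integral_FTC_Icc_real[of "-t" t h h'] d c by (simp add: k_def)
  qed
  ultimately have lim: "(k \<longlongrightarrow> I) at_top" by (rule Lim_transform_eventually)
  have "\<bar>I\<bar> < e" if e: "e > 0" for e
  proof -
    from tendstoD[OF lim, of "e/2"] e obtain X where X: "\<And>x. x \<ge> X \<Longrightarrow> \<bar>k x - I\<bar> < e/2"
      by (auto simp: eventually_at_top_linorder dist_real_def)
    from integrable_small[OF ki, of "e/2" X] e obtain x where "x \<ge> X" "\<bar>k x\<bar> < e/2" by auto
    with X[of x] show ?thesis by linarith
  qed
  then have "I = 0" by (metis less_irrefl zero_less_abs_iff)
  then show ?thesis by (simp add: I_def)
qed

lemma rl2_parts: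
  assumes r: "rl2 f" "rl2 f'" "rl2 g" "rl2 g'"
    and d: "\<And>x. (f has_real_derivative f' x) (at x)" "\<And>x. (g has_real_derivative g' x) (at x)"
    and c: "\<And>x. isCont f' x" "\<And>x. isCont g' x"
  shows "cl f' \<bullet> cl g = - (cl f \<bullet> cl g')"
proof -
  have c0: "isCont f x" "isCont g x" for x using d DERIV_isCont by blast+
  have "(LINT x|lborel. f' x * g x + f x * g' x) = 0"
  proof (rule integral_deriv_zero)
    show "((\<lambda>x. f x * g x) has_real_derivative f' x * g x + f x * g' x) (at x)" for x
      using DERIV_mult[OF d(1)[of x] d(2)[of x]] by (simp add: mult.commute add.commute)
    show "isCont (\<lambda>x. f' x * g x + f x * g' x) x" for x
      by (intro continuous_intros c c0)
  qed (intro Bochner_Integration.integrable_add rl2_integrable r)+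
  then show ?thesis
    using rl2_integrable[OF r(2,3)] rl2_integrable[OF r(1,4)] by (simp add: inner_cl r)
qed

lemma rl2_abs: "rl2 f \<Longrightarrow> rl2 (\<lambda>x. \<bar>f x\<bar>)"
  unfolding rl2_def
  by (rule L2I_mult[where f="\<lambda>x. complex_of_real (f x)" and C=1])
    (auto dest: rl2_measurable[unfolded rl2_def])

text \<open>Integrate \<open>(f^2)' = 2 * f * f'\<close> from a point where \<open>f^2\<close> is as
  small as desired, and apply Cauchy-Schwarz.\<close>

lemma agmon:
  assumes r: "rl2 f" "rl2 f'" and d: "\<And>x. (f has_real_derivative f' x) (at x)" and c: "\<And>x. isCont f' x"
  shows "(f x)\<^sup>2 \<le> 2 * norm (cl f) * norm (cl f')"
proof (rule ccontr)
  assume "\<not> ?thesis"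
  then have pos: "(f x)\<^sup>2 - 2 * norm (cl f) * norm (cl f') > 0" by simp
  have c0: "isCont f x" for x using d DERIV_isCont by blast
  have f2: "integrable lborel (\<lambda>x. f x * f x)" by (intro rl2_integrable r)
  have ff': "integrable lborel (\<lambda>x. f x * f' x)" by (intro rl2_integrable r)
  have bound: "\<bar>(f x)\<^sup>2 - (f t)\<^sup>2\<bar> \<le> 2 * norm (cl f) * norm (cl f')" for t
  proof -
    have "\<bar>(f x)\<^sup>2 - (f t)\<^sup>2\<bar> \<le> (LINT x|lborel. \<bar>2 * (f x * f' x)\<bar>)"
    proof (rule FTC_abs_le[where h="\<lambda>x. (f x)\<^sup>2"])
      show "((\<lambda>x. (f x)\<^sup>2) has_real_derivative 2 * (f x * f' x)) (at x)" for x
        using DERIV_power[OF d[of x], of 2] by (simp add: mult_ac)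
      show "isCont (\<lambda>x. 2 * (f x * f' x)) x" for x by (intro continuous_intros c c0)
    qed (use ff' in simp)
    also have "\<dots> = 2 * (cl (\<lambda>x. \<bar>f x\<bar>) \<bullet> cl (\<lambda>x. \<bar>f' x\<bar>))"
      using r by (simp add: inner_cl rl2_abs abs_mult)
    also have "\<dots> \<le> 2 * (norm (cl (\<lambda>x. \<bar>f x\<bar>)) * norm (cl (\<lambda>x. \<bar>f' x\<bar>)))"
      by (intro mult_left_mono norm_cauchy_schwarz) simp
    also have "\<dots> \<le> 2 * (norm (cl f) * norm (cl f'))"
      using norm_cl_le[OF rl2_abs[OF r(1)] r(1), of 1] norm_cl_le[OF rl2_abs[OF r(2)] r(2), of 1]
      by (intro mult_left_mono mult_mono) auto
    finally show ?thesis by simp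
  qed
  from integrable_small[OF f2 pos, of 0] obtain t where "\<bar>f t * f t\<bar> < (f x)\<^sup>2 - 2 * norm (cl f) * norm (cl f')" by blast
  with bound[of t] show False by (simp add: power2_eq_square)
qed

section \<open>Derivative sequences (jets) and the Leibniz rule\<close>

definition chain :: "(nat \<Rightarrow> real \<Rightarrow> real) \<Rightarrow> bool" where
  "chain f \<longleftrightarrow> (\<forall>k x. (f k has_real_derivative f (Suc k) x) (at x))"

definition jet :: "(nat \<Rightarrow> real \<Rightarrow> real) \<Rightarrow> bool" where
  "jet f \<longleftrightarrow> chain f \<and> (\<forall>k. rl2 (f k))"

definition bjet :: "(nat \<Rightarrow> real \<Rightarrow> real) \<Rightarrow> bool" where
  "bjet f \<longleftrightarrow> chain f \<and> (\<forall>k. \<exists>C. \<forall>x. \<bar>f k x\<bar> \<le> C)"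

lemma chainD: "chain f \<Longrightarrow> (f k has_real_derivative f (Suc k) x) (at x)"
  by (simp add: chain_def)

lemma chain_isCont: "chain f \<Longrightarrow> isCont (f k) x"
  using chainD DERIV_isCont by blast

lemma chain_measurable: "chain f \<Longrightarrow> f k \<in> borel_measurable borel"
  by (intro borel_measurable_continuous_onI) (simp add: continuous_on_eq_continuous_at chain_isCont)

lemma jet_chain: "jet f \<Longrightarrow> chain f" and jet_rl2: "jet f \<Longrightarrow> rl2 (f k)"
  by (auto simp: jet_def)

lemma jet_shift: "jet f \<Longrightarrow> jet (\<lambda>k. f (k + m))"
  by (auto simp: jet_def chain_def)

text \<open>The means of proving product identities at every order: both sides are derivative
  sequences, so only order zero is compared.\<close>

lemma chain_unique: "chain p \<Longrightarrow> chain q \<Longrightarrow> p 0 = q 0 \<Longrightarrow> p k = q k"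
proof (induction k)
  case (Suc k)
  then have "(p k has_real_derivative q (Suc k) x) (at x)" for x using chainD[of q k x] by simp
  then show ?case using chainD[OF Suc.prems(1)] DERIV_unique by blast
qed

lemma jet_agmon: "jet f \<Longrightarrow> (f k x)\<^sup>2 \<le> 2 * norm (cl (f k)) * norm (cl (f (Suc k)))"
  by (intro agmon jet_rl2 chainD jet_chain chain_isCont)

lemma jet_bjet: "jet f \<Longrightarrow> bjet f"
proof -
  assume f: "jet f"
  have "\<bar>f k x\<bar> \<le> sqrt (2 * norm (cl (f k)) * norm (cl (f (Suc k))))" for k x
    using jet_agmon[OF f] by (metis real_sqrt_abs real_sqrt_le_iff)
  then show ?thesis using f unfolding jet_def bjet_def by blast
qed

lemma jet_parts:
  assumes "jet f" "jet g"
  shows "cl (f (Suc k)) \<bullet> cl (g j) = - (cl (f k) \<bullet> cl (g (Suc j)))"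
  using assms by (intro rl2_parts jet_rl2 chainD jet_chain chain_isCont) auto

definition jprod :: "(nat \<Rightarrow> real \<Rightarrow> real) \<Rightarrow> (nat \<Rightarrow> real \<Rightarrow> real) \<Rightarrow> nat \<Rightarrow> real \<Rightarrow> real" where
  "jprod f g k x = (\<Sum>j\<le>k. real (k choose j) * f j x * g (k - j) x)"

lemma jprod_0 [simp]: "jprod f g 0 x = f 0 x * g 0 x"
  by (simp add: jprod_def)

lemma leibniz_sum:
  fixes a b :: "nat \<Rightarrow> real"
  shows "(\<Sum>j\<le>k. real (k choose j) * (a (Suc j) * b (k - j) + a j * b (Suc (k - j))))
    = (\<Sum>j\<le>Suc k. real (Suc k choose j) * (a j * b (Suc k - j)))"
proof -
  have "(\<Sum>j\<le>Suc k. real (Suc k choose j) * (a j * b (Suc k - j)))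
    = a 0 * b (Suc k) + (\<Sum>j\<le>k. real (Suc k choose Suc j) * (a (Suc j) * b (k - j)))"
    by (subst sum.atMost_Suc_shift) simp
  also have "(\<Sum>j\<le>k. real (Suc k choose Suc j) * (a (Suc j) * b (k - j)))
    = (\<Sum>j\<le>k. real (k choose j) * (a (Suc j) * b (k - j))) + (\<Sum>j\<le>k. real (k choose Suc j) * (a (Suc j) * b (k - j)))"
    by (simp add: sum.distrib[symmetric] algebra_simps)
  also have "a 0 * b (Suc k) + (\<dots>) = (\<Sum>j\<le>k. real (k choose j) * (a (Suc j) * b (k - j)))
     + (\<Sum>j\<le>Suc k. real (k choose j) * (a j * b (Suc k - j)))"
    unfolding sum.atMost_Suc_shift[of "\<lambda>j. real (k choose j) * (a j * b (Suc k - j))"] by simp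
  also have "(\<Sum>j\<le>Suc k. real (k choose j) * (a j * b (Suc k - j))) = (\<Sum>j\<le>k. real (k choose j) * (a j * b (Suc (k - j))))"
    by (simp add: Suc_diff_le)
  finally show ?thesis by (simp add: sum.distrib[symmetric] algebra_simps)
qed

lemma chain_jprod:
  assumes "chain f" "chain g"
  shows "chain (jprod f g)"
  unfolding chain_def
proof (intro allI)
  fix k x
  have "((\<lambda>x. \<Sum>j\<le>k. real (k choose j) * (f j x * g (k - j) x)) has_real_derivative
     (\<Sum>j\<le>k. real (k choose j) * (f (Suc j) x * g (k - j) x + f j x * g (Suc (k - j)) x))) (at x)"
    by (intro DERIV_sum DERIV_cmult DERIV_cong[OF DERIV_mult[OF chainD[OF assms(1)] chainD[OF assms(2)]]])
      (simp add: algebra_simps)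
  then show "(jprod f g k has_real_derivative jprod f g (Suc k) x) (at x)"
    unfolding leibniz_sum[of k "\<lambda>j. f j x" "\<lambda>j. g j x"] jprod_def[abs_def] by (simp add: mult.assoc)
qed

lemma rl2_sum: "(\<And>i. i \<in> A \<Longrightarrow> rl2 (f i)) \<Longrightarrow> rl2 (\<lambda>x. \<Sum>i\<in>A. f i x)"
  unfolding rl2_def by (simp add: L2_sum)

lemma cl_sum: "(\<And>i. i \<in> A \<Longrightarrow> rl2 (f i)) \<Longrightarrow> cl (\<lambda>x. \<Sum>i\<in>A. f i x) = (\<Sum>i\<in>A. cl (f i))"
  unfolding rl2_def cl_def by (simp add: abs_sum)

lemma bjet_rl2_mult: "bjet f \<Longrightarrow> rl2 h \<Longrightarrow> rl2 (\<lambda>x. f j x * h x)"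
proof -
  assume f: "bjet f" and h: "rl2 h"
  then obtain C where "\<And>x. \<bar>f j x\<bar> \<le> C" by (auto simp: bjet_def)
  with rl2_bmult[OF h, of "f j"] f show ?thesis by (auto simp: bjet_def chain_measurable)
qed

text \<open>The asymmetry between the factors is for the damping coefficient, which has bounded
  derivatives but is bounded below and so not square integrable.\<close>

lemma jet_jprod: "bjet f \<Longrightarrow> jet g \<Longrightarrow> jet (jprod f g)"
  unfolding jet_def
proof (intro conjI allI)
  assume f: "bjet f" and g: "chain g \<and> (\<forall>k. rl2 (g k))"
  show "chain (jprod f g)" using f g by (simp add: bjet_def chain_jprod)
  show "rl2 (jprod f g k)" for k
    unfolding jprod_def[abs_def] mult.assoc
    by (intro rl2_sum rl2_cmult bjet_rl2_mult f) (use g in simp)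
qed

lemma jet_add: "jet f \<Longrightarrow> jet g \<Longrightarrow> jet (\<lambda>k x. f k x + g k x)"
  by (auto simp: jet_def chain_def rl2_add intro!: DERIV_add)

lemma jet_diff: "jet f \<Longrightarrow> jet g \<Longrightarrow> jet (\<lambda>k x. f k x - g k x)"
  by (auto simp: jet_def chain_def rl2_diff intro!: DERIV_diff)

lemma jet_cmult: "jet f \<Longrightarrow> jet (\<lambda>k x. c * f k x)"
  by (auto simp: jet_def chain_def rl2_cmult intro!: DERIV_cmult)

subsection \<open>Band-limited elements\<close>

text \<open>The symbol of the \<open>k\<close>-th derivative, cut off at frequency \<open>N\<close>;
  order zero is the frequency projection. The cutoff makes derivatives of every order bounded
  operators.\<close>

definition band :: "real \<Rightarrow> nat \<Rightarrow> real \<Rightarrow> complex" where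
  "band N k \<xi> = (\<i> * of_real \<xi>) ^ k * ind (- N) N \<xi>"

lemma band_measurable [measurable]: "band N k \<in> borel_measurable borel"
  unfolding band_def by measurable

lemma band_norm: "N \<ge> 0 \<Longrightarrow> norm (band N k \<xi>) \<le> N ^ k"
  by (auto simp: band_def norm_mult norm_power ind_def indicator_def intro!: power_mono)

lemma bmul_band: "bmul (band N k)"
proof (cases "N \<ge> 0")
  case True
  then show ?thesis by (intro bmulI[where C="N^k"] band_norm) auto
next
  case False
  then have "band N k = (\<lambda>x. 0)" by (auto simp: band_def ind_def indicator_def)
  then show ?thesis by simp
qed

definition dN :: "real \<Rightarrow> nat \<Rightarrow> l2 \<Rightarrow> l2" where
  "dN N k = mlt (band N k)"

lemma ind_reflect [simp]: "ind (- N) N (- \<xi>) = ind (- N) N \<xi>"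
  by (auto simp: ind_def indicator_def)

lemma ind_cnj [simp]: "cnj (ind a b \<xi>) = ind a b \<xi>"
  by (auto simp: ind_def indicator_def)

lemma band_cnj: "cnj (band N k (- \<xi>)) = band N k \<xi>" "cnj (band N k \<xi>) = (-1) ^ k * band N k \<xi>"
  using power_minus[of "\<i> * of_real \<xi>" k] by (simp_all add: band_def)

lemma bounded_linear_dN: "bounded_linear (dN N k)"
  unfolding dN_def by (rule bounded_linear_mlt)

lemmas dN_add = linear_add[OF bounded_linear.linear[OF bounded_linear_dN]]
  and dN_diff = linear_diff[OF bounded_linear.linear[OF bounded_linear_dN]]
  and dN_scaleR = linear_scale[OF bounded_linear.linear[OF bounded_linear_dN]]
  and dN_neg = linear_neg[OF bounded_linear.linear[OF bounded_linear_dN]]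

lemma dN_dN: "N \<le> M \<Longrightarrow> dN M j (dN N k u) = dN N (j + k) u" "N \<le> M \<Longrightarrow> dN N j (dN M k u) = dN N (j + k) u"
proof -
  assume "N \<le> M"
  then have "(\<lambda>x. band M j x * band N k x) = band N (j + k)" "(\<lambda>x. band N j x * band M k x) = band N (j + k)"
    by (auto simp: band_def ind_def indicator_def power_add)
  then show "dN M j (dN N k u) = dN N (j + k) u" "dN N j (dN M k u) = dN N (j + k) u"
    by (simp_all add: dN_def mlt_mlt bmul_band)
qed

lemma dN_cj: "cj (dN N k u) = dN N k (cj u)"
  by (simp add: dN_def mlt_cj bmul_band band_cnj(1))

lemma dN_norm: "N \<ge> 0 \<Longrightarrow> norm (dN N k u) \<le> N ^ k * norm u"
  unfolding dN_def by (intro mlt_norm band_norm) auto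

lemma mlt_minus_power: "mlt (\<lambda>x. (-1) ^ k * m x) u = (-1) ^ k *\<^sub>R mlt m u" if "bmul m"
proof -
  have "(\<lambda>x. (-1) ^ k * m x) = (\<lambda>x. (\<lambda>x. of_real ((-1) ^ k)) x * m x)" by simp
  moreover have "mul (\<lambda>x. of_real r) v = r *\<^sub>R v" for r v
    using abs_scaleR[of "rep_l2 v" r] by (simp add: mul_rep scaleR_conv_of_real)
  ultimately show ?thesis
    using that linear_scale[OF bounded_linear.linear[OF bounded_linear_Fi]]
    by (simp add: mlt_def mul_mul[symmetric] del: of_real_power)
qed

text \<open>The symbol is \<open>\<i> ^ k\<close> times a real function, so the adjoint gains the
  sign \<open>(-1) ^ k\<close>. For odd \<open>k\<close> this removes the dispersive terms from all
  quadratic estimates.\<close>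

lemma dN_skew: "dN N k u \<bullet> v = (-1) ^ k * (u \<bullet> dN N k v)"
  unfolding dN_def using inner_mlt_left[OF bmul_band, of N k u v]
  by (simp add: band_cnj mlt_minus_power bmul_band)

lemma dN_tendsto: "(\<lambda>n. dN (real n) 0 u) \<longlonglongrightarrow> u"
proof -
  have "dN (real n) 0 u = Fi (abs_l2 (tr n (rep_l2 (Fop u))))" for n
    by (simp add: dN_def mlt_def mul_rep bmul_band tr_def[abs_def] band_def)
  moreover have "(\<lambda>n. Fi (abs_l2 (tr n (rep_l2 (Fop u))))) \<longlonglongrightarrow> Fi (Fop u)"
    using tr_tendsto[of "rep_l2 (Fop u)"] by (intro bounded_linear.tendsto[OF bounded_linear_Fi]) simp
  ultimately show ?thesis by simp
qed

text \<open>A smooth representative of \<open>dN N k u\<close>, by Fourier inversion.\<close>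

definition bl :: "real \<Rightarrow> l2 \<Rightarrow> nat \<Rightarrow> real \<Rightarrow> complex" where
  "bl N u k x = ft (\<lambda>\<xi>. band N k \<xi> * rep_l2 (Fop u) \<xi>) (- x) / (2 * pi)"

lemma band_rep: "(\<lambda>\<xi>. band N k \<xi> * rep_l2 v \<xi>) \<in> L2" "integrable lborel (\<lambda>\<xi>. band N k \<xi> * rep_l2 v \<xi>)"
proof -
  show *: "(\<lambda>\<xi>. band N k \<xi> * rep_l2 v \<xi>) \<in> L2" by (intro bmul_L2 bmul_band) simp
  have "ind (- N) N \<xi> * (band N k \<xi> * rep_l2 v \<xi>) = band N k \<xi> * rep_l2 v \<xi>" for \<xi>
    by (auto simp: band_def ind_def indicator_def)
  with ind_mult_integrable[OF *, of "-N" N] show "integrable lborel (\<lambda>\<xi>. band N k \<xi> * rep_l2 v \<xi>)" by simp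
qed

lemma bl_L2: "bl N u k \<in> L2"
  and abs_bl: "abs_l2 (bl N u k) = dN N k u"
proof -
  let ?v = "\<lambda>\<xi>. band N k \<xi> * rep_l2 (Fop u) \<xi>"
  have ftv: "ft ?v \<in> L2" by (intro bessel(1) band_rep)
  have eq: "bl N u k = (\<lambda>x. (1 / (2 * pi)) *\<^sub>R ft ?v (- x))"
    by (auto simp: bl_def scaleR_conv_of_real)
  show "bl N u k \<in> L2" unfolding eq by (intro L2_scaleR L2_reflect[OF ftv])
  have "abs_l2 (bl N u k) = (1 / (2 * pi)) *\<^sub>R rf (abs_l2 (ft ?v))"
    unfolding eq by (subst abs_scaleR) (auto simp: L2_reflect ftv rf_abs)
  also have "\<dots> = Fi (mul (band N k) (Fop u))"
    by (simp add: Fi_def Fop_abs[OF band_rep, symmetric] mul_rep[OF bmul_band])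
  finally show "abs_l2 (bl N u k) = dN N k u" by (simp add: dN_def mlt_def)
qed

lemma exp_taylor: "norm (exp (\<i> * of_real t) - 1 - \<i> * of_real t) \<le> t\<^sup>2"
proof -
  have "norm (iexp t - (\<Sum>k\<le>1. (\<i> * of_real t)^k / fact k)) \<le> \<bar>t\<bar> ^ Suc 1 / fact (Suc 1)"
    by (rule iexp_approx1)
  also have "\<dots> \<le> t\<^sup>2" by (simp add: fact_numeral power2_eq_square)
  finally show ?thesis by (simp add: diff_diff_eq)
qed

text \<open>A quadratic remainder bound avoids interchanging limits; it serves both the inversion
  integral and the flat functions at the origin.\<close>

lemma DERIV_quadratic:
  fixes F :: "real \<Rightarrow> real"
  assumes "\<And>h. \<bar>F (x + h) - F x - h * D\<bar> \<le> C * h\<^sup>2"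
  shows "(F has_real_derivative D) (at x)"
  unfolding DERIV_def
proof (rule LIM_zero_cancel, rule Lim_null_comparison)
  have "((\<lambda>h. C * \<bar>h\<bar>) \<longlongrightarrow> C * \<bar>0\<bar>) (at 0)" by (intro tendsto_intros)
  then show "((\<lambda>h. C * \<bar>h\<bar>) \<longlongrightarrow> 0) (at 0)" by simp
  have "norm ((F (x + h) - F x) / h - D) \<le> C * \<bar>h\<bar>" if "h \<noteq> 0" for h
  proof -
    have "norm ((F (x + h) - F x) / h - D) = \<bar>F (x + h) - F x - h * D\<bar> / \<bar>h\<bar>"
      using that by (simp add: field_simps)
    also have "\<dots> \<le> C * h\<^sup>2 / \<bar>h\<bar>" using assms by (rule divide_right_mono) simp
    also have "\<dots> = C * \<bar>h\<bar>" using that by (simp add: field_simps power2_eq_square abs_mult_self_eq)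
    finally show ?thesis .
  qed
  then show "\<forall>\<^sub>F h in at 0. norm ((F (x + h) - F x) / h - D) \<le> C * \<bar>h\<bar>"
    by (auto simp: eventually_at_filter)
qed

text \<open>Differentiation under the inversion integral with an explicit remainder:
  \<open>exp_taylor\<close> costs two further powers of \<open>\<xi>\<close>, that is the integrand
  of order \<open>k + 2\<close>, which is integrable because of the cutoff.\<close>

lemma bl_deriv: "((\<lambda>x. Re (bl N u k x)) has_real_derivative Re (bl N u (Suc k) x)) (at x)"
proof (rule DERIV_quadratic)
  fix h
  let ?v = "\<lambda>k \<xi>. band N k \<xi> * rep_l2 (Fop u) \<xi>"
  let ?e = "\<lambda>x \<xi>. exp (- \<i> * of_real (\<xi> * (- x)))"
  have i: "integrable lborel (\<lambda>\<xi>. ?v k \<xi> * ?e x \<xi>)" for k x by (intro ft_integrable band_rep)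
  have dec: "?v k \<xi> * ?e (x + h) \<xi> - ?v k \<xi> * ?e x \<xi> - of_real h * (?v (Suc k) \<xi> * ?e x \<xi>)
     = (?v k \<xi> * ?e x \<xi>) * (exp (\<i> * of_real (h * \<xi>)) - 1 - \<i> * of_real (h * \<xi>))" for \<xi>
    by (simp add: band_def algebra_simps exp_add)
  have eq: "ft (?v k) (- (x + h)) - ft (?v k) (- x) - of_real h * ft (?v (Suc k)) (- x)
     = (LINT \<xi>|lborel. ?v k \<xi> * ?e (x + h) \<xi> - ?v k \<xi> * ?e x \<xi> - of_real h * (?v (Suc k) \<xi> * ?e x \<xi>))"
    unfolding ft_def using i[of k "x+h"] i[of k x] i[of "Suc k" x]
    by (subst Bochner_Integration.integral_diff, simp, simp)+ simp
  have "norm (ft (?v k) (- (x + h)) - ft (?v k) (- x) - of_real h * ft (?v (Suc k)) (- x))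
     \<le> (LINT \<xi>|lborel. norm (?v k \<xi> * ?e (x + h) \<xi> - ?v k \<xi> * ?e x \<xi> - of_real h * (?v (Suc k) \<xi> * ?e x \<xi>)))"
    unfolding eq by (rule integral_norm_bound)
  also have "\<dots> \<le> (LINT \<xi>|lborel. h\<^sup>2 * norm (?v (k + 2) \<xi>))"
  proof (rule integral_mono')
    show "integrable lborel (\<lambda>\<xi>. h\<^sup>2 * norm (?v (k + 2) \<xi>))"
      by (intro integrable_mult_right integrable_norm band_rep)
    fix \<xi>
    have "norm ((?v k \<xi> * ?e x \<xi>) * (exp (\<i> * of_real (h * \<xi>)) - 1 - \<i> * of_real (h * \<xi>)))
      \<le> norm (?v k \<xi>) * (h * \<xi>)\<^sup>2"
      using exp_taylor[of "h * \<xi>"] by (simp add: norm_mult mult_left_mono del: of_real_mult)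
    also have "\<dots> = h\<^sup>2 * norm (?v (k + 2) \<xi>)"
      by (simp add: band_def norm_mult norm_power power_add power_mult_distrib power2_eq_square)
    finally show "norm (?v k \<xi> * ?e (x + h) \<xi> - ?v k \<xi> * ?e x \<xi> - of_real h * (?v (Suc k) \<xi> * ?e x \<xi>))
       \<le> h\<^sup>2 * norm (?v (k + 2) \<xi>)" unfolding dec .
  qed simp
  also have "\<dots> = h\<^sup>2 * (LINT \<xi>|lborel. norm (?v (k + 2) \<xi>))" by simp
  finally have b: "norm (ft (?v k) (- (x + h)) - ft (?v k) (- x) - of_real h * ft (?v (Suc k)) (- x))
      \<le> h\<^sup>2 * (LINT \<xi>|lborel. norm (?v (k + 2) \<xi>))" .
  have "bl N u k (x + h) - bl N u k x - of_real h * bl N u (Suc k) x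
      = (ft (?v k) (- (x + h)) - ft (?v k) (- x) - of_real h * ft (?v (Suc k)) (- x)) / of_real (2 * pi)"
    by (simp add: bl_def diff_divide_distrib)
  then have "norm (bl N u k (x + h) - bl N u k x - of_real h * bl N u (Suc k) x)
    \<le> h\<^sup>2 * (LINT \<xi>|lborel. norm (?v (k + 2) \<xi>)) / (2 * pi)"
    using divide_right_mono[OF b, of "2 * pi"] by (simp add: norm_divide)
  moreover have "\<bar>Re (bl N u k (x + h)) - Re (bl N u k x) - h * Re (bl N u (Suc k) x)\<bar>
     \<le> norm (bl N u k (x + h) - bl N u k x - of_real h * bl N u (Suc k) x)"
    using abs_Re_le_cmod[of "bl N u k (x + h) - bl N u k x - of_real h * bl N u (Suc k) x"] by simp
  ultimately show "\<bar>Re (bl N u k (x + h)) - Re (bl N u k x) - h * Re (bl N u (Suc k) x)\<bar>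
    \<le> (LINT \<xi>|lborel. norm (?v (k + 2) \<xi>)) / (2 * pi) * h\<^sup>2" by (simp add: mult.commute)
qed

lemma L2_Re: "f \<in> L2 \<Longrightarrow> rl2 (\<lambda>x. Re (f x))"
  unfolding rl2_def by (rule L2I_mult[where f=f and C=1]) (auto intro: abs_Re_le_cmod)

lemma cl_Re: "f \<in> L2 \<Longrightarrow> cl (\<lambda>x. Re (f x)) = (1/2) *\<^sub>R (abs_l2 f + cj (abs_l2 f))"
proof -
  assume f: "f \<in> L2"
  have "abs_l2 f + cj (abs_l2 f) = abs_l2 (\<lambda>x. 2 *\<^sub>R complex_of_real (Re (f x)))"
    using f by (simp add: cj_abs abs_add[symmetric] L2_cnj scaleR_conv_of_real complex_add_cnj)
  also have "\<dots> = 2 *\<^sub>R cl (\<lambda>x. Re (f x))"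
    unfolding cl_def by (rule abs_scaleR[OF L2_Re[OF f, unfolded rl2_def]])
  finally show ?thesis by simp
qed

lemma band_jet:
  assumes "cj u = u"
  shows "\<exists>f. jet f \<and> (\<forall>k. cl (f k) = dN N k u) \<and> f = (\<lambda>k x. Re (bl N u k x))"
proof (intro exI conjI allI)
  show "jet (\<lambda>k x. Re (bl N u k x))"
    unfolding jet_def chain_def by (auto intro: bl_deriv L2_Re bl_L2)
  show "cl (\<lambda>x. Re (bl N u k x)) = dN N k u" for k
    using assms by (simp add: cl_Re bl_L2 abs_bl dN_cj scaleR_2[symmetric])
qed simp

text \<open>Classical and truncated Fourier derivatives agree. The difference \<open>w\<close> is
  tested against itself: being real, it has band-limited smooth representatives, and moving the
  operators onto them leaves one integration by parts.\<close>

lemma dN_jet: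
  assumes "jet f"
  shows "dN N (Suc k) (cl (f j)) = dN N k (cl (f (Suc j)))"
proof -
  define w where "w = dN N (Suc k) (cl (f j)) - dN N k (cl (f (Suc j)))"
  have w: "cj w = w" unfolding w_def
    using linear_diff[OF bounded_linear.linear[OF bounded_linear_cj]]
    by (simp add: dN_cj assms jet_rl2)
  from band_jet[OF w] obtain g where g: "jet g" "\<And>k. cl (g k) = dN N k w" by blast
  have "w \<bullet> w = (-1) ^ Suc k * (cl (f j) \<bullet> cl (g (Suc k))) - (-1) ^ k * (cl (f (Suc j)) \<bullet> cl (g k))"
    unfolding g(2) by (subst (1) w_def) (simp add: inner_diff_left dN_skew del: power_Suc)
  also have "\<dots> = 0" using jet_parts[OF assms g(1), of j k] by simp
  finally show ?thesis by (simp add: w_def)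
qed

lemma dN_jet_iter: "jet f \<Longrightarrow> dN N k (cl (f j)) = dN N 0 (cl (f (j + k)))"
  by (induction k arbitrary: j) (auto simp: dN_jet)

text \<open>Between the frequencies \<open>N\<close> and \<open>M\<close> the symbol 1 is the symbol
  of the \<open>j\<close>-th derivative divided by \<open>(\<i> * \<xi>) ^ j\<close>, and the
  quotient is bounded by \<open>1 / N ^ j\<close>.\<close>

lemma dN_tail:
  assumes N: "0 < N" "N \<le> M"
  shows "norm (dN M 0 u - dN N 0 u) \<le> norm (dN M j u) / N ^ j"
proof -
  define m where "m \<xi> = (if \<bar>\<xi>\<bar> \<le> N then 0 else 1 / (\<i> * complex_of_real \<xi>) ^ j)" for \<xi>
  have [measurable]: "m \<in> borel_measurable borel" unfolding m_def by measurable
  have mb: "norm (m \<xi>) \<le> 1 / N ^ j" for \<xi>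
    using N by (auto simp: m_def norm_divide norm_power norm_mult intro!: divide_left_mono power_mono)
  then have bm: "bmul m" by (intro bmulI) auto
  have "band M 0 = (\<lambda>\<xi>. m \<xi> * band M j \<xi> + band N 0 \<xi>)"
    using N by (auto simp: m_def band_def ind_def indicator_def fun_eq_iff)
  then have "dN M 0 u = mlt (\<lambda>\<xi>. m \<xi> * band M j \<xi>) u + dN N 0 u"
    unfolding dN_def by (metis mlt_add_left bmul_mult bm bmul_band)
  then have "dN M 0 u - dN N 0 u = mlt m (dN M j u)"
    by (simp add: dN_def mlt_mlt bm bmul_band)
  then show ?thesis using mlt_norm[of m "1 / N ^ j" "dN M j u"] mb by simp
qed

lemma jet_interp:
  assumes "jet f"
  shows "(norm (cl (f (Suc k))))\<^sup>2 \<le> norm (cl (f k)) * norm (cl (f (Suc (Suc k))))"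
proof -
  have "(norm (cl (f (Suc k))))\<^sup>2 = - (cl (f k) \<bullet> cl (f (Suc (Suc k))))"
    unfolding power2_norm_eq_inner by (rule jet_parts[OF assms assms])
  also have "\<dots> \<le> norm (cl (f k)) * norm (cl (f (Suc (Suc k))))"
    using Cauchy_Schwarz_ineq2[of "cl (f k)" "cl (f (Suc (Suc k)))"] by linarith
  finally show ?thesis .
qed

subsection \<open>Differential inequalities\<close>

lemma deriv_nonpos_le:
  fixes y :: "real \<Rightarrow> real"
  assumes d: "\<And>t. t \<in> {0..T} \<Longrightarrow> (y has_real_derivative y' t) (at t within {0..T})"
    and le: "\<And>t. t \<in> {0..T} \<Longrightarrow> y' t \<le> 0" and T: "0 \<le> T"
  shows "y T \<le> y 0"
proof -
  obtain t where "t \<in> {0..T}" "y T - y 0 = y' t * (T - 0)"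
    using mvt_very_simple[OF T, of y "\<lambda>t h. y' t * h"] d
    by (auto simp: has_field_derivative_def)
  with le[of t] T show ?thesis by (smt (verit) mult_nonpos_nonneg)
qed

text \<open>The function \<open>(y - C / \<kappa>) * exp (\<kappa> * t)\<close> is
  nonincreasing.\<close>

lemma gronwall_decay:
  fixes y :: "real \<Rightarrow> real"
  assumes d: "\<And>t. t \<in> {0..T} \<Longrightarrow> (y has_real_derivative y' t) (at t within {0..T})"
    and le: "\<And>t. t \<in> {0..T} \<Longrightarrow> y' t \<le> - \<kappa> * y t + C" and T: "0 \<le> T" and k: "\<kappa> > 0"
  shows "y T \<le> (y 0 - C / \<kappa>) * exp (- \<kappa> * T) + C / \<kappa>"
proof -
  have "(y T - C / \<kappa>) * exp (\<kappa> * T) \<le> (y 0 - C / \<kappa>) * exp (\<kappa> * 0)"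
  proof (rule deriv_nonpos_le[OF _ _ T])
    fix t assume t: "t \<in> {0..T}"
    show "((\<lambda>t. (y t - C / \<kappa>) * exp (\<kappa> * t)) has_real_derivative
       (y' t + \<kappa> * (y t - C / \<kappa>)) * exp (\<kappa> * t)) (at t within {0..T})"
      by (rule derivative_eq_intros d[OF t] refl | simp add: algebra_simps)+
    show "(y' t + \<kappa> * (y t - C / \<kappa>)) * exp (\<kappa> * t) \<le> 0"
      using le[OF t] k by (intro mult_nonpos_nonneg) (auto simp: algebra_simps)
  qed
  then have "(y T - C / \<kappa>) \<le> (y 0 - C / \<kappa>) / exp (\<kappa> * T)" by (simp add: pos_le_divide_eq)
  then show ?thesis by (simp add: exp_minus divide_inverse)
qed

text \<open>With \<open>y * exp (\<delta> * t)\<close> in place of \<open>y\<close> the forcing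
  becomes constant and the damping rate \<open>\<kappa> - \<delta>\<close>, so the previous estimate
  applies.\<close>

lemma gronwall_decay_exp:
  fixes y :: "real \<Rightarrow> real"
  assumes d: "\<And>t. t \<in> {0..T} \<Longrightarrow> (y has_real_derivative y' t) (at t within {0..T})"
    and le: "\<And>t. t \<in> {0..T} \<Longrightarrow> y' t \<le> - \<kappa> * y t + C * exp (- \<delta> * t)"
    and T: "0 \<le> T" and k: "\<kappa> > \<delta>" and y0: "0 \<le> y 0" and C: "C \<ge> 0"
  shows "y T \<le> (y 0 + C / (\<kappa> - \<delta>)) * exp (- \<delta> * T)"
proof -
  have "y T * exp (\<delta> * T) \<le> (y 0 * exp (\<delta> * 0) - C / (\<kappa> - \<delta>)) * exp (- (\<kappa> - \<delta>) * T) + C / (\<kappa> - \<delta>)"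
  proof (rule gronwall_decay[where y="\<lambda>t. y t * exp (\<delta> * t)" and y'="\<lambda>t. (y' t + \<delta> * y t) * exp (\<delta> * t)"])
    fix t assume t: "t \<in> {0..T}"
    show "((\<lambda>t. y t * exp (\<delta> * t)) has_real_derivative (y' t + \<delta> * y t) * exp (\<delta> * t)) (at t within {0..T})"
      by (rule derivative_eq_intros d[OF t] refl | simp add: algebra_simps)+
    have "(y' t + \<delta> * y t) * exp (\<delta> * t) \<le> (- (\<kappa> - \<delta>) * y t + C * exp (- \<delta> * t)) * exp (\<delta> * t)"
      using le[OF t] by (intro mult_right_mono) (auto simp: algebra_simps)
    also have "\<dots> = - (\<kappa> - \<delta>) * (y t * exp (\<delta> * t)) + C * (exp (- \<delta> * t) * exp (\<delta> * t))"
      by (simp add: algebra_simps)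
    also have "exp (- \<delta> * t) * exp (\<delta> * t) = 1" by (simp add: exp_add[symmetric])
    finally show "(y' t + \<delta> * y t) * exp (\<delta> * t) \<le> - (\<kappa> - \<delta>) * (y t * exp (\<delta> * t)) + C" by simp
  qed (use T k in auto)
  also have "\<dots> \<le> y 0 + C / (\<kappa> - \<delta>)"
  proof -
    have "(y 0 - C / (\<kappa> - \<delta>)) * exp (- (\<kappa> - \<delta>) * T) \<le> y 0 * exp (- (\<kappa> - \<delta>) * T)"
      using C k by (intro mult_right_mono) auto
    also have "\<dots> \<le> y 0" using k T y0 by (intro mult_left_le) (auto intro: mult_nonpos_nonneg)
    finally show ?thesis by simp
  qed
  finally have "y T \<le> (y 0 + C / (\<kappa> - \<delta>)) / exp (\<delta> * T)" by (simp add: pos_le_divide_eq)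
  then show ?thesis by (simp add: exp_minus divide_inverse)
qed

lemma gronwall_growth:
  fixes y :: "real \<Rightarrow> real"
  assumes d: "\<And>t. t \<in> {0..T} \<Longrightarrow> (y has_real_derivative y' t) (at t within {0..T})"
    and le: "\<And>t. t \<in> {0..T} \<Longrightarrow> y' t \<le> K * y t + C" and T: "0 \<le> T" and k: "K \<ge> 0" and C: "C \<ge> 0"
  shows "y T \<le> (y 0 + C * T) * exp (K * T)"
proof -
  have "y T * exp (- K * T) - C * T \<le> y 0 * exp (- K * 0) - C * 0"
  proof (rule deriv_nonpos_le[OF _ _ T])
    fix t assume t: "t \<in> {0..T}"
    show "((\<lambda>t. y t * exp (- K * t) - C * t) has_real_derivative (y' t - K * y t) * exp (- K * t) - C) (at t within {0..T})"
      by (rule derivative_eq_intros d[OF t] refl | simp add: algebra_simps)+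
    have "(y' t - K * y t) * exp (- K * t) \<le> C * exp (- K * t)"
      using le[OF t] by (intro mult_right_mono) auto
    also have "\<dots> \<le> C" using C k t by (intro mult_left_le) auto
    finally show "(y' t - K * y t) * exp (- K * t) - C \<le> 0" by simp
  qed
  then have "y T / exp (K * T) \<le> y 0 + C * T" by (simp add: exp_minus divide_inverse)
  then show ?thesis by (simp add: pos_divide_le_eq)
qed

subsection \<open>Ordinary differential equations in Banach and Hilbert spaces\<close>

text \<open>The factorial bound on the increments gives convergence on every interval without a
  smallness condition. \<open>A\<close> encodes an invariant subspace: a bounded linear map commutes
  with the integral, so the iterates stay among its fixed points.\<close>

lemma picard_global:
  fixes X A :: "'b::banach \<Rightarrow> 'b"
  assumes lip: "\<And>u v. norm (X u - X v) \<le> L * norm (u - v)" and L: "L \<ge> 0"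
    and A: "bounded_linear A" "\<And>u. A u = u \<Longrightarrow> A (X u) = X u" "A u0 = u0"
  shows "\<exists>u. u 0 = u0 \<and> (\<forall>t\<ge>0. A (u t) = u t) \<and>
    (\<forall>T. \<forall>t\<in>{0..T}. (u has_vector_derivative X (u t)) (at t within {0..T}))"
proof -
  define pic where "pic = rec_nat (\<lambda>t::real. u0) (\<lambda>n f t. u0 + integral {0..t} (\<lambda>s. X (f s)))"
  have pic0: "pic 0 t = u0" and picS: "pic (Suc n) t = u0 + integral {0..t} (\<lambda>s. X (pic n s))" for n t
    by (simp_all add: pic_def)
  have Xc: "continuous_on S X" for S
    using lip L by (intro lipschitz_on_continuous_on[where L=L] lipschitz_onI) (auto simp: dist_norm)
  have c: "continuous_on {0..T} (pic n)" for n T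
  proof (induction n)
    case (Suc n)
    have "continuous_on {0..T} (\<lambda>s. X (pic n s))"
      by (rule continuous_on_compose2[OF Xc Suc]) auto
    then show ?case
      unfolding picS by (intro continuous_intros indefinite_integral_continuous_1 integrable_continuous_real)
  qed (simp add: pic0)
  have Xi: "(\<lambda>s. X (pic n s)) integrable_on {0..t}" for n t
    by (intro integrable_continuous_real continuous_on_compose2[OF Xc c]) auto
  define M where "M = norm (X u0)"
  have b: "norm (pic (Suc n) t - pic n t) \<le> M * L ^ n * t ^ Suc n / fact (Suc n)" if "t \<ge> 0" for n t
    using that
  proof (induction n arbitrary: t)
    case 0
    then show ?case by (simp add: picS pic0 M_def)
  next
    case (Suc n)
    have hi: "((\<lambda>s. L * (M * L ^ n * s ^ Suc n / fact (Suc n))) has_integral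
        (M * L ^ Suc n * t ^ Suc (Suc n) / fact (Suc (Suc n)) - M * L ^ Suc n * 0 ^ Suc (Suc n) / fact (Suc (Suc n)))) {0..t}"
    proof (rule fundamental_theorem_of_calculus[OF Suc.prems])
      fix s assume "s \<in> {0..t}"
      have "((\<lambda>s. M * L ^ Suc n / fact (Suc (Suc n)) * s ^ Suc (Suc n)) has_real_derivative
          M * L ^ Suc n / fact (Suc (Suc n)) * (of_nat (Suc (Suc n)) * s ^ Suc n)) (at s within {0..t})"
        by (intro DERIV_cmult) (rule derivative_eq_intros refl | simp)+
      moreover have "M * L ^ Suc n / fact (Suc (Suc n)) * (of_nat (Suc (Suc n)) * s ^ Suc n) = L * (M * L ^ n * s ^ Suc n / fact (Suc n))"
        unfolding fact_Suc[of "Suc n"] of_nat_mult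
        by (simp del: fact_Suc of_nat_Suc add: divide_simps)
      ultimately show "((\<lambda>s. M * L ^ Suc n * s ^ Suc (Suc n) / fact (Suc (Suc n))) has_vector_derivative
          L * (M * L ^ n * s ^ Suc n / fact (Suc n))) (at s within {0..t})"
        by (simp add: has_real_derivative_iff_has_vector_derivative mult_ac)
    qed
    have "pic (Suc (Suc n)) t - pic (Suc n) t = integral {0..t} (\<lambda>s. X (pic (Suc n) s) - X (pic n s))"
      by (subst Henstock_Kurzweil_Integration.integral_diff) (simp_all add: Xi picS[of "Suc n"] picS[of n t])
    also have "norm \<dots> \<le> integral {0..t} (\<lambda>s. L * (M * L ^ n * s ^ Suc n / fact (Suc n)))"
    proof (rule Henstock_Kurzweil_Integration.integral_norm_bound_integral)
      show "(\<lambda>s. X (pic (Suc n) s) - X (pic n s)) integrable_on {0..t}"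
        by (intro Henstock_Kurzweil_Integration.integrable_diff Xi)
      show "norm (X (pic (Suc n) s) - X (pic n s)) \<le> L * (M * L ^ n * s ^ Suc n / fact (Suc n))" if "s \<in> {0..t}" for s
        using that by (intro order_trans[OF lip] mult_left_mono L Suc.IH) auto
    qed (use hi in blast)
    also have "\<dots> = M * L ^ Suc n * t ^ Suc (Suc n) / fact (Suc (Suc n))"
      using integral_unique[OF hi] by simp
    finally show ?case .
  qed
  define f where "f n t = pic (Suc n) t - pic n t" for n t
  define u where "u t = u0 + (\<Sum>n. f n t)" for t
  have picf: "pic n t = u0 + (\<Sum>i<n. f i t)" for n t
    by (simp add: f_def sum_lessThan_telescope[of "\<lambda>n. pic n t"] pic0)
  have ul: "uniform_limit {0..T} pic u sequentially" for T
  proof (cases "T \<ge> 0")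
    case True
    have "uniform_limit {0..T} (\<lambda>n t. \<Sum>i<n. f i t) (\<lambda>t. \<Sum>n. f n t) sequentially"
    proof (rule Weierstrass_m_test)
      have "summable (\<lambda>n. M * T * ((L * T) ^ n /\<^sub>R fact n))"
        by (intro summable_mult summable_exp_generic)
      then show "summable (\<lambda>n. M * T * ((L * T) ^ n / fact n))" by (simp add: divide_inverse mult_ac)
      fix n t assume t: "t \<in> {0..T}"
      have "norm (f n t) \<le> M * L ^ n * t ^ Suc n / fact (Suc n)" unfolding f_def using b t by simp
      also have "\<dots> \<le> M * L ^ n * T ^ Suc n / fact n"
        using t L True by (intro frac_le mult_left_mono power_mono mult_nonneg_nonneg fact_mono) (auto simp: M_def)
      also have "\<dots> = M * T * ((L * T) ^ n / fact n)" by (simp add: power_mult_distrib)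
      finally show "norm (f n t) \<le> M * T * ((L * T) ^ n / fact n)" .
    qed
    then have "uniform_limit {0..T} (\<lambda>n t. u0 + (\<Sum>i<n. f i t)) (\<lambda>t. u0 + (\<Sum>n. f n t)) sequentially"
      by (intro uniform_limit_intros)
    then show ?thesis by (simp add: u_def[abs_def] picf[abs_def])
  qed simp
  have uc: "continuous_on {0..T} u" for T
    by (rule uniform_limit_theorem[OF _ ul]) (auto simp: c)
  have uX: "uniform_limit {0..T} (\<lambda>n s. X (pic n s)) (\<lambda>s. X (u s)) sequentially" for T
  proof (rule uniform_limitI)
    fix e :: real assume e: "e > 0"
    have "\<forall>\<^sub>F n in sequentially. \<forall>s\<in>{0..T}. dist (pic n s) (u s) < e / (L + 1)"
      by (rule uniform_limitD[OF ul]) (use e L in simp)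
    then show "\<forall>\<^sub>F n in sequentially. \<forall>s\<in>{0..T}. dist (X (pic n s)) (X (u s)) < e"
    proof eventually_elim
      case (elim n)
      show ?case
      proof
        fix s assume "s \<in> {0..T}"
        with elim have *: "norm (pic n s - u s) < e / (L + 1)" by (auto simp: dist_norm)
        have "norm (X (pic n s) - X (u s)) \<le> L * norm (pic n s - u s)" by (rule lip)
        also have "\<dots> \<le> (L + 1) * norm (pic n s - u s)" by (intro mult_right_mono) auto
        also have "\<dots> < e" using * L by (simp add: field_simps)
        finally show "dist (X (pic n s)) (X (u s)) < e" by (simp add: dist_norm)
      qed
    qed
  qed
  have lim: "(\<lambda>n. pic n t) \<longlonglongrightarrow> u t" if "t \<ge> 0" for t
    using tendsto_uniform_limitI[OF ul, of t t] that by simp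
  have int: "u t = u0 + integral {0..t} (\<lambda>s. X (u s))" if t: "t \<ge> 0" for t
  proof -
    obtain I J where IJ: "\<And>n. ((\<lambda>s. X (pic n s)) has_integral I n) {0..t}"
      "((\<lambda>s. X (u s)) has_integral J) {0..t}" "I \<longlonglongrightarrow> J"
      by (rule uniform_limit_integral[OF uX]) (auto intro: continuous_on_compose2[OF Xc c])
    have "pic (Suc n) t = u0 + I n" for n using integral_unique[OF IJ(1)] by (simp add: picS)
    then have "(\<lambda>n. pic (Suc n) t) \<longlonglongrightarrow> u0 + J" using IJ(3) by (simp add: tendsto_add)
    then have "u t = u0 + J" using LIMSEQ_unique[OF LIMSEQ_Suc[OF lim[OF t]]] by blast
    then show ?thesis using integral_unique[OF IJ(2)] by simp
  qed
  show ?thesis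
  proof (intro exI[of _ u] conjI allI impI ballI)
    show "u 0 = u0" using int[of 0] by simp
    have "A (pic n t) = pic n t" for n t
    proof (induction n arbitrary: t)
      case (Suc n)
      have "A (integral {0..t} (\<lambda>s. X (pic n s))) = integral {0..t} (A \<circ> (\<lambda>s. X (pic n s)))"
        by (rule integral_linear[OF Xi A(1), symmetric])
      also have "A \<circ> (\<lambda>s. X (pic n s)) = (\<lambda>s. X (pic n s))" using A(2) Suc by auto
      finally show ?case
        using A(3) by (simp add: picS linear_add[OF bounded_linear.linear[OF A(1)]])
    qed (simp add: pic0 A)
    then show "A (u t) = u t" if "t \<ge> 0" for t
      using bounded_linear.tendsto[OF A(1) lim[OF that]] lim[OF that] by (simp add: LIMSEQ_unique)
    show "(u has_vector_derivative X (u t)) (at t within {0..T})" if t: "t \<in> {0..T}" for T t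
    proof -
      have "((\<lambda>t. u0 + integral {0..t} (\<lambda>s. X (u s))) has_vector_derivative 0 + X (u t)) (at t within {0..T})"
        by (intro has_vector_derivative_add has_vector_derivative_const integral_has_vector_derivative t
            continuous_on_compose2[OF Xc uc]) auto
      then show ?thesis
        by (intro has_vector_derivative_transform[OF t, of u]) (use int in auto)
    qed
  qed
qed

definition retract :: "real \<Rightarrow> 'b::real_normed_vector \<Rightarrow> 'b" where
  "retract r u = (if norm u \<le> r then u else (r / norm u) *\<^sub>R u)"

lemma retract_norm: "r > 0 \<Longrightarrow> norm (retract r u) \<le> r"
  by (auto simp: retract_def)

text \<open>Write \<open>retract r u = \<phi> u *\<^sub>R u\<close>. The change of
  \<open>\<phi>\<close> multiplied by the norm of the second point is at most the difference of the
  norms; this and the change of the point give the two units of the constant.\<close>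

lemma retract_lipschitz:
  assumes r: "r > 0"
  shows "norm (retract r u - retract r v) \<le> 2 * norm (u - v)"
proof -
  define \<phi> where "\<phi> u = (if norm u \<le> r then 1 else r / norm u)" for u :: 'a
  have rp: "retract r u = \<phi> u *\<^sub>R u" for u :: 'a by (simp add: retract_def \<phi>_def)
  have p: "0 \<le> \<phi> u" "\<phi> u \<le> 1" for u :: 'a using r by (auto simp: \<phi>_def divide_le_eq_1)
  have *: "\<bar>\<phi> u - \<phi> v\<bar> * norm v \<le> \<bar>norm u - norm v\<bar>" for u v :: 'a
  proof (cases "norm u \<le> r"; cases "norm v \<le> r")
    assume "norm u \<le> r" "\<not> norm v \<le> r"
    then show ?thesis using r by (simp add: \<phi>_def abs_if left_diff_distrib) (auto simp: field_simps)
  next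
    assume a: "\<not> norm u \<le> r" "norm v \<le> r"
    then have nu: "r < norm u" "0 < norm u" using r by linarith+
    have "\<phi> u - \<phi> v = - ((norm u - r) / norm u)" using a nu by (simp add: \<phi>_def field_simps)
    then have "\<bar>\<phi> u - \<phi> v\<bar> * norm v = (norm u - r) * (norm v / norm u)"
      using nu by (simp add: abs_divide)
    also have "\<dots> \<le> (norm u - r) * 1" using a nu by (intro mult_left_mono) (auto simp: divide_le_eq_1)
    finally show ?thesis using a by simp
  next
    assume a: "\<not> norm u \<le> r" "\<not> norm v \<le> r"
    have nz: "norm u > 0" "norm v > 0" using a r by linarith+
    have "\<phi> u - \<phi> v = r * (norm v - norm u) / (norm u * norm v)"
      using a nz by (simp add: \<phi>_def field_simps)
    then have "\<bar>\<phi> u - \<phi> v\<bar> * norm v = r * \<bar>norm v - norm u\<bar> / (norm u * norm v) * norm v"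
      using r nz by (simp add: abs_mult abs_divide)
    also have "\<dots> = \<bar>norm u - norm v\<bar> * (r / norm u)"
      using nz by (simp add: abs_minus_commute)
    also have "\<dots> \<le> \<bar>norm u - norm v\<bar> * 1" using a nz by (intro mult_left_mono) (auto simp: divide_le_eq_1)
    finally show ?thesis by simp
  qed (simp add: \<phi>_def)
  have "retract r u - retract r v = \<phi> u *\<^sub>R (u - v) + (\<phi> u - \<phi> v) *\<^sub>R v"
    by (simp add: rp algebra_simps)
  then have "norm (retract r u - retract r v) \<le> \<phi> u * norm (u - v) + \<bar>\<phi> u - \<phi> v\<bar> * norm v"
    using norm_triangle_ineq[of "\<phi> u *\<^sub>R (u - v)" "(\<phi> u - \<phi> v) *\<^sub>R v"] p[of u] by simp
  also have "\<dots> \<le> 1 * norm (u - v) + \<bar>norm u - norm v\<bar>"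
    by (intro add_mono mult_right_mono p *) simp
  also have "\<dots> \<le> 2 * norm (u - v)" using norm_triangle_ineq3[of u v] by simp
  finally show ?thesis .
qed

lemma has_real_derivative_inner:
  fixes u v :: "real \<Rightarrow> 'b::real_inner"
  assumes "(u has_vector_derivative u') (at t within S)" "(v has_vector_derivative v') (at t within S)"
  shows "((\<lambda>t. u t \<bullet> v t) has_real_derivative u t \<bullet> v' + u' \<bullet> v t) (at t within S)"
  using bounded_bilinear.has_vector_derivative[OF bounded_bilinear_inner assms]
  by (simp add: has_real_derivative_iff_has_vector_derivative)

text \<open>Composition with the radial retraction makes a locally Lipschitz field globally
  Lipschitz. It stays dissipative, since outside the ball a point is a positive multiple of its
  retraction; so the norm never exceeds its initial value and the modification is never
  felt.\<close>

lemma ode_dissipative: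
  fixes X A :: "'b::{banach, real_inner} \<Rightarrow> 'b"
  assumes lip: "\<And>r. \<exists>L. \<forall>u v. norm u \<le> r \<longrightarrow> norm v \<le> r \<longrightarrow> norm (X u - X v) \<le> L * norm (u - v)"
    and A: "bounded_linear A" "\<And>u. A u = u \<Longrightarrow> A (X u) = X u" "A u0 = u0"
    and diss: "\<And>u. A u = u \<Longrightarrow> u \<bullet> X u \<le> 0"
  shows "\<exists>u. u 0 = u0 \<and> (\<forall>t\<ge>0. A (u t) = u t) \<and>
    (\<forall>T. \<forall>t\<in>{0..T}. (u has_vector_derivative X (u t)) (at t within {0..T}))"
proof -
  define r where "r = norm u0 + 1"
  have r: "r > 0" by (simp add: r_def add_nonneg_pos)
  obtain L0 where L0: "\<And>u v. norm u \<le> r \<Longrightarrow> norm v \<le> r \<Longrightarrow> norm (X u - X v) \<le> L0 * norm (u - v)"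
    using lip by blast
  define Y where "Y u = X (retract r u)" for u
  have Ylip: "norm (Y u - Y v) \<le> (2 * \<bar>L0\<bar>) * norm (u - v)" for u v
  proof -
    have "norm (Y u - Y v) \<le> L0 * norm (retract r u - retract r v)"
      unfolding Y_def by (intro L0 retract_norm r)
    also have "\<dots> \<le> \<bar>L0\<bar> * (2 * norm (u - v))"
      using retract_lipschitz[OF r, of u v] by (intro mult_mono) auto
    finally show ?thesis by simp
  qed
  have Ar: "A (retract r u) = retract r u" if "A u = u" for u
    using that by (simp add: retract_def linear_scale[OF bounded_linear.linear[OF A(1)]])
  obtain u where u: "u 0 = u0" "\<And>t. t \<ge> 0 \<Longrightarrow> A (u t) = u t"
    "\<And>T t. t \<in> {0..T} \<Longrightarrow> (u has_vector_derivative Y (u t)) (at t within {0..T})"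
    using picard_global[of Y "2 * \<bar>L0\<bar>" A u0, OF Ylip _ A(1) _ A(3)] A(2) Ar by (auto simp: Y_def)
  have Yd: "v \<bullet> Y v \<le> 0" if v: "A v = v" for v
  proof (cases "norm v \<le> r")
    case True
    then show ?thesis using diss[OF v] by (simp add: Y_def retract_def)
  next
    case False
    then have "v = (norm v / r) *\<^sub>R retract r v" using r by (simp add: retract_def)
    then have "v \<bullet> Y v = (norm v / r) * (retract r v \<bullet> X (retract r v))"
      unfolding Y_def by (metis inner_scaleR_left)
    also have "\<dots> \<le> 0" using diss[OF Ar[OF v]] r by (intro mult_nonneg_nonpos) auto
    finally show ?thesis .
  qed
  have "norm (u t) \<le> r" if t: "t \<ge> 0" for t
  proof -
    have "u t \<bullet> u t \<le> u 0 \<bullet> u 0"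
    proof (rule deriv_nonpos_le[OF _ _ t])
      fix s assume s: "s \<in> {0..t}"
      show "((\<lambda>t. u t \<bullet> u t) has_real_derivative u s \<bullet> Y (u s) + Y (u s) \<bullet> u s) (at s within {0..t})"
        by (intro has_real_derivative_inner u s)
      show "u s \<bullet> Y (u s) + Y (u s) \<bullet> u s \<le> 0"
        using Yd[OF u(2), of s] s by (simp add: inner_commute)
    qed
    then have "norm (u t) \<le> norm u0" by (simp add: u(1) norm_eq_sqrt_inner)
    then show ?thesis by (simp add: r_def)
  qed
  then have "Y (u t) = X (u t)" if "t \<ge> 0" for t using that by (simp add: Y_def retract_def)
  with u show ?thesis by (metis atLeastAtMost_iff)
qed

subsection \<open>The truncated equation\<close>

definition jt :: "real \<Rightarrow> l2 \<Rightarrow> nat \<Rightarrow> real \<Rightarrow> real" where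
  "jt N u k x = Re (bl N u k x)"

lemmas cj_add = linear_add[OF bounded_linear.linear[OF bounded_linear_cj]]
  and cj_diff = linear_diff[OF bounded_linear.linear[OF bounded_linear_cj]]
  and cj_neg = linear_neg[OF bounded_linear.linear[OF bounded_linear_cj]]
  and cj_scaleR = linear_scale[OF bounded_linear.linear[OF bounded_linear_cj]]

lemma jet_jt: "jet (jt N u)"
  unfolding jet_def chain_def jt_def[abs_def] by (auto intro: bl_deriv L2_Re bl_L2)

lemma cl_jt: "cl (jt N u k) = (1/2) *\<^sub>R (dN N k u + cj (dN N k u))"
  unfolding jt_def[abs_def] by (simp add: cl_Re bl_L2 abs_bl)

lemma cl_jt_real: "cj u = u \<Longrightarrow> cl (jt N u k) = dN N k u"
  by (simp add: cl_jt dN_cj scaleR_2[symmetric])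

lemma norm_cl_jt:
  assumes "N \<ge> 0"
  shows "norm (cl (jt N u k)) \<le> N ^ k * norm u"
proof -
  have "norm (dN N k u + cj (dN N k u)) \<le> N ^ k * norm u + N ^ k * norm u"
    using dN_norm[OF assms, of k u] by (intro norm_triangle_le add_mono) auto
  then show ?thesis by (simp add: cl_jt mult_ac)
qed

text \<open>Agmon with each derivative costing a factor \<open>N\<close>. The constant depends on
  \<open>N\<close> and serves only to make the truncated equation an ordinary differential equation
  with a locally Lipschitz field.\<close>

lemma jt_sup:
  assumes "N \<ge> 0"
  shows "\<bar>jt N u 0 x\<bar> \<le> sqrt (2 * N) * norm u"
proof -
  have "(jt N u 0 x)\<^sup>2 \<le> 2 * norm (cl (jt N u 0)) * norm (cl (jt N u (Suc 0)))"
    by (rule jet_agmon[OF jet_jt])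
  also have "\<dots> \<le> 2 * (N ^ 0 * norm u) * (N ^ Suc 0 * norm u)"
    using assms by (intro mult_mono norm_cl_jt mult_nonneg_nonneg) auto
  also have "\<dots> = (sqrt (2 * N) * norm u)\<^sup>2"
    using assms by (simp add: power_mult_distrib power2_eq_square)
  finally show ?thesis using assms by (intro abs_le_square_iff[THEN iffD2, of "jt N u 0 x" "sqrt (2 * N) * norm u", THEN order_trans]) auto
qed

text \<open>The choice of representatives is linear only up to null sets, which the inversion
  integral does not see; so linearity holds at every point.\<close>

lemma bl_linear: "bl N (u + v) k x = bl N u k x + bl N v k x" "bl N (r *\<^sub>R u) k x = r *\<^sub>R bl N u k x"
proof -
  have "eq_L2 (rep_l2 (Fop (u + v))) (\<lambda>\<xi>. rep_l2 (Fop u) \<xi> + rep_l2 (Fop v) \<xi>)"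
    by (simp add: eq_L2_def L2_add abs_eq_iff[symmetric] abs_add linear_add[OF bounded_linear.linear[OF bounded_linear_Fop]])
  then have "AE \<xi> in lborel. rep_l2 (Fop (u + v)) \<xi> = rep_l2 (Fop u) \<xi> + rep_l2 (Fop v) \<xi>" by (simp add: eq_L2_def)
  then have "ft (\<lambda>\<xi>. band N k \<xi> * rep_l2 (Fop (u + v)) \<xi>) (- x)
    = ft (\<lambda>\<xi>. band N k \<xi> * rep_l2 (Fop u) \<xi> + band N k \<xi> * rep_l2 (Fop v) \<xi>) (- x)"
    unfolding ft_def by (intro integral_cong_AE) (auto elim!: eventually_mono simp: algebra_simps)
  then show "bl N (u + v) k x = bl N u k x + bl N v k x"
    by (simp add: bl_def ft_add band_rep add_divide_distrib)
  have "eq_L2 (rep_l2 (Fop (r *\<^sub>R u))) (\<lambda>\<xi>. r *\<^sub>R rep_l2 (Fop u) \<xi>)"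
    by (simp add: eq_L2_def L2_scaleR abs_eq_iff[symmetric] abs_scaleR linear_scale[OF bounded_linear.linear[OF bounded_linear_Fop]] del: scaleR_conv_of_real)
  then have "AE \<xi> in lborel. rep_l2 (Fop (r *\<^sub>R u)) \<xi> = r *\<^sub>R rep_l2 (Fop u) \<xi>" by (simp add: eq_L2_def)
  then have "ft (\<lambda>\<xi>. band N k \<xi> * rep_l2 (Fop (r *\<^sub>R u)) \<xi>) (- x)
    = ft (\<lambda>\<xi>. of_real r * (band N k \<xi> * rep_l2 (Fop u) \<xi>)) (- x)"
    unfolding ft_def by (intro integral_cong_AE) (auto elim!: eventually_mono simp: scaleR_conv_of_real)
  then show "bl N (r *\<^sub>R u) k x = r *\<^sub>R bl N u k x"
    by (simp add: bl_def ft_cmult scaleR_conv_of_real)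
qed

lemma jt_linear: "jt N (u + v) k x = jt N u k x + jt N v k x" "jt N (r *\<^sub>R u) k x = r * jt N u k x"
  "jt N (u - v) k x = jt N u k x - jt N v k x"
proof -
  show *: "jt N (u + v) k x = jt N u k x + jt N v k x" "jt N (r *\<^sub>R u) k x = r * jt N u k x" for u v r
    by (simp_all add: jt_def bl_linear)
  show "jt N (u - v) k x = jt N u k x - jt N v k x"
    using *(1)[of "u - v" v] by simp
qed

lemma jt_measurable: "jt N u k \<in> borel_measurable borel"
  by (intro chain_measurable jet_chain jet_jt)

text \<open>Through real parts of band-limited representatives this is defined and real bilinear on
  all of \<open>l2\<close>; on real band-limited elements it is the ordinary product.\<close>

definition sq :: "real \<Rightarrow> l2 \<Rightarrow> l2 \<Rightarrow> l2" where
  "sq N u v = cl (\<lambda>x. jt N u 0 x * jt N v 0 x)"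

lemma rl2_sq: "rl2 (\<lambda>x. jt N u 0 x * jt N v 0 x)"
  by (intro bjet_rl2_mult jet_bjet jet_jt jet_rl2)

lemma norm_mult_jt:
  assumes "N \<ge> 0" "rl2 h"
  shows "norm (cl (\<lambda>x. jt N u 0 x * h x)) \<le> sqrt (2 * N) * norm u * norm (cl h)"
  by (intro norm_cl_mult_le jt_sup jt_measurable assms)

lemma sq_bilinear:
  assumes N: "N \<ge> 0"
  shows "bounded_bilinear (sq N)"
proof
  show "sq N (u + v) w = sq N u w + sq N v w" for u v w
    unfolding sq_def by (simp add: jt_linear distrib_right cl_add rl2_sq)
  show "sq N w (u + v) = sq N w u + sq N w v" for u v w
    unfolding sq_def by (simp add: jt_linear distrib_left cl_add rl2_sq)
  show "sq N (r *\<^sub>R u) v = r *\<^sub>R sq N u v" for r u v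
    unfolding sq_def using cl_cmult[OF rl2_sq[of N u v], of r] by (simp add: jt_linear mult.assoc)
  show "sq N u (r *\<^sub>R v) = r *\<^sub>R sq N u v" for r u v
    unfolding sq_def using cl_cmult[OF rl2_sq[of N u v], of r] by (simp add: jt_linear mult.left_commute)
  have "norm (sq N u v) \<le> norm u * norm v * sqrt (2 * N)" for u v
  proof -
    have "norm (sq N u v) \<le> sqrt (2 * N) * norm u * norm (cl (jt N v 0))"
      unfolding sq_def by (intro norm_mult_jt N jet_rl2 jet_jt)
    also have "\<dots> \<le> sqrt (2 * N) * norm u * norm v"
      using norm_cl_jt[OF N, of v 0] N by (intro mult_left_mono) auto
    finally show ?thesis by (simp add: mult_ac)
  qed
  then show "\<exists>K. \<forall>u v. norm (sq N u v) \<le> norm u * norm v * K" by blast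
qed

definition cu :: "real \<Rightarrow> l2 \<Rightarrow> l2" where
  "cu N u = cl (\<lambda>x. jt N u 0 x * (jt N u 0 x * jt N u 0 x))"

lemma rl2_cu: "rl2 (\<lambda>x. jt N u 0 x * (jt N v 0 x * jt N w 0 x))"
  by (intro bjet_rl2_mult jet_bjet jet_jt rl2_sq)

lemma cu_diff:
  assumes N: "N \<ge> 0" and r: "norm u \<le> r" "norm v \<le> r"
  shows "norm (cu N u - cu N v) \<le> 6 * N * r\<^sup>2 * norm (u - v)"
proof -
  have tri: "norm (cl (\<lambda>x. jt N p 0 x * (jt N q 0 x * jt N (u - v) 0 x))) \<le> 2 * N * r\<^sup>2 * norm (u - v)"
    if "norm p \<le> r" "norm q \<le> r" for p q
  proof -
    have r0: "r \<ge> 0" using r(1) norm_ge_zero order_trans by blast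
    have "norm (cl (\<lambda>x. jt N p 0 x * (jt N q 0 x * jt N (u - v) 0 x)))
      \<le> sqrt (2 * N) * norm p * (sqrt (2 * N) * norm q * norm (cl (jt N (u - v) 0)))"
      by (rule order_trans[OF norm_mult_jt[OF N rl2_sq] mult_left_mono[OF norm_mult_jt[OF N]]])
        (use N in \<open>auto intro: jet_rl2 jet_jt\<close>)
    also have "\<dots> \<le> sqrt (2 * N) * r * (sqrt (2 * N) * r * norm (u - v))"
      using that N r0 norm_cl_jt[OF N, of "u - v" 0] by (intro mult_mono mult_nonneg_nonneg) auto
    also have "\<dots> = 2 * N * r\<^sup>2 * norm (u - v)" using N by (simp add: power2_eq_square algebra_simps)
    finally show ?thesis .
  qed
  let ?c = "\<lambda>p q x. jt N p 0 x * (jt N q 0 x * jt N (u - v) 0 x)"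
  have "cu N u - cu N v = cl (\<lambda>x. ?c u u x + (?c u v x + ?c v v x))"
    unfolding cu_def by (subst cl_diff[symmetric]) (auto simp: rl2_cu jt_linear algebra_simps)
  also have "\<dots> = cl (?c u u) + (cl (?c u v) + cl (?c v v))"
    by (subst cl_add, (intro rl2_add rl2_cu)+)+ simp
  also have "norm (cl (?c u u) + (cl (?c u v) + cl (?c v v))) \<le> 2 * N * r\<^sup>2 * norm (u - v) + (2 * N * r\<^sup>2 * norm (u - v) + 2 * N * r\<^sup>2 * norm (u - v))"
    by (intro norm_triangle_le add_mono tri r)
  finally show ?thesis by (simp add: algebra_simps)
qed

text \<open>\<open>aj k\<close> is the \<open>k\<close>-th derivative of the damping coefficient \<open>a\<close>.\<close>

locale kawahara =
  fixes \<alpha> \<beta> \<mu> \<nu> \<sigma>0 \<gamma> :: real and aj :: "nat \<Rightarrow> real \<Rightarrow> real" and Ak :: "nat \<Rightarrow> real"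
  assumes alpha: "\<alpha> \<noteq> 0" and sigma0: "\<sigma>0 > 0" and gamma: "\<gamma> > 0"
    and aj_chain: "chain aj" and aj_ge: "\<And>x. aj 0 x \<ge> \<gamma>"
    and aj_bound: "\<And>k x. \<bar>aj k x\<bar> \<le> Ak k"
    and Ak_summable: "summable (\<lambda>k. \<sigma>0 ^ k / fact k * Ak k)"
begin

lemma Ak_nonneg: "Ak k \<ge> 0"
  using aj_bound[of k 0] by linarith

lemma bjet_aj: "bjet aj"
  using aj_chain aj_bound by (auto simp: bjet_def)

lemma aj_measurable [measurable]: "aj k \<in> borel_measurable borel"
  by (rule chain_measurable[OF aj_chain])

definition am :: "l2 \<Rightarrow> l2" where "am = mul (\<lambda>x. of_real (aj 0 x))"

lemma bmul_a: "bmul (\<lambda>x. of_real (aj 0 x))"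
  by (rule bmulI[where C="Ak 0"]) (auto simp: aj_bound)

lemma am_norm: "norm (am u) \<le> Ak 0 * norm u"
  unfolding am_def by (rule mul_norm) (auto simp: aj_bound)

lemma bounded_linear_am: "bounded_linear am"
  unfolding am_def by (rule bounded_linear_mul)

lemmas am_diff = linear_diff[OF bounded_linear.linear[OF bounded_linear_am]]

lemma am_cl: "rl2 f \<Longrightarrow> am (cl f) = cl (\<lambda>x. aj 0 x * f x)"
  unfolding am_def cl_def rl2_def by (simp add: mul_abs[OF bmul_a])

lemma am_cj: "cj (am u) = am (cj u)"
  unfolding am_def by (simp add: cj_mul[OF bmul_a])

lemma inner_am_ge: "\<gamma> * (norm u)\<^sup>2 \<le> u \<bullet> am u"
proof -
  have "\<gamma> * (norm u)\<^sup>2 = (LINT x|lborel. \<gamma> * (norm (rep_l2 u x))\<^sup>2)" by (simp add: norm_sq_rep)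
  also have "\<dots> \<le> (LINT x|lborel. rep_l2 u x \<bullet> (of_real (aj 0 x) * rep_l2 u x))"
  proof (rule integral_mono)
    show "integrable lborel (\<lambda>x. rep_l2 u x \<bullet> (of_real (aj 0 x) * rep_l2 u x))"
      by (intro L2_inner_integrable bmul_L2 bmul_a) auto
    show "\<gamma> * (norm (rep_l2 u x))\<^sup>2 \<le> rep_l2 u x \<bullet> (of_real (aj 0 x) * rep_l2 u x)" for x
      using mult_right_mono[OF aj_ge[of x], of "(norm (rep_l2 u x))\<^sup>2"]
      by (simp add: scaleR_conv_of_real[symmetric] power2_norm_eq_inner)
  qed (simp add: L2_integrable)
  also have "\<dots> = u \<bullet> am u"
    using inner_abs[of "rep_l2 u" "\<lambda>x. of_real (aj 0 x) * rep_l2 u x"]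
    by (simp add: am_def mul_rep[OF bmul_a] bmul_L2[OF bmul_a])
  finally show ?thesis .
qed

definition nl :: "real \<Rightarrow> l2 \<Rightarrow> l2" where
  "nl N u = \<mu> *\<^sub>R sq N u u + \<nu> *\<^sub>R cu N u"

text \<open>The vector field of the truncated equation. Products and damping leave the frequency
  band and are projected back by \<open>dN\<close>.\<close>

definition X :: "real \<Rightarrow> l2 \<Rightarrow> l2" where
  "X N u = - (\<alpha> *\<^sub>R dN N 5 u + \<beta> *\<^sub>R dN N 3 u + dN N 1 (nl N u) + dN N 0 (am u))"

text \<open>The derivatives of the flux \<open>\<mu> * f^2 + \<nu> * f^3\<close>.\<close>

definition hj :: "(nat \<Rightarrow> real \<Rightarrow> real) \<Rightarrow> nat \<Rightarrow> real \<Rightarrow> real" where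
  "hj f k x = \<mu> * jprod f f k x + \<nu> * jprod f (jprod f f) k x"

lemma jet_hj: "jet f \<Longrightarrow> jet (hj f)"
  unfolding hj_def[abs_def] by (intro jet_add jet_cmult jet_jprod jet_bjet)

lemma nl_cl: "nl N u = cl (hj (jt N u) 0)"
  unfolding nl_def sq_def cu_def hj_def[abs_def] jprod_0
  by (simp add: cl_add cl_cmult rl2_cmult rl2_sq rl2_cu)

lemma nl_cj: "cj (nl N u) = nl N u"
  by (simp add: nl_cl jet_rl2 jet_hj jet_jt)

definition realband :: "real \<Rightarrow> l2 \<Rightarrow> bool" where
  "realband N u \<longleftrightarrow> cj u = u \<and> dN N 0 u = u"

lemma realband_jt: "realband N u \<Longrightarrow> cl (jt N u k) = dN N k u" "realband N u \<Longrightarrow> cl (jt N u 0) = u"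
  by (simp_all add: realband_def cl_jt_real)

lemma realband_X: "realband N u \<Longrightarrow> realband N (X N u)"
  unfolding realband_def X_def
  by (simp add: cj_neg cj_add cj_diff cj_scaleR dN_cj nl_cj am_cj dN_neg dN_add dN_diff dN_scaleR dN_dN)

text \<open>The integrand \<open>u_x * (\<mu> * u^2 + \<nu> * u^3)\<close> is the derivative of
  \<open>\<mu> / 3 * u^3 + \<nu> / 4 * u^4\<close>; the projection is harmless because
  \<open>u\<close> itself lies in the band.\<close>

lemma nl_energy: 
  assumes "realband N u"
  shows "u \<bullet> dN N 1 (nl N u) = 0"
proof -
  let ?f = "jt N u"
  have j: "jet ?f" by (rule jet_jt)
  have "u \<bullet> dN N 1 (nl N u) = - (dN N 1 u \<bullet> nl N u)" using dN_skew[of N 1 u "nl N u"] by simp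
  also have "dN N 1 u \<bullet> nl N u = (LINT x|lborel. ?f 1 x * hj ?f 0 x)"
    unfolding nl_cl realband_jt(1)[OF assms, symmetric] by (intro inner_cl jet_rl2 j jet_hj)
  also have "\<dots> = 0"
  proof (rule integral_deriv_zero)
    let ?P = "\<lambda>x. ?f 0 x * ((\<mu> / 3 + \<nu> / 4 * ?f 0 x) * (?f 0 x * ?f 0 x))"
    note [derivative_intros] = chainD[OF jet_chain[OF j], of 0, simplified]
    show "(?P has_real_derivative ?f 1 x * hj ?f 0 x) (at x)" for x
      by (rule derivative_eq_intros refl | simp add: hj_def algebra_simps)+
    show "isCont (\<lambda>x. ?f 1 x * hj ?f 0 x) x" for x
      by (intro continuous_intros chain_isCont jet_chain j jet_hj)
    show "integrable lborel (\<lambda>x. ?f 1 x * hj ?f 0 x)" by (intro rl2_integrable jet_rl2 j jet_hj)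
    have "rl2 (\<lambda>x. \<mu> / 3 * (?f 0 x * ?f 0 x) + \<nu> / 4 * (?f 0 x * (?f 0 x * ?f 0 x)))"
      by (intro rl2_add rl2_cmult rl2_sq rl2_cu)
    from rl2_integrable[OF jet_rl2[OF j, of 0] this] show "integrable lborel ?P"
      by (simp add: algebra_simps)
  qed
  finally show ?thesis by simp
qed

lemma dN_odd_zero: "odd k \<Longrightarrow> u \<bullet> dN N k u = 0"
  using dN_skew[of N k u u] by (simp add: inner_commute)

lemma X_energy: 
  assumes "realband N u"
  shows "u \<bullet> X N u \<le> - \<gamma> * (norm u)\<^sup>2"
proof -
  have "u \<bullet> dN N 0 (am u) = dN N 0 u \<bullet> am u" using dN_skew[of N 0 u "am u"] by simp
  then have "u \<bullet> dN N 0 (am u) \<ge> \<gamma> * (norm u)\<^sup>2" using assms inner_am_ge[of u] by (simp add: realband_def)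
  then show ?thesis
    using nl_energy[OF assms] by (simp add: X_def inner_add_right inner_diff_right dN_odd_zero)
qed

lemma X_lipschitz:
  assumes N: "N \<ge> 0"
  shows "\<exists>L. \<forall>u v. norm u \<le> r \<longrightarrow> norm v \<le> r \<longrightarrow> norm (X N u - X N v) \<le> L * norm (u - v)"
proof -
  obtain K where K: "K \<ge> 0" "\<And>u v. norm (sq N u v) \<le> norm u * norm v * K"
    using bounded_bilinear.nonneg_bounded[OF sq_bilinear[OF N]] by blast
  let ?L = "\<bar>\<alpha>\<bar> * N ^ 5 + \<bar>\<beta>\<bar> * N ^ 3 + N * (\<bar>\<mu>\<bar> * (2 * \<bar>r\<bar> * K) + \<bar>\<nu>\<bar> * (6 * N * r\<^sup>2)) + Ak 0"
  show ?thesis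
  proof (intro exI[of _ ?L] allI impI)
    fix u v :: l2 assume r: "norm u \<le> r" "norm v \<le> r"
    interpret bounded_bilinear "sq N" by (rule sq_bilinear[OF N])
    have sqd: "sq N u u - sq N v v = sq N (u - v) u + sq N v (u - v)"
      by (simp add: diff_left diff_right)
    have "norm (sq N u u - sq N v v) \<le> norm (u - v) * norm u * K + norm v * norm (u - v) * K"
      unfolding sqd by (intro norm_triangle_le add_mono K)
    also have "\<dots> \<le> norm (u - v) * \<bar>r\<bar> * K + \<bar>r\<bar> * norm (u - v) * K"
      using r K(1) by (intro add_mono mult_right_mono mult_left_mono) auto
    finally have 1: "norm (sq N u u - sq N v v) \<le> (2 * \<bar>r\<bar> * K) * norm (u - v)" by (simp add: algebra_simps)
    have nld: "nl N u - nl N v = \<mu> *\<^sub>R (sq N u u - sq N v v) + \<nu> *\<^sub>R (cu N u - cu N v)"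
      by (simp add: nl_def algebra_simps)
    have 2: "norm (nl N u - nl N v) \<le> \<bar>\<mu>\<bar> * ((2 * \<bar>r\<bar> * K) * norm (u - v)) + \<bar>\<nu>\<bar> * (6 * N * r\<^sup>2 * norm (u - v))"
      unfolding nld by (intro norm_triangle_le add_mono) (auto intro!: mult_left_mono 1 cu_diff[OF N r])
    have Xd: "X N u - X N v = - (\<alpha> *\<^sub>R dN N 5 (u - v) + \<beta> *\<^sub>R dN N 3 (u - v) + dN N 1 (nl N u - nl N v) + dN N 0 (am (u - v)))"
      by (simp add: X_def dN_diff am_diff algebra_simps)
    have "norm (X N u - X N v) \<le> \<bar>\<alpha>\<bar> * (N ^ 5 * norm (u - v)) + \<bar>\<beta>\<bar> * (N ^ 3 * norm (u - v))
       + N ^ 1 * (\<bar>\<mu>\<bar> * ((2 * \<bar>r\<bar> * K) * norm (u - v)) + \<bar>\<nu>\<bar> * (6 * N * r\<^sup>2 * norm (u - v))) + N ^ 0 * (Ak 0 * norm (u - v))"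
      unfolding Xd norm_minus_cancel
      by (intro norm_triangle_le add_mono order_trans[OF dN_norm[OF N]] mult_left_mono 2 am_norm)
        (auto intro!: mult_left_mono dN_norm N am_norm zero_le_power)
    also have "\<dots> = ?L * norm (u - v)" by (simp add: algebra_simps)
    finally show "norm (X N u - X N v) \<le> ?L * norm (u - v)" .
  qed
qed

lemma galerkin_exists:
  assumes N: "N \<ge> 0" and u0: "cj u0 = u0"
  shows "\<exists>u. u 0 = dN N 0 u0 \<and> (\<forall>t\<ge>0. realband N (u t)) \<and>
    (\<forall>T. \<forall>t\<in>{0..T}. (u has_vector_derivative X N (u t)) (at t within {0..T}))"
proof -
  \<comment> \<open>The fixed points of \<open>A\<close> are exactly the real elements of the band,
    which are invariant under the field.\<close>
  define A where "A u = (1/2) *\<^sub>R dN N 0 (u + cj u)" for u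
  have A_iff: "A u = u \<longleftrightarrow> realband N u" for u
  proof
    assume A: "A u = u"
    have c: "cj u = u"
      using arg_cong[OF A, of cj] A by (simp add: A_def dN_cj cj_scaleR cj_add add.commute)
    then show "realband N u" using A by (simp add: A_def realband_def scaleR_2[symmetric] dN_scaleR)
  next
    assume "realband N u" then show "A u = u" by (simp add: A_def realband_def scaleR_2[symmetric] dN_scaleR)
  qed
  have Al: "bounded_linear A"
    unfolding A_def by (intro bounded_linear_compose[OF bounded_linear_scaleR_right] bounded_linear_compose[OF bounded_linear_dN]
        bounded_linear_add bounded_linear_ident bounded_linear_cj)
  have "\<exists>u. u 0 = dN N 0 u0 \<and> (\<forall>t\<ge>0. A (u t) = u t) \<and>
    (\<forall>T. \<forall>t\<in>{0..T}. (u has_vector_derivative X N (u t)) (at t within {0..T}))"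
  proof (rule ode_dissipative[OF X_lipschitz[OF N] Al])
    show "A (dN N 0 u0) = dN N 0 u0" unfolding A_iff realband_def by (simp add: dN_cj u0 dN_dN)
    show "u \<bullet> X N u \<le> 0" if "A u = u" for u
      using X_energy[OF that[unfolded A_iff]] gamma by (smt (verit) mult_minus_left mult_nonneg_nonneg zero_le_power2)
  qed (simp add: A_iff realband_X)
  then show ?thesis unfolding A_iff .
qed

definition gal :: "real \<Rightarrow> l2 \<Rightarrow> real \<Rightarrow> l2" where
  "gal N u0 = (SOME u. u 0 = dN N 0 u0 \<and> (\<forall>t\<ge>0. realband N (u t)) \<and>
    (\<forall>T. \<forall>t\<in>{0..T}. (u has_vector_derivative X N (u t)) (at t within {0..T})))"

lemma gal:
  assumes "N \<ge> 0" "cj u0 = u0"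
  shows "gal N u0 0 = dN N 0 u0" "t \<ge> 0 \<Longrightarrow> realband N (gal N u0 t)"
    "t \<in> {0..T} \<Longrightarrow> (gal N u0 has_vector_derivative X N (gal N u0 t)) (at t within {0..T})"
  using someI_ex[OF galerkin_exists[OF assms]] unfolding gal_def[symmetric] by blast+

lemma dN_deriv:
  "(u has_vector_derivative u') (at t within S) \<Longrightarrow> ((\<lambda>t. dN N k (u t)) has_vector_derivative dN N k u') (at t within S)"
  by (rule bounded_linear.has_vector_derivative[OF bounded_linear_dN])

lemma am_jt: "realband N u \<Longrightarrow> am u = cl (jprod aj (jt N u) 0)"
  using am_cl[OF jet_rl2[OF jet_jt], of N u 0] by (simp add: realband_jt(2) jprod_0[abs_def])

text \<open>Dispersion drops out by skewness. The projection can be moved onto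
  \<open>dN N k u\<close>, which it fixes, so that classical derivatives of products remain.\<close>

lemma X_inner:
  assumes u: "realband N u"
  shows "dN N k u \<bullet> dN N k (X N u)
    = - (cl (jt N u k) \<bullet> cl (hj (jt N u) (Suc k))) - (cl (jt N u k) \<bullet> cl (jprod aj (jt N u) k))"
proof -
  have j: "jet (jt N u)" "jet (hj (jt N u))" "jet (jprod aj (jt N u))"
    by (intro jet_jt jet_hj jet_jprod bjet_aj)+
  have sw: "dN N k (dN N j u) = dN N j (dN N k u)" for j by (simp add: dN_dN add.commute)
  have P: "dN N k u \<bullet> dN N 0 w = dN N k u \<bullet> w" for w
    using dN_skew[of N 0 "dN N k u" w] by (simp add: dN_dN)
  have "dN N k u \<bullet> dN N k (X N u) = - (dN N k u \<bullet> dN N k (dN N 1 (nl N u))) - (dN N k u \<bullet> dN N k (dN N 0 (am u)))"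
    unfolding X_def by (simp add: dN_neg dN_add dN_diff dN_scaleR inner_add_right inner_diff_right sw[of 5] sw[of 3] dN_odd_zero)
  also have "dN N k (dN N 1 (nl N u)) = dN N 0 (cl (hj (jt N u) (Suc k)))"
    using dN_jet_iter[OF j(2), of N "Suc k" 0] by (simp add: dN_dN nl_cl)
  also have "dN N k (dN N 0 (am u)) = dN N 0 (cl (jprod aj (jt N u) k))"
    using dN_jet_iter[OF j(3), of N k 0] by (simp add: dN_dN am_jt[OF u])
  finally show ?thesis unfolding P by (simp add: realband_jt(1)[OF u])
qed

end

subsection \<open>A priori bounds in the Sobolev space of order two\<close>

text \<open>Applied with \<open>z\<close> the square root of the norm of the second derivative: the
  leading energy is quartic in \<open>z\<close>, all corrections are cubic. Beyond the threshold
  \<open>K\<close> one has \<open>1 + z \<le> 2 * z\<close> and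
  \<open>8 * c \<le> \<epsilon> * z\<close>.\<close>

lemma cubic_le_quartic:
  fixes c \<epsilon> :: real
  assumes "\<epsilon> > 0" "c \<ge> 0"
  shows "\<exists>C\<ge>0. \<forall>z\<ge>0. c * (1 + z) ^ 3 \<le> \<epsilon> * z ^ 4 + C"
proof -
  define K where "K = max 1 (8 * c / \<epsilon>)"
  have "c * (1 + z) ^ 3 \<le> \<epsilon> * z ^ 4 + c * (1 + K) ^ 3" if z: "z \<ge> 0" for z
  proof (cases "z \<le> K")
    case True
    then have "c * (1 + z) ^ 3 \<le> c * (1 + K) ^ 3" using assms z by (intro mult_left_mono power_mono) auto
    then show ?thesis using assms z by (simp add: add_increasing)
  next
    case False
    then have "z \<ge> 1" "8 * c / \<epsilon> \<le> z" by (auto simp: K_def)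
    then have z1: "z \<ge> 1" "8 * c \<le> \<epsilon> * z" using assms by (auto simp: pos_divide_le_eq mult.commute)
    have "c * (1 + z) ^ 3 \<le> c * (2 * z) ^ 3" using assms z1 by (intro mult_left_mono power_mono) auto
    also have "\<dots> = 8 * c * z ^ 3" by (simp add: power_mult_distrib)
    also have "\<dots> \<le> \<epsilon> * z * z ^ 3" using z1 z by (intro mult_right_mono) auto
    also have "\<dots> = \<epsilon> * z ^ 4" by (simp add: eval_nat_numeral)
    finally show ?thesis using assms by (simp add: K_def add_increasing2)
  qed
  then show ?thesis using assms by (intro exI[of _ "c * (1 + K) ^ 3"]) (auto simp: K_def)
qed

lemma sq_commute: "sq N u v = sq N v u"
  by (simp add: sq_def mult.commute)

context kawahara
begin

lemma sq_inner: 
  assumes "realband N u" "realband N v" "realband N w"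
  shows "sq N u v \<bullet> w = sq N u w \<bullet> v"
proof -
  have "cl (\<lambda>x. jt N u 0 x * jt N v 0 x) \<bullet> cl (jt N w 0) = cl (\<lambda>x. jt N u 0 x * jt N w 0 x) \<bullet> cl (jt N v 0)"
    by (simp add: inner_cl rl2_sq jet_rl2 jet_jt mult_ac)
  then show ?thesis by (simp add: sq_def realband_jt(2) assms)
qed

lemma cu_inner:
  assumes "realband N u" "realband N w"
  shows "cu N u \<bullet> w = sq N u u \<bullet> sq N u w"
proof -
  have "cl (\<lambda>x. jt N u 0 x * (jt N u 0 x * jt N u 0 x)) \<bullet> cl (jt N w 0)
    = cl (\<lambda>x. jt N u 0 x * jt N u 0 x) \<bullet> cl (\<lambda>x. jt N u 0 x * jt N w 0 x)"
    by (simp add: inner_cl rl2_sq rl2_cu jet_rl2 jet_jt mult_ac)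
  then show ?thesis by (simp add: sq_def cu_def realband_jt(2) assms)
qed

lemma am_inner:
  assumes u: "realband N u"
  shows "dN N k u \<bullet> dN N k (dN N 0 (am u)) = cl (jt N u k) \<bullet> cl (jprod aj (jt N u) k)"
proof -
  have j: "jet (jprod aj (jt N u))" by (intro jet_jt jet_jprod bjet_aj)
  have "dN N k (dN N 0 (am u)) = dN N 0 (cl (jprod aj (jt N u) k))"
    using dN_jet_iter[OF j, of N k 0] by (simp add: dN_dN am_jt[OF u])
  moreover have "dN N k u \<bullet> dN N 0 w = dN N k u \<bullet> w" for w
    using dN_skew[of N 0 "dN N k u" w] by (simp add: dN_dN)
  ultimately show ?thesis by (simp add: realband_jt(1)[OF u])
qed

text \<open>Only the Leibniz term with no derivative on the coefficient is coercive. All others have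
  fewer derivatives on \<open>f\<close> and are treated as perturbations.\<close>

lemma a_term_norm:
  assumes f: "jet f"
  shows "norm (cl (jprod aj f k)) \<le> (\<Sum>j\<le>k. real (k choose j) * Ak j * norm (cl (f (k - j))))"
    "- (cl (f k) \<bullet> cl (jprod aj f k)) \<le> - \<gamma> * (norm (cl (f k)))\<^sup>2
      + (\<Sum>j=1..k. real (k choose j) * Ak j * norm (cl (f (k - j)))) * norm (cl (f k))"
proof -
  have r: "rl2 (\<lambda>x. aj j x * f i x)" for i j by (intro bjet_rl2_mult bjet_aj jet_rl2 f)
  have eq: "cl (jprod aj f k) = (\<Sum>j\<le>k. real (k choose j) *\<^sub>R cl (\<lambda>x. aj j x * f (k - j) x))"
    unfolding jprod_def[abs_def] mult.assoc
    by (subst cl_sum) (auto intro!: sum.cong rl2_cmult r simp: cl_cmult r)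
  have n: "norm (real (k choose j) *\<^sub>R cl (\<lambda>x. aj j x * f (k - j) x)) \<le> real (k choose j) * Ak j * norm (cl (f (k - j)))" for j
    using norm_cl_mult_le[OF jet_rl2[OF f, of "k - j"] aj_measurable[of j] aj_bound[of j]] by (simp add: mult_left_mono mult.assoc)
  show "norm (cl (jprod aj f k)) \<le> (\<Sum>j\<le>k. real (k choose j) * Ak j * norm (cl (f (k - j))))"
    unfolding eq by (rule order_trans[OF norm_sum]) (intro sum_mono n)
  let ?S = "\<Sum>j=1..k. real (k choose j) *\<^sub>R cl (\<lambda>x. aj j x * f (k - j) x)"
  have "cl (jprod aj f k) = am (cl (f k)) + ?S"
    unfolding eq atMost_atLeast0 by (subst sum.atLeast_Suc_atMost) (auto simp: am_cl jet_rl2 f)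
  moreover have "\<gamma> * (norm (cl (f k)))\<^sup>2 \<le> cl (f k) \<bullet> am (cl (f k))" by (rule inner_am_ge)
  moreover have "- (cl (f k) \<bullet> ?S) \<le> norm (cl (f k)) * (\<Sum>j=1..k. real (k choose j) * Ak j * norm (cl (f (k - j))))"
  proof -
    have "- (cl (f k) \<bullet> ?S) \<le> norm (cl (f k)) * norm ?S"
      using Cauchy_Schwarz_ineq2[of "cl (f k)" ?S] by linarith
    also have "norm ?S \<le> (\<Sum>j=1..k. real (k choose j) * Ak j * norm (cl (f (k - j))))"
      by (rule order_trans[OF norm_sum]) (intro sum_mono n)
    finally show ?thesis by (simp add: mult_left_mono)
  qed
  ultimately show "- (cl (f k) \<bullet> cl (jprod aj f k)) \<le> - \<gamma> * (norm (cl (f k)))\<^sup>2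
      + (\<Sum>j=1..k. real (k choose j) * Ak j * norm (cl (f (k - j)))) * norm (cl (f k))"
    by (simp add: inner_add_right mult.commute)
qed

lemma gal_decay:
  assumes "N \<ge> 0" "cj u0 = u0" "t \<ge> 0"
  shows "norm (gal N u0 t) \<le> exp (- \<gamma> * t) * norm u0"
proof -
  let ?u = "gal N u0"
  note g = gal[OF assms(1,2)]
  have "?u t \<bullet> ?u t \<le> (?u 0 \<bullet> ?u 0 - 0 / (2 * \<gamma>)) * exp (- (2 * \<gamma>) * t) + 0 / (2 * \<gamma>)"
  proof (rule gronwall_decay[OF _ _ assms(3)])
    fix s assume s: "s \<in> {0..t}"
    show "((\<lambda>t. ?u t \<bullet> ?u t) has_real_derivative ?u s \<bullet> X N (?u s) + X N (?u s) \<bullet> ?u s) (at s within {0..t})"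
      by (intro has_real_derivative_inner g(3) s)
    show "?u s \<bullet> X N (?u s) + X N (?u s) \<bullet> ?u s \<le> - (2 * \<gamma>) * (?u s \<bullet> ?u s) + 0"
      using X_energy[OF g(2)[of s]] s by (simp add: inner_commute power2_norm_eq_inner)
  qed (use gamma in simp)
  also have "\<dots> \<le> (norm u0)\<^sup>2 * (exp (- \<gamma> * t))\<^sup>2"
    using dN_norm[OF assms(1), of 0 u0]
    by (simp add: g(1) power2_norm_eq_inner[symmetric] exp_double[symmetric] power_mono mult_ac)
  finally have "(norm (?u t))\<^sup>2 \<le> (exp (- \<gamma> * t) * norm u0)\<^sup>2"
    by (simp add: power2_norm_eq_inner[symmetric] power_mult_distrib mult.commute)
  then show ?thesis by (rule power2_le_imp_le) simp
qed

text \<open>Conserved by the truncated equation without damping, and normalised by \<open>\<alpha>\<close> so that the leading term is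
  positive.\<close>

definition ham :: "real \<Rightarrow> l2 \<Rightarrow> real" where
  "ham N u = 1/2 * (dN N 2 u \<bullet> dN N 2 u) - \<beta> / (2 * \<alpha>) * (dN N 1 u \<bullet> dN N 1 u)
    + \<mu> / (3 * \<alpha>) * (sq N u u \<bullet> u) + \<nu> / (4 * \<alpha>) * (sq N u u \<bullet> sq N u u)"

definition hamd :: "real \<Rightarrow> l2 \<Rightarrow> real" where
  "hamd N u = - (cl (jt N u 2) \<bullet> cl (jprod aj (jt N u) 2)) + \<beta> / \<alpha> * (cl (jt N u 1) \<bullet> cl (jprod aj (jt N u) 1))
    - 1 / \<alpha> * (nl N u \<bullet> dN N 0 (am u))"

text \<open>The gradient of \<open>\<alpha> * ham\<close> is
  \<open>h = \<alpha> u_4 + \<beta> u_2 + nl\<close>, and the field is minus \<open>dN N 1 h\<close>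
  plus the projected damping. Since \<open>dN N 1\<close> is skew, \<open>h\<close> is orthogonal to
  its derivative and only the damping contributes.\<close>

lemma ham_deriv:
  assumes N: "N \<ge> 0" and d: "(u has_vector_derivative X N (u t)) (at t within S)" and u: "realband N (u t)"
  shows "((\<lambda>t. ham N (u t)) has_real_derivative hamd N (u t)) (at t within S)"
proof -
  let ?u = "u t" and ?X = "X N (u t)"
  have rX: "realband N ?X" by (rule realband_X[OF u])
  interpret bounded_bilinear "sq N" by (rule sq_bilinear[OF N])
  note di = has_real_derivative_inner
  have dsq: "((\<lambda>t. sq N (u t) (u t)) has_vector_derivative (sq N ?u ?X + sq N ?X ?u)) (at t within S)"
    by (rule has_vector_derivative[OF d d])
  have "((\<lambda>t. ham N (u t)) has_real_derivative
     1/2 * (dN N 2 ?u \<bullet> dN N 2 ?X + dN N 2 ?X \<bullet> dN N 2 ?u) - \<beta> / (2 * \<alpha>) * (dN N 1 ?u \<bullet> dN N 1 ?X + dN N 1 ?X \<bullet> dN N 1 ?u)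
    + \<mu> / (3 * \<alpha>) * (sq N ?u ?u \<bullet> ?X + (sq N ?u ?X + sq N ?X ?u) \<bullet> ?u)
    + \<nu> / (4 * \<alpha>) * (sq N ?u ?u \<bullet> (sq N ?u ?X + sq N ?X ?u) + (sq N ?u ?X + sq N ?X ?u) \<bullet> sq N ?u ?u)) (at t within S)"
    unfolding ham_def by (intro DERIV_add DERIV_diff DERIV_cmult di dN_deriv d dsq)
  also have "1/2 * (dN N 2 ?u \<bullet> dN N 2 ?X + dN N 2 ?X \<bullet> dN N 2 ?u) - \<beta> / (2 * \<alpha>) * (dN N 1 ?u \<bullet> dN N 1 ?X + dN N 1 ?X \<bullet> dN N 1 ?u)
    + \<mu> / (3 * \<alpha>) * (sq N ?u ?u \<bullet> ?X + (sq N ?u ?X + sq N ?X ?u) \<bullet> ?u)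
    + \<nu> / (4 * \<alpha>) * (sq N ?u ?u \<bullet> (sq N ?u ?X + sq N ?X ?u) + (sq N ?u ?X + sq N ?X ?u) \<bullet> sq N ?u ?u)
    = dN N 2 ?u \<bullet> dN N 2 ?X - \<beta> / \<alpha> * (dN N 1 ?u \<bullet> dN N 1 ?X) + 1 / \<alpha> * (nl N ?u \<bullet> ?X)"
  proof -
    have e: "sq N ?u ?X \<bullet> ?u = sq N ?u ?u \<bullet> ?X" "cu N ?u \<bullet> ?X = sq N ?u ?u \<bullet> sq N ?u ?X" "sq N ?X ?u = sq N ?u ?X"
      using sq_inner[OF u rX u] cu_inner[OF u rX] sq_commute by auto
    show ?thesis
      unfolding nl_def inner_add_left inner_add_right inner_scaleR_left e inner_commute[of "dN N _ ?X"] inner_commute[of "sq N ?u ?X" "sq N ?u ?u"]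
      using alpha by (simp add: field_simps)
  qed
  also have "\<dots> = hamd N ?u"
  proof -
    define h where "h = \<alpha> *\<^sub>R dN N 4 ?u + \<beta> *\<^sub>R dN N 2 ?u + nl N ?u"
    have Xh: "?X = - (dN N 1 h + dN N 0 (am ?u))"
      by (simp add: X_def h_def dN_add dN_scaleR dN_dN numeral_3_eq_3)
    have s4: "dN N 4 ?u \<bullet> w = dN N 2 ?u \<bullet> dN N 2 w" for w
      using dN_skew[of N 2 "dN N 2 ?u" w] by (simp add: dN_dN)
    have s2: "dN N 2 ?u \<bullet> w = - (dN N 1 ?u \<bullet> dN N 1 w)" for w
      using dN_skew[of N 1 "dN N 1 ?u" w] by (simp add: dN_dN numeral_2_eq_2)
    have "dN N 2 ?u \<bullet> dN N 2 ?X - \<beta> / \<alpha> * (dN N 1 ?u \<bullet> dN N 1 ?X) + 1 / \<alpha> * (nl N ?u \<bullet> ?X) = 1 / \<alpha> * (h \<bullet> ?X)"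
      unfolding h_def inner_add_left inner_scaleR_left s4 s2[of ?X] using alpha by (simp add: field_simps)
    also have "h \<bullet> ?X = - (h \<bullet> dN N 0 (am ?u))"
      unfolding Xh by (simp add: inner_diff_right dN_odd_zero)
    also have "h \<bullet> dN N 0 (am ?u) = \<alpha> * (cl (jt N ?u 2) \<bullet> cl (jprod aj (jt N ?u) 2))
       - \<beta> * (cl (jt N ?u 1) \<bullet> cl (jprod aj (jt N ?u) 1)) + nl N ?u \<bullet> dN N 0 (am ?u)"
      unfolding h_def inner_add_left inner_scaleR_left s4 s2[of "dN N 0 (am ?u)"] am_inner[OF u] by simp
    also have "1 / \<alpha> * - (\<alpha> * (cl (jt N ?u 2) \<bullet> cl (jprod aj (jt N ?u) 2))
       - \<beta> * (cl (jt N ?u 1) \<bullet> cl (jprod aj (jt N ?u) 1)) + nl N ?u \<bullet> dN N 0 (am ?u)) = hamd N ?u"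
      unfolding hamd_def using alpha by (simp add: field_simps)
    finally show ?thesis .
  qed
  finally show ?thesis .
qed

text \<open>Interpolation in the variable \<open>z\<close>: the first derivative and the square of
  the sup norm grow only linearly in \<open>z\<close>.\<close>

lemma sobolev_small:
  assumes f: "jet f" and r: "norm (cl (f 0)) \<le> r"
  defines "z \<equiv> sqrt (norm (cl (f 2)))"
  shows "norm (cl (f 1)) \<le> sqrt r * z" "(f 0 x)\<^sup>2 \<le> 2 * (r * sqrt r) * z" "\<bar>f 0 x\<bar> \<le> 1 + 2 * (r * sqrt r) * z"
proof -
  have r0: "r \<ge> 0" using r norm_ge_zero order_trans by blast
  have "(norm (cl (f 1)))\<^sup>2 \<le> norm (cl (f 0)) * norm (cl (f 2))"
    using jet_interp[OF f, of 0] by (simp add: numeral_2_eq_2)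
  also have "\<dots> \<le> r * norm (cl (f 2))" by (intro mult_right_mono r) simp
  also have "\<dots> = (sqrt r * z)\<^sup>2" using r0 by (simp add: z_def power_mult_distrib)
  finally show 1: "norm (cl (f 1)) \<le> sqrt r * z"
    by (rule power2_le_imp_le) (use r0 in \<open>simp add: z_def\<close>)
  have "(f 0 x)\<^sup>2 \<le> 2 * norm (cl (f 0)) * norm (cl (f 1))" using jet_agmon[OF f, of 0 x] by simp
  also have "\<dots> \<le> 2 * r * (sqrt r * z)" by (intro mult_mono 1) (use r r0 in auto)
  finally show 2: "(f 0 x)\<^sup>2 \<le> 2 * (r * sqrt r) * z" by (simp add: mult_ac)
  have "2 * \<bar>f 0 x\<bar> \<le> 1 + (f 0 x)\<^sup>2" using zero_le_power2[of "\<bar>f 0 x\<bar> - 1"] by (simp add: power2_diff)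
  then have "\<bar>f 0 x\<bar> \<le> 1 + (f 0 x)\<^sup>2" by linarith
  then show "\<bar>f 0 x\<bar> \<le> 1 + 2 * (r * sqrt r) * z" using 2 by linarith
qed

text \<open>In \<open>z\<close> the second-order energy is quartic. Every other term is at most
  cubic by \<open>sobolev_small\<close>; for the quartic potential this uses that the square of the
  sup norm is linear in \<open>z\<close>.\<close>

lemma ham_bounds:
  assumes r: "r \<ge> 0"
  shows "\<exists>c\<ge>0. \<forall>N u. N \<ge> 0 \<longrightarrow> realband N u \<longrightarrow> norm u \<le> r \<longrightarrow>
    \<bar>ham N u - 1/2 * (norm (dN N 2 u))\<^sup>2\<bar> \<le> c * (1 + sqrt (norm (dN N 2 u))) ^ 3 \<and>
    hamd N u \<le> - \<gamma> * (norm (dN N 2 u))\<^sup>2 + c * (1 + sqrt (norm (dN N 2 u))) ^ 3"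
proof -
  define q where "q = r * sqrt r"
  have q: "q \<ge> 0" using r by (simp add: q_def)
  define c1 where "c1 = \<bar>\<beta> / (2 * \<alpha>)\<bar> * r + \<bar>\<mu> / (3 * \<alpha>)\<bar> * ((1 + 2 * q) * r * r) + \<bar>\<nu> / (4 * \<alpha>)\<bar> * (2 * q * r * r)"
  define c2 where "c2 = 2 * Ak 1 * sqrt r + Ak 2 * r + \<bar>\<beta> / \<alpha>\<bar> * ((Ak 0 * sqrt r + Ak 1 * r) * sqrt r)
     + \<bar>1 / \<alpha>\<bar> * ((\<bar>\<mu>\<bar> * ((1 + 2 * q) * r) + \<bar>\<nu>\<bar> * (2 * q * r)) * (Ak 0 * r))"
  have c: "c1 \<ge> 0" "c2 \<ge> 0" using r q Ak_nonneg by (simp_all add: c1_def c2_def)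
  have main: "\<bar>ham N u - 1/2 * (norm (dN N 2 u))\<^sup>2\<bar> \<le> c1 * (1 + sqrt (norm (dN N 2 u))) ^ 3 \<and>
    hamd N u \<le> - \<gamma> * (norm (dN N 2 u))\<^sup>2 + c2 * (1 + sqrt (norm (dN N 2 u))) ^ 3"
    if N: "N \<ge> 0" and u: "realband N u" and ur: "norm u \<le> r" for N u
  proof -
    let ?f = "jt N u"
    have f: "jet ?f" by (rule jet_jt)
    have D: "norm (cl (?f k)) = norm (dN N k u)" "norm (cl (?f 0)) = norm u" for k
      using realband_jt[OF u] by simp_all
    define z where "z = sqrt (norm (dN N 2 u))"
    have z: "z \<ge> 0" by (simp add: z_def)
    have z2: "norm (dN N 2 u) = z\<^sup>2" by (simp add: z_def)
    have sm: "norm (dN N 1 u) \<le> sqrt r * z" "\<And>x. (?f 0 x)\<^sup>2 \<le> 2 * q * z" "\<And>x. \<bar>?f 0 x\<bar> \<le> 1 + 2 * q * z"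
    proof -
      have n0: "norm (cl (?f 0)) \<le> r" using ur D(2) by simp
      show "norm (dN N 1 u) \<le> sqrt r * z" "\<And>x. (?f 0 x)\<^sup>2 \<le> 2 * q * z" "\<And>x. \<bar>?f 0 x\<bar> \<le> 1 + 2 * q * z"
        using sobolev_small[OF f n0] by (simp_all add: D(1) z_def q_def)
    qed
    have Z: "1 \<le> (1 + z) ^ 3" "z \<le> (1 + z) ^ 3" "z\<^sup>2 \<le> (1 + z) ^ 3" "z ^ 3 \<le> (1 + z) ^ 3"
      using z by (simp_all add: eval_nat_numeral algebra_simps add_increasing)
    have sqn: "norm (sq N u v) \<le> (1 + 2 * q * z) * norm v" if "realband N v" for v
      using norm_cl_mult_le[OF jet_rl2[OF jet_jt] jt_measurable sm(3), of N v 0] realband_jt(2)[OF that]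
      by (simp add: sq_def)
    have cun: "norm (cu N u) \<le> 2 * q * z * norm u"
      using norm_cl_mult_le[OF jet_rl2[OF f, of 0], of "\<lambda>x. ?f 0 x * ?f 0 x" "2 * q * z"] sm(2) jt_measurable realband_jt(2)[OF u]
      by (simp add: cu_def mult.assoc power2_eq_square)
    have lin: "1 + 2 * q * z \<le> (1 + 2 * q) * (1 + z) ^ 3" and lin2: "2 * q * z \<le> 2 * q * (1 + z) ^ 3"
      using Z(1,2) q mult_left_mono[OF Z(2), of "2 * q"] by (simp_all add: distrib_right)
    have D1: "(norm (dN N 1 u))\<^sup>2 \<le> r * (1 + z) ^ 3"
    proof -
      have "(norm (dN N 1 u))\<^sup>2 \<le> (sqrt r * z)\<^sup>2" by (intro power_mono sm) simp
      also have "\<dots> = r * z\<^sup>2" using r by (simp add: power_mult_distrib)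
      also have "\<dots> \<le> r * (1 + z) ^ 3" by (intro mult_left_mono Z r)
      finally show ?thesis .
    qed
    have t3: "\<bar>sq N u u \<bullet> u\<bar> \<le> ((1 + 2 * q) * r * r) * (1 + z) ^ 3"
    proof -
      have "\<bar>sq N u u \<bullet> u\<bar> \<le> norm (sq N u u) * norm u" by (rule Cauchy_Schwarz_ineq2)
      also have "\<dots> \<le> ((1 + 2 * q) * (1 + z) ^ 3 * r) * r"
        using q z r by (intro mult_mono order_trans[OF sqn[OF u]] lin ur) auto
      finally show ?thesis by (simp add: mult_ac)
    qed
    have t4: "\<bar>sq N u u \<bullet> sq N u u\<bar> \<le> (2 * q * r * r) * (1 + z) ^ 3"
    proof -
      have "sq N u u \<bullet> sq N u u = cu N u \<bullet> u" by (rule cu_inner[OF u u, symmetric])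
      also have "\<bar>\<dots>\<bar> \<le> norm (cu N u) * norm u" by (rule Cauchy_Schwarz_ineq2)
      also have "\<dots> \<le> (2 * q * (1 + z) ^ 3 * r) * r"
        using q z r by (intro mult_mono order_trans[OF cun] lin2 ur) auto
      finally show ?thesis by (simp add: mult_ac)
    qed
    have "ham N u - 1/2 * (norm (dN N 2 u))\<^sup>2 = - (\<beta> / (2 * \<alpha>) * (norm (dN N 1 u))\<^sup>2)
       + \<mu> / (3 * \<alpha>) * (sq N u u \<bullet> u) + \<nu> / (4 * \<alpha>) * (sq N u u \<bullet> sq N u u)"
      by (simp add: ham_def power2_norm_eq_inner)
    also have "\<bar>\<dots>\<bar> \<le> \<bar>\<beta> / (2 * \<alpha>)\<bar> * (r * (1 + z) ^ 3) + \<bar>\<mu> / (3 * \<alpha>)\<bar> * (((1 + 2 * q) * r * r) * (1 + z) ^ 3)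
       + \<bar>\<nu> / (4 * \<alpha>)\<bar> * ((2 * q * r * r) * (1 + z) ^ 3)"
      by (intro order_trans[OF abs_triangle_ineq] add_mono)
        (auto simp only: abs_mult abs_minus_cancel abs_power2 abs_norm_cancel intro!: mult_left_mono D1 t3 t4 abs_ge_zero)
    also have "\<dots> = c1 * (1 + z) ^ 3" by (simp add: c1_def algebra_simps)
    finally have A: "\<bar>ham N u - 1/2 * (norm (dN N 2 u))\<^sup>2\<bar> \<le> c1 * (1 + z) ^ 3" .
    have h2: "- (cl (?f 2) \<bullet> cl (jprod aj ?f 2)) \<le> - \<gamma> * (norm (dN N 2 u))\<^sup>2 + (2 * Ak 1 * sqrt r + Ak 2 * r) * (1 + z) ^ 3"
    proof -
      have "- (cl (?f 2) \<bullet> cl (jprod aj ?f 2)) \<le> - \<gamma> * (norm (dN N 2 u))\<^sup>2 + (2 * Ak 1 * norm (dN N 1 u) + Ak 2 * norm u) * z\<^sup>2"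
      proof -
        have "(\<Sum>j = 1..2. real (2 choose j) * Ak j * norm (cl (?f (2 - j)))) = 2 * Ak 1 * norm (cl (?f 1)) + Ak 2 * norm (cl (?f 0))"
          by (simp add: numeral_2_eq_2)
        then show ?thesis
          using a_term_norm(2)[OF f, of 2] unfolding D(2) D(1)[of 1] D(1)[of 2] z2 by simp
      qed
      also have "(2 * Ak 1 * norm (dN N 1 u) + Ak 2 * norm u) * z\<^sup>2 \<le> (2 * Ak 1 * (sqrt r * z) + Ak 2 * r) * z\<^sup>2"
        using Ak_nonneg by (intro mult_right_mono add_mono mult_left_mono sm ur) auto
      also have "\<dots> = 2 * Ak 1 * sqrt r * z ^ 3 + Ak 2 * r * z\<^sup>2" by (simp add: eval_nat_numeral algebra_simps)
      also have "\<dots> \<le> 2 * Ak 1 * sqrt r * (1 + z) ^ 3 + Ak 2 * r * (1 + z) ^ 3"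
        using Ak_nonneg r by (intro add_mono mult_left_mono Z mult_nonneg_nonneg) auto
      finally show ?thesis by (simp add: distrib_right)
    qed
    have h1: "\<beta> / \<alpha> * (cl (?f 1) \<bullet> cl (jprod aj ?f 1)) \<le> \<bar>\<beta> / \<alpha>\<bar> * (((Ak 0 * sqrt r + Ak 1 * r) * sqrt r) * (1 + z) ^ 3)"
    proof -
      have "\<bar>cl (?f 1) \<bullet> cl (jprod aj ?f 1)\<bar> \<le> norm (cl (?f 1)) * norm (cl (jprod aj ?f 1))" by (rule Cauchy_Schwarz_ineq2)
      also have "\<dots> \<le> norm (dN N 1 u) * (Ak 0 * norm (dN N 1 u) + Ak 1 * norm u)"
        using a_term_norm(1)[OF f, of 1] by (intro mult_mono) (auto simp: D(1)[of 1, simplified] D(2))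
      also have "\<dots> \<le> (sqrt r * z) * (Ak 0 * (sqrt r * z) + Ak 1 * r)"
        using Ak_nonneg r z by (intro mult_mono add_mono mult_left_mono sm ur) auto
      also have "\<dots> = Ak 0 * sqrt r * sqrt r * z\<^sup>2 + Ak 1 * r * sqrt r * z" by (simp add: eval_nat_numeral algebra_simps)
      also have "\<dots> \<le> Ak 0 * sqrt r * sqrt r * (1 + z) ^ 3 + Ak 1 * r * sqrt r * (1 + z) ^ 3"
        using Ak_nonneg r by (intro add_mono mult_left_mono Z mult_nonneg_nonneg) auto
      finally have *: "\<bar>cl (?f 1) \<bullet> cl (jprod aj ?f 1)\<bar> \<le> ((Ak 0 * sqrt r + Ak 1 * r) * sqrt r) * (1 + z) ^ 3" by (simp only: distrib_right)
      have "\<beta> / \<alpha> * (cl (?f 1) \<bullet> cl (jprod aj ?f 1)) \<le> \<bar>\<beta> / \<alpha>\<bar> * \<bar>cl (?f 1) \<bullet> cl (jprod aj ?f 1)\<bar>"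
        by (simp only: abs_mult[symmetric] abs_ge_self)
      also have "\<dots> \<le> \<bar>\<beta> / \<alpha>\<bar> * (((Ak 0 * sqrt r + Ak 1 * r) * sqrt r) * (1 + z) ^ 3)"
        by (intro mult_left_mono *) simp
      finally show ?thesis .
    qed
    have h0: "- (1 / \<alpha> * (nl N u \<bullet> dN N 0 (am u))) \<le> \<bar>1 / \<alpha>\<bar> * (((\<bar>\<mu>\<bar> * ((1 + 2 * q) * r) + \<bar>\<nu>\<bar> * (2 * q * r)) * (Ak 0 * r)) * (1 + z) ^ 3)"
    proof -
      have n1: "norm (nl N u) \<le> \<bar>\<mu>\<bar> * ((1 + 2 * q) * (1 + z) ^ 3 * r) + \<bar>\<nu>\<bar> * (2 * q * (1 + z) ^ 3 * r)"
        unfolding nl_def using q z r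
        by (intro norm_triangle_le add_mono)
          (auto intro!: mult_left_mono order_trans[OF sqn[OF u]] order_trans[OF cun] mult_mono lin lin2 ur)
      have n2: "norm (dN N 0 (am u)) \<le> Ak 0 * r"
        using dN_norm[OF N, of 0 "am u"] am_norm[of u] mult_left_mono[OF ur Ak_nonneg[of 0]] by simp
      have "\<bar>nl N u \<bullet> dN N 0 (am u)\<bar> \<le> norm (nl N u) * norm (dN N 0 (am u))" by (rule Cauchy_Schwarz_ineq2)
      also have "\<dots> \<le> (\<bar>\<mu>\<bar> * ((1 + 2 * q) * (1 + z) ^ 3 * r) + \<bar>\<nu>\<bar> * (2 * q * (1 + z) ^ 3 * r)) * (Ak 0 * r)"
        using q z r by (intro mult_mono n1 n2) auto
      also have "\<dots> = ((\<bar>\<mu>\<bar> * ((1 + 2 * q) * r) + \<bar>\<nu>\<bar> * (2 * q * r)) * (Ak 0 * r)) * (1 + z) ^ 3" by algebra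
      finally have *: "\<bar>nl N u \<bullet> dN N 0 (am u)\<bar> \<le> \<dots>" .
      have "- (1 / \<alpha> * (nl N u \<bullet> dN N 0 (am u))) \<le> \<bar>1 / \<alpha>\<bar> * \<bar>nl N u \<bullet> dN N 0 (am u)\<bar>"
        by (simp only: abs_mult[symmetric] abs_ge_minus_self)
      also have "\<dots> \<le> \<bar>1 / \<alpha>\<bar> * (((\<bar>\<mu>\<bar> * ((1 + 2 * q) * r) + \<bar>\<nu>\<bar> * (2 * q * r)) * (Ak 0 * r)) * (1 + z) ^ 3)"
        by (intro mult_left_mono *) simp
      finally show ?thesis .
    qed
    have "hamd N u \<le> - \<gamma> * (norm (dN N 2 u))\<^sup>2 + c2 * (1 + z) ^ 3"
    proof -
      have "c2 * (1 + z) ^ 3 = (2 * Ak 1 * sqrt r + Ak 2 * r) * (1 + z) ^ 3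
        + \<bar>\<beta> / \<alpha>\<bar> * (((Ak 0 * sqrt r + Ak 1 * r) * sqrt r) * (1 + z) ^ 3)
        + \<bar>1 / \<alpha>\<bar> * (((\<bar>\<mu>\<bar> * ((1 + 2 * q) * r) + \<bar>\<nu>\<bar> * (2 * q * r)) * (Ak 0 * r)) * (1 + z) ^ 3)"
        unfolding c2_def by (simp only: distrib_right mult.assoc)
      then show ?thesis using h0 h1 h2 unfolding hamd_def by linarith
    qed
    with A show ?thesis by (simp add: z_def)
  qed
  show ?thesis
  proof (intro exI[of _ "c1 + c2"] conjI allI impI)
    fix N u assume a: "0 \<le> N" "realband N u" "norm u \<le> r"
    have "0 \<le> c1 * (1 + sqrt (norm (dN N 2 u))) ^ 3" "0 \<le> c2 * (1 + sqrt (norm (dN N 2 u))) ^ 3"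
      using c by simp_all
    with main[OF a] show "\<bar>ham N u - 1/2 * (norm (dN N 2 u))\<^sup>2\<bar> \<le> (c1 + c2) * (1 + sqrt (norm (dN N 2 u))) ^ 3"
      "hamd N u \<le> - \<gamma> * (norm (dN N 2 u))\<^sup>2 + (c1 + c2) * (1 + sqrt (norm (dN N 2 u))) ^ 3"
      unfolding distrib_right by linarith+
  qed (use c in simp)
qed

text \<open>The Hamiltonian is comparable to the squared norm of the second derivative up to
  additive constants and satisfies \<open>y' \<le> - \<gamma> * y + C\<close>, which gives a bound
  uniform in time and in \<open>N\<close>.\<close>

lemma H2_bound:
  assumes r: "r \<ge> 0"
  shows "\<exists>B\<ge>0. \<forall>N u0 t. N \<ge> 0 \<longrightarrow> cj u0 = u0 \<longrightarrow> norm u0 \<le> r \<longrightarrow> norm (dN N 2 u0) \<le> r \<longrightarrow> t \<ge> 0 \<longrightarrow>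
    norm (dN N 2 (gal N u0 t)) \<le> B"
proof -
  obtain c where c: "c \<ge> 0" and hb: "\<And>N u. N \<ge> 0 \<Longrightarrow> realband N u \<Longrightarrow> norm u \<le> r \<Longrightarrow>
    \<bar>ham N u - 1/2 * (norm (dN N 2 u))\<^sup>2\<bar> \<le> c * (1 + sqrt (norm (dN N 2 u))) ^ 3"
    "\<And>N u. N \<ge> 0 \<Longrightarrow> realband N u \<Longrightarrow> norm u \<le> r \<Longrightarrow>
    hamd N u \<le> - \<gamma> * (norm (dN N 2 u))\<^sup>2 + c * (1 + sqrt (norm (dN N 2 u))) ^ 3"
    using ham_bounds[OF r] by blast
  \<comment> \<open>Giving up a quarter of each leading term leaves \<open>3/4 * \<gamma>\<close>
    times the squared norm in \<open>hamd\<close>, which matches the factor \<open>3/4\<close> in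
    the upper bound of \<open>ham\<close>.\<close>
  obtain C1 where C1: "C1 \<ge> 0" "\<And>z. z \<ge> 0 \<Longrightarrow> c * (1 + z) ^ 3 \<le> 1/4 * z ^ 4 + C1"
    using cubic_le_quartic[of "1/4" c] c by auto
  obtain C2 where C2: "C2 \<ge> 0" "\<And>z. z \<ge> 0 \<Longrightarrow> c * (1 + z) ^ 3 \<le> \<gamma> / 4 * z ^ 4 + C2"
    using cubic_le_quartic[of "\<gamma>/4" c] c gamma by auto
  have y4: "sqrt y ^ 4 = y\<^sup>2" if "y \<ge> 0" for y
  proof -
    have "sqrt y ^ 4 = ((sqrt y)\<^sup>2)\<^sup>2" by simp
    then show ?thesis using that by (simp only: real_sqrt_pow2)
  qed
  have h1: "1/4 * (norm (dN N 2 u))\<^sup>2 - C1 \<le> ham N u" "ham N u \<le> 3/4 * (norm (dN N 2 u))\<^sup>2 + C1"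
    "hamd N u \<le> - \<gamma> * ham N u + (C2 + \<gamma> * C1)"
    if a: "N \<ge> 0" "realband N u" "norm u \<le> r" for N u
  proof -
    have b: "c * (1 + sqrt (norm (dN N 2 u))) ^ 3 \<le> 1/4 * (norm (dN N 2 u))\<^sup>2 + C1"
      "c * (1 + sqrt (norm (dN N 2 u))) ^ 3 \<le> \<gamma> / 4 * (norm (dN N 2 u))\<^sup>2 + C2"
      using C1(2)[of "sqrt (norm (dN N 2 u))"] C2(2)[of "sqrt (norm (dN N 2 u))"] by (simp_all add: y4)
    show 1: "1/4 * (norm (dN N 2 u))\<^sup>2 - C1 \<le> ham N u" "ham N u \<le> 3/4 * (norm (dN N 2 u))\<^sup>2 + C1"
      using hb(1)[OF a] b(1) by linarith+
    have "\<gamma> * ham N u \<le> \<gamma> * (3/4 * (norm (dN N 2 u))\<^sup>2 + C1)" using 1 gamma by simp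
    then show "hamd N u \<le> - \<gamma> * ham N u + (C2 + \<gamma> * C1)"
      using hb(2)[OF a] b(2) by (simp add: algebra_simps)
  qed
  define K where "K = (C2 + \<gamma> * C1) / \<gamma>"
  have K: "K \<ge> 0" using C1 C2 gamma by (simp add: K_def)
  show ?thesis
  proof (intro exI[of _ "sqrt (4 * (3/4 * r\<^sup>2 + C1 + K + C1))"] conjI allI impI)
    fix N u0 and t :: real assume a: "0 \<le> N" "cj u0 = u0" "norm u0 \<le> r" "norm (dN N 2 u0) \<le> r" and t: "0 \<le> t"
    let ?u = "gal N u0"
    note g = gal[OF a(1,2)]
    have ur: "norm (?u s) \<le> r" if "s \<ge> 0" for s
    proof -
      have "exp (- \<gamma> * s) * norm u0 \<le> 1 * norm u0" using that gamma by (intro mult_right_mono) auto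
      then show ?thesis using gal_decay[OF a(1,2) that] a(3) by linarith
    qed
    have "ham N (?u t) \<le> (ham N (?u 0) - (C2 + \<gamma> * C1) / \<gamma>) * exp (- \<gamma> * t) + (C2 + \<gamma> * C1) / \<gamma>"
    proof (rule gronwall_decay[OF _ _ t gamma])
      fix s assume s: "s \<in> {0..t}"
      show "((\<lambda>t. ham N (?u t)) has_real_derivative hamd N (?u s)) (at s within {0..t})"
        using s by (intro ham_deriv a g) auto
      show "hamd N (?u s) \<le> - \<gamma> * ham N (?u s) + (C2 + \<gamma> * C1)"
        using s by (intro h1 a g ur) auto
    qed
    also have "\<dots> \<le> (3/4 * r\<^sup>2 + C1) + K"
    proof -
      have h0: "ham N (?u 0) \<le> 3/4 * r\<^sup>2 + C1"
      proof -
        have "ham N (?u 0) \<le> 3/4 * (norm (dN N 2 (?u 0)))\<^sup>2 + C1" by (intro h1 a g ur) auto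
        also have "norm (dN N 2 (?u 0)) = norm (dN N 2 u0)" by (simp add: g(1) dN_dN)
        also have "3/4 * (norm (dN N 2 u0))\<^sup>2 + C1 \<le> 3/4 * r\<^sup>2 + C1" using a(4) by (simp add: power_mono)
        finally show ?thesis .
      qed
      have "(ham N (?u 0) - K) * exp (- \<gamma> * t) \<le> (3/4 * r\<^sup>2 + C1) * exp (- \<gamma> * t)"
        using h0 K by (intro mult_right_mono) auto
      also have "\<dots> \<le> (3/4 * r\<^sup>2 + C1) * 1" using C1 gamma t by (intro mult_left_mono) auto
      finally show ?thesis unfolding K_def by simp
    qed
    finally have "1/4 * (norm (dN N 2 (?u t)))\<^sup>2 - C1 \<le> 3/4 * r\<^sup>2 + C1 + K"
      using h1(1)[OF a(1) g(2)[OF t] ur[OF t]] by (rule order_trans[rotated])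
    then have "(norm (dN N 2 (?u t)))\<^sup>2 \<le> 4 * (3/4 * r\<^sup>2 + C1 + K + C1)" by argo
    then show "norm (dN N 2 (?u t)) \<le> sqrt (4 * (3/4 * r\<^sup>2 + C1 + K + C1))" by (rule real_le_rsqrt)
  qed (use C1 K in simp)
qed

end

subsection \<open>Weighted convolution estimates\<close>

text \<open>The subtraction is truncated: orders up to two carry no power of \<open>\<rho>\<close>, being bounded beforehand,
  and products of derivatives of higher order keep a spare power of \<open>\<rho>\<close>.\<close>

definition wt :: "real \<Rightarrow> nat \<Rightarrow> real" where
  "wt \<rho> k = \<rho> ^ (k - 2) * ((real k + 1) ^ 3 / fact k)"

lemma wt_pos: "\<rho> > 0 \<Longrightarrow> wt \<rho> k > 0"
  by (simp add: wt_def add_nonneg_pos)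

lemma power_split_le:
  fixes \<rho> :: real
  assumes "0 < \<rho>" "\<rho> \<le> 1" "a + b \<le> (c::nat)"
  shows "\<rho> ^ c \<le> \<rho> ^ a * \<rho> ^ b"
  using assms power_decreasing[of "a + b" c \<rho>] by (simp add: power_add)

text \<open>Here \<open>l\<close> is the order of the factor that keeps most derivatives. The
  binomial cancels the factorials of the weights, the cubes differ by at most a factor
  \<open>2^3\<close>, and \<open>e\<close> powers of \<open>\<rho>\<close> are left for the other
  factor.\<close>

lemma wt_choose_le:
  assumes \<rho>: "0 < \<rho>" "\<rho> \<le> 1" and j: "j \<le> k" and e: "e + (l - 2) \<le> k - 2" and kl: "real k + 1 \<le> 2 * (real l + 1)"
    and F: "F > 0" "(fact j * fact (k - j) :: real) = F * fact l"
  shows "real (k choose j) * wt \<rho> k \<le> 8 * (\<rho> ^ e / F) * wt \<rho> l"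
proof -
  have "real (k choose j) * wt \<rho> k = \<rho> ^ (k - 2) * ((real k + 1) ^ 3 / (fact j * fact (k - j)))"
    using j by (simp add: wt_def binomial_fact)
  also have "\<dots> = \<rho> ^ (k - 2) * ((real k + 1) ^ 3 / (F * fact l))" by (simp add: F(2))
  also have "\<dots> \<le> (\<rho> ^ e * \<rho> ^ (l - 2)) * ((2 * (real l + 1)) ^ 3 / (F * fact l))"
    using \<rho> F kl by (intro mult_mono power_split_le e divide_right_mono power_mono) auto
  also have "\<dots> = 8 * (\<rho> ^ e / F) * wt \<rho> l"
    unfolding power_mult_distrib by (simp add: wt_def)
  finally show ?thesis .
qed

text \<open>For \<open>j\<close> derivatives on the coefficient and \<open>k + 1 - j\<close> on
  \<open>f\<close>, the remaining one coming from \<open>f_x\<close>. Passing from the factorial of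
  \<open>k - j\<close> to that of \<open>k + 1 - j\<close> produces the factor
  \<open>k + 1 - j\<close>: the lost derivative.\<close>

lemma wt_shift1:
  assumes \<rho>: "0 < \<rho>" "\<rho> \<le> 1" and j: "1 \<le> j" "2 * j \<le> k + 1"
  shows "real (k choose j) * wt \<rho> k \<le> 8 * (\<rho> ^ (j - 1) / fact j) * real (k + 1 - j) * wt \<rho> (k + 1 - j)"
proof -
  define l where "l = k - j"
  have k: "k = l + j" "k + 1 - j = Suc l" using j by (auto simp: l_def)
  have "real (k choose j) * wt \<rho> k \<le> 8 * (\<rho> ^ (j - 1) / (fact j / real (Suc l))) * wt \<rho> (Suc l)"
    by (rule wt_choose_le[OF \<rho>]) (use j in \<open>auto simp: k\<close>)
  then show ?thesis unfolding k(2) by (simp add: field_simps)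
qed

text \<open>The mirror case, with \<open>i\<close> the small order on \<open>f\<close>. It starts at
  one because \<open>f\<close> enters through its derivative.\<close>

lemma wt_shift2:
  assumes \<rho>: "0 < \<rho>" "\<rho> \<le> 1" and i: "1 \<le> i" "2 * i < k + 1"
  shows "real (k choose (k + 1 - i)) * wt \<rho> k \<le> 8 * (\<rho> ^ (i - 1) / fact i) * real i * wt \<rho> (k + 1 - i)"
proof -
  obtain m where m: "i = Suc m" using i by (cases i) auto
  define j where "j = k + 1 - i"
  have k: "k = j + m" using i m by (auto simp: j_def)
  have "real (k choose j) * wt \<rho> k \<le> 8 * (\<rho> ^ (i - 1) / fact m) * wt \<rho> j"
    by (rule wt_choose_le[OF \<rho>]) (use i in \<open>auto simp: k m\<close>)
  moreover have "8 * (\<rho> ^ (i - 1) / fact i) * real i * wt \<rho> j = 8 * (\<rho> ^ (i - 1) / fact m) * wt \<rho> j"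
    by (simp add: m divide_simps del: of_nat_Suc)
  ultimately show ?thesis by (simp add: j_def)
qed

lemma wt_shift3:
  assumes \<rho>: "0 < \<rho>" "\<rho> \<le> 1" and i: "2 * i \<le> j"
  shows "real (j choose i) * wt \<rho> j \<le> 8 * (\<rho> ^ (i - 1) / fact i) * wt \<rho> (j - i)"
  by (rule wt_choose_le[OF \<rho>]) (use i in auto)

lemma shift_sum:
  fixes x :: "nat \<Rightarrow> real"
  assumes A: "A \<subseteq> {..K}" and inj: "inj_on \<phi> A" and im: "\<And>k. k \<in> A \<Longrightarrow> \<phi> k \<le> K"
  shows "(\<Sum>k\<in>A. x (\<phi> k) * x k) \<le> (\<Sum>k\<le>K. (x k)\<^sup>2)"
proof -
  have fin: "finite A" using A finite_subset by blast
  have "(\<Sum>k\<in>A. x (\<phi> k) * x k) \<le> (\<Sum>k\<in>A. 1/2 * (x (\<phi> k))\<^sup>2 + 1/2 * (x k)\<^sup>2)"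
  proof (rule sum_mono)
    fix k
    show "x (\<phi> k) * x k \<le> 1/2 * (x (\<phi> k))\<^sup>2 + 1/2 * (x k)\<^sup>2"
      using zero_le_power2[of "x (\<phi> k) - x k"] by (simp add: power2_diff)
  qed
  also have "\<dots> = 1/2 * (\<Sum>k\<in>\<phi> ` A. (x k)\<^sup>2) + 1/2 * (\<Sum>k\<in>A. (x k)\<^sup>2)"
    by (simp add: sum.distrib sum_distrib_left sum.reindex[OF inj])
  also have "\<dots> \<le> 1/2 * (\<Sum>k\<le>K. (x k)\<^sup>2) + 1/2 * (\<Sum>k\<le>K. (x k)\<^sup>2)"
    using A im by (intro add_mono mult_left_mono sum_mono2) auto
  finally show ?thesis by simp
qed

text \<open>Splits the lost derivative into half a derivative on each of the two factors.\<close>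

lemma le_sqrt_mult: "real l \<le> sqrt (real m + 1) * sqrt (real k + 1)" if "l \<le> m" "l \<le> k"
proof -
  have "real l * real l \<le> (real m + 1) * (real k + 1)" using that by (intro mult_mono) auto
  then show ?thesis by (simp add: real_sqrt_mult[symmetric] real_le_rsqrt power2_eq_square)
qed

text \<open>The weighted norm with half a derivative more than in the energy. Its squares are what
  the shrinking radius controls from order three on.\<close>

definition xw :: "real \<Rightarrow> (nat \<Rightarrow> real) \<Rightarrow> nat \<Rightarrow> real" where
  "xw \<rho> D k = sqrt (real k + 1) * (wt \<rho> k * D k)"

text \<open>The coefficient with which a sup norm of low order enters. The truncated exponent leaves
  orders zero and one without a power of \<open>\<rho>\<close>.\<close>

definition hw :: "real \<Rightarrow> (nat \<Rightarrow> real) \<Rightarrow> nat \<Rightarrow> real" where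
  "hw \<rho> s i = \<rho> ^ (i - 1) / fact i * s i"

text \<open>\<open>T k j\<close> stands for the norm of \<open>j\<close> derivatives of a
  coefficient times \<open>k + 1 - j\<close> derivatives of \<open>f\<close>. The sup norm goes to
  the factor of lower order: to the coefficient (\<open>sg\<close>) while
  \<open>2 * j \<le> k + 1\<close>, otherwise to \<open>f\<close> (\<open>s\<close>), with index
  \<open>i = k + 1 - j\<close>. \<open>Q\<close> leaves open how the majorants \<open>Dg\<close> of
  the coefficient compare with those of \<open>f\<close>.\<close>

lemma quad_sum:
  assumes \<rho>: "0 < \<rho>" "\<rho> \<le> 1" and K: "K \<ge> 3"
    and nn: "\<And>k. D k \<ge> 0" "\<And>k. s k \<ge> 0" "\<And>k. sg k \<ge> 0" "\<And>k. Dg k \<ge> 0"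
    and T1: "\<And>k j. 1 \<le> j \<Longrightarrow> j \<le> k \<Longrightarrow> T k j \<le> sg j * D (k + 1 - j)"
    and T2: "\<And>k j. 1 \<le> j \<Longrightarrow> j \<le> k \<Longrightarrow> T k j \<le> Dg j * s (k + 1 - j)"
    and Q: "\<And>i. 1 \<le> i \<Longrightarrow> (\<Sum>k | k \<le> K \<and> 2 * i < k + 1. xw \<rho> Dg (k + 1 - i) * xw \<rho> D k) \<le> Q * (\<Sum>k\<le>K. (xw \<rho> D k)\<^sup>2)"
  shows "(\<Sum>k\<le>K. \<Sum>j=1..k. real (k choose j) * wt \<rho> k * T k j * (wt \<rho> k * D k))
    \<le> 8 * ((\<Sum>j=1..K-1. hw \<rho> sg j) + (\<Sum>j=1..K-1. hw \<rho> s j) * Q) * (\<Sum>k\<le>K. (xw \<rho> D k)\<^sup>2)"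
proof -
  let ?x = "xw \<rho> D" and ?y = "xw \<rho> Dg"
  have w: "wt \<rho> k \<ge> 0" for k using wt_pos[OF \<rho>(1), of k] by simp
  have h: "hw \<rho> sg j \<ge> 0" "hw \<rho> s j \<ge> 0" for j using \<rho> nn by (auto simp: hw_def)
  have t1: "real (k choose j) * wt \<rho> k * T k j * (wt \<rho> k * D k) \<le> 8 * (hw \<rho> sg j * (?x (k + 1 - j) * ?x k))"
    if j: "1 \<le> j" "2 * j \<le> k + 1" for k j
  proof -
    have "real (k choose j) * wt \<rho> k * T k j * (wt \<rho> k * D k)
      \<le> (8 * (\<rho> ^ (j - 1) / fact j) * real (k + 1 - j) * wt \<rho> (k + 1 - j)) * (sg j * D (k + 1 - j)) * (wt \<rho> k * D k)"
    proof (rule mult_right_mono)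
      have "real (k choose j) * wt \<rho> k * T k j \<le> real (k choose j) * wt \<rho> k * (sg j * D (k + 1 - j))"
        using j w by (intro mult_left_mono T1) auto
      also have "\<dots> \<le> (8 * (\<rho> ^ (j - 1) / fact j) * real (k + 1 - j) * wt \<rho> (k + 1 - j)) * (sg j * D (k + 1 - j))"
        using nn by (intro mult_right_mono wt_shift1[OF \<rho> j] mult_nonneg_nonneg) auto
      finally show "real (k choose j) * wt \<rho> k * T k j \<le> \<dots>" .
    qed (use w nn in simp)
    also have "\<dots> = 8 * (hw \<rho> sg j * (real (k + 1 - j) * ((wt \<rho> (k + 1 - j) * D (k + 1 - j)) * (wt \<rho> k * D k))))"
      by (simp add: hw_def)
    also have "\<dots> \<le> 8 * (hw \<rho> sg j * ((sqrt (real (k + 1 - j) + 1) * sqrt (real k + 1)) * ((wt \<rho> (k + 1 - j) * D (k + 1 - j)) * (wt \<rho> k * D k))))"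
      using j w nn h by (intro mult_left_mono mult_right_mono le_sqrt_mult mult_nonneg_nonneg) auto
    also have "\<dots> = 8 * (hw \<rho> sg j * (?x (k + 1 - j) * ?x k))" by (simp add: xw_def)
    finally show ?thesis .
  qed
  have t2: "real (k choose (k + 1 - i)) * wt \<rho> k * T k (k + 1 - i) * (wt \<rho> k * D k) \<le> 8 * (hw \<rho> s i * (?y (k + 1 - i) * ?x k))"
    if i: "1 \<le> i" "2 * i < k + 1" for k i
  proof -
    have "real (k choose (k + 1 - i)) * wt \<rho> k * T k (k + 1 - i) * (wt \<rho> k * D k)
      \<le> (8 * (\<rho> ^ (i - 1) / fact i) * real i * wt \<rho> (k + 1 - i)) * (Dg (k + 1 - i) * s i) * (wt \<rho> k * D k)"
    proof (rule mult_right_mono)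
      have "T k (k + 1 - i) \<le> Dg (k + 1 - i) * s i" using T2[of "k + 1 - i" k] i by simp
      then have "real (k choose (k + 1 - i)) * wt \<rho> k * T k (k + 1 - i) \<le> real (k choose (k + 1 - i)) * wt \<rho> k * (Dg (k + 1 - i) * s i)"
        using w by (intro mult_left_mono) auto
      also have "\<dots> \<le> (8 * (\<rho> ^ (i - 1) / fact i) * real i * wt \<rho> (k + 1 - i)) * (Dg (k + 1 - i) * s i)"
        using nn by (intro mult_right_mono wt_shift2[OF \<rho> i] mult_nonneg_nonneg) auto
      finally show "real (k choose (k + 1 - i)) * wt \<rho> k * T k (k + 1 - i) \<le> \<dots>" .
    qed (use w nn in simp)
    also have "\<dots> = 8 * (hw \<rho> s i * (real i * ((wt \<rho> (k + 1 - i) * Dg (k + 1 - i)) * (wt \<rho> k * D k))))"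
      by (simp add: hw_def)
    also have "\<dots> \<le> 8 * (hw \<rho> s i * ((sqrt (real (k + 1 - i) + 1) * sqrt (real k + 1)) * ((wt \<rho> (k + 1 - i) * Dg (k + 1 - i)) * (wt \<rho> k * D k))))"
      using i w nn h by (intro mult_left_mono mult_right_mono le_sqrt_mult mult_nonneg_nonneg) auto
    also have "\<dots> = 8 * (hw \<rho> s i * (?y (k + 1 - i) * ?x k))" by (simp add: xw_def)
    finally show ?thesis .
  qed
  let ?F = "\<lambda>k j. real (k choose j) * wt \<rho> k * T k j * (wt \<rho> k * D k)"
  have split: "(\<Sum>j=1..k. ?F k j) \<le> (\<Sum>j=1..K-1. if 2 * j \<le> k + 1 then 8 * (hw \<rho> sg j * (?x (k + 1 - j) * ?x k)) else 0)
     + (\<Sum>i=1..K-1. if 2 * i < k + 1 then 8 * (hw \<rho> s i * (?y (k + 1 - i) * ?x k)) else 0)" if k: "k \<le> K" for k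
  proof -
    have "(\<Sum>j=1..k. ?F k j) = (\<Sum>j\<in>{j\<in>{1..k}. 2 * j \<le> k + 1}. ?F k j) + (\<Sum>j\<in>{j\<in>{1..k}. \<not> 2 * j \<le> k + 1}. ?F k j)"
      by (subst sum.union_disjoint[symmetric]) (auto intro!: sum.cong)
    also have "(\<Sum>j\<in>{j\<in>{1..k}. \<not> 2 * j \<le> k + 1}. ?F k j) = (\<Sum>i\<in>{i\<in>{1..k}. 2 * i < k + 1}. ?F k (k + 1 - i))"
      by (rule sum.reindex_bij_witness[of _ "\<lambda>i. k + 1 - i" "\<lambda>i. k + 1 - i"]) auto
    \<comment> \<open>\<open>2 * j \<le> K + 1\<close> forces \<open>j \<le> K - 1\<close> because
      \<open>K \<ge> 3\<close>, so the sup norms involved need derivatives up to order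
      \<open>K\<close> only.\<close>
    also have "{j\<in>{1..k}. 2 * j \<le> k + 1} = {j\<in>{1..K-1}. 2 * j \<le> k + 1}" using k K by auto
    also have "{j\<in>{1..k}. 2 * j < k + 1} = {j\<in>{1..K-1}. 2 * j < k + 1}" using k K by auto
    also have "(\<Sum>j\<in>{j\<in>{1..K-1}. 2 * j \<le> k + 1}. ?F k j) + (\<Sum>i\<in>{i\<in>{1..K-1}. 2 * i < k + 1}. ?F k (k + 1 - i))
      \<le> (\<Sum>j\<in>{j\<in>{1..K-1}. 2 * j \<le> k + 1}. 8 * (hw \<rho> sg j * (?x (k + 1 - j) * ?x k)))
       + (\<Sum>i\<in>{i\<in>{1..K-1}. 2 * i < k + 1}. 8 * (hw \<rho> s i * (?y (k + 1 - i) * ?x k)))"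
      by (intro add_mono sum_mono) (use t1 t2 in auto)
    also have "\<dots> = (\<Sum>j=1..K-1. if 2 * j \<le> k + 1 then 8 * (hw \<rho> sg j * (?x (k + 1 - j) * ?x k)) else 0)
     + (\<Sum>i=1..K-1. if 2 * i < k + 1 then 8 * (hw \<rho> s i * (?y (k + 1 - i) * ?x k)) else 0)"
      by (simp only: sum.inter_filter finite_atLeastAtMost)
    finally show ?thesis .
  qed
  let ?Z = "\<Sum>k\<le>K. (?x k)\<^sup>2"
  have "(\<Sum>k\<le>K. \<Sum>j=1..k. ?F k j) \<le> (\<Sum>k\<le>K. (\<Sum>j=1..K-1. if 2 * j \<le> k + 1 then 8 * (hw \<rho> sg j * (?x (k + 1 - j) * ?x k)) else 0)
     + (\<Sum>i=1..K-1. if 2 * i < k + 1 then 8 * (hw \<rho> s i * (?y (k + 1 - i) * ?x k)) else 0))"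
    by (intro sum_mono split) simp
  also have "\<dots> = (\<Sum>j=1..K-1. \<Sum>k\<le>K. if 2 * j \<le> k + 1 then 8 * (hw \<rho> sg j * (?x (k + 1 - j) * ?x k)) else 0)
    + (\<Sum>i=1..K-1. \<Sum>k\<le>K. if 2 * i < k + 1 then 8 * (hw \<rho> s i * (?y (k + 1 - i) * ?x k)) else 0)"
    unfolding sum.distrib by (intro arg_cong2[where f="(+)"] sum.swap)
  also have "\<dots> = (\<Sum>j=1..K-1. 8 * hw \<rho> sg j * (\<Sum>k\<in>{k\<in>{..K}. 2 * j \<le> k + 1}. ?x (k + 1 - j) * ?x k))
    + (\<Sum>i=1..K-1. 8 * hw \<rho> s i * (\<Sum>k\<in>{k\<in>{..K}. 2 * i < k + 1}. ?y (k + 1 - i) * ?x k))"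
    by (simp only: sum.inter_filter[symmetric] finite_atMost sum_distrib_left mult.assoc)
  also have "\<dots> \<le> (\<Sum>j=1..K-1. 8 * hw \<rho> sg j * ?Z) + (\<Sum>i=1..K-1. 8 * hw \<rho> s i * (Q * ?Z))"
  proof (intro add_mono sum_mono mult_left_mono)
    fix j assume "j \<in> {1..K-1}"
    then show "(\<Sum>k\<in>{k\<in>{..K}. 2 * j \<le> k + 1}. ?x (k + 1 - j) * ?x k) \<le> ?Z"
      by (intro shift_sum) (auto simp: inj_on_def)
  next
    fix i assume "i \<in> {1..K-1}"
    then show "(\<Sum>k\<in>{k\<in>{..K}. 2 * i < k + 1}. ?y (k + 1 - i) * ?x k) \<le> Q * ?Z"
      using Q[of i] by simp
  qed (use h in auto)
  also have "\<dots> = 8 * ((\<Sum>j=1..K-1. hw \<rho> sg j) + (\<Sum>j=1..K-1. hw \<rho> s j) * Q) * ?Z"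
    by (simp add: sum_distrib_left sum_distrib_right algebra_simps)
  finally show ?thesis .
qed

text \<open>Majorant for the sup norm of the \<open>j\<close>-th derivative of a square.\<close>

definition sqs :: "(nat \<Rightarrow> real) \<Rightarrow> nat \<Rightarrow> real" where
  "sqs s j = (\<Sum>i\<le>j. real (j choose i) * s i * s (j - i))"

text \<open>Majorant for the \<open>L2\<close> norm of the \<open>j\<close>-th derivative of a
  square. The sup norm always sits on the factor of lower order; the reflection of the index
  accounts for the factor 2.\<close>

definition sqD :: "(nat \<Rightarrow> real) \<Rightarrow> (nat \<Rightarrow> real) \<Rightarrow> nat \<Rightarrow> real" where
  "sqD s D j = 2 * (\<Sum>i | 2 * i \<le> j. real (j choose i) * s i * D (j - i))"

text \<open>A discrete convolution. Since \<open>i + l \<ge> 1\<close>, one of the two orders is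
  positive, so the index set is covered by two rectangles; the order-zero value \<open>s 0\<close>
  enters at most linearly.\<close>

lemma sqs_hw:
  assumes \<rho>: "0 < \<rho>" "\<rho> \<le> 1" and s: "\<And>k. s k \<ge> 0" and K: "K \<ge> 1"
  shows "(\<Sum>j=1..K-1. hw \<rho> (sqs s) j) \<le> 2 * (\<Sum>j=1..K-1. hw \<rho> s j) * (s 0 + (\<Sum>j=1..K-1. hw \<rho> s j))"
proof -
  let ?h = "hw \<rho> s"
  have h: "?h j \<ge> 0" for j using \<rho> s by (auto simp: hw_def)
  have trm: "hw \<rho> (sqs s) j \<le> (\<Sum>i\<le>j. ?h i * ?h (j - i))" for j
  proof -
    have "\<rho> ^ (j - 1) / fact j * (real (j choose i) * s i * s (j - i)) \<le> ?h i * ?h (j - i)" if i: "i \<le> j" for i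
    proof -
      have "\<rho> ^ (j - 1) / fact j * (real (j choose i) * s i * s (j - i)) = \<rho> ^ (j - 1) * (s i / fact i * (s (j - i) / fact (j - i)))"
        using i by (simp add: binomial_fact)
      also have "\<dots> \<le> (\<rho> ^ (i - 1) * \<rho> ^ (j - i - 1)) * (s i / fact i * (s (j - i) / fact (j - i)))"
        using \<rho> s i by (intro mult_right_mono power_split_le mult_nonneg_nonneg divide_nonneg_nonneg) auto
      finally show ?thesis by (simp add: hw_def mult_ac)
    qed
    then show ?thesis unfolding hw_def[of \<rho> "sqs s"] sqs_def sum_distrib_left by (intro sum_mono) auto
  qed
  have "(\<Sum>j=1..K-1. hw \<rho> (sqs s) j) \<le> (\<Sum>j=1..K-1. \<Sum>i\<le>j. ?h i * ?h (j - i))" by (intro sum_mono trm)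
  also have "\<dots> = (\<Sum>(j, i)\<in>Sigma {1..K-1} (\<lambda>j. {..j}). ?h i * ?h (j - i))" by (rule sum.Sigma) auto
  also have "\<dots> = (\<Sum>(i, l)\<in>{(i, l). 1 \<le> i + l \<and> i + l \<le> K - 1}. ?h i * ?h l)"
    by (rule sum.reindex_bij_witness[of _ "\<lambda>(i, l). (i + l, i)" "\<lambda>(j, i). (i, j - i)"]) auto
  also have "\<dots> \<le> (\<Sum>(i, l)\<in>({1..K-1} \<times> {..K-1}) \<union> ({..K-1} \<times> {1..K-1}). ?h i * ?h l)"
    by (rule sum_mono2) (auto simp: h)
  also have "\<dots> \<le> (\<Sum>(i, l)\<in>{1..K-1} \<times> {..K-1}. ?h i * ?h l) + (\<Sum>(i, l)\<in>{..K-1} \<times> {1..K-1}. ?h i * ?h l)"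
    by (subst sum_Un) (auto intro!: sum_nonneg simp: h)
  also have "\<dots> = 2 * (\<Sum>j=1..K-1. ?h j) * (\<Sum>j\<le>K-1. ?h j)"
    by (simp add: sum.cartesian_product[symmetric] sum_product[symmetric] mult.commute)
  also have "(\<Sum>j\<le>K-1. ?h j) = s 0 + (\<Sum>j=1..K-1. ?h j)"
    unfolding atMost_atLeast0 by (subst sum.atLeast_Suc_atMost) (auto simp: hw_def)
  finally show ?thesis .
qed

text \<open>The constant 32 is 2 from the ratio of the square roots, 8 from \<open>wt_shift3\<close>
  and 2 from \<open>sqD\<close>.\<close>

lemma sqD_bound:
  assumes \<rho>: "0 < \<rho>" "\<rho> \<le> 1" and nn: "\<And>k. s k \<ge> 0" "\<And>k. D k \<ge> 0"
  shows "xw \<rho> (sqD s D) j \<le> 32 * (\<Sum>i | 2 * i \<le> j. hw \<rho> s i * xw \<rho> D (j - i))"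
proof -
  have w: "wt \<rho> k \<ge> 0" for k using wt_pos[OF \<rho>(1), of k] by simp
  have "sqrt (real j + 1) * wt \<rho> j * (2 * (real (j choose i) * s i * D (j - i))) \<le> 32 * (hw \<rho> s i * xw \<rho> D (j - i))"
    if i: "2 * i \<le> j" for i
  proof -
    have "sqrt (real j + 1) \<le> sqrt (4 * (real (j - i) + 1))" using i by (intro real_sqrt_le_mono) auto
    then have sq: "sqrt (real j + 1) \<le> 2 * sqrt (real (j - i) + 1)" by (simp only: real_sqrt_mult real_sqrt_four)
    have "sqrt (real j + 1) * wt \<rho> j * (2 * (real (j choose i) * s i * D (j - i)))
      = sqrt (real j + 1) * ((real (j choose i) * wt \<rho> j) * (2 * (s i * D (j - i))))" by simp
    also have "\<dots> \<le> (2 * sqrt (real (j - i) + 1)) * ((8 * (\<rho> ^ (i - 1) / fact i) * wt \<rho> (j - i)) * (2 * (s i * D (j - i))))"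
      using nn w \<rho> by (intro mult_mono sq mult_right_mono wt_shift3 i mult_nonneg_nonneg) auto
    also have "\<dots> = 32 * (hw \<rho> s i * xw \<rho> D (j - i))" by (simp add: hw_def xw_def)
    finally show ?thesis .
  qed
  then have "(\<Sum>i | 2 * i \<le> j. sqrt (real j + 1) * wt \<rho> j * (2 * (real (j choose i) * s i * D (j - i))))
     \<le> (\<Sum>i | 2 * i \<le> j. 32 * (hw \<rho> s i * xw \<rho> D (j - i)))" by (intro sum_mono) auto
  then show ?thesis by (simp add: xw_def[of \<rho> "sqD s D"] sqD_def sum_distrib_left mult.assoc)
qed

text \<open>Provides the constant \<open>Q\<close> of \<open>quad_sum\<close> for squares: inserting
  \<open>sqD_bound\<close> gives the shifts from \<open>k\<close> to \<open>k + 1 - i - l\<close>,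
  each injective and hence covered by \<open>shift_sum\<close>.\<close>

lemma sqD_Q:
  assumes \<rho>: "0 < \<rho>" "\<rho> \<le> 1" and nn: "\<And>k. s k \<ge> 0" "\<And>k. D k \<ge> 0" and K: "K \<ge> 3" and i: "1 \<le> i"
  shows "(\<Sum>k | k \<le> K \<and> 2 * i < k + 1. xw \<rho> (sqD s D) (k + 1 - i) * xw \<rho> D k)
    \<le> 32 * (s 0 + (\<Sum>j=1..K-1. hw \<rho> s j)) * (\<Sum>k\<le>K. (xw \<rho> D k)\<^sup>2)"
proof -
  let ?x = "xw \<rho> D" and ?h = "hw \<rho> s"
  have w: "wt \<rho> k \<ge> 0" for k using wt_pos[OF \<rho>(1), of k] by simp
  have x: "?x k \<ge> 0" for k using w nn by (simp add: xw_def)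
  have h: "?h j \<ge> 0" for j using \<rho> nn by (auto simp: hw_def)
  let ?A = "{k\<in>{..K}. 2 * i < k + 1}"
  have "xw \<rho> (sqD s D) (k + 1 - i) * ?x k \<le> (\<Sum>l\<le>K-1. if 2 * l \<le> k + 1 - i then 32 * ?h l * (?x (k + 1 - i - l) * ?x k) else 0)"
    if k: "k \<in> ?A" for k
  proof -
    have "xw \<rho> (sqD s D) (k + 1 - i) * ?x k \<le> (32 * (\<Sum>l | 2 * l \<le> k + 1 - i. ?h l * ?x (k + 1 - i - l))) * ?x k"
      by (intro mult_right_mono sqD_bound[OF \<rho> nn] x)
    also have "{l. 2 * l \<le> k + 1 - i} = {l\<in>{..K-1}. 2 * l \<le> k + 1 - i}" using k K i by auto
    also have "(32 * (\<Sum>l\<in>{l\<in>{..K-1}. 2 * l \<le> k + 1 - i}. ?h l * ?x (k + 1 - i - l))) * ?x k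
      = (\<Sum>l\<in>{l\<in>{..K-1}. 2 * l \<le> k + 1 - i}. 32 * ?h l * (?x (k + 1 - i - l) * ?x k))"
      by (simp only: sum_distrib_left sum_distrib_right mult.assoc)
    finally show ?thesis by (simp only: sum.inter_filter finite_atMost)
  qed
  then have "(\<Sum>k\<in>?A. xw \<rho> (sqD s D) (k + 1 - i) * ?x k)
     \<le> (\<Sum>k\<in>?A. \<Sum>l\<le>K-1. if 2 * l \<le> k + 1 - i then 32 * ?h l * (?x (k + 1 - i - l) * ?x k) else 0)" by (rule sum_mono)
  also have "\<dots> = (\<Sum>l\<le>K-1. 32 * ?h l * (\<Sum>k\<in>{k\<in>?A. 2 * l \<le> k + 1 - i}. ?x (k + 1 - i - l) * ?x k))"
  proof -
    have "finite ?A" by simp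
    then show ?thesis
      by (subst sum.swap) (simp only: sum.inter_filter[symmetric] sum_distrib_left mult.assoc)
  qed
  also have "\<dots> \<le> (\<Sum>l\<le>K-1. 32 * ?h l * (\<Sum>k\<le>K. (?x k)\<^sup>2))"
  proof (intro sum_mono mult_left_mono)
    fix l
    show "(\<Sum>k\<in>{k\<in>?A. 2 * l \<le> k + 1 - i}. ?x (k + 1 - i - l) * ?x k) \<le> (\<Sum>k\<le>K. (?x k)\<^sup>2)"
      using i by (intro shift_sum) (auto simp: inj_on_def)
  qed (use h in auto)
  also have "\<dots> = 32 * (\<Sum>l\<le>K-1. ?h l) * (\<Sum>k\<le>K. (?x k)\<^sup>2)"
    by (simp only: sum_distrib_right[symmetric] sum_distrib_left[symmetric])
  also have "(\<Sum>l\<le>K-1. ?h l) = s 0 + (\<Sum>j=1..K-1. ?h j)"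
    unfolding atMost_atLeast0 by (subst sum.atLeast_Suc_atMost) (auto simp: hw_def)
  finally show ?thesis by simp
qed

text \<open>\<open>s\<close> is Agmon's majorant of the sup norms. The term \<open>j = 1\<close>
  involves norms of order at most two only and is kept apart. For \<open>j \<ge> 2\<close> the two
  weights hold \<open>2 * j - 3\<close> powers of \<open>\<rho>\<close> against
  \<open>2 * j - 2\<close> in the square of \<open>hw\<close>: one spare power. The cubes in
  \<open>wt\<close> leave the summable factor \<open>1 / (j + 1)^2\<close>.\<close>

lemma hw_tail:
  fixes D :: "nat \<Rightarrow> real"
  assumes \<rho>: "0 < \<rho>" "\<rho> \<le> 1" and D: "\<And>k. D k \<ge> 0" and K: "K \<ge> 3"
  defines "s \<equiv> \<lambda>k. sqrt (2 * D k * D (Suc k))" and "Y \<equiv> \<Sum>k\<le>K. (wt \<rho> k * D k)\<^sup>2"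
  shows "(\<Sum>j=1..K-1. hw \<rho> s j) \<le> s 1 + sqrt (\<rho> * Y)"
proof -
  have Y: "Y \<ge> 0" unfolding Y_def by (intro sum_nonneg) simp
  have one: "hw \<rho> s j \<le> sqrt (2 * \<rho> * Y) / (real j + 1)\<^sup>2" if j: "2 \<le> j" "j \<le> K - 1" for j
  proof -
    obtain i where i: "j = Suc (Suc i)" using j by (metis Suc_le_D numeral_2_eq_2 Suc_le_mono)
    define p where "p = real j + 1"
    have p: "p > 0" "p \<ge> 1" by (simp_all add: p_def)
    define b where "b k = wt \<rho> k * D k" for k
    have b0: "b k \<ge> 0" for k using wt_pos[OF \<rho>(1), of k] D by (simp add: b_def)
    have bY: "b k * b l \<le> Y" if "k \<le> K" "l \<le> K" for k l
    proof -
      have "(b k)\<^sup>2 \<le> Y" "(b l)\<^sup>2 \<le> Y" unfolding Y_def b_def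
        using that by (auto intro!: member_le_sum[of _ "{..K}" "\<lambda>k. (wt \<rho> k * D k)\<^sup>2"])
      moreover have "2 * (b k * b l) \<le> (b k)\<^sup>2 + (b l)\<^sup>2"
        using zero_le_power2[of "b k - b l"] by (simp add: power2_diff)
      ultimately show ?thesis by linarith
    qed
    have wj: "wt \<rho> j = \<rho> ^ i * (p ^ 3 / fact j)" and wSj: "wt \<rho> (Suc j) = \<rho> ^ Suc i * ((p + 1) ^ 3 / (p * fact j))"
      by (simp_all add: wt_def i p_def add_ac)
    have Dj: "D j = b j * fact j / (\<rho> ^ i * p ^ 3)" "D (Suc j) = b (Suc j) * (p * fact j) / (\<rho> ^ Suc i * (p + 1) ^ 3)"
      unfolding b_def wj wSj using \<rho> p by (simp_all add: field_simps)
    have "hw \<rho> s j = \<rho> ^ Suc i / fact j * sqrt (2 * D j * D (Suc j))" by (simp only: hw_def s_def i diff_Suc_1)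
    then have "(hw \<rho> s j)\<^sup>2 = (\<rho> ^ Suc i / fact j)\<^sup>2 * (2 * D j * D (Suc j))"
      using D by (simp only: power_mult_distrib real_sqrt_pow2 mult_nonneg_nonneg zero_le_numeral)
    also have "\<dots> = 2 * \<rho> * (b j * b (Suc j)) * (1 / (p\<^sup>2 * (p + 1) ^ 3))"
    proof -
      define q R F where "q = \<rho> ^ i" and "R = (p + 1) ^ 3" and "F = (fact j :: real)"
      have "q \<noteq> 0" "R \<noteq> 0" "F \<noteq> 0" "p \<noteq> 0" "\<rho> \<noteq> 0" using \<rho> p by (auto simp: q_def R_def F_def)
      then show ?thesis
        unfolding Dj power_Suc q_def[symmetric] R_def[symmetric] F_def[symmetric]
        by (simp add: field_simps power2_eq_square power3_eq_cube)
    qed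
    also have "\<dots> \<le> 2 * \<rho> * Y * (1 / (p\<^sup>2 * p\<^sup>2))"
    proof (intro mult_mono divide_left_mono)
      have "p\<^sup>2 \<le> (p + 1) ^ 2 * 1" using p by (simp add: power_mono)
      also have "\<dots> \<le> (p + 1) ^ 2 * (p + 1)" using p by (intro mult_left_mono) auto
      also have "\<dots> = (p + 1) ^ 3" by (simp add: power2_eq_square power3_eq_cube)
      finally show "p\<^sup>2 \<le> (p + 1) ^ 3" .
    qed (use bY j K \<rho> p Y b0 in auto)
    also have "\<dots> = (sqrt (2 * \<rho> * Y) / p\<^sup>2)\<^sup>2" using \<rho> Y by (simp add: power_divide power2_eq_square)
    finally have "(hw \<rho> s j)\<^sup>2 \<le> (sqrt (2 * \<rho> * Y) / p\<^sup>2)\<^sup>2" .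
    then show ?thesis unfolding p_def[symmetric] by (rule power2_le_imp_le) (use \<rho> Y in auto)
  qed
  \<comment> \<open>The telescoping bound \<open>1/2\<close> is enough to absorb the
    \<open>sqrt 2\<close> of Agmon's inequality.\<close>
  have tele: "(\<Sum>j=2..M. 1 / (real j + 1)\<^sup>2) \<le> 1/2 - 1 / (real M + 1)" if "M \<ge> 1" for M
    using that
  proof (induction M rule: dec_induct)
    case (step M)
    have "(\<Sum>j=2..Suc M. 1 / (real j + 1)\<^sup>2) = (\<Sum>j=2..M. 1 / (real j + 1)\<^sup>2) + 1 / (real (Suc M) + 1)\<^sup>2"
      using step by simp
    moreover have "1 / (real (Suc M) + 1)\<^sup>2 \<le> 1 / (real M + 1) - 1 / (real (Suc M) + 1)"
    proof -
      have "1 / (real M + 1) - 1 / (real (Suc M) + 1) = 1 / ((real M + 1) * (real M + 2))"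
        by (simp add: field_simps)
      moreover have "1 / (real (Suc M) + 1)\<^sup>2 \<le> 1 / ((real M + 1) * (real M + 2))"
        by (intro divide_left_mono) (auto simp: power2_eq_square algebra_simps add_pos_nonneg)
      ultimately show ?thesis by simp
    qed
    ultimately show ?case using step by linarith
  qed simp
  have "(\<Sum>j=1..K-1. hw \<rho> s j) = hw \<rho> s 1 + (\<Sum>j=2..K-1. hw \<rho> s j)"
    using K by (subst sum.atLeast_Suc_atMost) (auto simp: numeral_2_eq_2)
  also have "(\<Sum>j=2..K-1. hw \<rho> s j) \<le> (\<Sum>j=2..K-1. sqrt (2 * \<rho> * Y) * (1 / (real j + 1)\<^sup>2))"
    using one by (intro sum_mono) auto
  also have "\<dots> = sqrt (2 * \<rho> * Y) * (\<Sum>j=2..K-1. 1 / (real j + 1)\<^sup>2)" by (simp add: sum_distrib_left)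
  also have "\<dots> \<le> sqrt (2 * \<rho> * Y) * (1/2)"
  proof (rule mult_left_mono)
    have "(\<Sum>j=2..K-1. 1 / (real j + 1)\<^sup>2) \<le> 1/2 - 1 / (real (K - 1) + 1)" using K by (intro tele) auto
    also have "\<dots> \<le> 1/2" by simp
    finally show "(\<Sum>j=2..K-1. 1 / (real j + 1)\<^sup>2) \<le> 1/2" .
  qed (use \<rho> Y in simp)
  also have "\<dots> \<le> sqrt (\<rho> * Y)"
  proof -
    have "sqrt (2 * \<rho> * Y) \<le> sqrt (4 * (\<rho> * Y))" using \<rho> Y by (intro real_sqrt_le_mono) auto
    also have "\<dots> = 2 * sqrt (\<rho> * Y)" by (simp only: real_sqrt_mult real_sqrt_four)
    finally show ?thesis by simp
  qed
  finally show ?thesis by (simp add: hw_def)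
qed

section \<open>Weighted estimates of the damping and of the flux\<close>

context kawahara
begin

definition Asum :: real where "Asum = (\<Sum>k. \<sigma>0 ^ k / fact k * Ak k)"

lemma Asum_ge: "finite F \<Longrightarrow> (\<Sum>k\<in>F. \<sigma>0 ^ k / fact k * Ak k) \<le> Asum"
  unfolding Asum_def using sigma0 Ak_nonneg by (intro sum_le_suminf Ak_summable) auto

lemma Asum_nonneg: "Asum \<ge> 0"
  using Asum_ge[of "{}"] by simp

text \<open>The two summands come from the two cases of \<open>a_weight\<close> with at most one
  derivative left on the solution: \<open>64 / \<sigma>0^2\<close> for \<open>j \<ge> 2\<close> and
  \<open>8 / \<sigma>0\<close> for \<open>j = 1\<close>.\<close>

definition Econst :: real where "Econst = 64 / \<sigma>0\<^sup>2 + 8 / \<sigma>0"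

text \<open>From \<open>k + 1 \<le> (j + 1) * (l + 1) \<le> 2 ^ j * (l + 1)\<close> the cubes cost
  \<open>8 ^ j\<close>, which is why \<open>8 * \<rho> \<le> \<sigma>0\<close> is required. If two
  derivatives remain on the solution, all \<open>j\<close> powers of \<open>\<rho>\<close> are
  available and one is kept as a small factor; otherwise the truncated exponents lose up to two of
  them.\<close>

lemma a_weight:
  assumes \<rho>: "0 < \<rho>" "\<rho> \<le> 1" "\<rho> \<le> \<sigma>0 / 8" and j: "1 \<le> j" "j \<le> k"
  shows "real (k choose j) * wt \<rho> k * Ak j \<le>
    (if k - j < 2 then Econst else 8 * \<rho> / \<sigma>0) * (\<sigma>0 ^ j / fact j * Ak j) * wt \<rho> (k - j)"
proof -
  define l where "l = k - j"
  define e where "e = (if l < 2 then j - 2 else j)"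
  have k: "k = l + j" using j by (simp add: l_def)
  have "real (k choose j) * wt \<rho> k = \<rho> ^ (k - 2) * ((real k + 1) ^ 3 / (fact j * fact l))"
    using j by (simp add: wt_def binomial_fact l_def)
  also have "\<dots> \<le> (\<rho> ^ e * \<rho> ^ (l - 2)) * ((2 ^ j * (real l + 1)) ^ 3 / (fact j * fact l))"
  proof (intro mult_mono divide_right_mono power_mono power_split_le)
    have "real j + 1 \<le> 2 ^ j" using of_nat_less_two_power[of j, where 'a=real] by (induction j) auto
    then have "(real j + 1) * (real l + 1) \<le> 2 ^ j * (real l + 1)" by (intro mult_right_mono) auto
    moreover have "real k + 1 \<le> (real j + 1) * (real l + 1)" by (simp add: k algebra_simps)
    ultimately show "real k + 1 \<le> 2 ^ j * (real l + 1)" by linarith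
    show "e + (l - 2) \<le> k - 2" using j by (auto simp: e_def k)
  qed (use \<rho> in auto)
  also have "\<dots> = (\<rho> ^ e * 8 ^ j / fact j) * wt \<rho> l"
    by (simp add: wt_def power_mult_distrib power_mult[symmetric] mult.commute[of j 3])
      (simp add: power_mult)
  finally have 1: "real (k choose j) * wt \<rho> k \<le> (\<rho> ^ e * 8 ^ j / fact j) * wt \<rho> l" .
  have 2: "\<rho> ^ e * 8 ^ j \<le> (if l < 2 then Econst else 8 * \<rho> / \<sigma>0) * \<sigma>0 ^ j"
  proof (cases "l < 2")
    case True
    show ?thesis
    proof (cases "j = 1")
      case True
      then have "\<rho> ^ e * 8 ^ j = 8" using \<open>l < 2\<close> by (simp add: e_def)
      also have "\<dots> \<le> Econst * \<sigma>0 ^ j" using True sigma0 by (simp add: Econst_def field_simps)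
      finally show ?thesis using \<open>l < 2\<close> by simp
    next
      case False
      define i where "i = j - 2"
      have i: "j = i + 2" using False j by (simp add: i_def)
      have "\<rho> ^ e * 8 ^ j = 64 * (8 * \<rho>) ^ i" using True by (simp add: e_def i power_add power_mult_distrib)
      also have "\<dots> \<le> 64 * \<sigma>0 ^ i" using \<rho> by (intro mult_left_mono power_mono) auto
      also have "\<dots> = 64 / \<sigma>0\<^sup>2 * \<sigma>0 ^ j" using sigma0 by (simp add: i power_add power2_eq_square)
      also have "\<dots> \<le> Econst * \<sigma>0 ^ j" using sigma0 by (intro mult_right_mono) (auto simp: Econst_def)
      finally show ?thesis using True by simp
    qed
  next
    case False
    have "\<rho> ^ e * 8 ^ j = (8 * \<rho>) * (8 * \<rho>) ^ (j - 1)"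
      using False j by (cases j) (simp_all add: e_def power_mult_distrib)
    also have "\<dots> \<le> (8 * \<rho>) * \<sigma>0 ^ (j - 1)" using \<rho> by (intro mult_left_mono power_mono) auto
    also have "\<dots> = 8 * \<rho> / \<sigma>0 * \<sigma>0 ^ j" using sigma0 j by (cases j) (simp_all)
    finally show ?thesis using False by simp
  qed
  have "real (k choose j) * wt \<rho> k * Ak j \<le> (\<rho> ^ e * 8 ^ j / fact j) * wt \<rho> l * Ak j"
    by (intro mult_right_mono 1 Ak_nonneg)
  also have "\<dots> \<le> ((if l < 2 then Econst else 8 * \<rho> / \<sigma>0) * \<sigma>0 ^ j / fact j) * wt \<rho> l * Ak j"
    using wt_pos[OF \<rho>(1), of l] by (intro mult_right_mono divide_right_mono 2 Ak_nonneg) auto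
  finally show ?thesis by (simp add: l_def mult_ac)
qed

text \<open>Terms with \<open>k - j \<ge> 2\<close> form a convolution and carry the small factor
  \<open>\<rho>\<close>. Those with \<open>k - j < 2\<close> contain only \<open>D 0\<close> or
  \<open>D 1\<close>, so they are linear in \<open>sqrt Y\<close> and act as a forcing that decays
  in time.\<close>

lemma a_sum:
  fixes D :: "nat \<Rightarrow> real" and K :: nat
  assumes \<rho>: "0 < \<rho>" "\<rho> \<le> 1" "\<rho> \<le> \<sigma>0 / 8" and D: "\<And>k. D k \<ge> 0"
  defines "Y \<equiv> \<Sum>k\<le>K. (wt \<rho> k * D k)\<^sup>2"
  shows "(\<Sum>k\<le>K. \<Sum>j=1..k. real (k choose j) * wt \<rho> k * Ak j * D (k - j) * (wt \<rho> k * D k))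
    \<le> 8 * \<rho> / \<sigma>0 * Asum * Y + 16 * Econst * Asum * (D 0 + D 1) * sqrt Y"
proof -
  define b where "b k = wt \<rho> k * D k" for k
  define a where "a j = \<sigma>0 ^ j / fact j * Ak j" for j
  have a0: "a j \<ge> 0" for j using sigma0 Ak_nonneg by (simp add: a_def)
  have b0: "b k \<ge> 0" for k using wt_pos[OF \<rho>(1), of k] D by (simp add: b_def)
  have Y: "Y \<ge> 0" unfolding Y_def by (intro sum_nonneg) simp
  have E: "Econst \<ge> 0" using sigma0 by (simp add: Econst_def)
  have bY: "b k \<le> sqrt Y" if "k \<le> K" for k
    unfolding Y_def b_def using that
    by (intro real_le_rsqrt member_le_sum[of _ "{..K}" "\<lambda>k. (wt \<rho> k * D k)\<^sup>2"]) auto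
  \<comment> \<open>The 8 is the weight of order one; each \<open>j\<close> meets at most two
    indices \<open>k\<close> with \<open>k - j < 2\<close>, which makes the 16 of the claim.\<close>
  let ?W = "8 * Econst * (D 0 + D 1) * sqrt Y"
  have W: "?W \<ge> 0" using E D Y by (intro mult_nonneg_nonneg add_nonneg_nonneg) auto
  have F: "real (k choose j) * wt \<rho> k * Ak j * D (k - j) * (wt \<rho> k * D k)
     \<le> 8 * \<rho> / \<sigma>0 * (a j * (b (k - j) * b k)) + (if k < j + 2 then a j * ?W else 0)" if k: "k \<le> K" and j: "j \<in> {1..k}" for k j
  proof -
    have "real (k choose j) * wt \<rho> k * Ak j * (D (k - j) * b k) \<le>
     (if k - j < 2 then Econst else 8 * \<rho> / \<sigma>0) * (\<sigma>0 ^ j / fact j * Ak j) * wt \<rho> (k - j) * (D (k - j) * b k)"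
      using j D b0 by (intro mult_right_mono a_weight \<rho> mult_nonneg_nonneg) auto
    also have "\<dots> = (if k - j < 2 then Econst else 8 * \<rho> / \<sigma>0) * (a j * (b (k - j) * b k))"
      by (simp add: a_def b_def)
    also have "\<dots> \<le> 8 * \<rho> / \<sigma>0 * (a j * (b (k - j) * b k)) + (if k < j + 2 then a j * ?W else 0)"
    proof (cases "k - j < 2")
      case True
      then have "k - j = 0 \<or> k - j = 1" by linarith
      then have "b (k - j) \<le> 8 * (D 0 + D 1)" using D[of 0] D[of 1] by (auto simp: b_def wt_def)
      then have "b (k - j) * b k \<le> 8 * (D 0 + D 1) * sqrt Y" using bY[OF k] b0 D by (intro mult_mono) auto
      then have "Econst * (a j * (b (k - j) * b k)) \<le> Econst * (a j * (8 * (D 0 + D 1) * sqrt Y))"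
        by (intro mult_left_mono a0 E)
      moreover have "0 \<le> 8 * \<rho> / \<sigma>0 * (a j * (b (k - j) * b k))"
        using \<rho> sigma0 a0 b0 by (intro mult_nonneg_nonneg) auto
      ultimately show ?thesis using True j by (auto simp: mult_ac)
    qed auto
    finally show ?thesis by (simp add: b_def mult_ac)
  qed
  have sw: "(\<Sum>k\<le>K. \<Sum>j=1..k. G k j) = (\<Sum>j=1..K. \<Sum>k=j..K. G k j)" for G :: "nat \<Rightarrow> nat \<Rightarrow> real"
    unfolding sum.Sigma[OF finite_atMost ballI[OF finite_atLeastAtMost]] sum.Sigma[OF finite_atLeastAtMost ballI[OF finite_atLeastAtMost]]
    by (rule sum.reindex_bij_witness[of _ "\<lambda>(j, k). (k, j)" "\<lambda>(k, j). (j, k)"]) auto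
  have Aj: "(\<Sum>j=1..K. a j) \<le> Asum" unfolding a_def by (rule Asum_ge) simp
  have "(\<Sum>k\<le>K. \<Sum>j=1..k. real (k choose j) * wt \<rho> k * Ak j * D (k - j) * (wt \<rho> k * D k))
    \<le> (\<Sum>k\<le>K. \<Sum>j=1..k. 8 * \<rho> / \<sigma>0 * (a j * (b (k - j) * b k)) + (if k < j + 2 then a j * ?W else 0))"
    by (intro sum_mono F) auto
  also have "\<dots> = (\<Sum>j=1..K. \<Sum>k=j..K. 8 * \<rho> / \<sigma>0 * (a j * (b (k - j) * b k)) + (if k < j + 2 then a j * ?W else 0))"
    by (rule sw)
  also have "\<dots> = (\<Sum>j=1..K. 8 * \<rho> / \<sigma>0 * (a j * (\<Sum>k=j..K. b (k - j) * b k)) + (\<Sum>k=j..K. if k < j + 2 then a j * ?W else 0))"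
    by (simp add: sum.distrib sum_distrib_left)
  also have "\<dots> \<le> (\<Sum>j=1..K. 8 * \<rho> / \<sigma>0 * (a j * Y) + 2 * (a j * ?W))"
  proof (intro sum_mono add_mono mult_left_mono a0)
    fix j
    show "(\<Sum>k=j..K. b (k - j) * b k) \<le> Y"
      unfolding Y_def b_def[symmetric] by (intro shift_sum) (auto simp: inj_on_def)
    have "(\<Sum>k=j..K. if k < j + 2 then a j * ?W else 0) = (\<Sum>k\<in>{k\<in>{j..K}. k < j + 2}. a j * ?W)"
      by (rule sum.inter_filter[symmetric]) simp
    also have "\<dots> = real (card {k\<in>{j..K}. k < j + 2}) * (a j * ?W)" by simp
    also have "\<dots> \<le> 2 * (a j * ?W)"
    proof (rule mult_right_mono)
      have "card {k\<in>{j..K}. k < j + 2} \<le> card {j, Suc j}" by (intro card_mono) auto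
      then show "real (card {k\<in>{j..K}. k < j + 2}) \<le> 2" by simp
    qed (use a0 W in simp)
    finally show "(\<Sum>k=j..K. if k < j + 2 then a j * ?W else 0) \<le> 2 * (a j * ?W)" .
  qed (use \<rho> sigma0 in auto)
  also have "\<dots> = (\<Sum>j=1..K. a j * (8 * \<rho> / \<sigma>0 * Y + 2 * ?W))"
    by (intro sum.cong) (simp_all add: algebra_simps)
  also have "\<dots> = (\<Sum>j=1..K. a j) * (8 * \<rho> / \<sigma>0 * Y + 2 * ?W)"
    by (simp only: sum_distrib_right)
  also have "\<dots> \<le> Asum * (8 * \<rho> / \<sigma>0 * Y + 2 * ?W)"
    using Aj \<rho> sigma0 Y W E D by (intro mult_right_mono add_nonneg_nonneg mult_nonneg_nonneg) auto
  finally show ?thesis by (simp add: algebra_simps)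
qed

lemma jprod_square_norm:
  assumes f: "jet f" and s: "\<And>k x. \<bar>f k x\<bar> \<le> s k"
  shows "\<bar>jprod f f j x\<bar> \<le> sqs s j" "norm (cl (jprod f f j)) \<le> sqD s (\<lambda>k. norm (cl (f k))) j"
proof -
  have s0: "s k \<ge> 0" for k using s[of k 0] by linarith
  have "\<bar>jprod f f j x\<bar> \<le> (\<Sum>i\<le>j. \<bar>real (j choose i) * f i x * f (j - i) x\<bar>)"
    unfolding jprod_def by (rule sum_abs)
  also have "\<dots> \<le> sqs s j"
    unfolding sqs_def abs_mult using s s0 by (intro sum_mono mult_mono) auto
  finally show "\<bar>jprod f f j x\<bar> \<le> sqs s j" .
  let ?D = "\<lambda>k. norm (cl (f k))"
  have r: "rl2 (\<lambda>x. f i x * f l x)" for i l by (intro bjet_rl2_mult jet_bjet jet_rl2 f)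
  have n: "norm (cl (\<lambda>x. f i x * f l x)) \<le> s i * ?D l" "norm (cl (\<lambda>x. f i x * f l x)) \<le> s l * ?D i" for i l
    using norm_cl_mult_le[OF jet_rl2[OF f, of l] chain_measurable[OF jet_chain[OF f], of i] s]
      norm_cl_mult_le[OF jet_rl2[OF f, of i] chain_measurable[OF jet_chain[OF f], of l] s] by (simp_all add: mult.commute)
  have eq: "cl (jprod f f j) = (\<Sum>i\<le>j. real (j choose i) *\<^sub>R cl (\<lambda>x. f i x * f (j - i) x))"
    unfolding jprod_def[abs_def] mult.assoc
    by (subst cl_sum) (auto intro!: sum.cong rl2_cmult r simp: cl_cmult r)
  have "norm (cl (jprod f f j)) \<le> (\<Sum>i\<le>j. real (j choose i) * norm (cl (\<lambda>x. f i x * f (j - i) x)))"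
    unfolding eq by (rule order_trans[OF norm_sum]) simp
  also have "\<dots> = (\<Sum>i\<in>{i\<in>{..j}. 2 * i \<le> j}. real (j choose i) * norm (cl (\<lambda>x. f i x * f (j - i) x)))
     + (\<Sum>i\<in>{i\<in>{..j}. \<not> 2 * i \<le> j}. real (j choose i) * norm (cl (\<lambda>x. f i x * f (j - i) x)))"
    by (subst sum.union_disjoint[symmetric]) (auto intro!: sum.cong)
  also have "(\<Sum>i\<in>{i\<in>{..j}. \<not> 2 * i \<le> j}. real (j choose i) * norm (cl (\<lambda>x. f i x * f (j - i) x)))
     = (\<Sum>i\<in>{i\<in>{..j}. 2 * i < j}. real (j choose i) * norm (cl (\<lambda>x. f (j - i) x * f i x)))"
    by (rule sum.reindex_bij_witness[of _ "\<lambda>i. j - i" "\<lambda>i. j - i"]) (auto simp: binomial_symmetric[symmetric])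
  also have "\<dots> \<le> (\<Sum>i\<in>{i\<in>{..j}. 2 * i < j}. real (j choose i) * s i * ?D (j - i))"
    unfolding mult.assoc by (intro sum_mono mult_left_mono n) auto
  also have "\<dots> \<le> (\<Sum>i\<in>{i\<in>{..j}. 2 * i \<le> j}. real (j choose i) * s i * ?D (j - i))"
    using s0 by (intro sum_mono2) auto
  also have "(\<Sum>i\<in>{i\<in>{..j}. 2 * i \<le> j}. real (j choose i) * norm (cl (\<lambda>x. f i x * f (j - i) x)))
     \<le> (\<Sum>i\<in>{i\<in>{..j}. 2 * i \<le> j}. real (j choose i) * s i * ?D (j - i))"
    unfolding mult.assoc by (intro sum_mono mult_left_mono n) auto
  also have "{i\<in>{..j}. 2 * i \<le> j} = {i. 2 * i \<le> j}" by auto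
  finally show "norm (cl (jprod f f j)) \<le> sqD s ?D j" by (simp add: sqD_def)
qed

text \<open>The coefficient \<open>g = 2 * \<mu> * f + 3 * \<nu> * f^2\<close> with its derivatives:
  the derivative of the flux is \<open>g * f_x\<close>.\<close>

definition gj :: "(nat \<Rightarrow> real \<Rightarrow> real) \<Rightarrow> nat \<Rightarrow> real \<Rightarrow> real" where
  "gj f k x = 2 * \<mu> * f k x + 3 * \<nu> * jprod f f k x"

lemma jet_gj: "jet f \<Longrightarrow> jet (gj f)"
  unfolding gj_def[abs_def] by (intro jet_add jet_cmult jet_jprod jet_bjet)

lemma hj_Suc:
  assumes f: "jet f"
  shows "hj f (Suc k) = jprod (gj f) (\<lambda>i. f (Suc i)) k"
proof (rule chain_unique[of "\<lambda>k. hj f (Suc k)"])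
  show "chain (\<lambda>k. hj f (Suc k))" using jet_chain[OF jet_hj[OF f]] by (simp add: chain_def)
  show "chain (jprod (gj f) (\<lambda>i. f (Suc i)))"
    using f by (intro chain_jprod jet_chain[OF jet_gj[OF f]]) (simp add: jet_def chain_def)
  show "hj f (Suc 0) = jprod (gj f) (\<lambda>i. f (Suc i)) 0"
    by (rule ext) (simp add: hj_def gj_def jprod_def algebra_simps)
qed

text \<open>Collected from \<open>nonlinear_sum\<close>: \<open>17 = 17/2 * 2\<close> and
  \<open>51 = 17/2 * 6\<close> belong to the sup norms of \<open>gj\<close>,
  \<open>16 = 8 * 2\<close> and \<open>768 = 8 * 3 * 32\<close> to its \<open>L2\<close>
  norms.\<close>

definition Cnl :: real where "Cnl = 17 * \<bar>\<mu>\<bar> + 16 * \<bar>\<mu>\<bar> + 51 * \<bar>\<nu>\<bar> + 768 * \<bar>\<nu>\<bar>"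

text \<open>The Leibniz term with all derivatives on \<open>f_x\<close> is integrated by parts,
  which moves one derivative to the coefficient and loses nothing. All other terms lose exactly one
  derivative and go into \<open>quad_sum\<close>.\<close>

lemma nonlinear_sum:
  assumes f: "jet f" and \<rho>: "0 < \<rho>" "\<rho> \<le> 1" and K: "K \<ge> 3" and s: "\<And>k x. \<bar>f k x\<bar> \<le> s k"
  defines "D \<equiv> \<lambda>k. norm (cl (f k))" and "H \<equiv> \<Sum>j=1..K-1. hw \<rho> s j"
  shows "(\<Sum>k\<le>K. (wt \<rho> k)\<^sup>2 * - (cl (f k) \<bullet> cl (hj f (Suc k)))) \<le> Cnl * (1 + s 0 + H) * H * (\<Sum>k\<le>K. (xw \<rho> D k)\<^sup>2)"
proof -
  let ?g = "gj f"
  define sg where "sg j = 2 * \<bar>\<mu>\<bar> * s j + 3 * \<bar>\<nu>\<bar> * sqs s j" for j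
  define Dg where "Dg j = 2 * \<bar>\<mu>\<bar> * D j + 3 * \<bar>\<nu>\<bar> * sqD s D j" for j
  have s0: "s k \<ge> 0" for k using s[of k 0] by linarith
  have D0: "D k \<ge> 0" for k by (simp add: D_def)
  have sqs0: "sqs s j \<ge> 0" and sqD0: "sqD s D j \<ge> 0" for j
    using s0 D0 by (auto simp: sqs_def sqD_def intro!: sum_nonneg)
  have w: "wt \<rho> k \<ge> 0" for k using wt_pos[OF \<rho>(1), of k] by simp
  let ?Z = "\<Sum>k\<le>K. (xw \<rho> D k)\<^sup>2"
  have Z0: "?Z \<ge> 0" by (intro sum_nonneg) simp
  have H0: "H \<ge> 0" unfolding H_def using \<rho> s0 by (intro sum_nonneg) (simp add: hw_def)
  have gjet: "jet ?g" by (rule jet_gj[OF f])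
  have gs: "\<bar>?g j x\<bar> \<le> sg j" for j x
  proof -
    have "\<bar>?g j x\<bar> \<le> \<bar>2 * \<mu> * f j x\<bar> + \<bar>3 * \<nu> * jprod f f j x\<bar>" unfolding gj_def by (rule abs_triangle_ineq)
    also have "\<dots> \<le> sg j" unfolding sg_def abs_mult
      using s jprod_square_norm(1)[OF f s] by (intro add_mono mult_mono) (auto intro: s0 sqs0)
    finally show ?thesis .
  qed
  have gD: "norm (cl (?g j)) \<le> Dg j" for j
  proof -
    have r: "rl2 (f j)" "rl2 (jprod f f j)" by (intro jet_rl2 f jet_jprod jet_bjet)+
    have "cl (?g j) = (2 * \<mu>) *\<^sub>R cl (f j) + (3 * \<nu>) *\<^sub>R cl (jprod f f j)"
      unfolding gj_def[abs_def] using r by (simp add: cl_add cl_cmult rl2_cmult)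
    then have "norm (cl (?g j)) \<le> \<bar>2 * \<mu>\<bar> * norm (cl (f j)) + \<bar>3 * \<nu>\<bar> * norm (cl (jprod f f j))"
      using norm_triangle_ineq[of "(2 * \<mu>) *\<^sub>R cl (f j)" "(3 * \<nu>) *\<^sub>R cl (jprod f f j)"] by simp
    also have "\<dots> \<le> Dg j" unfolding Dg_def D_def abs_mult
      using jprod_square_norm(2)[OF f s] by (intro add_mono) (auto intro!: mult_left_mono)
    finally show ?thesis .
  qed
  have rg: "rl2 (\<lambda>x. ?g j x * f l x)" for j l by (intro bjet_rl2_mult jet_bjet jet_rl2 f gjet)
  define T where "T k j = norm (cl (\<lambda>x. ?g j x * f (k + 1 - j) x))" for k j
  have T1: "T k j \<le> sg j * D (k + 1 - j)" for k j
    unfolding T_def D_def by (intro norm_cl_mult_le gs jet_rl2[OF f] chain_measurable jet_chain gjet)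
  have T2: "T k j \<le> Dg j * s (k + 1 - j)" for k j
  proof -
    have "T k j \<le> s (k + 1 - j) * norm (cl (?g j))"
      unfolding T_def mult.commute[of "?g j _"]
      by (intro norm_cl_mult_le s jet_rl2[OF gjet] chain_measurable jet_chain f)
    also have "\<dots> \<le> s (k + 1 - j) * Dg j" by (intro mult_left_mono gD s0)
    finally show ?thesis by (simp add: mult.commute)
  qed
  have perk: "- (cl (f k) \<bullet> cl (hj f (Suc k))) \<le> 1/2 * sg 1 * (D k)\<^sup>2 + (\<Sum>j=1..k. real (k choose j) * T k j * D k)" for k
  proof -
    let ?S = "\<Sum>j=1..k. real (k choose j) *\<^sub>R cl (\<lambda>x. ?g j x * f (k + 1 - j) x)"
    have "cl (hj f (Suc k)) = (\<Sum>j\<le>k. real (k choose j) *\<^sub>R cl (\<lambda>x. ?g j x * f (Suc (k - j)) x))"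
      unfolding hj_Suc[OF f] jprod_def[abs_def] mult.assoc
      by (subst cl_sum) (auto intro!: sum.cong rl2_cmult rg simp: cl_cmult rg)
    also have "\<dots> = cl (\<lambda>x. ?g 0 x * f (Suc k) x) + ?S"
      unfolding atMost_atLeast0 by (subst sum.atLeast_Suc_atMost) (auto intro!: sum.cong simp: Suc_diff_le)
    finally have hS: "cl (hj f (Suc k)) = cl (\<lambda>x. ?g 0 x * f (Suc k) x) + ?S" .
    \<comment> \<open>Symmetry of multiplication by \<open>g\<close> makes the top-order term equal
      to minus itself up to a commutator; this leaves half of the term with
      \<open>g_x\<close>.\<close>
    have main: "cl (f k) \<bullet> cl (\<lambda>x. ?g 0 x * f (Suc k) x) = - (1/2) * (cl (f k) \<bullet> cl (\<lambda>x. ?g 1 x * f k x))"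
    proof -
      have "cl (f (Suc k)) \<bullet> cl (\<lambda>x. ?g 0 x * f k x) = - (cl (f k) \<bullet> cl (\<lambda>x. ?g 1 x * f k x + ?g 0 x * f (Suc k) x))"
      proof (rule rl2_parts)
        show "((\<lambda>x. ?g 0 x * f k x) has_real_derivative ?g 1 x * f k x + ?g 0 x * f (Suc k) x) (at x)" for x
          using DERIV_mult[OF chainD[OF jet_chain[OF gjet], of 0] chainD[OF jet_chain[OF f], of k]] by (simp add: mult.commute)
        show "isCont (\<lambda>x. ?g 1 x * f k x + ?g 0 x * f (Suc k) x) x" for x
          by (intro continuous_intros chain_isCont jet_chain gjet f)
      qed (auto intro: jet_rl2[OF f] rg rl2_add[OF rg rg] chainD[OF jet_chain[OF f]] chain_isCont[OF jet_chain[OF f]])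
      moreover have "cl (f (Suc k)) \<bullet> cl (\<lambda>x. ?g 0 x * f k x) = cl (f k) \<bullet> cl (\<lambda>x. ?g 0 x * f (Suc k) x)"
        unfolding inner_cl[OF jet_rl2[OF f] rg] by (simp add: mult_ac)
      ultimately show ?thesis by (simp add: cl_add rg inner_add_right)
    qed
    have "\<bar>cl (f k) \<bullet> cl (\<lambda>x. ?g 1 x * f k x)\<bar> \<le> norm (cl (f k)) * norm (cl (\<lambda>x. ?g 1 x * f k x))" by (rule Cauchy_Schwarz_ineq2)
    also have "\<dots> \<le> D k * (sg 1 * D k)" unfolding D_def
      by (intro mult_left_mono norm_cl_mult_le gs jet_rl2[OF f] chain_measurable jet_chain gjet) simp
    finally have 1: "cl (f k) \<bullet> cl (\<lambda>x. ?g 1 x * f k x) \<le> sg 1 * (D k)\<^sup>2" by (simp add: power2_eq_square mult_ac)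
    have "- (cl (f k) \<bullet> ?S) \<le> norm (cl (f k)) * norm ?S"
      using Cauchy_Schwarz_ineq2[of "cl (f k)" ?S] by linarith
    also have "norm ?S \<le> (\<Sum>j=1..k. real (k choose j) * T k j)"
      unfolding T_def by (rule order_trans[OF norm_sum]) simp
    finally have "- (cl (f k) \<bullet> ?S) \<le> D k * (\<Sum>j=1..k. real (k choose j) * T k j)"
      by (simp add: D_def mult_left_mono)
    then have 2: "- (cl (f k) \<bullet> ?S) \<le> (\<Sum>j=1..k. real (k choose j) * T k j * D k)"
      by (simp add: sum_distrib_left mult_ac)
    show ?thesis unfolding hS inner_add_right main using 1 2 by linarith
  qed
  have "(\<Sum>k\<le>K. (wt \<rho> k)\<^sup>2 * - (cl (f k) \<bullet> cl (hj f (Suc k))))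
    \<le> (\<Sum>k\<le>K. (wt \<rho> k)\<^sup>2 * (1/2 * sg 1 * (D k)\<^sup>2 + (\<Sum>j=1..k. real (k choose j) * T k j * D k)))"
    by (intro sum_mono mult_left_mono perk) simp
  also have "\<dots> = 1/2 * sg 1 * (\<Sum>k\<le>K. (wt \<rho> k * D k)\<^sup>2) + (\<Sum>k\<le>K. \<Sum>j=1..k. real (k choose j) * wt \<rho> k * T k j * (wt \<rho> k * D k))"
    by (simp add: distrib_left sum.distrib sum_distrib_left power_mult_distrib mult_ac power2_eq_square)
  also have "\<dots> \<le> 1/2 * (\<Sum>j=1..K-1. hw \<rho> sg j) * ?Z + 8 * ((\<Sum>j=1..K-1. hw \<rho> sg j) + H * (2 * \<bar>\<mu>\<bar> + 96 * \<bar>\<nu>\<bar> * (s 0 + H))) * ?Z"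
  proof (rule add_mono)
    have sg0: "sg j \<ge> 0" for j unfolding sg_def using s0 sqs0 by simp
    have "sg 1 = hw \<rho> sg 1" by (simp add: hw_def)
    also have "\<dots> \<le> (\<Sum>j=1..K-1. hw \<rho> sg j)"
      using K \<rho> sg0 by (intro member_le_sum) (auto simp: hw_def)
    finally have m1: "sg 1 \<le> (\<Sum>j=1..K-1. hw \<rho> sg j)" .
    then have m2: "0 \<le> 1/2 * (\<Sum>j=1..K-1. hw \<rho> sg j)" using sg0[of 1] by simp
    have "(wt \<rho> k * D k)\<^sup>2 \<le> (xw \<rho> D k)\<^sup>2" for k
    proof (rule power_mono)
      have "1 * (wt \<rho> k * D k) \<le> sqrt (real k + 1) * (wt \<rho> k * D k)" using w D0 by (intro mult_right_mono) auto
      then show "wt \<rho> k * D k \<le> xw \<rho> D k" by (simp add: xw_def)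
    qed (use w D0 in simp)
    then have "(\<Sum>k\<le>K. (wt \<rho> k * D k)\<^sup>2) \<le> ?Z" by (intro sum_mono)
    then show "1/2 * sg 1 * (\<Sum>k\<le>K. (wt \<rho> k * D k)\<^sup>2) \<le> 1/2 * (\<Sum>j=1..K-1. hw \<rho> sg j) * ?Z"
      using m1 m2 sg0[of 1] by (intro mult_mono) (auto intro: sum_nonneg)
    show "(\<Sum>k\<le>K. \<Sum>j=1..k. real (k choose j) * wt \<rho> k * T k j * (wt \<rho> k * D k))
      \<le> 8 * ((\<Sum>j=1..K-1. hw \<rho> sg j) + H * (2 * \<bar>\<mu>\<bar> + 96 * \<bar>\<nu>\<bar> * (s 0 + H))) * ?Z"
      unfolding H_def
    proof (rule quad_sum[where s=s and sg=sg and Dg=Dg and D=D and T=T, OF \<rho> K D0 s0 sg0 _ T1 T2])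
      show "Dg k \<ge> 0" for k unfolding Dg_def using D0 sqD0 by simp
      fix i :: nat assume i: "1 \<le> i"
      have xg: "xw \<rho> Dg j * y = 2 * \<bar>\<mu>\<bar> * (xw \<rho> D j * y) + 3 * \<bar>\<nu>\<bar> * (xw \<rho> (sqD s D) j * y)" for j y
        by (simp add: xw_def Dg_def algebra_simps)
      have e1: "(\<Sum>k | k \<le> K \<and> 2 * i < k + 1. xw \<rho> D (k + 1 - i) * xw \<rho> D k) \<le> ?Z"
        using i by (intro shift_sum) (auto simp: inj_on_def)
      have "(\<Sum>k | k \<le> K \<and> 2 * i < k + 1. xw \<rho> Dg (k + 1 - i) * xw \<rho> D k)
        = 2 * \<bar>\<mu>\<bar> * (\<Sum>k | k \<le> K \<and> 2 * i < k + 1. xw \<rho> D (k + 1 - i) * xw \<rho> D k)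
        + 3 * \<bar>\<nu>\<bar> * (\<Sum>k | k \<le> K \<and> 2 * i < k + 1. xw \<rho> (sqD s D) (k + 1 - i) * xw \<rho> D k)"
        unfolding xg by (simp only: sum.distrib sum_distrib_left)
      also have "\<dots> \<le> 2 * \<bar>\<mu>\<bar> * ?Z + 3 * \<bar>\<nu>\<bar> * (32 * (s 0 + (\<Sum>j=1..K-1. hw \<rho> s j)) * ?Z)"
        by (intro add_mono mult_left_mono e1 sqD_Q[OF \<rho> s0 D0 K i]) auto
      also have "\<dots> = (2 * \<bar>\<mu>\<bar> + 96 * \<bar>\<nu>\<bar> * (s 0 + (\<Sum>j=1..K-1. hw \<rho> s j))) * ?Z" by (simp add: algebra_simps)
      finally show "(\<Sum>k | k \<le> K \<and> 2 * i < k + 1. xw \<rho> Dg (k + 1 - i) * xw \<rho> D k) \<le> \<dots>" .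
    qed
  qed
  \<comment> \<open>\<open>17/2\<close> adds the \<open>1/2\<close> of the integrated top-order term
    to the 8 of \<open>quad_sum\<close>.\<close>
  also have "\<dots> = (17/2 * (\<Sum>j=1..K-1. hw \<rho> sg j) + H * (16 * \<bar>\<mu>\<bar> + 768 * \<bar>\<nu>\<bar> * (s 0 + H))) * ?Z"
    by (simp add: algebra_simps)
  also have "\<dots> \<le> (17/2 * (2 * \<bar>\<mu>\<bar> * H + 3 * \<bar>\<nu>\<bar> * (2 * H * (s 0 + H))) + H * (16 * \<bar>\<mu>\<bar> + 768 * \<bar>\<nu>\<bar> * (s 0 + H))) * ?Z"
  proof (intro mult_right_mono add_mono mult_left_mono Z0 order_refl)
    have "(\<Sum>j=1..K-1. hw \<rho> sg j) = 2 * \<bar>\<mu>\<bar> * H + 3 * \<bar>\<nu>\<bar> * (\<Sum>j=1..K-1. hw \<rho> (sqs s) j)"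
      unfolding H_def by (simp add: hw_def sg_def sum_distrib_left sum.distrib[symmetric] algebra_simps)
    also have "\<dots> \<le> 2 * \<bar>\<mu>\<bar> * H + 3 * \<bar>\<nu>\<bar> * (2 * H * (s 0 + H))"
      unfolding H_def using K by (intro add_left_mono mult_left_mono sqs_hw[OF \<rho> s0]) auto
    finally show "(\<Sum>j=1..K-1. hw \<rho> sg j) \<le> \<dots>" .
  qed (use H0 s0[of 0] in \<open>auto intro!: add_nonneg_nonneg mult_nonneg_nonneg\<close>)
  also have "\<dots> \<le> (Cnl * (1 + s 0 + H) * H) * ?Z"
  proof (rule mult_right_mono[OF _ Z0])
    have "Cnl * (1 + s 0 + H) * H - (17/2 * (2 * \<bar>\<mu>\<bar> * H + 3 * \<bar>\<nu>\<bar> * (2 * H * (s 0 + H))) + H * (16 * \<bar>\<mu>\<bar> + 768 * \<bar>\<nu>\<bar> * (s 0 + H)))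
      = (51 * \<bar>\<nu>\<bar> + 768 * \<bar>\<nu>\<bar>) * H + 33 * \<bar>\<mu>\<bar> * (s 0 + H) * H"
      by (simp add: Cnl_def algebra_simps)
    also have "\<dots> \<ge> 0" using H0 s0[of 0] by simp
    finally show "17/2 * (2 * \<bar>\<mu>\<bar> * H + 3 * \<bar>\<nu>\<bar> * (2 * H * (s 0 + H))) + H * (16 * \<bar>\<mu>\<bar> + 768 * \<bar>\<nu>\<bar> * (s 0 + H)) \<le> Cnl * (1 + s 0 + H) * H"
      by simp
  qed
  finally show ?thesis .
qed

lemma damping_sum:
  fixes K :: nat
  assumes f: "jet f" and \<rho>: "0 < \<rho>" "\<rho> \<le> 1" "\<rho> \<le> \<sigma>0 / 8"
  defines "D \<equiv> \<lambda>k. norm (cl (f k))"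
  defines "Y \<equiv> \<Sum>k\<le>K. (wt \<rho> k * D k)\<^sup>2"
  shows "(\<Sum>k\<le>K. (wt \<rho> k)\<^sup>2 * - (cl (f k) \<bullet> cl (jprod aj f k)))
    \<le> - \<gamma> * Y + (8 * \<rho> / \<sigma>0 * Asum * Y + 16 * Econst * Asum * (D 0 + D 1) * sqrt Y)"
proof -
  have "(\<Sum>k\<le>K. (wt \<rho> k)\<^sup>2 * - (cl (f k) \<bullet> cl (jprod aj f k)))
    \<le> (\<Sum>k\<le>K. (wt \<rho> k)\<^sup>2 * (- \<gamma> * (D k)\<^sup>2 + (\<Sum>j=1..k. real (k choose j) * Ak j * D (k - j)) * D k))"
    unfolding D_def by (intro sum_mono mult_left_mono a_term_norm(2)[OF f]) simp
  also have "\<dots> = - \<gamma> * Y + (\<Sum>k\<le>K. \<Sum>j=1..k. real (k choose j) * wt \<rho> k * Ak j * D (k - j) * (wt \<rho> k * D k))"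
    unfolding Y_def
    by (simp add: distrib_left sum.distrib sum_distrib_left sum_distrib_right power_mult_distrib mult_ac power2_eq_square sum_negf right_diff_distrib sum_subtractf)
  also have "\<dots> \<le> - \<gamma> * Y + (8 * \<rho> / \<sigma>0 * Asum * Y + 16 * Econst * Asum * (D 0 + D 1) * sqrt Y)"
    unfolding Y_def by (intro add_left_mono a_sum \<rho>) (simp add: D_def)
  finally show ?thesis .
qed

end

subsection \<open>Uniform Gevrey bounds\<close>

text \<open>At the first time with \<open>\<phi> \<ge> c\<close> the intermediate value theorem
  still gives \<open>\<phi> \<le> c\<close> up to that time, and \<open>step\<close> yields the
  strict inequality there.\<close>

lemma bootstrap:
  fixes \<phi> :: "real \<Rightarrow> real"
  assumes cont: "continuous_on {0..T} \<phi>" and T: "0 \<le> T"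
    and step: "\<And>\<tau>. \<tau> \<in> {0..T} \<Longrightarrow> (\<And>t. t \<in> {0..\<tau>} \<Longrightarrow> \<phi> t \<le> c) \<Longrightarrow> \<phi> \<tau> < c" and init: "\<phi> 0 < c"
  shows "\<phi> T < c"
proof (rule ccontr)
  assume "\<not> \<phi> T < c"
  define S where "S = {t\<in>{0..T}. \<phi> t \<in> {c..}}"
  have "S \<noteq> {}" using \<open>\<not> \<phi> T < c\<close> T by (auto simp: S_def)
  moreover have "compact S"
  proof -
    have "S = {0..T} \<inter> \<phi> -` {c..}" by (auto simp: S_def)
    then have "closed S" using continuous_closed_preimage[OF cont closed_atLeastAtMost closed_atLeast] by simp
    moreover have "bounded S" by (rule bounded_subset[OF bounded_closed_interval[of 0 T]]) (auto simp: S_def)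
    ultimately show ?thesis by (simp add: compact_eq_bounded_closed)
  qed
  ultimately obtain s where s: "s \<in> S" "\<And>t. t \<in> S \<Longrightarrow> s \<le> t" using compact_attains_inf[of S] by blast
  have "\<phi> t \<le> c" if t: "t \<in> {0..s}" for t
  proof (rule ccontr)
    assume "\<not> \<phi> t \<le> c"
    moreover have "continuous_on {0..t} \<phi>" using s t by (intro continuous_on_subset[OF cont]) (auto simp: S_def)
    ultimately obtain x where x: "0 \<le> x" "x \<le> t" "\<phi> x = c" using IVT'[of \<phi> 0 c t] init t by auto
    then have "x \<in> S" using s t by (auto simp: S_def)
    then have "s \<le> x" by (rule s(2))
    then have "x = t" using x t by auto
    then show False using x \<open>\<not> \<phi> t \<le> c\<close> by simp
  qed
  with step[of s] s(1) show False by (auto simp: S_def)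
qed

lemma wt_mono: "0 < r \<Longrightarrow> r \<le> \<rho> \<Longrightarrow> wt r k \<le> wt \<rho> k"
  unfolding wt_def by (intro mult_right_mono power_mono) auto

context kawahara
begin

definition Yg :: "real \<Rightarrow> real \<Rightarrow> nat \<Rightarrow> l2 \<Rightarrow> real" where
  "Yg N \<rho> K u = (\<Sum>k\<le>K. (wt \<rho> k * norm (dN N k u))\<^sup>2)"

text \<open>Half the logarithmic derivative of \<open>Yg\<close> in \<open>\<rho>\<close>, that is
  the gain from a shrinking radius; it is zero on orders up to two.\<close>

definition Zm :: "real \<Rightarrow> real \<Rightarrow> nat \<Rightarrow> l2 \<Rightarrow> real" where
  "Zm N \<rho> K u = (\<Sum>k\<le>K. real (k - 2) * (wt \<rho> k * norm (dN N k u))\<^sup>2)"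

lemma Yg_nonneg: "Yg N \<rho> K u \<ge> 0" and Zm_nonneg: "Zm N \<rho> K u \<ge> 0"
  unfolding Yg_def Zm_def by (auto intro: sum_nonneg)

lemma Yg_deriv:
  assumes d: "(u has_vector_derivative X N (u t)) (at t within S)" and u: "realband N (u t)"
    and \<rho>: "(\<rho> has_real_derivative - l * \<rho> t) (at t within S)" "\<rho> t > 0"
  shows "((\<lambda>t. Yg N (\<rho> t) K (u t)) has_real_derivative
    - 2 * l * Zm N (\<rho> t) K (u t) + 2 * (\<Sum>k\<le>K. (wt (\<rho> t) k)\<^sup>2 * (dN N k (u t) \<bullet> dN N k (X N (u t))))) (at t within S)"
proof -
  have w: "((\<lambda>t. (wt (\<rho> t) k)\<^sup>2) has_real_derivative - 2 * l * real (k - 2) * (wt (\<rho> t) k)\<^sup>2) (at t within S)" for k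
  proof -
    define c where "c = (real k + 1) ^ 3 / fact k"
    have "((\<lambda>t. \<rho> t ^ (k - 2)) has_real_derivative - l * real (k - 2) * \<rho> t ^ (k - 2)) (at t within S)"
    proof (cases "k - 2")
      case (Suc m)
      then show ?thesis using DERIV_power[OF \<rho>(1), of "Suc m"] by (simp add: mult_ac)
    qed simp
    from DERIV_cmult_right[OF this, of c]
    have "((\<lambda>t. wt (\<rho> t) k) has_real_derivative - l * real (k - 2) * wt (\<rho> t) k) (at t within S)"
      unfolding wt_def c_def[symmetric] by (simp add: mult_ac)
    from DERIV_power[OF this, of 2] show ?thesis by (simp add: power2_eq_square mult_ac)
  qed
  have n: "((\<lambda>t. (norm (dN N k (u t)))\<^sup>2) has_real_derivative 2 * (dN N k (u t) \<bullet> dN N k (X N (u t)))) (at t within S)" for k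
    using has_real_derivative_inner[OF dN_deriv[OF d, where k=k and N=N] dN_deriv[OF d, where k=k and N=N]]
    by (simp add: power2_norm_eq_inner inner_commute)
  have "((\<lambda>t. \<Sum>k\<le>K. (wt (\<rho> t) k)\<^sup>2 * (norm (dN N k (u t)))\<^sup>2) has_real_derivative
    (\<Sum>k\<le>K. - 2 * l * real (k - 2) * (wt (\<rho> t) k)\<^sup>2 * (norm (dN N k (u t)))\<^sup>2 + 2 * (dN N k (u t) \<bullet> dN N k (X N (u t))) * (wt (\<rho> t) k)\<^sup>2)) (at t within S)"
    by (intro DERIV_sum DERIV_mult w n)
  then show ?thesis
    by (simp add: Yg_def Zm_def power_mult_distrib sum.distrib sum_distrib_left mult_ac sum_negf sum_subtractf)
qed

text \<open>\<open>H\<close> majorises the sup norms of positive order and \<open>P\<close> is the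
  part of \<open>Yg\<close> of order at most two, with weights 1, 8 and 27/2. The half-derivative
  sum is controlled by \<open>Zm\<close> except on \<open>P\<close>, which is therefore kept
  explicit.\<close>

lemma gevrey_inequality:
  assumes u: "realband N u" and \<rho>: "0 < \<rho>" "\<rho> \<le> 1" "\<rho> \<le> \<sigma>0 / 8" and K: "K \<ge> 3"
  defines "D \<equiv> \<lambda>k. norm (dN N k u)"
  defines "s0 \<equiv> sqrt (2 * D 0 * D 1)" and "H \<equiv> sqrt (2 * D 1 * D 2) + sqrt (\<rho> * Yg N \<rho> K u)"
  defines "P \<equiv> (D 0)\<^sup>2 + (8 * D 1)\<^sup>2 + (27/2 * D 2)\<^sup>2"
  shows "(\<Sum>k\<le>K. (wt \<rho> k)\<^sup>2 * (dN N k u \<bullet> dN N k (X N u))) \<le>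
    - \<gamma> * Yg N \<rho> K u + (8 * \<rho> / \<sigma>0 * Asum * Yg N \<rho> K u + 16 * Econst * Asum * (D 0 + D 1) * sqrt (Yg N \<rho> K u))
    + Cnl * (1 + s0 + H) * H * (4 * Zm N \<rho> K u + 3 * P)"
    "P \<le> Yg N \<rho> K u"
proof -
  let ?f = "jt N u" and ?Y = "Yg N \<rho> K u"
  have f: "jet ?f" by (rule jet_jt)
  have Df: "norm (cl (?f k)) = D k" for k by (simp add: D_def realband_jt(1)[OF u])
  define s where "s k = sqrt (2 * D k * D (Suc k))" for k
  have sb: "\<bar>?f k x\<bar> \<le> s k" for k x
    using jet_agmon[OF f, of k x] unfolding Df s_def by (metis real_sqrt_abs real_sqrt_le_iff)
  have Yeq: "?Y = (\<Sum>k\<le>K. (wt \<rho> k * D k)\<^sup>2)" by (simp add: Yg_def D_def)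
  have D0: "D k \<ge> 0" for k by (simp add: D_def)
  let ?H = "\<Sum>j=1..K-1. hw \<rho> s j"
  have H1: "?H \<le> H" using hw_tail[OF \<rho>(1,2) D0 K] unfolding Yeq H_def s_def by (simp add: numeral_2_eq_2)
  have H0: "?H \<ge> 0" using \<rho> D0 by (intro sum_nonneg) (simp add: hw_def s_def)
  have s00: "s 0 = s0" "s0 \<ge> 0" using D0 by (simp_all add: s_def s0_def)
  have C0: "Cnl \<ge> 0" by (simp add: Cnl_def)
  let ?Z = "\<Sum>k\<le>K. (xw \<rho> D k)\<^sup>2"
  have b3: "(\<Sum>k\<le>2. (wt \<rho> k * D k)\<^sup>2) = P"
    by (simp add: P_def wt_def numeral_2_eq_2 fact_numeral)
  show "P \<le> ?Y" unfolding b3[symmetric] Yeq using K by (intro sum_mono2) auto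
  have Zle: "?Z \<le> 4 * Zm N \<rho> K u + 3 * P"
  proof -
    have "?Z = (\<Sum>k\<le>K. (real k + 1) * (wt \<rho> k * D k)\<^sup>2)"
      by (simp add: xw_def power_mult_distrib)
    also have "\<dots> \<le> (\<Sum>k\<le>K. 4 * (real (k - 2) * (wt \<rho> k * D k)\<^sup>2) + (if k \<le> 2 then 3 * (wt \<rho> k * D k)\<^sup>2 else 0))"
    proof (rule sum_mono)
      fix k
      \<comment> \<open>Equality holds at \<open>k = 2\<close> and \<open>k = 3\<close>, which fixes
        the constants 3 and 4.\<close>
      have "real k + 1 \<le> 4 * real (k - 2) + (if k \<le> 2 then 3 else 0)" by auto
      from mult_right_mono[OF this, of "(wt \<rho> k * D k)\<^sup>2"]
      show "(real k + 1) * (wt \<rho> k * D k)\<^sup>2 \<le> 4 * (real (k - 2) * (wt \<rho> k * D k)\<^sup>2) + (if k \<le> 2 then 3 * (wt \<rho> k * D k)\<^sup>2 else 0)"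
        by (auto simp: algebra_simps split: if_splits)
    qed
    also have "\<dots> = 4 * Zm N \<rho> K u + (\<Sum>k\<le>K. if k \<le> 2 then 3 * (wt \<rho> k * D k)\<^sup>2 else 0)"
      by (simp add: Zm_def D_def sum.distrib sum_distrib_left)
    also have "(\<Sum>k\<le>K. if k \<le> 2 then 3 * (wt \<rho> k * D k)\<^sup>2 else 0) = (\<Sum>k\<in>{k\<in>{..K}. k \<le> 2}. 3 * (wt \<rho> k * D k)\<^sup>2)"
      by (rule sum.inter_filter[symmetric]) simp
    also have "{k\<in>{..K}. k \<le> 2} = {..2}" using K by auto
    also have "(\<Sum>k\<le>2. 3 * (wt \<rho> k * D k)\<^sup>2) = 3 * P" by (simp only: b3 sum_distrib_left[symmetric])
    finally show ?thesis .
  qed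
  have Z0: "?Z \<ge> 0" by (intro sum_nonneg) simp
  have "(\<Sum>k\<le>K. (wt \<rho> k)\<^sup>2 * (dN N k u \<bullet> dN N k (X N u)))
    = (\<Sum>k\<le>K. (wt \<rho> k)\<^sup>2 * - (cl (?f k) \<bullet> cl (hj ?f (Suc k)))) + (\<Sum>k\<le>K. (wt \<rho> k)\<^sup>2 * - (cl (?f k) \<bullet> cl (jprod aj ?f k)))"
    by (simp add: X_inner[OF u] sum.distrib[symmetric] distrib_left[symmetric] right_diff_distrib)
  also have "\<dots> \<le> Cnl * (1 + s 0 + ?H) * ?H * ?Z
     + (- \<gamma> * ?Y + (8 * \<rho> / \<sigma>0 * Asum * ?Y + 16 * Econst * Asum * (D 0 + D 1) * sqrt ?Y))"
    using nonlinear_sum[OF f \<rho>(1,2) K sb] damping_sum[OF f \<rho>, of K] unfolding Df Yeq by (rule add_mono)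
  also have "Cnl * (1 + s 0 + ?H) * ?H * ?Z \<le> Cnl * (1 + s0 + H) * H * (4 * Zm N \<rho> K u + 3 * P)"
    unfolding s00(1) using C0 H0 H1 Z0 Zle s00(2) by (intro mult_mono mult_nonneg_nonneg) auto
  finally show "(\<Sum>k\<le>K. (wt \<rho> k)\<^sup>2 * (dN N k u \<bullet> dN N k (X N u))) \<le>
    - \<gamma> * ?Y + (8 * \<rho> / \<sigma>0 * Asum * ?Y + 16 * Econst * Asum * (D 0 + D 1) * sqrt ?Y)
    + Cnl * (1 + s0 + H) * H * (4 * Zm N \<rho> K u + 3 * P)" by linarith
qed

text \<open>\<open>\<epsilon>\<close> plays the role of \<open>exp(-\<gamma>t/8)\<close>: the \<open>L\<^sup>2\<close> norm decays like \<open>\<epsilon>^8\<close>, interpolation with the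
  second derivative gives \<open>\<epsilon>^4\<close> for the first derivative and \<open>\<epsilon>\<^sup>2\<close> for its supremum.\<close>

lemma gevrey_closed_inequality:
  assumes R: "R \<ge> 0" and B: "B \<ge> 0"
  shows "\<exists>\<Lambda> C7 c4. \<Lambda> \<ge> 0 \<and> C7 \<ge> 0 \<and> c4 \<ge> 0 \<and> (\<forall>N u \<rho> K M \<epsilon>. realband N u \<longrightarrow> 0 < \<rho> \<longrightarrow> \<rho> \<le> 1 \<longrightarrow> \<rho> \<le> \<sigma>0 / 8 \<longrightarrow> K \<ge> 3 \<longrightarrow>
     0 < \<epsilon> \<longrightarrow> \<epsilon> \<le> 1 \<longrightarrow> norm (dN N 0 u) \<le> R * \<epsilon> ^ 8 \<longrightarrow> norm (dN N 2 u) \<le> B \<longrightarrow>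
     Yg N \<rho> K u \<le> 4 * M\<^sup>2 * \<epsilon>\<^sup>2 \<longrightarrow> M \<ge> 0 \<longrightarrow> 2 * M * sqrt \<rho> \<le> 1 \<longrightarrow> c4 * sqrt \<rho> \<le> \<gamma> / 4 \<longrightarrow> 16 * \<rho> / \<sigma>0 * Asum \<le> \<gamma> / 4 \<longrightarrow>
     - 2 * (\<Lambda> * \<epsilon>) * Zm N \<rho> K u + 2 * (\<Sum>k\<le>K. (wt \<rho> k)\<^sup>2 * (dN N k u \<bullet> dN N k (X N u))) \<le> - \<gamma> * Yg N \<rho> K u + C7 * \<epsilon>\<^sup>2)"
proof -
  \<comment> \<open>By interpolation \<open>d1 * \<epsilon>^4\<close> bounds the first derivative,
    \<open>c0\<close> the sup norm, \<open>c1 * \<epsilon>^2\<close> the sup norm of the first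
    derivative, and \<open>B3\<close> bounds \<open>P\<close>. None of them involves
    \<open>M\<close>.\<close>
  define d1 where "d1 = sqrt (R * B)"
  define c0 where "c0 = sqrt (2 * R * d1)"
  define c1 where "c1 = sqrt (2 * d1 * B)"
  define C3 where "C3 = Cnl * (2 + c0 + c1)"
  define B3 where "B3 = R\<^sup>2 + (8 * d1)\<^sup>2 + (27/2 * B)\<^sup>2"
  define \<Lambda> where "\<Lambda> = 4 * C3 * (c1 + 1)"
  define c4 where "c4 = 6 * C3 * sqrt B3"
  define F where "F = 32 * Econst * Asum"
  define C7 where "C7 = 6 * C3 * c1 * B3 + F\<^sup>2 * (R + d1)\<^sup>2 / (2 * \<gamma>)"
  have E: "Econst \<ge> 0" using sigma0 by (simp add: Econst_def)
  have nn: "d1 \<ge> 0" "c0 \<ge> 0" "c1 \<ge> 0" "C3 \<ge> 0" "B3 \<ge> 0" "F \<ge> 0"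
    using R B E Asum_nonneg by (simp_all add: d1_def c0_def c1_def C3_def B3_def F_def Cnl_def)
  have main: "- 2 * (\<Lambda> * \<epsilon>) * Zm N \<rho> K u + 2 * (\<Sum>k\<le>K. (wt \<rho> k)\<^sup>2 * (dN N k u \<bullet> dN N k (X N u))) \<le> - \<gamma> * Yg N \<rho> K u + C7 * \<epsilon>\<^sup>2"
    if u: "realband N u" and \<rho>: "0 < \<rho>" "\<rho> \<le> 1" "\<rho> \<le> \<sigma>0 / 8" and K: "K \<ge> 3" and e: "0 < \<epsilon>" "\<epsilon> \<le> 1"
      and u0: "norm (dN N 0 u) \<le> R * \<epsilon> ^ 8" and u2: "norm (dN N 2 u) \<le> B" and Y: "Yg N \<rho> K u \<le> 4 * M\<^sup>2 * \<epsilon>\<^sup>2" and M: "M \<ge> 0"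
      and M\<rho>: "2 * M * sqrt \<rho> \<le> 1" and c4: "c4 * sqrt \<rho> \<le> \<gamma> / 4" and A\<rho>: "16 * \<rho> / \<sigma>0 * Asum \<le> \<gamma> / 4"
    for N u \<rho> K M \<epsilon>
  proof -
    let ?Y = "Yg N \<rho> K u"
    define D where "D k = norm (dN N k u)" for k
    have D0: "D k \<ge> 0" for k by (simp add: D_def)
    have ep: "\<epsilon> ^ n \<le> 1" for n using e by (intro power_le_one) auto
    have ep2: "\<epsilon> ^ 8 \<le> \<epsilon>\<^sup>2" "\<epsilon> ^ 4 \<le> \<epsilon>\<^sup>2" "\<epsilon>\<^sup>2 \<le> \<epsilon>" "\<epsilon> ^ 4 \<le> 1" using e power_decreasing[of _ _ \<epsilon>] ep power_decreasing[of 1 2 \<epsilon>] by auto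
    have Dz: "D 0 \<le> R * \<epsilon> ^ 8" "D 2 \<le> B" using u0 u2 by (simp_all add: D_def)
    have D1: "D 1 \<le> d1 * \<epsilon> ^ 4"
    proof (rule power2_le_imp_le)
      have "(D 1)\<^sup>2 \<le> D 0 * D 2"
        using jet_interp[OF jet_jt[of N u], of 0] by (simp add: realband_jt(1)[OF u] D_def numeral_2_eq_2)
      also have "\<dots> \<le> (R * \<epsilon> ^ 8) * B" using D0 R e by (intro mult_mono Dz) auto
      also have "\<dots> = (d1 * \<epsilon> ^ 4)\<^sup>2" using R B by (simp add: d1_def power_mult_distrib power_mult[symmetric])
      finally show "(D 1)\<^sup>2 \<le> (d1 * \<epsilon> ^ 4)\<^sup>2" .
    qed (use nn e in simp)
    have D0': "D 0 \<le> R" "D 1 \<le> d1"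
      using Dz(1) D1 mult_left_mono[OF ep[of 8] R] mult_left_mono[OF ep[of 4] nn(1)] by auto
    have Dz2: "D 0 + D 1 \<le> (R + d1) * \<epsilon>\<^sup>2"
      using Dz(1) D1 mult_left_mono[OF ep2(1) R] mult_left_mono[OF ep2(2) nn(1)] by (simp add: distrib_right)
    define s0 where "s0 = sqrt (2 * D 0 * D 1)"
    have s0: "0 \<le> s0" "s0 \<le> c0" using D0' D0 R unfolding s0_def c0_def by (auto intro!: real_sqrt_le_mono mult_mono)
    have s1: "sqrt (2 * D 1 * D 2) \<le> c1 * \<epsilon>\<^sup>2"
    proof -
      have "2 * D 1 * D 2 \<le> 2 * (d1 * \<epsilon> ^ 4) * B" using D1 Dz(2) D0 nn e by (intro mult_mono) auto
      also have "\<dots> = (c1 * \<epsilon>\<^sup>2)\<^sup>2" using nn B by (simp add: c1_def power_mult_distrib power_mult[symmetric])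
      finally show ?thesis using nn by (intro real_le_lsqrt) auto
    qed
    define q where "q = sqrt (\<rho> * ?Y)"
    define H where "H = sqrt (2 * D 1 * D 2) + q"
    have q0: "q \<ge> 0" using \<rho> Yg_nonneg by (simp add: q_def)
    \<comment> \<open>The only use of the hypothetical bound on \<open>Yg\<close>: the smallness of
      \<open>M * sqrt \<rho>\<close> brings the higher sup norms down to size
      \<open>\<epsilon>\<close>, independently of \<open>M\<close>.\<close>
    have qe: "q \<le> \<epsilon>"
    proof -
      have "sqrt ?Y \<le> 2 * M * \<epsilon>" using Y M e by (intro real_le_lsqrt Yg_nonneg) (auto simp: power_mult_distrib)
      then have "sqrt \<rho> * sqrt ?Y \<le> sqrt \<rho> * (2 * M * \<epsilon>)" using \<rho> by (intro mult_left_mono) auto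
      also have "\<dots> = (2 * M * sqrt \<rho>) * \<epsilon>" by simp
      also have "\<dots> \<le> 1 * \<epsilon>" using M\<rho> e by (intro mult_right_mono) auto
      finally show ?thesis by (simp add: q_def real_sqrt_mult)
    qed
    have H0: "H \<ge> 0" using q0 D0 by (simp add: H_def)
    have H1: "H \<le> (c1 + 1) * \<epsilon>" "H \<le> c1 * \<epsilon>\<^sup>2 + q"
      using s1 qe mult_left_mono[OF ep2(3) nn(3)] by (auto simp: H_def distrib_right)
    have H2: "H \<le> c1 + 1" 
    proof -
      have "(c1 + 1) * \<epsilon> \<le> (c1 + 1) * 1" using nn e by (intro mult_left_mono) auto
      then show ?thesis using H1(1) by simp
    qed
    define \<Gamma> where "\<Gamma> = Cnl * (1 + s0 + H) * H"
    have G: "\<Gamma> \<le> C3 * H" unfolding \<Gamma>_def C3_def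
      using H0 H2 s0 nn by (intro mult_right_mono mult_left_mono) (auto simp: Cnl_def)
    have G0: "\<Gamma> \<ge> 0" unfolding \<Gamma>_def using H0 s0 by (simp add: Cnl_def)
    define P where "P = (D 0)\<^sup>2 + (8 * D 1)\<^sup>2 + (27/2 * D 2)\<^sup>2"
    have P0: "P \<ge> 0" by (simp add: P_def)
    have PB: "P \<le> B3" unfolding P_def B3_def using D0' Dz(2) D0 by (intro add_mono power_mono mult_left_mono) auto
    note st = gevrey_inequality[OF u \<rho> K, folded D_def, folded s0_def, folded q_def, folded H_def, folded P_def, folded \<Gamma>_def]
    have PY: "P \<le> ?Y" by (rule st(2))
    \<comment> \<open>\<open>P\<close> is bounded both by a constant and by \<open>Yg\<close>. Their
      geometric mean pairs with \<open>q = sqrt (\<rho> * Yg)\<close> to give a multiple of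
      \<open>Yg\<close> with the small factor \<open>sqrt \<rho>\<close>.\<close>
    have Psq: "P \<le> sqrt B3 * sqrt ?Y"
    proof -
      have "P * P \<le> B3 * ?Y" using PB PY P0 nn by (intro mult_mono) auto
      then have "sqrt (P * P) \<le> sqrt (B3 * ?Y)" by (rule real_sqrt_le_mono)
      then show ?thesis using P0 by (simp add: real_sqrt_mult)
    qed
    have t1: "8 * \<Gamma> * Zm N \<rho> K u \<le> 2 * (\<Lambda> * \<epsilon>) * Zm N \<rho> K u"
    proof (rule mult_right_mono[OF _ Zm_nonneg])
      have "\<Gamma> \<le> C3 * ((c1 + 1) * \<epsilon>)" by (rule order_trans[OF G mult_left_mono[OF H1(1) nn(4)]])
      then show "8 * \<Gamma> \<le> 2 * (\<Lambda> * \<epsilon>)" by (simp add: \<Lambda>_def)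
    qed
    have t2: "6 * \<Gamma> * P \<le> 6 * C3 * c1 * B3 * \<epsilon>\<^sup>2 + \<gamma> / 4 * ?Y"
    proof -
      have "\<Gamma> * P \<le> (C3 * (c1 * \<epsilon>\<^sup>2 + q)) * P"
        by (intro mult_right_mono P0 order_trans[OF G] mult_left_mono H1 nn)
      also have "\<dots> = C3 * c1 * \<epsilon>\<^sup>2 * P + C3 * q * P" by (simp add: algebra_simps)
      also have "\<dots> \<le> C3 * c1 * \<epsilon>\<^sup>2 * B3 + C3 * q * (sqrt B3 * sqrt ?Y)"
        using nn q0 by (intro add_mono mult_left_mono PB Psq) auto
      also have "C3 * q * (sqrt B3 * sqrt ?Y) = (C3 * sqrt B3 * sqrt \<rho>) * ?Y"
        using Yg_nonneg[of N \<rho> K u] by (simp add: q_def real_sqrt_mult)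
      finally have "6 * (\<Gamma> * P) \<le> 6 * (C3 * c1 * \<epsilon>\<^sup>2 * B3) + (c4 * sqrt \<rho>) * ?Y" by (simp add: c4_def)
      also have "(c4 * sqrt \<rho>) * ?Y \<le> \<gamma> / 4 * ?Y" by (intro mult_right_mono c4 Yg_nonneg)
      finally show ?thesis by (simp add: mult_ac)
    qed
    have t3: "2 * (8 * \<rho> / \<sigma>0 * Asum * ?Y) \<le> \<gamma> / 4 * ?Y"
      using mult_right_mono[OF A\<rho> Yg_nonneg, of N \<rho> K u] by simp
    have t4: "2 * (16 * Econst * Asum * (D 0 + D 1) * sqrt ?Y) \<le> \<gamma> / 2 * ?Y + F\<^sup>2 * (R + d1)\<^sup>2 / (2 * \<gamma>) * \<epsilon>\<^sup>2"
    proof -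
      define a where "a = F * ((R + d1) * \<epsilon>\<^sup>2)"
      define y where "y = sqrt ?Y"
      have y2: "?Y = y\<^sup>2" using Yg_nonneg by (simp add: y_def)
      have "2 * (16 * Econst * Asum * (D 0 + D 1) * sqrt ?Y) = F * (D 0 + D 1) * y" by (simp add: F_def y_def)
      also have "\<dots> \<le> a * y" unfolding a_def using Yg_nonneg by (intro mult_right_mono mult_left_mono Dz2 nn) (simp add: y_def)
      \<comment> \<open>Young's inequality, weighted so that exactly half of \<open>\<gamma>\<close>
        is spent.\<close>
      also have "\<dots> \<le> \<gamma> / 2 * y\<^sup>2 + a\<^sup>2 / (2 * \<gamma>)"
      proof -
        have "0 \<le> (\<gamma> * y - a)\<^sup>2 / (2 * \<gamma>)" using gamma by simp
        also have "\<dots> = \<gamma> / 2 * y\<^sup>2 + a\<^sup>2 / (2 * \<gamma>) - a * y"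
          using gamma by (simp add: power2_diff field_simps power2_eq_square)
        finally show ?thesis by simp
      qed
      also have "a\<^sup>2 / (2 * \<gamma>) \<le> F\<^sup>2 * (R + d1)\<^sup>2 / (2 * \<gamma>) * \<epsilon>\<^sup>2"
      proof -
        have "a\<^sup>2 = F\<^sup>2 * (R + d1)\<^sup>2 * \<epsilon> ^ 4" by (simp add: a_def power_mult_distrib power_mult[symmetric])
        also have "\<dots> \<le> F\<^sup>2 * (R + d1)\<^sup>2 * \<epsilon>\<^sup>2" by (intro mult_left_mono ep2) simp
        finally show ?thesis using gamma by (simp add: divide_right_mono)
      qed
      finally show ?thesis by (simp add: y2)
    qed
    \<comment> \<open>Budget: of the damping \<open>2 * \<gamma>\<close> a quarter of
      \<open>\<gamma>\<close> goes to \<open>t2\<close>, a quarter to \<open>t3\<close> and a half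
      to \<open>t4\<close>, leaving \<open>\<gamma>\<close>; \<open>t1\<close> is covered by the
      shrinking radius.\<close>
    have "2 * (\<Sum>k\<le>K. (wt \<rho> k)\<^sup>2 * (dN N k u \<bullet> dN N k (X N u))) \<le>
      - 2 * \<gamma> * ?Y + 2 * (8 * \<rho> / \<sigma>0 * Asum * ?Y) + 2 * (16 * Econst * Asum * (D 0 + D 1) * sqrt ?Y)
      + 8 * \<Gamma> * Zm N \<rho> K u + 6 * \<Gamma> * P"
    proof -
      have "\<Gamma> * (4 * Zm N \<rho> K u + 3 * P) = 4 * (\<Gamma> * Zm N \<rho> K u) + 3 * (\<Gamma> * P)" by (simp add: algebra_simps)
      with st(1) show ?thesis by (simp only: mult.assoc)
    qed
    then show ?thesis using t1 t2 t3 t4 unfolding C7_def distrib_right by linarith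
  qed
  have "\<Lambda> \<ge> 0" "C7 \<ge> 0" "c4 \<ge> 0" using nn gamma by (simp_all add: \<Lambda>_def C7_def c4_def)
  then show ?thesis
    by - (rule exI[of _ \<Lambda>], rule exI[of _ C7], rule exI[of _ c4], intro conjI allI impI, assumption+, rule main; assumption)
qed

text \<open>\<open>(k + 1)^3 \<le> 8 ^ k\<close> and \<open>16 * \<rho> \<le> \<sigma>0\<close> give
  terms decreasing like \<open>(1/2) ^ k\<close>. The other summands of the constant make up for the
  powers of \<open>\<rho>\<close> absent from the weights of low order.\<close>

lemma dN_norm_initial:
  assumes "\<And>k. norm (dN N k u0) \<le> R * fact k / \<sigma>0 ^ k" and R: "R \<ge> 0"
    and \<rho>: "0 < \<rho>" "\<rho> \<le> 1" "\<rho> \<le> \<sigma>0 / 16"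
  shows "Yg N \<rho> K u0 \<le> 2 * (R * (256 / \<sigma>0\<^sup>2 + 16 / \<sigma>0 + 1))\<^sup>2"
proof -
  define Q where "Q = 256 / \<sigma>0\<^sup>2 + 16 / \<sigma>0 + 1"
  have Q: "Q \<ge> 1" "256 / \<sigma>0\<^sup>2 \<le> Q" "16 / \<sigma>0 \<le> Q" using sigma0 by (simp_all add: Q_def)
  have w: "wt \<rho> k * (fact k / \<sigma>0 ^ k) \<le> Q * (1/2) ^ k" for k
  proof -
    have "wt \<rho> k * (fact k / \<sigma>0 ^ k) = \<rho> ^ (k - 2) * (real k + 1) ^ 3 / \<sigma>0 ^ k" by (simp add: wt_def)
    also have "\<dots> \<le> Q * (1/2) ^ k"
    proof -
      consider "k = 0" | "k = 1" | i where "k = i + 2" by (metis One_nat_def Suc_1 add.commute add_2_eq_Suc' not0_implies_Suc)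
      then show ?thesis
      proof cases
        case 3
        have p2: "real k + 1 \<le> 2 ^ k" using of_nat_less_two_power[of k, where 'a=real] by (induction k) auto
        have "\<rho> ^ (k - 2) * (real k + 1) ^ 3 / \<sigma>0 ^ k \<le> (\<sigma>0 / 16) ^ i * (2 ^ k) ^ 3 / \<sigma>0 ^ k"
        proof (intro divide_right_mono mult_mono power_mono)
          show "\<rho> ^ (k - 2) \<le> (\<sigma>0 / 16) ^ i" using power_mono[OF \<rho>(3), of i] \<rho>(1) 3 by simp
        qed (use \<rho> sigma0 p2 in auto)
        also have "\<dots> = 256 / \<sigma>0\<^sup>2 * (1/2) ^ k"
        proof -
          have "(2 ^ k) ^ 3 = (64 * 8 ^ i :: real)" unfolding 3 by (simp add: power_add power_mult_distrib power_mult[symmetric] mult.commute[of i]) (simp add: power_mult)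
          moreover have "(1/2) ^ k = (1/4 :: real) * (1/2) ^ i" using 3 by (simp add: power_add power2_eq_square)
          moreover have "(1/2) ^ i = (8 / 16 :: real) ^ i" by simp
          moreover have "(2 :: real) ^ i * 8 ^ i = 16 ^ i" by (simp add: power_mult_distrib[symmetric])
          ultimately show ?thesis using sigma0 3 by (simp add: power_add power_divide power2_eq_square field_simps)
        qed
        also have "\<dots> \<le> Q * (1/2) ^ k" by (intro mult_right_mono Q) auto
        finally show ?thesis .
      qed (use Q in auto)
    qed
    finally show ?thesis .
  qed
  have wp: "wt \<rho> k \<ge> 0" for k using wt_pos[OF \<rho>(1), of k] by simp
  have "Yg N \<rho> K u0 \<le> (\<Sum>k\<le>K. (R * Q)\<^sup>2 * (1/4) ^ k)"
    unfolding Yg_def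
  proof (rule sum_mono)
    fix k
    have "wt \<rho> k * norm (dN N k u0) \<le> wt \<rho> k * (R * fact k / \<sigma>0 ^ k)" by (intro mult_left_mono assms wp)
    also have "\<dots> = R * (wt \<rho> k * (fact k / \<sigma>0 ^ k))" by simp
    also have "\<dots> \<le> R * (Q * (1/2) ^ k)" by (intro mult_left_mono w R)
    finally have "(wt \<rho> k * norm (dN N k u0))\<^sup>2 \<le> (R * Q * (1/2) ^ k)\<^sup>2" using wp by (intro power_mono) auto
    also have "\<dots> = (R * Q)\<^sup>2 * (1/4) ^ k"
      by (simp add: power_mult_distrib power_mult[symmetric] mult.commute[of k 2]) (simp add: power_mult power_divide)
    finally show "(wt \<rho> k * norm (dN N k u0))\<^sup>2 \<le> (R * Q)\<^sup>2 * (1/4) ^ k" .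
  qed
  also have "\<dots> = (R * Q)\<^sup>2 * (\<Sum>k\<le>K. (1/4) ^ k)" by (simp add: sum_distrib_left)
  also have "\<dots> \<le> (R * Q)\<^sup>2 * 2"
  proof (rule mult_left_mono)
    have "(\<Sum>k\<le>K. (1/4) ^ k) \<le> (\<Sum>k. (1/4 :: real) ^ k)" by (intro sum_le_suminf) auto
    also have "(\<Sum>k. (1/4 :: real) ^ k) \<le> 2" by (simp add: suminf_geometric)
    finally show "(\<Sum>k\<le>K. (1/4 :: real) ^ k) \<le> 2" .
  qed simp
  finally show ?thesis by (simp only: Q_def mult.commute[of _ 2])
qed

text \<open>What membership of the data in the space of radius \<open>\<sigma>0\<close> is used for,
  uniformly in the cutoff. All constants of the uniform bound depend on the data through
  \<open>R\<close> only.\<close>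

definition admissible :: "real \<Rightarrow> l2 \<Rightarrow> bool" where
  "admissible R u0 \<longleftrightarrow> cj u0 = u0 \<and> norm u0 \<le> R \<and> (\<forall>N\<ge>0. \<forall>k. norm (dN N k u0) \<le> R * fact k / \<sigma>0 ^ k)"

text \<open>Constants are fixed in the order \<open>R2\<close>, \<open>B\<close>, then
  \<open>\<Lambda>\<close>, \<open>C7\<close>, \<open>c4\<close>, then \<open>M\<close>,
  \<open>q\<close>, \<open>r\<close>, each from earlier ones; that no choice refers to a later one
  is the point of the preceding estimates.\<close>

lemma gevrey_bound:
  assumes R: "R \<ge> 0"
  shows "\<exists>r>0. \<exists>M. \<forall>u0 N K t. admissible R u0 \<longrightarrow> N \<ge> 0 \<longrightarrow> K \<ge> 3 \<longrightarrow> t \<ge> 0 \<longrightarrow> Yg N r K (gal N u0 t) \<le> M"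
proof -
  define R2 where "R2 = R + R * 2 / \<sigma>0\<^sup>2"
  have R2: "R2 \<ge> 0" using R by (simp add: R2_def)
  obtain B where B: "B \<ge> 0" and BB: "\<And>N u0 t. N \<ge> 0 \<Longrightarrow> cj u0 = u0 \<Longrightarrow> norm u0 \<le> R2 \<Longrightarrow> norm (dN N 2 u0) \<le> R2 \<Longrightarrow> t \<ge> 0 \<Longrightarrow>
    norm (dN N 2 (gal N u0 t)) \<le> B"
    using H2_bound[OF R2] by blast
  from gevrey_closed_inequality[OF R B] obtain \<Lambda> C7 c4 where L0: "\<Lambda> \<ge> 0 \<and> C7 \<ge> 0 \<and> c4 \<ge> 0 \<and> (\<forall>N u \<rho> K M \<epsilon>. realband N u \<longrightarrow> 0 < \<rho> \<longrightarrow> \<rho> \<le> 1 \<longrightarrow> \<rho> \<le> \<sigma>0 / 8 \<longrightarrow> K \<ge> 3 \<longrightarrow>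
     0 < \<epsilon> \<longrightarrow> \<epsilon> \<le> 1 \<longrightarrow> norm (dN N 0 u) \<le> R * \<epsilon> ^ 8 \<longrightarrow> norm (dN N 2 u) \<le> B \<longrightarrow>
     Yg N \<rho> K u \<le> 4 * M\<^sup>2 * \<epsilon>\<^sup>2 \<longrightarrow> M \<ge> 0 \<longrightarrow> 2 * M * sqrt \<rho> \<le> 1 \<longrightarrow> c4 * sqrt \<rho> \<le> \<gamma> / 4 \<longrightarrow> 16 * \<rho> / \<sigma>0 * Asum \<le> \<gamma> / 4 \<longrightarrow>
     - 2 * (\<Lambda> * \<epsilon>) * Zm N \<rho> K u + 2 * (\<Sum>k\<le>K. (wt \<rho> k)\<^sup>2 * (dN N k u \<bullet> dN N k (X N u))) \<le> - \<gamma> * Yg N \<rho> K u + C7 * \<epsilon>\<^sup>2)"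
    by (elim exE)
  note L = conjunct1[OF L0] conjunct1[OF conjunct2[OF L0]] conjunct1[OF conjunct2[OF conjunct2[OF L0]]]
  note ineq = conjunct2[OF conjunct2[OF conjunct2[OF L0]], rule_format]
  define Y0 where "Y0 = 2 * (R * (256 / \<sigma>0\<^sup>2 + 16 / \<sigma>0 + 1))\<^sup>2"
  \<comment> \<open>\<open>Y0\<close> bounds the initial energy, and the quotient is the response in
    \<open>gronwall_decay_exp\<close> to a forcing decaying at rate \<open>\<gamma> / 4\<close>. The
    bootstrap thus improves \<open>4 * M^2\<close> to \<open>m = M^2\<close>.\<close>
  define m where "m = Y0 + C7 / (\<gamma> - \<gamma> / 4) + 1"
  define M where "M = sqrt m"
  have m: "m > 0" "Y0 + C7 / (\<gamma> - \<gamma> / 4) < m" using L gamma by (auto simp: m_def Y0_def intro!: add_nonneg_pos add_nonneg_nonneg)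
  have M: "M > 0" "M\<^sup>2 = m" using m by (simp_all add: M_def)
  \<comment> \<open>One entry for each smallness condition in \<open>small\<close>. Radii stay below
    \<open>q^2\<close> because two of the conditions concern \<open>sqrt \<rho>\<close>; the added
    ones avoid division by zero.\<close>
  define q where "q = min 1 (min (\<sigma>0 / 16) (min (1 / (2 * M)) (min (\<gamma> / (4 * c4 + 1)) (\<gamma> * \<sigma>0 / (64 * Asum + 1)))))"
  have q0: "q > 0" using sigma0 M gamma L Asum_nonneg by (simp add: q_def add_nonneg_pos)
  have q: "q \<le> 1" "q \<le> \<sigma>0 / 16" "q \<le> 1 / (2 * M)" "q \<le> \<gamma> / (4 * c4 + 1)" "q \<le> \<gamma> * \<sigma>0 / (64 * Asum + 1)"
    unfolding q_def by (meson min.cobounded1 min.cobounded2 order_trans)+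
  have small: "\<rho> \<le> 1" "\<rho> \<le> \<sigma>0 / 16" "\<rho> \<le> \<sigma>0 / 8" "2 * M * sqrt \<rho> \<le> 1" "c4 * sqrt \<rho> \<le> \<gamma> / 4" "16 * \<rho> / \<sigma>0 * Asum \<le> \<gamma> / 4"
    if r: "0 < \<rho>" "\<rho> \<le> q\<^sup>2" for \<rho>
  proof -
    have qq: "q\<^sup>2 \<le> q" using q0 q(1) by (simp add: power2_eq_square mult_left_le)
    then have \<rho>q: "\<rho> \<le> q" using r by simp
    have sq: "sqrt \<rho> \<le> q" using r q0 by (intro real_le_lsqrt) auto
    show "\<rho> \<le> 1" "\<rho> \<le> \<sigma>0 / 16" using \<rho>q q by linarith+
    then show "\<rho> \<le> \<sigma>0 / 8" using sigma0 by linarith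
    have "sqrt \<rho> \<le> 1 / (2 * M)" using sq q(3) by linarith
    then show "2 * M * sqrt \<rho> \<le> 1" using M by (simp add: field_simps)
    have "c4 * sqrt \<rho> \<le> c4 * (\<gamma> / (4 * c4 + 1))" using sq q(4) L by (intro mult_left_mono) auto
    also have "\<dots> \<le> \<gamma> / 4" using L gamma by (simp add: field_simps add_nonneg_pos)
    finally show "c4 * sqrt \<rho> \<le> \<gamma> / 4" .
    have "16 * \<rho> / \<sigma>0 * Asum \<le> 16 * (\<gamma> * \<sigma>0 / (64 * Asum + 1)) / \<sigma>0 * Asum"
      using \<rho>q q(5) sigma0 Asum_nonneg by (intro mult_right_mono divide_right_mono mult_left_mono) auto
    also have "\<dots> = 16 * \<gamma> * Asum / (64 * Asum + 1)" using sigma0 by simp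
    also have "\<dots> \<le> \<gamma> / 4" using Asum_nonneg gamma by (simp add: field_simps add_nonneg_pos)
    finally show "16 * \<rho> / \<sigma>0 * Asum \<le> \<gamma> / 4" .
  qed
  define \<delta> where "\<delta> = \<gamma> / 8"
  have d: "\<delta> > 0" using gamma by (simp add: \<delta>_def)
  define r where "r = q\<^sup>2 * exp (- \<Lambda> / \<delta>)"
  \<comment> \<open>the solution of \<open>\<rho>' = - \<Lambda> exp(-\<delta>t) \<rho>\<close> that tends to \<open>r\<close>\<close>
  define \<rho> where "\<rho> t = r * exp (\<Lambda> / \<delta> * exp (- \<delta> * t))" for t
  have r: "r > 0" using q0 by (simp add: r_def)
  have \<rho>0: "\<rho> t > 0" for t using r by (simp add: \<rho>_def)
  have \<rho>b: "r \<le> \<rho> t" "\<rho> t \<le> q\<^sup>2" if "t \<ge> 0" for t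
  proof -
    have "1 \<le> exp (\<Lambda> / \<delta> * exp (- \<delta> * t))" using L d by simp
    then show "r \<le> \<rho> t" using r by (simp add: \<rho>_def)
    have "\<Lambda> / \<delta> * exp (- \<delta> * t) \<le> \<Lambda> / \<delta> * 1" using L d that by (intro mult_left_mono) auto
    then have "\<rho> t \<le> r * exp (\<Lambda> / \<delta>)" unfolding \<rho>_def using r by (intro mult_left_mono) auto
    also have "\<dots> = q\<^sup>2" by (simp add: r_def exp_minus)
    finally show "\<rho> t \<le> q\<^sup>2" .
  qed
  have \<rho>d: "(\<rho> has_real_derivative - (\<Lambda> * exp (- \<delta> * t)) * \<rho> t) (at t within S)" for t S
    unfolding \<rho>_def by (rule derivative_eq_intros refl | use d in simp)+
  have main: "Yg N (\<rho> t1) K (gal N u0 t1) \<le> 4 * M\<^sup>2"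
    if a: "admissible R u0" and N: "N \<ge> 0" and K: "K \<ge> 3" and t1: "t1 \<ge> 0" for u0 N K t1
  proof -
    have u0: "cj u0 = u0" "norm u0 \<le> R" "\<And>k. norm (dN N k u0) \<le> R * fact k / \<sigma>0 ^ k"
      using a N by (auto simp: admissible_def)
    let ?u = "gal N u0"
    note g = gal[OF N u0(1)]
    define y where "y t = Yg N (\<rho> t) K (?u t)" for t
    define y' where "y' t = - 2 * (\<Lambda> * exp (- \<delta> * t)) * Zm N (\<rho> t) K (?u t)
       + 2 * (\<Sum>k\<le>K. (wt (\<rho> t) k)\<^sup>2 * (dN N k (?u t) \<bullet> dN N k (X N (?u t))))" for t
    have yd: "(y has_real_derivative y' t) (at t within {0..T})" if "t \<in> {0..T}" for t T
      unfolding y_def[abs_def] y'_def using that by (intro Yg_deriv g \<rho>d \<rho>0) auto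
    have y0: "y 0 \<le> Y0"
    proof -
      have "y 0 = Yg N (\<rho> 0) K u0" by (simp add: y_def g(1) Yg_def dN_dN)
      also have "\<dots> \<le> Y0" unfolding Y0_def using small[OF \<rho>0 \<rho>b(2), of 0] by (intro dN_norm_initial u0 R \<rho>0) auto
      finally show ?thesis .
    qed
    have bnd: "norm (dN N 2 (?u t)) \<le> B" if "t \<ge> 0" for t
    proof (rule BB[OF N u0(1) _ _ that])
      show "norm u0 \<le> R2" using u0(2) R by (simp add: R2_def add_increasing2)
      have "norm (dN N 2 u0) \<le> R * 2 / \<sigma>0\<^sup>2" using u0(3)[of 2] by (simp add: fact_numeral)
      then show "norm (dN N 2 u0) \<le> R2" using R by (simp add: R2_def add_increasing)
    qed
    have e8: "exp (- \<delta> * t) ^ 8 = exp (- \<gamma> * t)" for t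
      by (simp add: exp_of_nat_mult[symmetric] \<delta>_def)
    have e2: "(exp (- \<delta> * t))\<^sup>2 = exp (- (\<gamma> / 4) * t)" for t
      by (simp add: exp_double[symmetric] \<delta>_def)
    have le: "y' t \<le> - \<gamma> * y t + C7 * exp (- (\<gamma> / 4) * t)" if t: "t \<ge> 0" and Y: "y t * exp (\<gamma> / 4 * t) \<le> 4 * M\<^sup>2" for t
      unfolding y'_def y_def e2[symmetric]
    proof (rule ineq[where M=M])
      have "norm (dN N 0 (?u t)) = norm (?u t)" using g(2)[OF t] by (simp add: realband_def)
      also have "\<dots> \<le> exp (- \<gamma> * t) * norm u0" by (rule gal_decay[OF N u0(1) t])
      also have "\<dots> \<le> exp (- \<gamma> * t) * R" using u0 by (intro mult_left_mono) auto
      finally show "norm (dN N 0 (?u t)) \<le> R * exp (- \<delta> * t) ^ 8" unfolding e8 by (simp only: mult.commute[of R])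
      have "y t \<le> 4 * M\<^sup>2 / exp (\<gamma> / 4 * t)" using Y by (simp add: pos_le_divide_eq)
      then show "Yg N (\<rho> t) K (?u t) \<le> 4 * M\<^sup>2 * (exp (- \<delta> * t))\<^sup>2"
        unfolding e2 using exp_minus[of "\<gamma> / 4 * t"] by (simp only: y_def divide_inverse minus_mult_left)
      show "exp (- \<delta> * t) \<le> 1" using t d by simp
    qed (rule g(2)[OF t] \<rho>0 small[OF \<rho>0 \<rho>b(2)[OF t]] K exp_gt_zero bnd[OF t] less_imp_le[OF M(1)])+
    \<comment> \<open>The bootstrap runs on the bound in its decaying form, because
      \<open>ineq\<close> asks for \<open>Yg\<close> of size
      \<open>\<epsilon>^2 = exp (- (\<gamma> / 4) * t)\<close>.\<close>
    have "y t1 * exp (\<gamma> / 4 * t1) < 4 * M\<^sup>2"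
    proof (rule bootstrap[OF _ t1, where \<phi>="\<lambda>t. y t * exp (\<gamma> / 4 * t)"])
      have "continuous_on {0..t1} y" by (rule DERIV_continuous_on[where D=y']) (rule yd)
      then show "continuous_on {0..t1} (\<lambda>t. y t * exp (\<gamma> / 4 * t))" by (intro continuous_intros)
      show "y 0 * exp (\<gamma> / 4 * 0) < 4 * M\<^sup>2" using y0 m L gamma unfolding M(2) m_def by (simp add: add_nonneg_pos)
          (smt (verit) divide_nonneg_pos Y0_def zero_le_power2)
      fix \<tau> assume \<tau>: "\<tau> \<in> {0..t1}" and hyp: "\<And>t. t \<in> {0..\<tau>} \<Longrightarrow> y t * exp (\<gamma> / 4 * t) \<le> 4 * M\<^sup>2"
      have "y \<tau> \<le> (y 0 + C7 / (\<gamma> - \<gamma> / 4)) * exp (- (\<gamma> / 4) * \<tau>)"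
        by (rule gronwall_decay_exp[OF yd le]) (use \<tau> hyp gamma L in \<open>auto simp: y_def Yg_nonneg\<close>)
      also have "\<dots> \<le> m * exp (- (\<gamma> / 4) * \<tau>)" using y0 m(2) by (intro mult_right_mono) auto
      finally have "y \<tau> * exp (\<gamma> / 4 * \<tau>) \<le> m * exp (- (\<gamma> / 4) * \<tau>) * exp (\<gamma> / 4 * \<tau>)" by (rule mult_right_mono) simp
      also have "\<dots> = m" by (simp add: exp_minus)
      also have "\<dots> < 4 * M\<^sup>2" using m M by simp
      finally show "y \<tau> * exp (\<gamma> / 4 * \<tau>) < 4 * M\<^sup>2" .
    qed
    moreover have "y t1 * 1 \<le> y t1 * exp (\<gamma> / 4 * t1)"
      using t1 gamma by (intro mult_left_mono) (auto simp: y_def Yg_nonneg)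
    ultimately show ?thesis by (simp add: y_def)
  qed
  have "Yg N r K (gal N u0 t) \<le> 4 * M\<^sup>2" if "admissible R u0" "N \<ge> 0" "K \<ge> 3" "t \<ge> 0" for u0 N K t
  proof -
    have "Yg N r K (gal N u0 t) \<le> Yg N (\<rho> t) K (gal N u0 t)"
      unfolding Yg_def using wt_mono[OF r \<rho>b(1)[OF that(4)]] wt_pos[OF r] by (intro sum_mono power_mono mult_right_mono) (auto simp: less_imp_le)
    also have "\<dots> \<le> 4 * M\<^sup>2" by (rule main[OF that])
    finally show ?thesis .
  qed
  then show ?thesis using r by blast
qed

end

subsection \<open>Convergence of the truncated solutions\<close>

lemma jprod_1: "jprod p q (Suc 0) x = p 0 x * q 1 x + p 1 x * q 0 x"
  by (simp add: jprod_def)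

lemma jprod_norm:
  assumes p: "bjet p" and f: "jet f" and P: "\<And>j x. j \<le> k \<Longrightarrow> \<bar>p j x\<bar> \<le> P" and B: "\<And>j. j \<le> k \<Longrightarrow> norm (cl (f j)) \<le> B"
  shows "norm (cl (jprod p f k)) \<le> 2 ^ k * P * B"
proof -
  have P0: "P \<ge> 0" using P[of 0 0] by simp
  have m: "p j \<in> borel_measurable borel" for j using p by (auto simp: bjet_def intro: chain_measurable)
  have r: "rl2 (\<lambda>x. real (k choose j) * (p j x * f (k - j) x))" for j
    by (intro rl2_cmult bjet_rl2_mult p jet_rl2 f)
  have "cl (jprod p f k) = (\<Sum>j\<le>k. cl (\<lambda>x. real (k choose j) * (p j x * f (k - j) x)))"
    unfolding jprod_def[abs_def] mult.assoc by (rule cl_sum) (rule r)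
  also have "norm \<dots> \<le> (\<Sum>j\<le>k. real (k choose j) * (P * B))"
  proof (rule sum_norm_le)
    fix j assume j: "j \<in> {..k}"
    have "norm (cl (\<lambda>x. p j x * f (k - j) x)) \<le> P * norm (cl (f (k - j)))"
      using j by (intro norm_cl_mult_le jet_rl2 f m P) auto
    also have "\<dots> \<le> P * B" using B[of "k - j"] P0 by (intro mult_left_mono) auto
    finally have "real (k choose j) * norm (cl (\<lambda>x. p j x * f (k - j) x)) \<le> real (k choose j) * (P * B)"
      by (intro mult_left_mono) auto
    then show "norm (cl (\<lambda>x. real (k choose j) * (p j x * f (k - j) x))) \<le> real (k choose j) * (P * B)"
      by (simp add: cl_cmult bjet_rl2_mult p jet_rl2 f)
  qed
  also have "\<dots> = 2 ^ k * P * B"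
    by (simp add: sum_distrib_right[symmetric] of_nat_sum[symmetric] choose_row_sum)
  finally show ?thesis .
qed

text \<open>A bound on finitely many derivatives, which the weighted energy supplies uniformly in
  the cutoff; with Agmon it also gives sup bounds up to order three.\<close>

definition jbd :: "real \<Rightarrow> (nat \<Rightarrow> real \<Rightarrow> real) \<Rightarrow> bool" where
  "jbd B f \<longleftrightarrow> jet f \<and> (\<forall>k\<le>4. norm (cl (f k)) \<le> B)"

lemma jbd_jet: "jbd B f \<Longrightarrow> jet f" and jbd_norm: "jbd B f \<Longrightarrow> k \<le> 4 \<Longrightarrow> norm (cl (f k)) \<le> B"
  by (auto simp: jbd_def)

lemma jbd_nonneg: "jbd B f \<Longrightarrow> B \<ge> 0"
  using jbd_norm[of B f 0] norm_ge_zero order_trans by blast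

lemma jbd_sup: "jbd B f \<Longrightarrow> k \<le> 3 \<Longrightarrow> \<bar>f k x\<bar> \<le> 2 * B"
proof -
  assume f: "jbd B f" and k: "k \<le> 3"
  have "(f k x)\<^sup>2 \<le> 2 * norm (cl (f k)) * norm (cl (f (Suc k)))" by (rule jet_agmon[OF jbd_jet[OF f]])
  also have "\<dots> \<le> 2 * B * B" using k jbd_nonneg[OF f] by (intro mult_mono jbd_norm[OF f]) auto
  also have "\<dots> \<le> (2 * B)\<^sup>2" by (simp add: power2_eq_square)
  finally show ?thesis using jbd_nonneg[OF f] by (intro power2_le_imp_le[of "\<bar>f k x\<bar>"]) auto
qed

text \<open>\<open>f\<^sup>2 - g\<^sup>2\<close> and \<open>f\<^sup>3 - g\<^sup>3\<close> are products of \<open>f - g\<close> with the following factors.\<close>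

definition Q2 :: "(nat \<Rightarrow> real \<Rightarrow> real) \<Rightarrow> (nat \<Rightarrow> real \<Rightarrow> real) \<Rightarrow> nat \<Rightarrow> real \<Rightarrow> real" where
  "Q2 f g k x = f k x + g k x"

definition Q3 :: "(nat \<Rightarrow> real \<Rightarrow> real) \<Rightarrow> (nat \<Rightarrow> real \<Rightarrow> real) \<Rightarrow> nat \<Rightarrow> real \<Rightarrow> real" where
  "Q3 f g k x = jprod f f k x + jprod f g k x + jprod g g k x"

lemma jet_mult: "jet f \<Longrightarrow> jet g \<Longrightarrow> jet (jprod f g)"
  by (intro jet_jprod jet_bjet)

lemma jet_Q: "jet f \<Longrightarrow> jet g \<Longrightarrow> jet (Q2 f g)" "jet f \<Longrightarrow> jet g \<Longrightarrow> jet (Q3 f g)"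
  unfolding Q2_def[abs_def] Q3_def[abs_def] by (intro jet_add jet_mult; assumption)+

text \<open>Both sides are derivative sequences, so only the algebraic identities at order zero need
  checking.\<close>

lemma factor:
  assumes f: "jet f" and g: "jet g"
  shows "jprod (Q2 f g) (\<lambda>k x. f k x - g k x) k = (\<lambda>x. jprod f f k x - jprod g g k x)"
    "jprod (Q3 f g) (\<lambda>k x. f k x - g k x) k = (\<lambda>x. jprod f (jprod f f) k x - jprod g (jprod g g) k x)"
proof -
  let ?E = "\<lambda>k x. f k x - g k x"
  note j = jet_mult jet_diff jet_Q f g
  show "jprod (Q2 f g) ?E k = (\<lambda>x. jprod f f k x - jprod g g k x)"
    by (rule chain_unique[where q="\<lambda>k x. jprod f f k x - jprod g g k x"]; (intro jet_chain j)?)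
      (auto simp: Q2_def algebra_simps)
  show "jprod (Q3 f g) ?E k = (\<lambda>x. jprod f (jprod f f) k x - jprod g (jprod g g) k x)"
    by (rule chain_unique[where q="\<lambda>k x. jprod f (jprod f f) k x - jprod g (jprod g g) k x"]; (intro jet_chain j)?)
      (auto simp: Q3_def algebra_simps)
qed

lemma Q_sup:
  assumes f: "jbd B f" and g: "jbd B g" and k: "k \<le> 1"
  shows "\<bar>Q2 f g k x\<bar> \<le> 4 * B" "\<bar>Q3 f g k x\<bar> \<le> 24 * B\<^sup>2"
proof -
  have s: "\<bar>f i x\<bar> \<le> 2 * B" "\<bar>g i x\<bar> \<le> 2 * B" if "i \<le> 1" for i using jbd_sup[OF f] jbd_sup[OF g] that by auto
  show "\<bar>Q2 f g k x\<bar> \<le> 4 * B" unfolding Q2_def using s[OF k] by linarith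
  have B: "B \<ge> 0" by (rule jbd_nonneg[OF f])
  have p: "\<bar>a * b\<bar> \<le> 4 * B\<^sup>2" if "\<bar>a\<bar> \<le> 2 * B" "\<bar>b\<bar> \<le> 2 * B" for a b
    using mult_mono[OF that] B by (simp add: abs_mult power2_eq_square)
  consider "k = 0" | "k = 1" using k by linarith
  then show "\<bar>Q3 f g k x\<bar> \<le> 24 * B\<^sup>2"
  proof cases
    case 1
    then show ?thesis using p[OF s(1)[of 0] s(1)[of 0]] p[OF s(1)[of 0] s(2)[of 0]] p[OF s(2)[of 0] s(2)[of 0]] zero_le_power2[of B]
      unfolding 1 Q3_def jprod_0 by linarith
  next
    case 2
    then show ?thesis using p[OF s(1)[of 0] s(1)[of 1]] p[OF s(1)[of 0] s(2)[of 1]] p[OF s(1)[of 1] s(2)[of 0]] p[OF s(2)[of 0] s(2)[of 1]]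
      by (simp add: Q3_def jprod_1 mult.commute)
  qed
qed

text \<open>With \<open>x\<close> the pairing of \<open>e\<close> with \<open>q * e_x\<close> and
  \<open>y\<close> that with \<open>q_x * e\<close>, integration by parts gives
  \<open>x + y = - x\<close>. So no derivative of \<open>e\<close> survives and differences can be
  estimated in \<open>L2\<close> without loss.\<close>

lemma jprod_skew:
  assumes q: "jet q" and e: "jet e" and S: "\<And>x. \<bar>q 1 x\<bar> \<le> S"
  shows "\<bar>cl (e 0) \<bullet> cl (jprod q e 1)\<bar> \<le> S * (norm (cl (e 0)))\<^sup>2"
proof -
  have qb: "bjet q" by (rule jet_bjet[OF q])
  have r: "rl2 (\<lambda>x. q i x * e j x)" "rl2 (e j)" for i j by (intro bjet_rl2_mult qb jet_rl2 e)+
  obtain C where C: "\<And>x. \<bar>q 0 x\<bar> \<le> C" using qb by (auto simp: bjet_def)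
  have m: "q i \<in> borel_measurable borel" for i by (rule chain_measurable[OF jet_chain[OF q]])
  have eq: "cl (jprod q e 1) = cl (\<lambda>x. q 0 x * e 1 x) + cl (\<lambda>x. q 1 x * e 0 x)"
    using cl_add[OF r(1)[of 0 1] r(1)[of 1 0]] by (simp add: jprod_1[abs_def])
  define x y where "x = cl (e 0) \<bullet> cl (\<lambda>x. q 0 x * e 1 x)" and "y = cl (e 0) \<bullet> cl (\<lambda>x. q 1 x * e 0 x)"
  have "cl (e 0) \<bullet> cl (jprod q e 1) = - (cl (e 1) \<bullet> cl (jprod q e 0))"
    using jet_parts[OF e jet_mult[OF q e], of 0 0] by simp
  also have "cl (jprod q e 0) = cl (\<lambda>x. q 0 x * e 0 x)" by (simp add: jprod_0[abs_def])
  also have "cl (e 1) \<bullet> cl (\<lambda>x. q 0 x * e 0 x) = x"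
    unfolding x_def using inner_cl_mult[OF r(2) r(2) m C, of 0 1] by (simp add: inner_commute)
  finally have "x + y = - x" unfolding eq inner_add_right by (simp add: x_def y_def)
  then have "\<bar>cl (e 0) \<bullet> cl (jprod q e 1)\<bar> \<le> \<bar>y\<bar>" unfolding eq inner_add_right x_def[symmetric] y_def[symmetric] by linarith
  also have "\<dots> \<le> norm (cl (e 0)) * norm (cl (\<lambda>x. q 1 x * e 0 x))" unfolding y_def by (rule Cauchy_Schwarz_ineq2)
  also have "\<dots> \<le> norm (cl (e 0)) * (S * norm (cl (e 0)))" by (intro mult_left_mono norm_cl_mult_le r m S) simp
  finally show ?thesis by (simp add: power2_eq_square mult_ac)
qed

lemma jprod1_norm:
  assumes q: "jet q" and e: "jet e" and S: "\<And>k x. k \<le> 1 \<Longrightarrow> \<bar>q k x\<bar> \<le> S"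
  shows "norm (cl (jprod q e 1)) \<le> S * (norm (cl (e 0)) + norm (cl (e 1)))"
proof -
  have r: "rl2 (\<lambda>x. q i x * e j x)" "rl2 (e j)" for i j by (intro bjet_rl2_mult jet_bjet q jet_rl2 e)+
  have m: "q i \<in> borel_measurable borel" for i by (rule chain_measurable[OF jet_chain[OF q]])
  have "cl (jprod q e 1) = cl (\<lambda>x. q 0 x * e 1 x) + cl (\<lambda>x. q 1 x * e 0 x)"
    using cl_add[OF r(1)[of 0 1] r(1)[of 1 0]] by (simp add: jprod_1[abs_def])
  also have "norm \<dots> \<le> S * norm (cl (e 1)) + S * norm (cl (e 0))"
    by (intro norm_triangle_le add_mono norm_cl_mult_le r m S) auto
  finally show ?thesis by (simp add: distrib_left)
qed

lemma product_difference:
  assumes f: "jbd B f" and g: "jbd B g" and e: "e = (\<lambda>k x. f k x - g k x)"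
  shows "norm (cl (jprod f f 1) - cl (jprod g g 1)) \<le> 4 * B * (norm (cl (e 0)) + norm (cl (e 1)))"
    "norm (cl (jprod f (jprod f f) 1) - cl (jprod g (jprod g g) 1)) \<le> 24 * B\<^sup>2 * (norm (cl (e 0)) + norm (cl (e 1)))"
    "\<bar>cl (e 0) \<bullet> (cl (jprod f f 1) - cl (jprod g g 1))\<bar> \<le> 4 * B * (norm (cl (e 0)))\<^sup>2"
    "\<bar>cl (e 0) \<bullet> (cl (jprod f (jprod f f) 1) - cl (jprod g (jprod g g) 1))\<bar> \<le> 24 * B\<^sup>2 * (norm (cl (e 0)))\<^sup>2"
proof -
  have j: "jet f" "jet g" "jet e" unfolding e by (intro jet_diff jbd_jet[OF f] jbd_jet[OF g])+
  have r: "rl2 (jprod h h' 1)" if "jet h" "jet h'" for h h' using that by (intro jet_rl2 jet_mult)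
  have eq: "cl (jprod f f 1) - cl (jprod g g 1) = cl (jprod (Q2 f g) e 1)"
    "cl (jprod f (jprod f f) 1) - cl (jprod g (jprod g g) 1) = cl (jprod (Q3 f g) e 1)"
    unfolding e factor[OF j(1,2)] by (intro cl_diff[symmetric] r j jet_mult)+
  note s = Q_sup[OF f g]
  show "norm (cl (jprod f f 1) - cl (jprod g g 1)) \<le> 4 * B * (norm (cl (e 0)) + norm (cl (e 1)))"
    unfolding eq by (intro jprod1_norm jet_Q j s)
  show "norm (cl (jprod f (jprod f f) 1) - cl (jprod g (jprod g g) 1)) \<le> 24 * B\<^sup>2 * (norm (cl (e 0)) + norm (cl (e 1)))"
    unfolding eq by (intro jprod1_norm jet_Q j s)
  show "\<bar>cl (e 0) \<bullet> (cl (jprod f f 1) - cl (jprod g g 1))\<bar> \<le> 4 * B * (norm (cl (e 0)))\<^sup>2"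
    unfolding eq by (intro jprod_skew jet_Q j s) simp
  show "\<bar>cl (e 0) \<bullet> (cl (jprod f (jprod f f) 1) - cl (jprod g (jprod g g) 1))\<bar> \<le> 24 * B\<^sup>2 * (norm (cl (e 0)))\<^sup>2"
    unfolding eq by (intro jprod_skew jet_Q j s) simp
qed

context kawahara
begin

text \<open>Everything but dispersion, before projection to the band; its limit is the forcing in
  the Duhamel formula.\<close>

definition Wj :: "(nat \<Rightarrow> real \<Rightarrow> real) \<Rightarrow> l2" where
  "Wj f = \<mu> *\<^sub>R cl (jprod f f 1) + \<nu> *\<^sub>R cl (jprod f (jprod f f) 1) + am (cl (f 0))"

lemma X_Wj:
  assumes u: "realband N u"
  shows "X N u = - (\<alpha> *\<^sub>R dN N 5 u + \<beta> *\<^sub>R dN N 3 u + dN N 0 (Wj (jt N u)))"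
proof -
  let ?f = "jt N u"
  have j: "jet ?f" by (rule jet_jt)
  have r: "rl2 (jprod ?f ?f 1)" "rl2 (jprod ?f (jprod ?f ?f) 1)" by (intro jet_rl2 jet_mult j)+
  have "dN N 1 (nl N u) = dN N 0 (cl (hj ?f 1))" unfolding nl_cl using dN_jet[OF jet_hj[OF j], of N 0 0] by simp
  also have "cl (hj ?f 1) = \<mu> *\<^sub>R cl (jprod ?f ?f 1) + \<nu> *\<^sub>R cl (jprod ?f (jprod ?f ?f) 1)"
    unfolding hj_def[abs_def] by (simp only: cl_add[OF rl2_cmult[OF r(1)] rl2_cmult[OF r(2)]] cl_cmult r)
  finally show ?thesis by (simp add: X_def Wj_def realband_jt(2)[OF u] dN_add add_ac)
qed

definition cS :: "real \<Rightarrow> real" where "cS B = \<bar>\<mu>\<bar> * (4 * B) + \<bar>\<nu>\<bar> * (24 * B\<^sup>2)"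

text \<open>Bounds one derivative of \<open>Wj\<close>: \<open>8 * B^2\<close> and
  \<open>64 * B^3\<close> come from two derivatives of the square and of the cube.\<close>

definition cT :: "real \<Rightarrow> real" where
  "cT B = \<bar>\<mu>\<bar> * (8 * B\<^sup>2) + \<bar>\<nu>\<bar> * (64 * B ^ 3) + 2 * (Ak 0 + Ak 1) * B"

text \<open>The norm bound needs the first derivative of the difference and is used after
  interpolation. The one-sided bound avoids it by \<open>jprod_skew\<close>, with the damping
  contributing a favourable sign, and is fit for a Gronwall argument.\<close>

lemma Wj_diff:
  assumes f: "jbd B f" and g: "jbd B g" and e: "e = (\<lambda>k x. f k x - g k x)"
  shows "norm (Wj f - Wj g) \<le> (cS B + Ak 0) * (norm (cl (e 0)) + norm (cl (e 1)))"
    "- (cS B * (norm (cl (e 0)))\<^sup>2) \<le> cl (e 0) \<bullet> (Wj f - Wj g)"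
proof -
  note d = product_difference[OF f g e]
  have a: "am (cl (f 0)) - am (cl (g 0)) = am (cl (e 0))"
    unfolding am_diff[symmetric] e by (simp add: cl_diff jet_rl2 jbd_jet[OF f] jbd_jet[OF g])
  define p q where "p = cl (jprod f f 1) - cl (jprod g g 1)"
    and "q = cl (jprod f (jprod f f) 1) - cl (jprod g (jprod g g) 1)"
  note d = d[folded p_def q_def]
  have eq: "Wj f - Wj g = \<mu> *\<^sub>R p + \<nu> *\<^sub>R q + am (cl (e 0))"
    unfolding a[symmetric] Wj_def p_def q_def by (simp add: algebra_simps)
  let ?n = "norm (cl (e 0)) + norm (cl (e 1))"
  have "norm (\<mu> *\<^sub>R p + \<nu> *\<^sub>R q + am (cl (e 0))) \<le> \<bar>\<mu>\<bar> * norm p + \<bar>\<nu>\<bar> * norm q + norm (am (cl (e 0)))"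
    by (intro norm_triangle_le add_mono) auto
  also have "\<dots> \<le> \<bar>\<mu>\<bar> * (4 * B * ?n) + \<bar>\<nu>\<bar> * (24 * B\<^sup>2 * ?n) + Ak 0 * ?n"
  proof (intro add_mono mult_left_mono d)
    have "Ak 0 * norm (cl (e 0)) \<le> Ak 0 * ?n" using Ak_nonneg[of 0] by (intro mult_left_mono) auto
    then show "norm (am (cl (e 0))) \<le> Ak 0 * ?n" using am_norm order_trans by blast
  qed auto
  also have "\<dots> = (cS B + Ak 0) * ?n" by (simp add: cS_def algebra_simps)
  finally show "norm (Wj f - Wj g) \<le> (cS B + Ak 0) * ?n" unfolding eq .
  have mx: "- (\<bar>m\<bar> * x) \<le> m * y" if "\<bar>y\<bar> \<le> x" for m x y :: real
  proof -
    have "\<bar>m * y\<bar> \<le> \<bar>m\<bar> * x" using that by (simp add: abs_mult mult_left_mono)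
    then show ?thesis by linarith
  qed
  have "0 \<le> \<gamma> * (norm (cl (e 0)))\<^sup>2" using gamma by simp
  also have "\<dots> \<le> cl (e 0) \<bullet> am (cl (e 0))" by (rule inner_am_ge)
  finally have "0 \<le> cl (e 0) \<bullet> am (cl (e 0))" .
  then show "- (cS B * (norm (cl (e 0)))\<^sup>2) \<le> cl (e 0) \<bullet> (Wj f - Wj g)"
    unfolding eq using mx[OF d(3), of \<mu>] mx[OF d(4), of \<nu>] by (simp add: inner_add_right cS_def algebra_simps)
qed

text \<open>One bounded derivative of \<open>Wj\<close> gives the rate \<open>1 / N\<close> by
  \<open>dN_tail\<close>.\<close>

lemma Wj_tail:
  assumes f: "jbd B f" and N: "0 < N" "N \<le> M"
  shows "norm (dN M 0 (Wj f) - dN N 0 (Wj f)) \<le> cT B / N"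
proof -
  have j: "jet f" by (rule jbd_jet[OF f])
  have B: "B \<ge> 0" by (rule jbd_nonneg[OF f])
  define w where "w k x = (\<mu> * jprod f f (k + 1) x + \<nu> * jprod f (jprod f f) (k + 1) x) + jprod aj f k x" for k x
  have jw: "jet w" unfolding w_def[abs_def]
    by (intro jet_add jet_cmult jet_shift[where m=1] jet_mult j jet_jprod[OF bjet_aj])
  have r: "rl2 (jprod f f k)" "rl2 (jprod f (jprod f f) k)" "rl2 (jprod aj f k)" for k
    by (intro jet_rl2 jet_mult j jet_jprod[OF bjet_aj])+
  have cw: "cl (w k) = (\<mu> *\<^sub>R cl (jprod f f (k + 1)) + \<nu> *\<^sub>R cl (jprod f (jprod f f) (k + 1))) + cl (jprod aj f k)" for k
    unfolding w_def[abs_def]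
    by (simp only: cl_add[OF rl2_add[OF rl2_cmult[OF r(1)] rl2_cmult[OF r(2)]] r(3)] cl_add[OF rl2_cmult[OF r(1)] rl2_cmult[OF r(2)]] cl_cmult[OF r(1)] cl_cmult[OF r(2)])
  have W: "Wj f = cl (w 0)" unfolding cw by (simp add: Wj_def am_cl jet_rl2 j jprod_0[abs_def])
  have n2: "norm (cl (jprod f f k)) \<le> 8 * B\<^sup>2" if "k \<le> 2" for k
  proof -
    have "norm (cl (jprod f f k)) \<le> 2 ^ k * (2 * B) * B"
      using that by (intro jprod_norm jet_bjet j jbd_sup[OF f] jbd_norm[OF f]) auto
    also have "\<dots> \<le> 2 ^ 2 * (2 * B) * B" using that B by (intro mult_right_mono power_increasing) auto
    finally show ?thesis by (simp add: power2_eq_square)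
  qed
  have n3: "norm (cl (jprod f (jprod f f) 2)) \<le> 2 ^ 2 * (2 * B) * (8 * B\<^sup>2)"
    by (intro jprod_norm jet_bjet j jet_mult jbd_sup[OF f] n2) auto
  have n1: "norm (cl (jprod aj f 1)) \<le> 2 ^ 1 * (Ak 0 + Ak 1) * B"
  proof (intro jprod_norm bjet_aj j jbd_norm[OF f])
    fix i x assume "i \<le> (1::nat)"
    then have "i = 0 \<or> i = 1" by linarith
    then show "\<bar>aj i x\<bar> \<le> Ak 0 + Ak 1" using aj_bound[of i x] Ak_nonneg[of 0] Ak_nonneg[of 1] by auto
  qed auto
  have "norm (dN M 0 (Wj f) - dN N 0 (Wj f)) \<le> norm (dN M 1 (Wj f)) / N"
    using dN_tail[OF N, of "Wj f" 1] by simp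
  also have "dN M 1 (Wj f) = dN M 0 (cl (w 1))" unfolding W using dN_jet[OF jw, of M 0 0] by simp
  also have "norm (dN M 0 (cl (w 1))) \<le> norm (cl (w 1))" using dN_norm[of M 0 "cl (w 1)"] N by simp
  also have "norm (cl (w 1)) \<le> cT B"
  proof -
    have "norm (cl (w 1)) \<le> \<bar>\<mu>\<bar> * norm (cl (jprod f f 2)) + \<bar>\<nu>\<bar> * norm (cl (jprod f (jprod f f) 2)) + norm (cl (jprod aj f 1))"
      unfolding cw by (intro norm_triangle_le add_mono) (auto simp: numeral_2_eq_2)
    also have "\<dots> \<le> \<bar>\<mu>\<bar> * (8 * B\<^sup>2) + \<bar>\<nu>\<bar> * (2 ^ 2 * (2 * B) * (8 * B\<^sup>2)) + 2 ^ 1 * (Ak 0 + Ak 1) * B"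
      by (intro add_mono mult_left_mono n1 n2 n3) auto
    finally show ?thesis by (simp add: cT_def power2_eq_square power3_eq_cube mult_ac)
  qed
  finally show ?thesis using N by (simp add: divide_right_mono)
qed

text \<open>Elements of the smaller band have the same derivatives under either cutoff, so
  dispersion acts on the difference alone and drops out. The different projections leave a spectral
  tail as the only inhomogeneity.\<close>

lemma X_difference_inner:
  assumes u: "realband N u" "jbd B (jt N u)" and v: "realband M v" "jbd B (jt M v)" and N: "0 < N" "N \<le> M"
  shows "(u - v) \<bullet> (X N u - X M v) \<le> cS B * (norm (u - v))\<^sup>2 + 2 * B * cT B / N"
proof -
  let ?f = "jt N u" and ?g = "jt M v" and ?e = "u - v"
  have un: "dN M 0 u = u" using u(1) dN_dN(1)[OF N(2), of 0 0 u] by (simp add: realband_def)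
  have uk: "dN N k u = dN M k u" for k
    using dN_dN(1)[OF N(2), of k 0 u] u(1) by (simp add: realband_def)
  have e0: "dN M 0 ?e = ?e" using un v(1) by (simp add: dN_diff realband_def)
  have ce: "cl (\<lambda>x. ?f 0 x - ?g 0 x) = ?e"
    by (simp add: cl_diff jet_rl2 jet_jt realband_jt(2) u v)
  have P: "?e \<bullet> dN M 0 w = ?e \<bullet> w" for w using dN_skew[of M 0 ?e w] e0 by simp
  have "X N u - X M v = - (\<alpha> *\<^sub>R dN M 5 ?e + \<beta> *\<^sub>R dN M 3 ?e + dN M 0 (Wj ?f - Wj ?g)) + (dN M 0 (Wj ?f) - dN N 0 (Wj ?f))"
    unfolding X_Wj[OF u(1)] X_Wj[OF v(1)] uk by (simp add: dN_diff scaleR_diff_right)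
  then have "?e \<bullet> (X N u - X M v) = - (?e \<bullet> (Wj ?f - Wj ?g)) + ?e \<bullet> (dN M 0 (Wj ?f) - dN N 0 (Wj ?f))"
    by (simp add: inner_add_right inner_diff_right dN_odd_zero P)
  also have "- (?e \<bullet> (Wj ?f - Wj ?g)) \<le> cS B * (norm ?e)\<^sup>2"
    using Wj_diff(2)[OF u(2) v(2) refl] unfolding ce by simp
  also have "?e \<bullet> (dN M 0 (Wj ?f) - dN N 0 (Wj ?f)) \<le> 2 * B * (cT B / N)"
  proof -
    have "norm ?e \<le> norm u + norm v" by (rule norm_triangle_ineq4)
    also have "\<dots> \<le> 2 * B" using jbd_norm[OF u(2), of 0] jbd_norm[OF v(2), of 0] by (simp add: realband_jt(2) u v)
    finally have "norm ?e \<le> 2 * B" .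
    then have "norm ?e * norm (dN M 0 (Wj ?f) - dN N 0 (Wj ?f)) \<le> 2 * B * (cT B / N)"
      using jbd_nonneg[OF u(2)] by (intro mult_mono Wj_tail[OF u(2) N]) auto
    then show ?thesis using norm_cauchy_schwarz order_trans by blast
  qed
  finally show ?thesis by simp
qed

end

section \<open>The limit of the truncated solutions\<close>

locale kawahara_data = kawahara +
  fixes R r Mb :: real and u0 :: l2
  assumes R: "R \<ge> 0" and adm: "admissible R u0" and r: "r > 0"
    and Yb: "\<And>N K t. N \<ge> 0 \<Longrightarrow> K \<ge> 3 \<Longrightarrow> t \<ge> 0 \<Longrightarrow> Yg N r K (gal N u0 t) \<le> Mb"
begin

lemma u0_real: "cj u0 = u0"
  using adm by (simp add: admissible_def)

lemma Mb_nonneg: "Mb \<ge> 0"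
  using Yb[of 0 3 0] Yg_nonneg[of 0 r 3 "gal 0 u0 0"] by simp

lemma norm_le_Yg:
  assumes "Yg N r K u \<le> C" "k \<le> K"
  shows "norm (dN N k u) \<le> sqrt C / wt r k"
proof -
  have "(wt r k * norm (dN N k u))\<^sup>2 \<le> Yg N r K u"
    unfolding Yg_def using assms by (intro member_le_sum) auto
  then have "wt r k * norm (dN N k u) \<le> sqrt C" using assms by (intro real_le_rsqrt) auto
  then show ?thesis using wt_pos[OF r, of k] by (simp add: field_simps)
qed

definition Bd :: real where "Bd = (\<Sum>k\<le>4. sqrt Mb / wt r k)"

lemma gal_norm:
  assumes "N \<ge> 0" "t \<ge> 0" "k \<le> 4"
  shows "norm (dN N k (gal N u0 t)) \<le> Bd"
proof -
  have "norm (dN N k (gal N u0 t)) \<le> sqrt Mb / wt r k" using assms by (intro norm_le_Yg[OF Yb[of N 4 t]]) auto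
  also have "\<dots> \<le> Bd" unfolding Bd_def using assms Mb_nonneg wt_pos[OF r] by (intro member_le_sum) (auto simp: less_imp_le)
  finally show ?thesis .
qed

lemma Bd_nonneg: "Bd \<ge> 0"
  using gal_norm[of 0 0 0] norm_ge_zero order_trans by blast

lemma gal_realband: "N \<ge> 0 \<Longrightarrow> t \<ge> 0 \<Longrightarrow> realband N (gal N u0 t)"
  by (rule gal(2)[OF _ u0_real])

lemma gal_jbd: "N \<ge> 0 \<Longrightarrow> t \<ge> 0 \<Longrightarrow> jbd Bd (jt N (gal N u0 t))"
  by (simp add: jbd_def jet_jt realband_jt(1)[OF gal_realband] gal_norm)

definition rate :: "real \<Rightarrow> real" where
  "rate T = sqrt (((R / \<sigma>0)\<^sup>2 + 4 * Bd * cT Bd * T) * exp (2 * cS Bd * T))"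

lemma cT_nonneg: "cT Bd \<ge> 0" and cS_nonneg: "cS Bd \<ge> 0"
  using Bd_nonneg Ak_nonneg[of 0] Ak_nonneg[of 1] by (simp_all add: cT_def cS_def)

text \<open>Gronwall for the squared difference: both the initial gap and the inhomogeneity are of
  order \<open>1 / N\<close>, hence the square root in the rate.\<close>

lemma gal_rate:
  assumes N: "1 \<le> N" "N \<le> M" and t: "0 \<le> t" "t \<le> T"
  shows "norm (gal N u0 t - gal M u0 t) \<le> rate T / sqrt N"
proof -
  let ?u = "gal N u0" and ?v = "gal M u0"
  define y where "y t = (norm (?u t - ?v t))\<^sup>2" for t
  have N0: "0 < N" "N \<ge> 0" "M \<ge> 0" using N by auto
  note gu = gal[OF N0(2) u0_real] and gv = gal[OF N0(3) u0_real]
  have d: "(y has_real_derivative 2 * ((?u s - ?v s) \<bullet> (X N (?u s) - X M (?v s)))) (at s within {0..t})" if "s \<in> {0..t}" for s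
  proof -
    have "((\<lambda>s. ?u s - ?v s) has_vector_derivative X N (?u s) - X M (?v s)) (at s within {0..t})"
      by (intro has_vector_derivative_diff gu(3) gv(3) that)
    from has_real_derivative_inner[OF this this] show ?thesis
      unfolding y_def by (simp add: power2_norm_eq_inner inner_commute)
  qed
  have le: "2 * ((?u s - ?v s) \<bullet> (X N (?u s) - X M (?v s))) \<le> 2 * cS Bd * y s + 4 * Bd * cT Bd / N" if "s \<in> {0..t}" for s
    using that X_difference_inner[OF gal_realband[OF N0(2)] gal_jbd[OF N0(2)] gal_realband[OF N0(3)] gal_jbd[OF N0(3)] N0(1) N(2), of s s]
    by (simp add: y_def)
  have C: "4 * Bd * cT Bd / N \<ge> 0" using Bd_nonneg cT_nonneg N by simp
  have "y t \<le> (y 0 + 4 * Bd * cT Bd / N * t) * exp (2 * cS Bd * t)"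
    by (rule gronwall_growth[OF d le]) (use t cS_nonneg C in auto)
  also have "\<dots> \<le> ((R / \<sigma>0)\<^sup>2 / N + 4 * Bd * cT Bd / N * T) * exp (2 * cS Bd * T)"
  proof (intro mult_mono add_mono)
    \<comment> \<open>The initial gap is the spectral tail of the data, of size
      \<open>1 / N\<close>; its square is weakened to \<open>1 / N\<close> to match the
      inhomogeneity.\<close>
    have "norm (?u 0 - ?v 0) = norm (dN M 0 u0 - dN N 0 u0)" by (simp add: gu gv norm_minus_commute)
    also have "\<dots> \<le> norm (dN M 1 u0) / N" using dN_tail[OF N0(1) N(2), of u0 1] by simp
    also have "\<dots> \<le> (R / \<sigma>0) / N"
    proof (rule divide_right_mono)
      have "norm (dN M 1 u0) \<le> R * fact 1 / \<sigma>0 ^ 1" using adm N0(3) unfolding admissible_def by blast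
      then show "norm (dN M 1 u0) \<le> R / \<sigma>0" by simp
    qed (use N in simp)
    finally have "y 0 \<le> ((R / \<sigma>0) / N)\<^sup>2" unfolding y_def by (intro power_mono) auto
    also have "\<dots> = (R / \<sigma>0)\<^sup>2 / N * (1 / N)" by (simp add: power2_eq_square)
    also have "\<dots> \<le> (R / \<sigma>0)\<^sup>2 / N * 1" using N by (intro mult_left_mono) auto
    finally show "y 0 \<le> (R / \<sigma>0)\<^sup>2 / N" by simp
    show "exp (2 * cS Bd * t) \<le> exp (2 * cS Bd * T)" using t cS_nonneg by (simp add: mult_left_mono)
    have "0 \<le> (R / \<sigma>0)\<^sup>2 / N" "0 \<le> 4 * Bd * cT Bd / N * T" using N mult_nonneg_nonneg[OF C, of T] t by auto
    then show "0 \<le> (R / \<sigma>0)\<^sup>2 / N + 4 * Bd * cT Bd / N * T" by simp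
  qed (use C t in auto)
  also have "\<dots> = (rate T / sqrt N)\<^sup>2"
  proof -
    have "0 \<le> ((R / \<sigma>0)\<^sup>2 + 4 * Bd * cT Bd * T) * exp (2 * cS Bd * T)"
      using Bd_nonneg cT_nonneg t by simp
    then show ?thesis using N by (simp add: rate_def power_divide field_simps)
  qed
  finally have "(norm (?u t - ?v t))\<^sup>2 \<le> (rate T / sqrt N)\<^sup>2" by (simp add: y_def)
  moreover have "0 \<le> rate T / sqrt N" using Bd_nonneg cT_nonneg t N by (simp add: rate_def)
  ultimately show ?thesis by (rule power2_le_imp_le)
qed

text \<open>The cutoff is \<open>n + 1\<close> because \<open>gal_rate\<close> requires at least
  one.\<close>

definition un :: "nat \<Rightarrow> real \<Rightarrow> l2" where "un n t = gal (real (Suc n)) u0 t"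

definition Fn :: "nat \<Rightarrow> real \<Rightarrow> nat \<Rightarrow> real \<Rightarrow> real" where "Fn n t = jt (real (Suc n)) (un n t)"

definition eps :: "real \<Rightarrow> nat \<Rightarrow> real" where "eps T n = rate T / sqrt (real (Suc n))"

lemma eps_tendsto: "(\<lambda>n. c * eps T n) \<longlonglongrightarrow> 0" "(\<lambda>n. c * sqrt (d * eps T n)) \<longlonglongrightarrow> 0"
proof -
  have "(\<lambda>n. rate T * sqrt (inverse (real (Suc n)))) \<longlonglongrightarrow> rate T * sqrt 0"
    by (intro tendsto_intros LIMSEQ_inverse_real_of_nat)
  then have e: "eps T \<longlonglongrightarrow> 0" by (simp add: eps_def[abs_def] real_sqrt_inverse divide_inverse)
  show "(\<lambda>n. c * eps T n) \<longlonglongrightarrow> 0" using tendsto_mult_left[OF e, of c] by simp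
  have "(\<lambda>n. c * sqrt (d * eps T n)) \<longlonglongrightarrow> c * sqrt (d * 0)" by (intro tendsto_intros e)
  then show "(\<lambda>n. c * sqrt (d * eps T n)) \<longlonglongrightarrow> 0" by simp
qed

lemma Fn_jbd: "t \<ge> 0 \<Longrightarrow> jbd Bd (Fn n t)"
  unfolding Fn_def un_def by (intro gal_jbd) auto

lemma cl_Fn: "t \<ge> 0 \<Longrightarrow> cl (Fn n t 0) = un n t"
  unfolding Fn_def un_def by (intro realband_jt gal_realband) auto

lemma jet_Fn: "jet (Fn n t)"
  unfolding Fn_def by (rule jet_jt)

text \<open>The \<open>L2\<close> rate interpolated with the uniform second-order bound: the first
  derivative and the sup norm converge at the square root of that rate.\<close>

lemma Fn_diff:
  assumes n: "n \<le> m" and t: "0 \<le> t" "t \<le> T"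
  shows "norm (un n t - un m t) \<le> eps T n"
    "norm (cl (\<lambda>x. Fn n t 1 x - Fn m t 1 x)) \<le> sqrt (2 * Bd * eps T n)"
    "\<bar>Fn n t 0 x - Fn m t 0 x\<bar> \<le> 2 * sqrt (Bd * eps T n)"
proof -
  show e0: "norm (un n t - un m t) \<le> eps T n" unfolding un_def eps_def using n t by (intro gal_rate) auto
  let ?e = "\<lambda>k x. Fn n t k x - Fn m t k x"
  have j: "jet ?e" by (intro jet_diff jet_Fn)
  have c0: "cl (?e 0) = un n t - un m t" by (simp add: cl_diff jet_rl2 jet_Fn cl_Fn t)
  have nb: "norm (cl (?e k)) \<le> 2 * Bd" if "k \<le> 4" for k
  proof -
    have "norm (cl (?e k)) \<le> norm (cl (Fn n t k)) + norm (cl (Fn m t k))"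
      unfolding cl_diff[OF jet_rl2[OF jet_Fn] jet_rl2[OF jet_Fn]] by (rule norm_triangle_ineq4)
    also have "\<dots> \<le> Bd + Bd" by (intro add_mono jbd_norm[OF Fn_jbd] that t)
    finally show ?thesis by simp
  qed
  have e1: "(norm (cl (?e 1)))\<^sup>2 \<le> eps T n * (2 * Bd)"
  proof -
    have "(norm (cl (?e 1)))\<^sup>2 \<le> norm (cl (?e 0)) * norm (cl (?e 2))"
      using jet_interp[OF j, of 0] by (simp add: numeral_2_eq_2)
    also have "\<dots> \<le> eps T n * (2 * Bd)" using nb[of 2] e0 order_trans[OF norm_ge_zero e0] unfolding c0
      by (intro mult_mono) auto
    finally show ?thesis .
  qed
  then show "norm (cl (\<lambda>x. Fn n t 1 x - Fn m t 1 x)) \<le> sqrt (2 * Bd * eps T n)"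
    by (intro real_le_rsqrt) (simp add: mult_ac)
  have ep: "eps T n \<ge> 0" using e0 norm_ge_zero order_trans by blast
  have "(?e 0 x)\<^sup>2 \<le> 2 * norm (cl (?e 0)) * norm (cl (?e (Suc 0)))" by (rule jet_agmon[OF j])
  also have "\<dots> \<le> 2 * eps T n * (2 * Bd)" using nb[of 1] e0 ep unfolding c0 by (intro mult_mono) auto
  also have "\<dots> = (2 * sqrt (Bd * eps T n))\<^sup>2" using ep Bd_nonneg by (simp add: power_mult_distrib)
  finally show "\<bar>Fn n t 0 x - Fn m t 0 x\<bar> \<le> 2 * sqrt (Bd * eps T n)"
    using ep Bd_nonneg by (intro power2_le_imp_le[of "\<bar>?e 0 x\<bar>"]) auto
qed

lemma rate_limit:
  fixes f :: "nat \<Rightarrow> 'a::banach"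
  assumes d: "\<And>n m. n \<le> m \<Longrightarrow> norm (f n - f m) \<le> e n" and e: "e \<longlonglongrightarrow> 0"
  shows "f \<longlonglongrightarrow> lim f" "norm (f n - lim f) \<le> e n"
proof -
  have "Cauchy f"
  proof (rule metric_CauchyI)
    fix \<epsilon> :: real assume "0 < \<epsilon>"
    then obtain N where N: "\<And>n. n \<ge> N \<Longrightarrow> \<bar>e n\<bar> < \<epsilon> / 2" using LIMSEQ_D[OF e, of "\<epsilon> / 2"] by auto
    have "dist (f m) (f n) < \<epsilon>" if "m \<ge> N" "n \<ge> N" for m n
    proof -
      have "dist (f m) (f n) \<le> dist (f N) (f m) + dist (f N) (f n)" by (rule dist_triangle3)
      also have "\<dots> \<le> e N + e N" using d[of N m] d[of N n] that by (intro add_mono) (auto simp: dist_norm)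
      finally show ?thesis using N[of N] by auto
    qed
    then show "\<exists>M. \<forall>m\<ge>M. \<forall>n\<ge>M. dist (f m) (f n) < \<epsilon>" by blast
  qed
  then show l: "f \<longlonglongrightarrow> lim f" by (simp add: Cauchy_convergent convergent_LIMSEQ_iff[symmetric])
  have "(\<lambda>m. norm (f n - f m)) \<longlonglongrightarrow> norm (f n - lim f)" by (intro tendsto_intros l)
  moreover have "\<forall>\<^sub>F m in sequentially. norm (f n - f m) \<le> e n"
    using eventually_ge_at_top[of n] by eventually_elim (rule d)
  ultimately show "norm (f n - lim f) \<le> e n" by (rule tendsto_upperbound) simp
qed

definition U :: "real \<Rightarrow> l2" where "U t = lim (\<lambda>n. un n t)"

text \<open>A concrete function representing the limit: the final statement concerns functions, and
  the weak derivatives are taken of pointwise powers.\<close>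

definition fl :: "real \<Rightarrow> real \<Rightarrow> real" where "fl t x = lim (\<lambda>n. Fn n t 0 x)"

text \<open>Defined as the limit of derivatives of squares; that it is the derivative of the square
  of the limit is shown later by testing.\<close>

definition V2 :: "real \<Rightarrow> l2" where "V2 t = lim (\<lambda>n. cl (jprod (Fn n t) (Fn n t) 1))"

definition V3 :: "real \<Rightarrow> l2" where "V3 t = lim (\<lambda>n. cl (jprod (Fn n t) (jprod (Fn n t) (Fn n t)) 1))"

definition W :: "real \<Rightarrow> l2" where "W t = \<mu> *\<^sub>R V2 t + \<nu> *\<^sub>R V3 t + am (U t)"

lemma un_lim:
  assumes "0 \<le> t" "t \<le> T"
  shows "(\<lambda>n. un n t) \<longlonglongrightarrow> U t" "norm (un n t - U t) \<le> eps T n"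
  unfolding U_def using rate_limit[of "\<lambda>n. un n t" "eps T"] Fn_diff(1)[OF _ assms] eps_tendsto(1)[of 1 T] by auto

lemma fl_lim:
  assumes "0 \<le> t"
  shows "(\<lambda>n. Fn n t 0 x) \<longlonglongrightarrow> fl t x"
  unfolding fl_def
  using rate_limit(1)[of "\<lambda>n. Fn n t 0 x" "\<lambda>n. 2 * sqrt (Bd * eps t n)"] Fn_diff(3)[OF _ assms order_refl] eps_tendsto(2)[of 2 Bd t] by auto

lemma V_lim:
  assumes t: "0 \<le> t"
  shows "(\<lambda>n. cl (jprod (Fn n t) (Fn n t) 1)) \<longlonglongrightarrow> V2 t"
    "(\<lambda>n. cl (jprod (Fn n t) (jprod (Fn n t) (Fn n t)) 1)) \<longlonglongrightarrow> V3 t"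
proof -
  have d: "norm (cl (\<lambda>x. Fn n t 0 x - Fn m t 0 x)) + norm (cl (\<lambda>x. Fn n t 1 x - Fn m t 1 x)) \<le> eps t n + sqrt (2 * Bd * eps t n)"
    if "n \<le> m" for n m
    using Fn_diff(1,2)[OF that t order_refl] by (simp add: cl_diff jet_rl2 jet_Fn cl_Fn t)
  have z: "(\<lambda>n. c * (eps t n + sqrt (2 * Bd * eps t n))) \<longlonglongrightarrow> 0" for c
    using tendsto_add[OF eps_tendsto(1)[of c t] eps_tendsto(2)[of c "2 * Bd" t]] by (simp add: distrib_left)
  show "(\<lambda>n. cl (jprod (Fn n t) (Fn n t) 1)) \<longlonglongrightarrow> V2 t"
    unfolding V2_def
  proof (rule rate_limit(1)[OF _ z])
    fix n m :: nat assume "n \<le> m"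
    from mult_left_mono[OF d[OF this], of "4 * Bd"] product_difference(1)[OF Fn_jbd[OF t] Fn_jbd[OF t] refl, of n m] Bd_nonneg
    show "norm (cl (jprod (Fn n t) (Fn n t) 1) - cl (jprod (Fn m t) (Fn m t) 1)) \<le> 4 * Bd * (eps t n + sqrt (2 * Bd * eps t n))"
      by linarith
  qed
  show "(\<lambda>n. cl (jprod (Fn n t) (jprod (Fn n t) (Fn n t)) 1)) \<longlonglongrightarrow> V3 t"
    unfolding V3_def
  proof (rule rate_limit(1)[OF _ z])
    fix n m :: nat assume "n \<le> m"
    from mult_left_mono[OF d[OF this], of "24 * Bd\<^sup>2"] product_difference(2)[OF Fn_jbd[OF t] Fn_jbd[OF t] refl, of n m] zero_le_power2[of Bd]
    show "norm (cl (jprod (Fn n t) (jprod (Fn n t) (Fn n t)) 1) - cl (jprod (Fn m t) (jprod (Fn m t) (Fn m t)) 1)) \<le> 24 * Bd\<^sup>2 * (eps t n + sqrt (2 * Bd * eps t n))"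
      by linarith
  qed
qed

definition dl :: "real \<Rightarrow> nat \<Rightarrow> real" where
  "dl T n = (cS Bd + Ak 0) * (eps T n + sqrt (2 * Bd * eps T n)) + cT Bd / real (Suc n)"

lemma dl_tendsto: "dl T \<longlonglongrightarrow> 0"
proof -
  have "(\<lambda>n. (cS Bd + Ak 0) * eps T n + (cS Bd + Ak 0) * sqrt (2 * Bd * eps T n) + cT Bd / real (Suc n)) \<longlonglongrightarrow> 0 + 0 + 0"
    using tendsto_mult_left[OF LIMSEQ_inverse_real_of_nat, of "cT Bd"] unfolding divide_inverse
    by (intro tendsto_add eps_tendsto) simp
  then show ?thesis by (simp add: dl_def[abs_def] distrib_left)
qed

lemma Wj_lim: 
  assumes t: "0 \<le> t"
  shows "(\<lambda>n. Wj (Fn n t)) \<longlonglongrightarrow> W t"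
  unfolding Wj_def W_def using cl_Fn[OF t]
  by (auto intro!: tendsto_add tendsto_scaleR tendsto_const V_lim[OF t, simplified] bounded_linear.tendsto[OF bounded_linear_am] un_lim[OF t order_refl])

text \<open>Two errors: replacing the truncated solution by its limit, through
  \<open>Wj_diff\<close> with the second index tending to infinity, and the projection, through
  \<open>Wj_tail\<close> with the larger cutoff tending to infinity.\<close>

lemma W_rate:
  assumes t: "0 \<le> t" "t \<le> T"
  shows "norm (dN (real (Suc n)) 0 (Wj (Fn n t)) - W t) \<le> dl T n"
proof -
  have S0: "cS Bd + Ak 0 \<ge> 0" using cS_nonneg Ak_nonneg[of 0] by simp
  have "norm (Wj (Fn n t) - W t) \<le> (cS Bd + Ak 0) * (eps T n + sqrt (2 * Bd * eps T n))"
  proof (rule tendsto_upperbound)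
    show "(\<lambda>m. norm (Wj (Fn n t) - Wj (Fn m t))) \<longlonglongrightarrow> norm (Wj (Fn n t) - W t)"
      by (intro tendsto_intros Wj_lim t)
    show "\<forall>\<^sub>F m in sequentially. norm (Wj (Fn n t) - Wj (Fn m t)) \<le> (cS Bd + Ak 0) * (eps T n + sqrt (2 * Bd * eps T n))"
      using eventually_ge_at_top[of n]
    proof eventually_elim
      case (elim m)
      have "norm (Wj (Fn n t) - Wj (Fn m t)) \<le> (cS Bd + Ak 0) * (norm (cl (\<lambda>x. Fn n t 0 x - Fn m t 0 x)) + norm (cl (\<lambda>x. Fn n t 1 x - Fn m t 1 x)))"
        by (rule Wj_diff(1)[OF Fn_jbd[OF t(1)] Fn_jbd[OF t(1)] refl])
      also have "\<dots> \<le> (cS Bd + Ak 0) * (eps T n + sqrt (2 * Bd * eps T n))"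
        using Fn_diff(1,2)[OF elim t] S0 by (intro mult_left_mono add_mono) (auto simp: cl_diff jet_rl2 jet_Fn cl_Fn t)
      finally show ?case .
    qed
  qed simp
  moreover have "norm (Wj (Fn n t) - dN (real (Suc n)) 0 (Wj (Fn n t))) \<le> cT Bd / real (Suc n)"
  proof (rule tendsto_upperbound)
    show "(\<lambda>m. norm (dN (real m) 0 (Wj (Fn n t)) - dN (real (Suc n)) 0 (Wj (Fn n t)))) \<longlonglongrightarrow> norm (Wj (Fn n t) - dN (real (Suc n)) 0 (Wj (Fn n t)))"
      by (intro tendsto_intros dN_tendsto)
    show "\<forall>\<^sub>F m in sequentially. norm (dN (real m) 0 (Wj (Fn n t)) - dN (real (Suc n)) 0 (Wj (Fn n t))) \<le> cT Bd / real (Suc n)"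
      using eventually_ge_at_top[of "Suc n"] by eventually_elim (intro Wj_tail Fn_jbd t; simp)
  qed simp
  ultimately show ?thesis
    unfolding dl_def
    using norm_triangle_ineq[of "dN (real (Suc n)) 0 (Wj (Fn n t)) - Wj (Fn n t)" "Wj (Fn n t) - W t"]
    by (simp add: norm_minus_commute[of "Wj (Fn n t)" "dN _ _ _"] del: of_nat_Suc)
qed

lemma fl_bound: "t \<ge> 0 \<Longrightarrow> \<bar>fl t x\<bar> \<le> 2 * Bd"
  by (rule tendsto_upperbound[OF tendsto_rabs[OF fl_lim]]) (auto intro!: always_eventually jbd_sup[OF Fn_jbd])

lemma fl_measurable: "t \<ge> 0 \<Longrightarrow> fl t \<in> borel_measurable borel"
  by (rule borel_measurable_LIMSEQ_metric[where f="\<lambda>n. Fn n t 0"]) (auto intro: fl_lim chain_measurable jet_chain jet_Fn)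

text \<open>Fatou identifies the pointwise limit with the limit in norm: the distance of
  \<open>fl t\<close> to \<open>U t\<close> is at most every positive number.\<close>

lemma fl_cl:
  assumes t: "t \<ge> 0"
  shows "rl2 (fl t)" "cl (fl t) = U t"
proof -
  have F: "(\<lambda>x. complex_of_real (Fn n t 0 x)) \<in> L2" for n using jet_rl2[OF jet_Fn] unfolding rl2_def .
  have m: "(\<lambda>x. complex_of_real (fl t x)) \<in> borel_measurable borel" using fl_measurable[OF t] by measurable
  have fat: "(\<lambda>x. complex_of_real (fl t x) - rep_l2 w x) \<in> L2 \<and> norm (abs_l2 (\<lambda>x. complex_of_real (fl t x) - rep_l2 w x)) \<le> C"
    if C: "\<forall>\<^sub>F n in sequentially. norm (un n t - w) \<le> C" "C \<ge> 0" for w C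
  proof -
    have L: "(\<lambda>x. complex_of_real (Fn n t 0 x) - rep_l2 w x) \<in> L2" for n by (intro L2_diff F rep_L2)
    have e: "abs_l2 (\<lambda>x. complex_of_real (Fn n t 0 x) - rep_l2 w x) = un n t - w" for n
      using cl_Fn[OF t, of n] by (simp add: abs_diff F cl_def)
    have h: "AE x in lborel. (\<lambda>n. complex_of_real (Fn n t 0 x) - rep_l2 w x) \<longlonglongrightarrow> complex_of_real (fl t x) - rep_l2 w x"
      by (intro AE_I2 tendsto_intros fl_lim t)
    have i: "\<forall>\<^sub>F n in sequentially. (LINT x|lborel. (norm (complex_of_real (Fn n t 0 x) - rep_l2 w x))\<^sup>2) \<le> C\<^sup>2"
      using C(1) by eventually_elim (auto simp: norm_abs_sq[symmetric] L e intro: power_mono)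
    have j: "(\<lambda>x. complex_of_real (fl t x) - rep_l2 w x) \<in> borel_measurable borel" using m by measurable
    note * = L2_fatou[OF L j h i]
    have "norm (abs_l2 (\<lambda>x. complex_of_real (fl t x) - rep_l2 w x)) \<le> sqrt (C\<^sup>2)"
      unfolding norm_abs[OF *(1)] by (rule real_sqrt_le_mono[OF *(2)])
    then show ?thesis using *(1) C(2) by simp
  qed
  have "norm (abs_l2 (\<lambda>x. complex_of_real (fl t x) - rep_l2 (U t) x)) \<le> 0"
  proof (rule field_le_epsilon)
    fix e :: real assume e: "0 < e"
    have "(\<lambda>n. norm (un n t - U t)) \<longlonglongrightarrow> 0" using un_lim(1)[OF t order_refl] by (simp add: tendsto_norm_zero_iff LIM_zero_iff)
    then have "\<forall>\<^sub>F n in sequentially. norm (un n t - U t) < e" using e by (rule order_tendstoD)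
    then have "\<forall>\<^sub>F n in sequentially. norm (un n t - U t) \<le> e" by eventually_elim simp
    from fat[OF this] e show "norm (abs_l2 (\<lambda>x. complex_of_real (fl t x) - rep_l2 (U t) x)) \<le> 0 + e" by simp
  qed
  moreover
  obtain C where C: "\<And>n. norm (un n t - U t) \<le> C"
    using convergent_imp_bounded[OF tendsto_diff[OF un_lim(1)[OF t order_refl] tendsto_const[of "U t"]]]
    by (auto simp: bounded_iff)
  have "C \<ge> 0" using C[of 0] norm_ge_zero order_trans by blast
  with fat[of "U t" C] C have L: "(\<lambda>x. complex_of_real (fl t x) - rep_l2 (U t) x) \<in> L2" by simp
  from L2_add[OF this rep_L2[of "U t"]] have F': "(\<lambda>x. complex_of_real (fl t x)) \<in> L2" by simp
  ultimately show "rl2 (fl t)" "cl (fl t) = U t"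
    using abs_diff[OF F' rep_L2[of "U t"]] by (simp_all add: rl2_def cl_def)
qed

lemma powers_lim:
  assumes t: "t \<ge> 0"
  shows "rl2 (\<lambda>x. (fl t x)\<^sup>2)" "rl2 (\<lambda>x. (fl t x) ^ 3)"
    "(\<lambda>n. cl (jprod (Fn n t) (Fn n t) 0)) \<longlonglongrightarrow> cl (\<lambda>x. (fl t x)\<^sup>2)"
    "(\<lambda>n. cl (jprod (Fn n t) (jprod (Fn n t) (Fn n t)) 0)) \<longlonglongrightarrow> cl (\<lambda>x. (fl t x) ^ 3)"
proof -
  note [measurable] = fl_measurable[OF t]
  have [measurable]: "Fn n t 0 \<in> borel_measurable borel" for n by (intro chain_measurable jet_chain jet_Fn)
  have b: "\<bar>fl t x\<bar> \<le> 2 * Bd" "\<bar>Fn n t 0 x\<bar> \<le> 2 * Bd" for n x using fl_bound[OF t] jbd_sup[OF Fn_jbd[OF t]] by auto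
  have p: "\<bar>a * b\<bar> \<le> 4 * Bd\<^sup>2" if "\<bar>a\<bar> \<le> 2 * Bd" "\<bar>b\<bar> \<le> 2 * Bd" for a b
    using mult_mono[OF that] Bd_nonneg by (simp add: abs_mult power2_eq_square)
  have r2: "rl2 (\<lambda>x. fl t x * fl t x)" by (rule rl2_bmult[OF fl_cl(1)[OF t] _ b(1)]) measurable
  have r3: "rl2 (\<lambda>x. (fl t x * fl t x) * fl t x)" by (rule rl2_bmult[OF fl_cl(1)[OF t] _ p[OF b(1) b(1)]]) measurable
  show R2: "rl2 (\<lambda>x. (fl t x)\<^sup>2)" "rl2 (\<lambda>x. (fl t x) ^ 3)" using r2 r3 by (simp_all add: power2_eq_square power3_eq_cube)
  have rF: "rl2 (jprod (Fn n t) (Fn n t) 0)" "rl2 (jprod (Fn n t) (jprod (Fn n t) (Fn n t)) 0)" for n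
    by (intro jet_rl2 jet_mult jet_Fn)+
  have rd: "rl2 (\<lambda>x. Fn n t 0 x - fl t x)" for n by (intro rl2_diff jet_rl2 jet_Fn fl_cl t)
  have cd: "cl (\<lambda>x. Fn n t 0 x - fl t x) = un n t - U t" for n
    by (simp add: cl_diff jet_rl2 jet_Fn fl_cl t cl_Fn)
  have z: "(\<lambda>n. c * norm (un n t - U t)) \<longlonglongrightarrow> 0" for c
  proof -
    have "(\<lambda>n. c * norm (un n t - U t)) \<longlonglongrightarrow> c * norm (U t - U t)" by (intro tendsto_intros un_lim(1)[OF t order_refl])
    then show ?thesis by simp
  qed
  show "(\<lambda>n. cl (jprod (Fn n t) (Fn n t) 0)) \<longlonglongrightarrow> cl (\<lambda>x. (fl t x)\<^sup>2)"
  proof (rule Lim_transform_bound[OF _ z[of "4 * Bd"], THEN LIM_zero_cancel], intro always_eventually allI)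
    fix n
    have eq: "cl (jprod (Fn n t) (Fn n t) 0) - cl (\<lambda>x. (fl t x)\<^sup>2) = cl (\<lambda>x. (Fn n t 0 x + fl t x) * (Fn n t 0 x - fl t x))"
      unfolding cl_diff[OF rF(1) R2(1), symmetric] by (rule arg_cong[where f=cl]) (simp add: fun_eq_iff algebra_simps power2_eq_square)
    have "norm (cl (\<lambda>x. (Fn n t 0 x + fl t x) * (Fn n t 0 x - fl t x))) \<le> 4 * Bd * norm (cl (\<lambda>x. Fn n t 0 x - fl t x))"
    proof (rule norm_cl_mult_le[OF rd])
      fix x show "\<bar>Fn n t 0 x + fl t x\<bar> \<le> 4 * Bd" using b(1)[of x] b(2)[of n x] by linarith
    qed measurable
    then show "norm (cl (jprod (Fn n t) (Fn n t) 0) - cl (\<lambda>x. (fl t x)\<^sup>2)) \<le> norm (4 * Bd * norm (un n t - U t))"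
      unfolding cd eq by simp
  qed
  show "(\<lambda>n. cl (jprod (Fn n t) (jprod (Fn n t) (Fn n t)) 0)) \<longlonglongrightarrow> cl (\<lambda>x. (fl t x) ^ 3)"
  proof (rule Lim_transform_bound[OF _ z[of "12 * Bd\<^sup>2"], THEN LIM_zero_cancel], intro always_eventually allI)
    fix n
    have eq: "cl (jprod (Fn n t) (jprod (Fn n t) (Fn n t)) 0) - cl (\<lambda>x. (fl t x) ^ 3)
      = cl (\<lambda>x. (Fn n t 0 x * Fn n t 0 x + Fn n t 0 x * fl t x + fl t x * fl t x) * (Fn n t 0 x - fl t x))"
      unfolding cl_diff[OF rF(2) R2(2), symmetric] by (rule arg_cong[where f=cl]) (simp add: fun_eq_iff algebra_simps power3_eq_cube)
    have "norm (cl (\<lambda>x. (Fn n t 0 x * Fn n t 0 x + Fn n t 0 x * fl t x + fl t x * fl t x) * (Fn n t 0 x - fl t x))) \<le> 12 * Bd\<^sup>2 * norm (cl (\<lambda>x. Fn n t 0 x - fl t x))"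
    proof (rule norm_cl_mult_le[OF rd])
      fix x show "\<bar>Fn n t 0 x * Fn n t 0 x + Fn n t 0 x * fl t x + fl t x * fl t x\<bar> \<le> 12 * Bd\<^sup>2"
        using p[OF b(2)[of n x] b(2)[of n x]] p[OF b(2)[of n x] b(1)[of x]] p[OF b(1)[of x] b(1)[of x]] by linarith
    qed measurable
    then show "norm (cl (jprod (Fn n t) (jprod (Fn n t) (Fn n t)) 0) - cl (\<lambda>x. (fl t x) ^ 3)) \<le> norm (12 * Bd\<^sup>2 * norm (un n t - U t))"
      unfolding cd eq by simp
  qed
qed

text \<open>For a fixed cutoff \<open>N\<close> the quantities are continuous on \<open>l2\<close>.
  Lowering the cutoff from \<open>n + 1\<close> to \<open>N\<close> only decreases norms, so the
  uniform bound passes to the limit and then holds for every \<open>N\<close>.\<close>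

lemma U_facts:
  assumes t: "t \<ge> 0"
  shows "norm (U t) \<le> exp (- \<gamma> * t) * norm u0" "N \<ge> 0 \<Longrightarrow> K \<ge> 3 \<Longrightarrow> Yg N r K (U t) \<le> Mb"
proof -
  have "norm (un n t) \<le> exp (- \<gamma> * t) * norm u0" for n unfolding un_def by (intro gal_decay u0_real t) simp
  then show "norm (U t) \<le> exp (- \<gamma> * t) * norm u0"
    by (intro tendsto_upperbound[OF tendsto_norm[OF un_lim(1)[OF t order_refl]]] always_eventually) auto
  assume N: "N \<ge> 0" and K: "K \<ge> 3"
  show "Yg N r K (U t) \<le> Mb"
  proof (rule tendsto_upperbound)
    show "(\<lambda>n. Yg N r K (un n t)) \<longlonglongrightarrow> Yg N r K (U t)"
      unfolding Yg_def by (intro tendsto_intros bounded_linear.tendsto[OF bounded_linear_dN] un_lim(1)[OF t order_refl])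
    have "\<forall>\<^sub>F n in sequentially. N \<le> real (Suc n)" using filterlim_at_top[THEN iffD1, OF filterlim_real_sequentially, rule_format, of N]
      by eventually_elim simp
    then show "\<forall>\<^sub>F n in sequentially. Yg N r K (un n t) \<le> Mb"
    proof eventually_elim
      case (elim n)
      have "Yg N r K (un n t) \<le> Yg (real (Suc n)) r K (un n t)"
        unfolding Yg_def
      proof (intro sum_mono power_mono mult_left_mono)
        fix k
        have "norm (dN N k (un n t)) = norm (dN N 0 (dN (real (Suc n)) k (un n t)))" by (simp add: dN_dN elim del: of_nat_Suc)
        also have "\<dots> \<le> norm (dN (real (Suc n)) k (un n t))" using dN_norm[OF N, of 0] by simp
        finally show "norm (dN N k (un n t)) \<le> norm (dN (real (Suc n)) k (un n t))" .
      qed (use wt_pos[OF r] in \<open>auto simp: less_imp_le\<close>)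
      also have "\<dots> \<le> Mb" unfolding un_def by (intro Yb K t) simp
      finally show ?case .
    qed
  qed simp
qed

end

subsection \<open>The Duhamel formula\<close>

definition phase :: "real \<Rightarrow> real \<Rightarrow> real \<Rightarrow> real \<Rightarrow> complex" where
  "phase \<alpha> \<beta> t \<xi> = exp (- \<i> * of_real (t * (\<alpha> * \<xi>^5 - \<beta> * \<xi>^3)))"

definition Sop :: "real \<Rightarrow> real \<Rightarrow> real \<Rightarrow> l2 \<Rightarrow> l2" where "Sop \<alpha> \<beta> t = mlt (phase \<alpha> \<beta> t)"

lemma phase_measurable [measurable]: "phase \<alpha> \<beta> t \<in> borel_measurable borel"
  unfolding phase_def by measurable

lemma norm_phase [simp]: "norm (phase \<alpha> \<beta> t \<xi>) = 1"
  unfolding phase_def mult_minus_left by (rule norm_exp_i)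

lemma bmul_phase: "bmul (phase \<alpha> \<beta> t)"
  by (rule bmulI[where C=1]) auto

lemma phase_add: "phase \<alpha> \<beta> s \<xi> * phase \<alpha> \<beta> t \<xi> = phase \<alpha> \<beta> (s + t) \<xi>"
  by (simp add: phase_def exp_add[symmetric] algebra_simps)

lemma bounded_linear_Sop: "bounded_linear (Sop \<alpha> \<beta> t)"
  unfolding Sop_def by (rule bounded_linear_mlt)

lemmas Sop_diff = linear_diff[OF bounded_linear.linear[OF bounded_linear_Sop]]

lemma Sop_zero [simp]: "Sop \<alpha> \<beta> 0 u = u"
  by (simp add: Sop_def mlt_def phase_def[abs_def])

lemma norm_Sop: "norm (Sop \<alpha> \<beta> t u) \<le> norm u"
  unfolding Sop_def using mlt_norm[OF phase_measurable, of \<alpha> \<beta> t 1 u] by simp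

lemma Sop_adjoint: "Sop \<alpha> \<beta> t u \<bullet> v = u \<bullet> Sop \<alpha> \<beta> (- t) v"
proof -
  have "cnj (phase \<alpha> \<beta> t \<xi>) = phase \<alpha> \<beta> (- t) \<xi>" for \<xi> by (simp add: phase_def exp_cnj)
  then show ?thesis by (simp add: Sop_def inner_mlt_left bmul_phase)
qed

text \<open>Dominated convergence of the unimodular symbols on each fixed vector; this strong
  continuity is what the Duhamel integrand needs.\<close>

lemma Sop_strong: 
  assumes "s \<longlonglongrightarrow> t"
  shows "(\<lambda>n. Sop \<alpha> \<beta> (s n) u) \<longlonglongrightarrow> Sop \<alpha> \<beta> t u"
proof -
  have "(\<lambda>n. abs_l2 (\<lambda>\<xi>. phase \<alpha> \<beta> (s n) \<xi> * rep_l2 (Fop u) \<xi>)) \<longlonglongrightarrow> abs_l2 (\<lambda>\<xi>. phase \<alpha> \<beta> t \<xi> * rep_l2 (Fop u) \<xi>)"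
  proof (rule L2_dominated(3))
    show "integrable lborel (\<lambda>x. (norm (rep_l2 (Fop u) x))\<^sup>2)" by (intro L2_integrable rep_L2)
    show "AE x in lborel. (\<lambda>n. phase \<alpha> \<beta> (s n) x * rep_l2 (Fop u) x) \<longlonglongrightarrow> phase \<alpha> \<beta> t x * rep_l2 (Fop u) x"
      unfolding phase_def by (intro AE_I2 tendsto_intros assms)
  qed (auto simp: norm_mult)
  then have "(\<lambda>n. mul (phase \<alpha> \<beta> (s n)) (Fop u)) \<longlonglongrightarrow> mul (phase \<alpha> \<beta> t) (Fop u)" by (simp add: mul_rep bmul_phase)
  from bounded_linear.tendsto[OF bounded_linear_Fi this] show ?thesis by (simp add: Sop_def mlt_def)
qed

lemma continuous_on_Sop:
  fixes w :: "real \<Rightarrow> l2"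
  assumes w: "continuous_on A w" and f: "continuous_on A f"
  shows "continuous_on A (\<lambda>s. Sop \<alpha> \<beta> (f s) (w s))"
  unfolding continuous_on_sequentially comp_def
proof (intro allI ballI impI, elim conjE)
  fix x :: "nat \<Rightarrow> real" and a assume a: "a \<in> A" "\<forall>n. x n \<in> A" "x \<longlonglongrightarrow> a"
  have wl: "(\<lambda>n. w (x n)) \<longlonglongrightarrow> w a" and fl: "(\<lambda>n. f (x n)) \<longlonglongrightarrow> f a"
    using w f a unfolding continuous_on_sequentially comp_def by blast+
  have "(\<lambda>n. norm (w (x n) - w a) + norm (Sop \<alpha> \<beta> (f (x n)) (w a) - Sop \<alpha> \<beta> (f a) (w a))) \<longlonglongrightarrow> norm (w a - w a) + norm (Sop \<alpha> \<beta> (f a) (w a) - Sop \<alpha> \<beta> (f a) (w a))"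
    by (intro tendsto_intros wl Sop_strong fl)
  then have z: "(\<lambda>n. norm (w (x n) - w a) + norm (Sop \<alpha> \<beta> (f (x n)) (w a) - Sop \<alpha> \<beta> (f a) (w a))) \<longlonglongrightarrow> 0" by simp
  show "(\<lambda>n. Sop \<alpha> \<beta> (f (x n)) (w (x n))) \<longlonglongrightarrow> Sop \<alpha> \<beta> (f a) (w a)"
  proof (rule Lim_transform_bound[OF _ z, THEN LIM_zero_cancel], intro always_eventually allI)
    fix n
    have "Sop \<alpha> \<beta> (f (x n)) (w (x n)) - Sop \<alpha> \<beta> (f a) (w a)
      = Sop \<alpha> \<beta> (f (x n)) (w (x n) - w a) + (Sop \<alpha> \<beta> (f (x n)) (w a) - Sop \<alpha> \<beta> (f a) (w a))" by (simp add: Sop_diff)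
    then have "norm (Sop \<alpha> \<beta> (f (x n)) (w (x n)) - Sop \<alpha> \<beta> (f a) (w a)) \<le> norm (w (x n) - w a) + norm (Sop \<alpha> \<beta> (f (x n)) (w a) - Sop \<alpha> \<beta> (f a) (w a))"
      by (simp only:) (intro order_trans[OF norm_triangle_ineq] add_right_mono norm_Sop)
    then show "norm (Sop \<alpha> \<beta> (f (x n)) (w (x n)) - Sop \<alpha> \<beta> (f a) (w a)) \<le> norm (norm (w (x n) - w a) + norm (Sop \<alpha> \<beta> (f (x n)) (w a) - Sop \<alpha> \<beta> (f a) (w a)))"
      by simp
  qed
qed

lemma mlt_scaleR: "bmul m \<Longrightarrow> mlt (\<lambda>x. of_real r * m x) u = r *\<^sub>R mlt m u"
proof -
  assume m: "bmul m"
  have "mlt (\<lambda>x. of_real r) v = r *\<^sub>R v" for v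
    by (rule Fop_eq_iff[THEN iffD1])
      (simp add: mul_rep abs_scaleR[symmetric, OF rep_L2, simplified scaleR_conv_of_real] linear_scale[OF bounded_linear.linear[OF bounded_linear_Fop]] del: abs_rep,
       simp add: abs_scaleR scaleR_conv_of_real[symmetric])
  from this[of "mlt m u"] show ?thesis by (simp add: mlt_mlt m)
qed

text \<open>On a bounded frequency band the generator is a bounded operator and the symbol has a
  quadratic Taylor remainder. This is why truncated vectors serve as tests.\<close>

lemma Sop_deriv:
  fixes \<alpha> \<beta> N t :: real and \<phi> :: l2
  assumes N: "N \<ge> 0"
  defines "c \<equiv> \<lambda>s. Sop \<alpha> \<beta> (s - t) (dN N 0 \<phi>)"
  shows "(c has_vector_derivative - (\<alpha> *\<^sub>R dN N 5 (c s) + \<beta> *\<^sub>R dN N 3 (c s))) (at s within A)"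
proof -
  define q where "q \<xi> = \<alpha> * \<xi> ^ 5 - \<beta> * \<xi> ^ 3" for \<xi>
  \<comment> \<open>The square of the maximum of the dispersion relation on the band, from the
    remainder \<open>(h * q \<xi>)^2\<close>.\<close>
  define K where "K = (\<bar>\<alpha>\<bar> * N ^ 5 + \<bar>\<beta>\<bar> * N ^ 3)\<^sup>2"
  let ?D = "- (\<alpha> *\<^sub>R dN N 5 (c s) + \<beta> *\<^sub>R dN N 3 (c s))"
  have est: "norm (c y - c s - (y - s) *\<^sub>R ?D) \<le> K * (y - s)\<^sup>2 * norm \<phi>" for y
  proof -
    define p where "p = phase \<alpha> \<beta> (s - t)"
    define h where "h = y - s"
    have bp: "bmul p" by (simp add: p_def bmul_phase)
    note b = bmul_mult bmul_band bmul_const bp bmul_phase bmul_add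
    have c: "c s = mlt (\<lambda>\<xi>. p \<xi> * band N 0 \<xi>) \<phi>" "c y = mlt (\<lambda>\<xi>. phase \<alpha> \<beta> (y - t) \<xi> * band N 0 \<xi>) \<phi>"
      by (simp_all add: c_def Sop_def dN_def mlt_mlt p_def b)
    have d: "dN N k (mlt (\<lambda>\<xi>. p \<xi> * band N 0 \<xi>) \<phi>) = mlt (\<lambda>\<xi>. band N k \<xi> * (p \<xi> * band N 0 \<xi>)) \<phi>" for k
      by (simp add: dN_def mlt_mlt b)
    have "c y - c s - (y - s) *\<^sub>R ?D = c y + (-1) *\<^sub>R c s + (h * \<alpha>) *\<^sub>R dN N 5 (c s) + (h * \<beta>) *\<^sub>R dN N 3 (c s)"
      by (simp add: h_def algebra_simps)
    also have "\<dots> = mlt (\<lambda>\<xi>. phase \<alpha> \<beta> (y - t) \<xi> * band N 0 \<xi> + of_real (-1) * (p \<xi> * band N 0 \<xi>)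
        + of_real (h * \<alpha>) * (band N 5 \<xi> * (p \<xi> * band N 0 \<xi>)) + of_real (h * \<beta>) * (band N 3 \<xi> * (p \<xi> * band N 0 \<xi>))) \<phi>"
      unfolding c d by (simp only: mlt_scaleR[symmetric] mlt_add_left[symmetric] b)
    also have "norm \<dots> \<le> K * h\<^sup>2 * norm \<phi>"
    proof (rule mlt_norm)
      fix \<xi>
      show "norm (phase \<alpha> \<beta> (y - t) \<xi> * band N 0 \<xi> + of_real (-1) * (p \<xi> * band N 0 \<xi>)
        + of_real (h * \<alpha>) * (band N 5 \<xi> * (p \<xi> * band N 0 \<xi>)) + of_real (h * \<beta>) * (band N 3 \<xi> * (p \<xi> * band N 0 \<xi>))) \<le> K * h\<^sup>2"
      proof (cases "\<bar>\<xi>\<bar> \<le> N")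
        case True
        then have i: "ind (- N) N \<xi> = 1" by (auto simp: ind_def indicator_def)
        have ph: "phase \<alpha> \<beta> (y - t) \<xi> = exp (\<i> * of_real (- (h * q \<xi>))) * p \<xi>"
          unfolding p_def using phase_add[of \<alpha> \<beta> h \<xi> "s - t"] by (simp add: h_def phase_def q_def)
        \<comment> \<open>These powers convert
          \<open>- \<i> * (\<alpha> * \<xi>^5 - \<beta> * \<xi>^3)\<close> into minus
          \<open>\<alpha> * (\<i> * \<xi>)^5 + \<beta> * (\<i> * \<xi>)^3\<close>.\<close>
        have "\<i> ^ 5 = \<i>" "\<i> ^ 3 = - \<i>" by (simp_all add: numeral_eq_Suc)
        then have "phase \<alpha> \<beta> (y - t) \<xi> * band N 0 \<xi> + of_real (-1) * (p \<xi> * band N 0 \<xi>)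
          + of_real (h * \<alpha>) * (band N 5 \<xi> * (p \<xi> * band N 0 \<xi>)) + of_real (h * \<beta>) * (band N 3 \<xi> * (p \<xi> * band N 0 \<xi>))
          = (exp (\<i> * of_real (- (h * q \<xi>))) - 1 - \<i> * of_real (- (h * q \<xi>))) * p \<xi>"
          by (simp add: ph band_def i q_def power_mult_distrib algebra_simps)
        also have "norm \<dots> \<le> (- (h * q \<xi>))\<^sup>2"
          using exp_taylor[of "- (h * q \<xi>)"] by (simp add: norm_mult p_def)
        also have "\<dots> = (q \<xi>)\<^sup>2 * h\<^sup>2" by (simp add: power_mult_distrib)
        also have "(q \<xi>)\<^sup>2 \<le> K" unfolding K_def
        proof (rule power2_le_iff_abs_le[THEN iffD2])
          have "\<bar>q \<xi>\<bar> \<le> \<bar>\<alpha>\<bar> * \<bar>\<xi>\<bar> ^ 5 + \<bar>\<beta>\<bar> * \<bar>\<xi>\<bar> ^ 3"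
            unfolding q_def by (rule order_trans[OF abs_triangle_ineq4]) (simp add: abs_mult power_abs)
          also have "\<dots> \<le> \<bar>\<alpha>\<bar> * N ^ 5 + \<bar>\<beta>\<bar> * N ^ 3" using True by (intro add_mono mult_left_mono power_mono) auto
          finally show "\<bar>q \<xi>\<bar> \<le> \<bar>\<alpha>\<bar> * N ^ 5 + \<bar>\<beta>\<bar> * N ^ 3" .
        qed (use N in simp)
        finally show ?thesis by (simp add: mult_right_mono)
      next
        case False
        then have "ind (- N) N \<xi> = 0" by (auto simp: ind_def indicator_def)
        then show ?thesis by (simp add: band_def K_def)
      qed
    qed (auto simp: p_def)
    finally show ?thesis by (simp add: h_def)
  qed
  show ?thesis
    unfolding has_vector_derivative_def has_derivative_within_alt
  proof (intro conjI allI impI bounded_linear_scaleR_left)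
    fix e :: real assume e: "0 < e"
    define d where "d = e / (K * norm \<phi> + 1)"
    have K: "K * norm \<phi> + 1 > 0" by (simp add: K_def add_nonneg_pos)
    show "\<exists>d>0. \<forall>y\<in>A. norm (y - s) < d \<longrightarrow> norm (c y - c s - (y - s) *\<^sub>R ?D) \<le> e * norm (y - s)"
    proof (intro exI[of _ d] conjI ballI impI)
      show "d > 0" using e K by (simp add: d_def)
      fix y assume "norm (y - s) < d"
      then have "(K * norm \<phi> + 1) * \<bar>y - s\<bar> \<le> e" using K by (simp add: d_def field_simps)
      from mult_right_mono[OF this, of "\<bar>y - s\<bar>"]
      have "K * (y - s)\<^sup>2 * norm \<phi> + (y - s)\<^sup>2 \<le> e * \<bar>y - s\<bar>" by (simp add: power2_eq_square algebra_simps)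
      with est[of y] show "norm (c y - c s - (y - s) *\<^sub>R ?D) \<le> e * norm (y - s)"
        using zero_le_power2[of "y - s"] by (simp only: real_norm_def)
    qed
  qed
qed

context kawahara_data
begin

lemma un_cont: "continuous_on {0..T} (un n)"
  unfolding continuous_on_eq_continuous_within un_def
  by (rule ballI, rule has_vector_derivative_continuous, rule gal(3)[OF _ u0_real]) auto

lemma U_cont: "continuous_on {0..T} U"
proof (rule uniform_limit_theorem)
  show "\<forall>\<^sub>F n in sequentially. continuous_on {0..T} (un n)" by (simp add: un_cont)
  show "uniform_limit {0..T} un U sequentially"
  proof (rule uniform_limitI)
    fix e :: real assume "0 < e"
    then have "\<forall>\<^sub>F n in sequentially. eps T n < e" using eps_tendsto(1)[of 1 T] by (auto dest: order_tendstoD)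
    then show "\<forall>\<^sub>F n in sequentially. \<forall>t\<in>{0..T}. dist (un n t) (U t) < e"
      by eventually_elim (auto simp: dist_norm intro: le_less_trans[OF un_lim(2)])
  qed
qed simp

text \<open>The forcing contains a derivative, so its continuity in time is that of \<open>U\<close>
  after interpolation with the second-order bound, at the cost of a square root.\<close>

lemma W_diff:
  assumes s: "0 \<le> s" and t: "0 \<le> t"
  shows "norm (W s - W t) \<le> (cS Bd + Ak 0) * (norm (U s - U t) + sqrt (norm (U s - U t) * (2 * Bd)))"
proof (rule LIMSEQ_le)
  have S0: "cS Bd + Ak 0 \<ge> 0" using cS_nonneg Ak_nonneg[of 0] by simp
  show "(\<lambda>n. norm (Wj (Fn n s) - Wj (Fn n t))) \<longlonglongrightarrow> norm (W s - W t)"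
    by (intro tendsto_intros Wj_lim s t)
  show "(\<lambda>n. (cS Bd + Ak 0) * (norm (un n s - un n t) + sqrt (norm (un n s - un n t) * (2 * Bd)))) \<longlonglongrightarrow>
      (cS Bd + Ak 0) * (norm (U s - U t) + sqrt (norm (U s - U t) * (2 * Bd)))"
    by (intro tendsto_intros un_lim(1)[OF _ order_refl] s t)
  have "norm (Wj (Fn n s) - Wj (Fn n t)) \<le> (cS Bd + Ak 0) * (norm (un n s - un n t) + sqrt (norm (un n s - un n t) * (2 * Bd)))" for n
  proof -
    let ?e = "\<lambda>k x. Fn n s k x - Fn n t k x"
    have j: "jet ?e" by (intro jet_diff jet_Fn)
    have c0: "cl (?e 0) = un n s - un n t" by (simp add: cl_diff jet_rl2 jet_Fn cl_Fn s t)
    have "norm (cl (?e 2)) \<le> norm (cl (Fn n s 2)) + norm (cl (Fn n t 2))"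
      unfolding cl_diff[OF jet_rl2[OF jet_Fn] jet_rl2[OF jet_Fn]] by (rule norm_triangle_ineq4)
    also have "\<dots> \<le> Bd + Bd" by (intro add_mono jbd_norm[OF Fn_jbd] s t) auto
    finally have "norm (cl (?e 0)) * norm (cl (?e 2)) \<le> norm (cl (?e 0)) * (2 * Bd)" by (intro mult_left_mono) auto
    with jet_interp[OF j, of 0] have "(norm (cl (?e 1)))\<^sup>2 \<le> norm (un n s - un n t) * (2 * Bd)"
      unfolding c0 by (simp add: numeral_2_eq_2)
    then have "norm (cl (?e 1)) \<le> sqrt (norm (un n s - un n t) * (2 * Bd))" by (rule real_le_rsqrt)
    moreover have "norm (Wj (Fn n s) - Wj (Fn n t)) \<le> (cS Bd + Ak 0) * (norm (cl (?e 0)) + norm (cl (?e 1)))"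
      by (rule Wj_diff(1)[OF Fn_jbd[OF s] Fn_jbd[OF t] refl])
    ultimately show ?thesis unfolding c0 using S0 by (meson add_left_mono mult_left_mono order_trans)
  qed
  then show "\<exists>M. \<forall>n\<ge>M. norm (Wj (Fn n s) - Wj (Fn n t)) \<le> (cS Bd + Ak 0) * (norm (un n s - un n t) + sqrt (norm (un n s - un n t) * (2 * Bd)))"
    by blast
qed

lemma W_cont: "continuous_on {0..T} W"
  unfolding continuous_on_def
proof (intro ballI)
  fix t assume t: "t \<in> {0..T}"
  let ?b = "\<lambda>s. (cS Bd + Ak 0) * (norm (U s - U t) + sqrt (norm (U s - U t) * (2 * Bd)))"
  have "(U \<longlongrightarrow> U t) (at t within {0..T})" using U_cont t by (auto simp: continuous_on_def)
  then have "(?b \<longlongrightarrow> (cS Bd + Ak 0) * (norm (U t - U t) + sqrt (norm (U t - U t) * (2 * Bd)))) (at t within {0..T})"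
    by (intro tendsto_intros)
  then have z: "(?b \<longlongrightarrow> 0) (at t within {0..T})" by simp
  have "\<forall>\<^sub>F s in at t within {0..T}. norm (W s - W t) \<le> ?b s"
    unfolding eventually_at_filter using W_diff t by (intro always_eventually) auto
  from Lim_null_comparison[OF this z] show "(W \<longlongrightarrow> W t) (at t within {0..T})" by (rule LIM_zero_cancel)
qed

text \<open>The test vector evolves under the adjoint group and reaches the projected
  \<open>\<phi>\<close> at time \<open>t\<close>. Along it the dispersive terms of the pairing
  cancel, and the fundamental theorem of calculus gives the formula.\<close>

lemma duhamel_weak:
  assumes t: "0 \<le> t"
  shows "((\<lambda>s. - (dN (real (Suc n)) 0 (Wj (Fn n s)) \<bullet> Sop \<alpha> \<beta> (s - t) (dN (real (Suc n)) 0 \<phi>)))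
    has_integral un n t \<bullet> \<phi> - dN (real (Suc n)) 0 u0 \<bullet> Sop \<alpha> \<beta> (- t) (dN (real (Suc n)) 0 \<phi>)) {0..t}"
proof -
  define N where "N = real (Suc n)"
  have N: "N \<ge> 0" by (simp add: N_def)
  define c where "c s = Sop \<alpha> \<beta> (s - t) (dN N 0 \<phi>)" for s
  have u: "realband N (un n s)" if "s \<ge> 0" for s unfolding un_def N_def[symmetric] by (rule gal_realband[OF N that])
  have d: "((\<lambda>s. un n s \<bullet> c s) has_vector_derivative - (dN N 0 (Wj (Fn n s)) \<bullet> c s)) (at s within {0..t})" if s: "s \<in> {0..t}" for s
  proof -
    have du: "(un n has_vector_derivative X N (un n s)) (at s within {0..t})"
      using gal(3)[OF N u0_real s] unfolding un_def N_def[symmetric] .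
    have dc: "(c has_vector_derivative - (\<alpha> *\<^sub>R dN N 5 (c s) + \<beta> *\<^sub>R dN N 3 (c s))) (at s within {0..t})"
      unfolding c_def by (rule Sop_deriv[OF N])
    have "un n s \<bullet> - (\<alpha> *\<^sub>R dN N 5 (c s) + \<beta> *\<^sub>R dN N 3 (c s)) + X N (un n s) \<bullet> c s = - (dN N 0 (Wj (Fn n s)) \<bullet> c s)"
      unfolding X_Wj[OF u[of s]] using s X_Wj[OF u[of s]] dN_skew[of N 5 "un n s" "c s"] dN_skew[of N 3 "un n s" "c s"]
      by (simp add: Fn_def N_def[symmetric] inner_add_left inner_add_right inner_diff_left inner_diff_right del: of_nat_Suc)
    with has_real_derivative_inner[OF du dc] show ?thesis
      by (simp add: has_real_derivative_iff_has_vector_derivative)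
  qed
  have "((\<lambda>s. - (dN N 0 (Wj (Fn n s)) \<bullet> c s)) has_integral (un n t \<bullet> c t - un n 0 \<bullet> c 0)) {0..t}"
    by (rule fundamental_theorem_of_calculus[OF t d])
  moreover have "un n t \<bullet> c t = un n t \<bullet> \<phi>"
    using dN_skew[of N 0 "un n t" \<phi>] u[OF t] by (simp add: c_def realband_def)
  moreover have "un n 0 = dN N 0 u0" unfolding un_def N_def[symmetric] by (rule gal(1)[OF N u0_real])
  ultimately show ?thesis by (simp add: c_def N_def)
qed

text \<open>The integral exists by continuity. Its value is found weakly, by dominated convergence
  in \<open>duhamel_weak\<close>, so no convergence of \<open>l2\<close>-valued integrals is
  involved.\<close>

theorem duhamel:
  assumes t: "0 \<le> t"
  shows "((\<lambda>s. Sop \<alpha> \<beta> (t - s) (W s)) has_integral Sop \<alpha> \<beta> t u0 - U t) {0..t}"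
proof -
  have "continuous_on {0..t} (\<lambda>s. Sop \<alpha> \<beta> (t - s) (W s))"
    by (intro continuous_on_Sop W_cont continuous_intros)
  then have "(\<lambda>s. Sop \<alpha> \<beta> (t - s) (W s)) integrable_on {0..t}" by (rule integrable_continuous_real)
  then obtain I where I: "((\<lambda>s. Sop \<alpha> \<beta> (t - s) (W s)) has_integral I) {0..t}" by blast
  have "(I + U t - Sop \<alpha> \<beta> t u0) \<bullet> \<phi> = 0" for \<phi>
  proof -
    define f where "f n s = - (dN (real (Suc n)) 0 (Wj (Fn n s)) \<bullet> Sop \<alpha> \<beta> (s - t) (dN (real (Suc n)) 0 \<phi>))" for n s
    define L where "L n = un n t \<bullet> \<phi> - dN (real (Suc n)) 0 u0 \<bullet> Sop \<alpha> \<beta> (- t) (dN (real (Suc n)) 0 \<phi>)" for n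
    have fL: "(f n has_integral L n) {0..t}" for n unfolding f_def L_def by (rule duhamel_weak[OF t])
    have P: "(\<lambda>n. dN (real (Suc n)) 0 v) \<longlonglongrightarrow> v" for v by (rule LIMSEQ_Suc[OF dN_tendsto])
    have wl: "(\<lambda>n. dN (real (Suc n)) 0 (Wj (Fn n s))) \<longlonglongrightarrow> W s" if "s \<in> {0..t}" for s
      by (rule Lim_null_comparison[OF _ dl_tendsto[of t], THEN LIM_zero_cancel])
        (use that in \<open>auto intro!: always_eventually W_rate simp del: of_nat_Suc\<close>)
    have Ll: "L \<longlonglongrightarrow> U t \<bullet> \<phi> - u0 \<bullet> Sop \<alpha> \<beta> (- t) \<phi>"
      unfolding L_def by (intro tendsto_intros un_lim(1)[OF t order_refl] P bounded_linear.tendsto[OF bounded_linear_Sop])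
    obtain D where D: "\<And>n. \<bar>dl t n\<bar> \<le> D"
      using convergent_imp_bounded[OF dl_tendsto[of t]] by (auto simp: bounded_iff)
    define h where "h s = (norm (W s) + D) * norm \<phi>" for s
    have "continuous_on {0..t} h" unfolding h_def by (intro continuous_intros W_cont)
    then have hi: "h integrable_on {0..t}" by (rule integrable_continuous_real)
    have bd: "norm (f n s) \<le> h s" if "s \<in> {0..t}" for n s
    proof -
      have "norm (f n s) \<le> norm (dN (real (Suc n)) 0 (Wj (Fn n s))) * norm (Sop \<alpha> \<beta> (s - t) (dN (real (Suc n)) 0 \<phi>))"
        unfolding f_def by (simp add: Cauchy_Schwarz_ineq2 del: of_nat_Suc)
      also have "\<dots> \<le> (norm (W s) + D) * norm \<phi>"
      proof (rule mult_mono)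
        have "norm (dN (real (Suc n)) 0 (Wj (Fn n s))) \<le> norm (W s) + norm (dN (real (Suc n)) 0 (Wj (Fn n s)) - W s)"
          by (rule norm_triangle_sub)
        also have "\<dots> \<le> norm (W s) + D" using W_rate[of s t n] that D[of n] by auto
        finally show "norm (dN (real (Suc n)) 0 (Wj (Fn n s))) \<le> norm (W s) + D" .
        show "norm (Sop \<alpha> \<beta> (s - t) (dN (real (Suc n)) 0 \<phi>)) \<le> norm \<phi>"
          using norm_Sop[of \<alpha> \<beta> "s - t" "dN (real (Suc n)) 0 \<phi>"] dN_norm[of "real (Suc n)" 0 \<phi>] by (simp del: of_nat_Suc)
        show "0 \<le> norm (W s) + D" using order_trans[OF abs_ge_zero D[of 0]] by simp
      qed simp
      finally show ?thesis by (simp add: h_def)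
    qed
    have pl: "(\<lambda>n. f n s) \<longlonglongrightarrow> - (W s \<bullet> Sop \<alpha> \<beta> (s - t) \<phi>)" if "s \<in> {0..t}" for s
      unfolding f_def by (intro tendsto_intros wl that P bounded_linear.tendsto[OF bounded_linear_Sop])
    have "(\<lambda>n. integral {0..t} (f n)) \<longlonglongrightarrow> integral {0..t} (\<lambda>s. - (W s \<bullet> Sop \<alpha> \<beta> (s - t) \<phi>))"
      by (rule dominated_convergence(2)[OF has_integral_integrable[OF fL] hi bd pl])
    moreover have "integral {0..t} (f n) = L n" for n by (rule integral_unique[OF fL])
    ultimately have "integral {0..t} (\<lambda>s. - (W s \<bullet> Sop \<alpha> \<beta> (s - t) \<phi>)) = U t \<bullet> \<phi> - u0 \<bullet> Sop \<alpha> \<beta> (- t) \<phi>"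
      using Ll LIMSEQ_unique by auto
    moreover have "integral {0..t} (\<lambda>s. - (W s \<bullet> Sop \<alpha> \<beta> (s - t) \<phi>)) = - (I \<bullet> \<phi>)"
    proof (rule integral_unique)
      have "((\<lambda>s. - (Sop \<alpha> \<beta> (t - s) (W s) \<bullet> \<phi>)) has_integral - (I \<bullet> \<phi>)) {0..t}"
        using has_integral_linear[OF I bounded_linear_inner_left[of \<phi>]] by (intro has_integral_neg) (simp add: o_def)
      then show "((\<lambda>s. - (W s \<bullet> Sop \<alpha> \<beta> (s - t) \<phi>)) has_integral - (I \<bullet> \<phi>)) {0..t}" by (simp add: Sop_adjoint)
    qed
    ultimately show ?thesis by (simp add: inner_diff_left inner_add_left Sop_adjoint)
  qed
  \<comment> \<open>The difference is tested against itself.\<close>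
  from this[of "I + U t - Sop \<alpha> \<beta> t u0"] have "I + U t - Sop \<alpha> \<beta> t u0 = 0" by (simp only: inner_eq_zero_iff)
  then have "I = Sop \<alpha> \<beta> t u0 - U t" by (simp add: algebra_simps)
  then show ?thesis using I by simp
qed

lemma weak_derivatives:
  assumes t: "t \<ge> 0" and p: "rl2 p" "rl2 p'" "\<And>x. (p has_real_derivative p' x) (at x)" "\<And>x. isCont p' x"
  shows "cl (\<lambda>x. (fl t x)\<^sup>2) \<bullet> cl p' = - (V2 t \<bullet> cl p)" "cl (\<lambda>x. (fl t x) ^ 3) \<bullet> cl p' = - (V3 t \<bullet> cl p)"
proof -
  have ip: "cl (g 0) \<bullet> cl p' = - (cl (g 1) \<bullet> cl p)" if g: "jet g" for g
    using rl2_parts[OF jet_rl2[OF g] jet_rl2[OF g] p(1,2) chainD[OF jet_chain[OF g]] p(3) chain_isCont[OF jet_chain[OF g]] p(4), of 0] by simp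
  have "(\<lambda>n. cl (jprod (Fn n t) (Fn n t) 0) \<bullet> cl p') \<longlonglongrightarrow> cl (\<lambda>x. (fl t x)\<^sup>2) \<bullet> cl p'"
    by (intro tendsto_intros powers_lim t)
  moreover have "(\<lambda>n. - (cl (jprod (Fn n t) (Fn n t) 1) \<bullet> cl p)) \<longlonglongrightarrow> - (V2 t \<bullet> cl p)"
    by (intro tendsto_intros V_lim t)
  ultimately show "cl (\<lambda>x. (fl t x)\<^sup>2) \<bullet> cl p' = - (V2 t \<bullet> cl p)"
    unfolding ip[OF jet_mult[OF jet_Fn jet_Fn]] by (rule LIMSEQ_unique)
  have "(\<lambda>n. cl (jprod (Fn n t) (jprod (Fn n t) (Fn n t)) 0) \<bullet> cl p') \<longlonglongrightarrow> cl (\<lambda>x. (fl t x) ^ 3) \<bullet> cl p'"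
    by (intro tendsto_intros powers_lim t)
  moreover have "(\<lambda>n. - (cl (jprod (Fn n t) (jprod (Fn n t) (Fn n t)) 1) \<bullet> cl p)) \<longlonglongrightarrow> - (V3 t \<bullet> cl p)"
    by (intro tendsto_intros V_lim t)
  ultimately show "cl (\<lambda>x. (fl t x) ^ 3) \<bullet> cl p' = - (V3 t \<bullet> cl p)"
    unfolding ip[OF jet_mult[OF jet_Fn jet_mult[OF jet_Fn jet_Fn]]] by (rule LIMSEQ_unique)
qed

end

subsection \<open>Test functions and weak derivatives\<close>

text \<open>Functions \<open>p (1 / x) * exp (- 1 / x)\<close> extended by zero: a family closed
  under differentiation, with \<open>p\<close> replaced by \<open>X^2 * (p - p')\<close>.\<close>

definition flat :: "real poly \<Rightarrow> real \<Rightarrow> real" where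
  "flat p x = (if x > 0 then poly p (1 / x) * exp (- (1 / x)) else 0)"

lemma power_fact_le_exp: "0 \<le> x \<Longrightarrow> x ^ k \<le> fact k * exp x" for x :: real
proof -
  assume x: "0 \<le> x"
  have "(\<Sum>n\<in>{k}. x ^ n /\<^sub>R fact n) \<le> (\<Sum>n. x ^ n /\<^sub>R fact n)"
    using x by (intro sum_le_suminf summable_exp_generic) auto
  then show ?thesis by (simp add: exp_def field_simps)
qed

lemma poly_exp_bound: "\<exists>C. \<forall>y\<ge>0. \<bar>poly p y\<bar> * exp (- y) \<le> C" for p :: "real poly"
proof (intro exI allI impI)
  fix y :: real assume y: "y \<ge> 0"
  have e: "y ^ i * exp (- y) \<le> fact i" for i
    using power_fact_le_exp[OF y, of i] by (simp add: exp_minus field_simps)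
  have "\<bar>poly p y\<bar> * exp (- y) \<le> (\<Sum>i\<le>degree p. \<bar>coeff p i * y ^ i\<bar>) * exp (- y)"
    unfolding poly_altdef by (intro mult_right_mono sum_abs) simp
  also have "\<dots> = (\<Sum>i\<le>degree p. \<bar>coeff p i\<bar> * (y ^ i * exp (- y)))"
    using y by (simp add: sum_distrib_right abs_mult mult.assoc)
  also have "\<dots> \<le> (\<Sum>i\<le>degree p. \<bar>coeff p i\<bar> * fact i)" by (intro sum_mono mult_left_mono e) auto
  finally show "\<bar>poly p y\<bar> * exp (- y) \<le> (\<Sum>i\<le>degree p. \<bar>coeff p i\<bar> * fact i)" .
qed

text \<open>Away from zero this is the product rule. At zero \<open>y^2 * p y * exp (- y)\<close> is
  bounded for \<open>y = 1 / h\<close>, so the increment is at most a constant times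
  \<open>h^2\<close>.\<close>

lemma flat_deriv: "(flat p has_real_derivative flat ([:0, 0, 1:] * (p - pderiv p)) x) (at x)"
proof -
  consider "x > 0" | "x < 0" | "x = 0" by linarith
  then show ?thesis
  proof cases
    case 1
    have "((\<lambda>x. poly p (1 / x) * exp (- (1 / x))) has_real_derivative
      poly p (1 / x) * (exp (- (1 / x)) * (1 / x\<^sup>2)) + poly (pderiv p) (1 / x) * (- (1 / x\<^sup>2)) * exp (- (1 / x))) (at x)"
      using 1 by (auto intro!: derivative_eq_intros DERIV_chain2[OF poly_DERIV] simp: power2_eq_square)
    then have "((\<lambda>x. poly p (1 / x) * exp (- (1 / x))) has_real_derivative flat ([:0, 0, 1:] * (p - pderiv p)) x) (at x)"
      using 1 by (simp add: flat_def algebra_simps power2_eq_square)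
    then show ?thesis
      by (rule DERIV_cong_ev[THEN iffD1, rotated -1])
        (use eventually_gt_at_top in \<open>auto simp: flat_def intro!: eventually_mono[OF eventually_nhds_in_open[of "{0<..}" x]] 1\<close>)
  next
    case 2
    have "((\<lambda>x. 0) has_real_derivative flat ([:0, 0, 1:] * (p - pderiv p)) x) (at x)" using 2 by (simp add: flat_def)
    then show ?thesis
      by (rule DERIV_cong_ev[THEN iffD1, rotated -1])
        (auto simp: flat_def intro!: eventually_mono[OF eventually_nhds_in_open[of "{..<0}" x]] 2)
  next
    case 3
    obtain C where C: "\<And>y. y \<ge> 0 \<Longrightarrow> \<bar>poly ([:0, 0, 1:] * p) y\<bar> * exp (- y) \<le> C" using poly_exp_bound by blast
    have C0: "C \<ge> 0" using C[of 0] by simp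
    have "(flat p has_real_derivative 0) (at 0)"
    proof (rule DERIV_quadratic[where C=C])
      fix h :: real
      show "\<bar>flat p (0 + h) - flat p 0 - h * 0\<bar> \<le> C * h\<^sup>2"
      proof (cases "h > 0")
        case True
        with C[of "1 / h"] have "\<bar>poly p (1 / h)\<bar> * exp (- (1 / h)) * (1 / h\<^sup>2) \<le> C"
          by (simp add: abs_mult power2_eq_square mult_ac)
        from mult_right_mono[OF this, of "h\<^sup>2"] True show ?thesis by (simp add: flat_def abs_mult)
      qed (use C0 in \<open>simp add: flat_def\<close>)
    qed
    then show ?thesis using 3 by (simp add: flat_def)
  qed
qed

definition bump :: "nat \<Rightarrow> real \<Rightarrow> real" where
  "bump k = flat (((\<lambda>p. [:0, 0, 1:] * (p - pderiv p)) ^^ k) [:1:])"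

lemma chain_bump: "chain bump"
  unfolding chain_def bump_def funpow.simps comp_def using flat_deriv by blast

lemma bump_0: "bump 0 x = (if x > 0 then exp (- (1 / x)) else 0)"
  by (simp add: bump_def flat_def)

lemma chain_affine:
  assumes "chain f"
  shows "chain (\<lambda>k x. c ^ k * f k (c * x + d))"
  unfolding chain_def
proof (intro allI)
  fix k x
  have "((\<lambda>x. f k (c * x + d)) has_real_derivative f (Suc k) (c * x + d) * c) (at x)"
    by (rule DERIV_chain2[OF chainD[OF assms]]) (auto intro!: derivative_eq_intros)
  from DERIV_cmult[OF this, of "c ^ k"]
  show "((\<lambda>x. c ^ k * f k (c * x + d)) has_real_derivative c ^ Suc k * f (Suc k) (c * x + d)) (at x)"
    by (simp add: mult_ac)
qed

lemma chain_funpow: "chain f \<Longrightarrow> (deriv ^^ k) (f 0) = f k"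
proof (induction k)
  case (Suc k)
  then have "(deriv ^^ Suc k) (f 0) = deriv (f k)" by simp
  also have "\<dots> = f (Suc k)" using chainD[OF Suc.prems] by (intro ext DERIV_imp_deriv)
  finally show ?case .
qed simp

lemma smooth_chain: "chain f \<Longrightarrow> smooth (f 0)"
  unfolding smooth_def differentiable_on_def real_differentiable_def
  by (simp only: chain_funpow) (blast intro: chainD)

lemma chain_smooth:
  assumes "smooth f"
  shows "chain (\<lambda>k. (deriv ^^ k) f)"
  unfolding chain_def
proof (intro allI)
  fix k x
  have "(deriv ^^ k) f differentiable at x" using assms by (simp add: smooth_def differentiable_on_def)
  then have "((deriv ^^ k) f has_real_derivative deriv ((deriv ^^ k) f) x) (at x)"
    by (simp add: DERIV_deriv_iff_real_differentiable)
  then show "((deriv ^^ k) f has_real_derivative (deriv ^^ Suc k) f x) (at x)" by simp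
qed

definition test :: "(real \<Rightarrow> real) \<Rightarrow> bool" where
  "test \<phi> \<longleftrightarrow> smooth \<phi> \<and> (\<exists>r. \<forall>x. \<bar>x\<bar> > r \<longrightarrow> \<phi> x = 0)"

lemma rl2_compact_support:
  assumes c: "\<And>x. isCont f x" and z: "\<And>x. \<bar>x\<bar> > r \<Longrightarrow> f x = 0"
  shows "rl2 f"
proof -
  have co: "continuous_on UNIV f" using c by (simp add: continuous_on_eq_continuous_at)
  then have [measurable]: "f \<in> borel_measurable borel" by (rule borel_measurable_continuous_onI)
  have "compact (f ` {-r..r})" by (intro compact_continuous_image continuous_on_subset[OF co]) auto
  then obtain C where C: "\<And>x. x \<in> {-r..r} \<Longrightarrow> \<bar>f x\<bar> \<le> C" using compact_imp_bounded by (force simp: bounded_iff)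
  have "(\<lambda>x. complex_of_real (f x)) \<in> L2"
  proof (rule L2I_mult[OF ind_L2[of "-r" r], where C=C])
    fix x show "norm (complex_of_real (f x)) \<le> C * norm (ind (- r) r x)"
    proof (cases "x \<in> {-r..r}")
      case False
      then have "\<bar>x\<bar> > r" by auto
      then show ?thesis using False z[of x] by (auto simp: ind_def indicator_def)
    qed (use C in \<open>auto simp: ind_def indicator_def\<close>)
  qed measurable
  then show ?thesis by (simp add: rl2_def)
qed

lemma test_facts:
  assumes "test \<phi>"
  shows "rl2 \<phi>" "rl2 (deriv \<phi>)" "(\<phi> has_real_derivative deriv \<phi> x) (at x)" "isCont (deriv \<phi>) x"
proof -
  from assms obtain r where s: "smooth \<phi>" and r: "\<And>x. \<bar>x\<bar> > r \<Longrightarrow> \<phi> x = 0" by (auto simp: test_def)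
  note ch = chain_smooth[OF s]
  show d: "(\<phi> has_real_derivative deriv \<phi> x) (at x)" for x using chainD[OF ch, of 0 x] by simp
  show i: "isCont (deriv \<phi>) x" for x using chain_isCont[OF ch, where k=1 and x=x] by simp
  show "rl2 \<phi>" by (rule rl2_compact_support[OF DERIV_isCont[OF d] r])
  show "rl2 (deriv \<phi>)"
  proof (rule rl2_compact_support[OF i])
    fix x assume x: "r < \<bar>x\<bar>"
    have "\<forall>\<^sub>F y in nhds x. \<phi> y = 0"
      using x by (intro eventually_mono[OF eventually_nhds_in_open[of "{y. r < \<bar>y\<bar>}" x]]) (auto intro!: open_Collect_less continuous_intros r)
    then have "deriv \<phi> x = deriv (\<lambda>_. 0) x" by (rule deriv_cong_ev) simp
    then show "deriv \<phi> x = 0" by simp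
  qed
qed

text \<open>Two opposite copies of the flat exponential, stretched so that each tends to one on its
  open half-line, since \<open>exp (- 1 / (n * d))\<close> tends to one. This yields test functions
  tending to the indicator of an interval.\<close>

definition window :: "real \<Rightarrow> real \<Rightarrow> nat \<Rightarrow> real \<Rightarrow> real" where
  "window a b n x = bump 0 (real n * x + - real n * a) * bump 0 (- real n * x + real n * b)"

lemma window_outside: "x \<notin> {a..b} \<Longrightarrow> window a b n x = 0"
proof -
  assume "x \<notin> {a..b}"
  then consider "x < a" | "b < x" by (auto simp: not_le)
  then show ?thesis
  proof cases
    case 1
    then have "real n * x \<le> real n * a" by (intro mult_left_mono) auto
    then show ?thesis by (simp add: window_def bump_0)
  next
    case 2
    then have "real n * b \<le> real n * x" by (intro mult_left_mono) auto
    then show ?thesis by (simp add: window_def bump_0)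
  qed
qed

lemma window_bound: "\<bar>window a b n x\<bar> \<le> 1"
proof -
  have "0 \<le> bump 0 y \<and> bump 0 y \<le> 1" for y by (auto simp: bump_0)
  then show ?thesis unfolding window_def abs_mult by (intro mult_le_one) auto
qed

lemma test_window: "test (window a b n)"
proof -
  let ?f = "\<lambda>k x. (real n) ^ k * bump k (real n * x + - real n * a)"
  let ?g = "\<lambda>k x. (- real n) ^ k * bump k (- real n * x + real n * b)"
  have "smooth (jprod ?f ?g 0)" by (intro smooth_chain chain_jprod chain_affine chain_bump)
  also have "jprod ?f ?g 0 = window a b n" by (simp add: window_def[abs_def] jprod_0[abs_def])
  finally have "smooth (window a b n)" .
  moreover have "window a b n x = 0" if "\<bar>x\<bar> > \<bar>a\<bar> + \<bar>b\<bar>" for x using that by (intro window_outside) auto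
  ultimately show ?thesis unfolding test_def by blast
qed

lemma window_tendsto:
  assumes "x \<noteq> a" "x \<noteq> b"
  shows "(\<lambda>n. of_real (window a b n x)) \<longlonglongrightarrow> ind a b x"
proof (cases "x \<in> {a..b}")
  case False
  then show ?thesis by (simp add: window_outside ind_def)
next
  case True
  have b: "(\<lambda>n. bump 0 (real n * d)) \<longlonglongrightarrow> 1" if d: "d > 0" for d
  proof -
    have lim: "(\<lambda>n. exp (- (1 / (real n * d)))) \<longlonglongrightarrow> 1" using d by real_asymp
    have ev: "\<forall>\<^sub>F n in sequentially. bump 0 (real n * d) = exp (- (1 / (real n * d)))"
      using eventually_gt_at_top[of 0] by eventually_elim (simp add: bump_0 d)
    show ?thesis by (rule tendsto_cong[THEN iffD2, OF ev lim])
  qed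
  have "(\<lambda>n. window a b n x) \<longlonglongrightarrow> 1 * 1"
    using tendsto_mult[OF b[of "x - a"] b[of "b - x"]] True assms by (simp add: window_def algebra_simps)
  then have "(\<lambda>n. complex_of_real (window a b n x)) \<longlonglongrightarrow> of_real (1 * 1)" by (rule tendsto_of_real)
  then show ?thesis using True by (simp add: ind_def)
qed

text \<open>The windows converge boundedly to indicators off the endpoints, so vanishing against
  test functions implies vanishing over intervals.\<close>

lemma test_null:
  assumes d: "d \<in> L2" and z: "\<And>\<phi>. test \<phi> \<Longrightarrow> (LINT x|lborel. d x * of_real (\<phi> x)) = 0"
  shows "AE x in lborel. d x = 0"
proof (rule L2_null[OF d])
  fix a b
  have [measurable]: "d \<in> borel_measurable borel" by (rule L2_measurable[OF d])
  have [measurable]: "window a b n \<in> borel_measurable borel" for n by (rule rl2_measurable[OF test_facts(1)[OF test_window]])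
  have "(\<lambda>n. LINT x|lborel. d x * of_real (window a b n x)) \<longlonglongrightarrow> (LINT x|lborel. d x * ind a b x)"
  proof (rule integral_dominated_convergence)
    show "integrable lborel (\<lambda>x. norm (ind a b x * d x))" by (intro integrable_norm ind_mult_integrable d)
    have "AE x in lborel. x \<noteq> a \<and> x \<noteq> b" using AE_lborel_singleton[of a] AE_lborel_singleton[of b] by eventually_elim simp
    then show "AE x in lborel. (\<lambda>n. d x * of_real (window a b n x)) \<longlonglongrightarrow> d x * ind a b x"
      by eventually_elim (intro tendsto_intros window_tendsto; simp)
    show "AE x in lborel. norm (d x * of_real (window a b n x)) \<le> norm (ind a b x * d x)" for n
    proof (intro AE_I2)
      fix x
      show "norm (d x * of_real (window a b n x)) \<le> norm (ind a b x * d x)"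
        using window_outside[of x a b n] mult_left_mono[OF window_bound[of a b n x] norm_ge_zero[of "d x"]]
        by (cases "x \<in> {a..b}") (auto simp: ind_def norm_mult)
    qed
  qed measurable
  moreover have "(LINT x|lborel. d x * of_real (window a b n x)) = 0" for n by (rule z[OF test_window])
  ultimately have "(LINT x|lborel. d x * ind a b x) = 0" by (simp add: LIMSEQ_const_iff)
  then show "(LINT x|lborel. ind a b x * d x) = 0" by (simp add: mult.commute)
qed

text \<open>By \<open>test_null\<close> a square integrable weak derivative is unique up to null
  sets, so the choice in \<open>partial_x\<close> is determined as a class.\<close>

lemma partial_x_unique:
  assumes g: "g \<in> L2" and w: "\<And>\<phi>. test \<phi> \<Longrightarrow> (LINT x|lborel. f x * of_real (deriv \<phi> x)) = - (LINT x|lborel. g x * of_real (\<phi> x))"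
  shows "partial_x f \<in> L2" "abs_l2 (partial_x f) = abs_l2 g"
proof -
  let ?P = "\<lambda>g. g \<in> L2 \<and> (\<forall>\<phi>. smooth \<phi> \<and> (\<exists>r. \<forall>x. \<bar>x\<bar> > r \<longrightarrow> \<phi> x = 0) \<longrightarrow>
       (LINT x|lborel. f x * of_real (deriv \<phi> x)) = - (LINT x|lborel. g x * of_real (\<phi> x)))"
  have "?P g" using g w by (auto simp: test_def)
  then have P: "?P (partial_x f)" unfolding partial_x_def by (rule someI[of ?P])
  then show L: "partial_x f \<in> L2" by blast
  have "AE x in lborel. partial_x f x - g x = 0"
  proof (rule test_null[OF L2_diff[OF L g]])
    fix \<phi> assume t: "test \<phi>"
    have p: "(\<lambda>x. complex_of_real (\<phi> x)) \<in> L2" using test_facts(1)[OF t] by (simp add: rl2_def)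
    have "(LINT x|lborel. f x * of_real (deriv \<phi> x)) = - (LINT x|lborel. partial_x f x * of_real (\<phi> x))"
      by (rule conjunct2[OF P, rule_format]) (use t in \<open>simp add: test_def\<close>)
    with w[OF t] have "(LINT x|lborel. partial_x f x * of_real (\<phi> x)) = (LINT x|lborel. g x * of_real (\<phi> x))" by simp
    then show "(LINT x|lborel. (partial_x f x - g x) * of_real (\<phi> x)) = 0"
      by (simp add: left_diff_distrib L2_mult_integrable L g p)
  qed
  then show "abs_l2 (partial_x f) = abs_l2 g" unfolding abs_eq_iff[OF L g] by eventually_elim simp
qed

text \<open>Reality of \<open>v\<close> gives it a real representative, for which the real product
  coincides with the complex integral in the definition.\<close>

lemma partial_x_cl:
  assumes f: "rl2 f" and v: "cj v = v" and w: "\<And>\<phi>. test \<phi> \<Longrightarrow> cl f \<bullet> cl (deriv \<phi>) = - (v \<bullet> cl \<phi>)"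
  shows "partial_x (\<lambda>x. of_real (f x)) \<in> L2" "abs_l2 (partial_x (\<lambda>x. of_real (f x))) = v"
proof -
  define g where "g x = Re (rep_l2 v x)" for x
  have g: "rl2 g" unfolding g_def by (intro L2_Re rep_L2)
  have gv: "cl g = v" unfolding g_def[abs_def] cl_Re[OF rep_L2] by (simp add: v scaleR_2[symmetric])
  have gL: "(\<lambda>x. complex_of_real (g x)) \<in> L2" using g by (simp add: rl2_def)
  have i: "(LINT x|lborel. complex_of_real (h x) * complex_of_real (k x)) = of_real (cl h \<bullet> cl k)" if "rl2 h" "rl2 k" for h k
    by (simp add: inner_cl that of_real_mult[symmetric] del: of_real_mult)
  have "(LINT x|lborel. complex_of_real (f x) * of_real (deriv \<phi> x)) = - (LINT x|lborel. complex_of_real (g x) * of_real (\<phi> x))"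
    if t: "test \<phi>" for \<phi>
    using w[OF t] unfolding i[OF f test_facts(2)[OF t]] i[OF g test_facts(1)[OF t]] gv by simp
  from partial_x_unique[OF gL this] gv
  show "partial_x (\<lambda>x. of_real (f x)) \<in> L2" "abs_l2 (partial_x (\<lambda>x. of_real (f x))) = v" by (auto simp: cl_def)
qed

subsection \<open>Gevrey norms\<close>

text \<open>Membership and a norm bound under the full exponential weight, formulated on classes so
  that limits and differences can be handled in \<open>l2\<close>.\<close>

definition gev :: "real \<Rightarrow> real \<Rightarrow> l2 \<Rightarrow> bool" where
  "gev s C v \<longleftrightarrow> (\<lambda>\<xi>. of_real (exp (s * \<bar>\<xi>\<bar>)) * rep_l2 (Fop v) \<xi>) \<in> L2 \<and>
     norm (abs_l2 (\<lambda>\<xi>. of_real (exp (s * \<bar>\<xi>\<bar>)) * rep_l2 (Fop v) \<xi>)) \<le> C"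

lemma gev_diff:
  assumes "gev s C v" "gev s D w"
  shows "gev s (C + D) (v - w)"
proof -
  let ?e = "\<lambda>v \<xi>. complex_of_real (exp (s * \<bar>\<xi>\<bar>)) * rep_l2 (Fop v) \<xi>"
  have L: "?e v \<in> L2" "?e w \<in> L2" and n: "norm (abs_l2 (?e v)) \<le> C" "norm (abs_l2 (?e w)) \<le> D"
    using assms by (auto simp: gev_def)
  have "Fop (v - w) = abs_l2 (\<lambda>\<xi>. rep_l2 (Fop v) \<xi> - rep_l2 (Fop w) \<xi>)"
    by (simp add: abs_diff linear_diff[OF bounded_linear.linear[OF bounded_linear_Fop]])
  then have "AE \<xi> in lborel. rep_l2 (Fop (v - w)) \<xi> = rep_l2 (Fop v) \<xi> - rep_l2 (Fop w) \<xi>"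
    using rep_abs[OF L2_diff[OF rep_L2[of "Fop v"] rep_L2[of "Fop w"]]] by simp
  then have ae: "AE \<xi> in lborel. ?e (v - w) \<xi> = ?e v \<xi> - ?e w \<xi>" by eventually_elim (simp add: right_diff_distrib)
  have d: "(\<lambda>\<xi>. ?e v \<xi> - ?e w \<xi>) \<in> L2" by (rule L2_diff[OF L])
  have L': "?e (v - w) \<in> L2" by (rule L2_AE[OF d ae]) measurable
  have "abs_l2 (?e (v - w)) = abs_l2 (?e v) - abs_l2 (?e w)" using abs_eq_iff[OF L' d] ae abs_diff[OF L] by simp
  then have "norm (abs_l2 (?e (v - w))) \<le> C + D" using norm_triangle_ineq4[of "abs_l2 (?e v)" "abs_l2 (?e w)"] n by simp
  then show ?thesis using L' by (simp add: gev_def)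
qed

text \<open>The weight in \<open>G_norm\<close> is the geometric mean of \<open>1\<close> and the squared weight in \<open>gev\<close>.\<close>

lemma gev_G:
  assumes f: "f \<in> L2" and g: "gev (2 * \<sigma>) C (abs_l2 f)"
  shows "f \<in> G_space \<sigma>" "(G_norm \<sigma> f)\<^sup>2 \<le> sqrt (2 * pi) * norm (abs_l2 f) * C"
proof -
  define h where "h = rep_l2 (Fop (abs_l2 f))"
  define k where "k \<xi> = complex_of_real (exp (2 * \<sigma> * \<bar>\<xi>\<bar>)) * h \<xi>" for \<xi>
  have k: "k \<in> L2" "norm (abs_l2 k) \<le> C" using g by (simp_all add: gev_def k_def[abs_def] h_def)
  have h: "h \<in> L2" "abs_l2 h = Fop (abs_l2 f)" by (simp_all add: h_def)
  have hk: "h \<xi> \<bullet> k \<xi> = exp (2 * \<sigma> * \<bar>\<xi>\<bar>) * (norm (h \<xi>))\<^sup>2" for \<xi>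
    by (simp only: k_def scaleR_conv_of_real[symmetric] inner_scaleR_right power2_norm_eq_inner)
  have "AE \<xi> in lborel. fourier f \<xi> = h \<xi>"
    using abs_eq_iff[OF fourier_L2[OF f] h(1)] abs_fourier[OF f] h(2) by simp
  then have ae: "AE \<xi> in lborel. h \<xi> \<bullet> k \<xi> = exp (2 * \<sigma> * \<bar>\<xi>\<bar>) * (norm (fourier f \<xi>))\<^sup>2"
    by eventually_elim (simp add: hk)
  have [measurable]: "fourier f \<in> borel_measurable borel" by (rule L2_measurable[OF fourier_L2[OF f]])
  have [measurable]: "h \<in> borel_measurable borel" "k \<in> borel_measurable borel" by (rule L2_measurable[OF h(1)], rule L2_measurable[OF k(1)])
  have i: "integrable lborel (\<lambda>\<xi>. h \<xi> \<bullet> k \<xi>)" by (rule L2_inner_integrable[OF h(1) k(1)])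
  have "integrable lborel (\<lambda>\<xi>. exp (2 * \<sigma> * \<bar>\<xi>\<bar>) * (norm (fourier f \<xi>))\<^sup>2)"
    by (rule integrable_cong_AE_imp[OF i _ ae]) measurable
  then show "f \<in> G_space \<sigma>" using f by (simp add: G_space_def)
  have "(LINT \<xi>|lborel. exp (2 * \<sigma> * \<bar>\<xi>\<bar>) * (norm (fourier f \<xi>))\<^sup>2) = (LINT \<xi>|lborel. h \<xi> \<bullet> k \<xi>)"
    by (rule integral_cong_AE) (use ae in \<open>auto elim: eventually_mono\<close>)
  also have "\<dots> = abs_l2 h \<bullet> abs_l2 k" by (rule inner_abs[OF h(1) k(1), symmetric])
  also have "\<dots> \<le> norm (abs_l2 h) * norm (abs_l2 k)" by (rule norm_cauchy_schwarz)
  also have "\<dots> \<le> norm (abs_l2 h) * C" by (rule mult_left_mono[OF k(2)]) simp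
  also have "norm (abs_l2 h) = sqrt (2 * pi) * norm (abs_l2 f)" by (simp add: h norm_Fop)
  finally show "(G_norm \<sigma> f)\<^sup>2 \<le> sqrt (2 * pi) * norm (abs_l2 f) * C"
    by (simp add: G_norm_def)
qed

lemma G_norm_nonneg: "G_norm \<sigma> f \<ge> 0"
  by (simp add: G_norm_def)

lemma G_space_abs:
  assumes f: "f \<in> G_space \<sigma>"
  shows "f \<in> L2" "gev \<sigma> (G_norm \<sigma> f) (abs_l2 f)"
proof -
  show L: "f \<in> L2" using f by (simp add: G_space_def)
  define h where "h = rep_l2 (Fop (abs_l2 f))"
  have h: "h \<in> L2" "abs_l2 h = Fop (abs_l2 f)" by (simp_all add: h_def)
  have ae: "AE \<xi> in lborel. h \<xi> = fourier f \<xi>"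
    using abs_eq_iff[OF h(1) fourier_L2[OF L]] abs_fourier[OF L] h(2) by simp
  have [measurable]: "fourier f \<in> borel_measurable borel" by (rule L2_measurable[OF fourier_L2[OF L]])
  have [measurable]: "h \<in> borel_measurable borel" by (rule L2_measurable[OF h(1)])
  let ?e = "\<lambda>g \<xi>. complex_of_real (exp (\<sigma> * \<bar>\<xi>\<bar>)) * g \<xi>"
  have sq: "(norm (?e g \<xi>))\<^sup>2 = exp (2 * \<sigma> * \<bar>\<xi>\<bar>) * (norm (g \<xi>))\<^sup>2" for g \<xi>
    by (simp add: norm_mult power_mult_distrib exp_double[symmetric] mult.assoc)
  have fL: "?e (fourier f) \<in> L2" using f by (simp add: L2_def sq G_space_def)
  have ae': "AE \<xi> in lborel. ?e h \<xi> = ?e (fourier f) \<xi>" using ae by eventually_elim simp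
  have hL: "?e h \<in> L2" by (rule L2_AE[OF fL ae']) measurable
  have "abs_l2 (?e h) = abs_l2 (?e (fourier f))" using abs_eq_iff[OF hL fL] ae' by simp
  then have "norm (abs_l2 (?e h)) = G_norm \<sigma> f" by (simp only: norm_abs[OF fL] sq G_norm_def)
  then show "gev \<sigma> (G_norm \<sigma> f) (abs_l2 f)" using hL by (simp add: gev_def h_def)
qed

lemma abs_band: "abs_l2 (\<lambda>\<xi>. band N k \<xi> * rep_l2 (Fop v) \<xi>) = Fop (dN N k v)"
  by (simp add: dN_def mul_rep bmul_band)

text \<open>The symbol is bounded by \<open>t ^ k \<le> fact k * exp t\<close> with
  \<open>t = s * \<bar>\<xi>\<bar>\<close>. Plancherel's factor \<open>sqrt (2 * pi)\<close> exceeds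
  one and is discarded.\<close>

lemma gev_deriv:
  assumes s: "s > 0" and g: "gev s C v" and N: "N \<ge> 0"
  shows "norm (dN N k v) \<le> C * fact k / s ^ k" "norm v \<le> C"
proof -
  let ?e = "\<lambda>\<xi>. complex_of_real (exp (s * \<bar>\<xi>\<bar>)) * rep_l2 (Fop v) \<xi>"
  have e: "?e \<in> L2" "norm (abs_l2 ?e) \<le> C" using g by (auto simp: gev_def)
  have pi1: "1 \<le> sqrt (2 * pi)" using pi_gt3 by simp
  have main: "norm w \<le> D * C" if w: "norm (Fop w) \<le> D * norm (abs_l2 ?e)" and D: "D \<ge> 0" for w D
  proof -
    have "norm w \<le> sqrt (2 * pi) * norm w" using mult_right_mono[OF pi1 norm_ge_zero[of w]] by simp
    also have "\<dots> = norm (Fop w)" by (simp add: norm_Fop)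
    also have "\<dots> \<le> D * norm (abs_l2 ?e)" by (rule w)
    also have "\<dots> \<le> D * C" by (rule mult_left_mono[OF e(2) D])
    finally show ?thesis .
  qed
  have "norm (Fop (dN N k v)) \<le> (fact k / s ^ k) * norm (abs_l2 ?e)"
    unfolding abs_band[symmetric]
  proof (rule norm_abs_le[OF bmul_L2[OF bmul_band rep_L2] e(1)])
    fix \<xi>
    have "norm (band N k \<xi>) \<le> \<bar>\<xi>\<bar> ^ k" by (auto simp: band_def norm_mult norm_power ind_def indicator_def)
    also have "\<dots> = (s * \<bar>\<xi>\<bar>) ^ k / s ^ k" using s by (simp add: power_mult_distrib)
    also have "\<dots> \<le> fact k * exp (s * \<bar>\<xi>\<bar>) / s ^ k" using s by (intro divide_right_mono power_fact_le_exp) auto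
    finally show "norm (band N k \<xi> * rep_l2 (Fop v) \<xi>) \<le> fact k / s ^ k * norm (?e \<xi>)"
      using mult_right_mono[of _ _ "norm (rep_l2 (Fop v) \<xi>)"] by (fastforce simp: norm_mult)
  qed (use s in simp)
  from main[OF this] show "norm (dN N k v) \<le> C * fact k / s ^ k" using s by (simp add: mult.commute)
  have "norm (abs_l2 (rep_l2 (Fop v))) \<le> 1 * norm (abs_l2 ?e)"
    using s by (intro norm_abs_le rep_L2 e) (auto simp: norm_mult mult_le_cancel_right1)
  then show "norm v \<le> C" using main[of v 1] by simp
qed

section \<open>Analyticity of the limit and the solution property\<close>

context kawahara_data
begin

text \<open>The exponential is expanded in its power series. At radius \<open>r' / 2\<close> term
  \<open>k\<close> is at most \<open>(1/2) ^ k\<close> times a constant, because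
  \<open>r' ^ k / fact k \<le> wt r k\<close>; the minimum with one compensates for the powers
  missing from the weight. Cutting the partial sums off at frequency \<open>n\<close> makes them
  square integrable, and Fatou removes both truncations.\<close>

lemma gev_bound:
  defines "r' \<equiv> min r 1"
  assumes Y: "\<And>N K. N \<ge> 0 \<Longrightarrow> K \<ge> 3 \<Longrightarrow> Yg N r K v \<le> Mb"
  shows "gev (r' / 2) (2 * sqrt (2 * pi) * sqrt Mb) v"
proof -
  let ?h = "rep_l2 (Fop v)"
  have r': "0 < r'" "r' \<le> r" "r' \<le> 1" using r by (auto simp: r'_def)
  define g where "g n \<xi> = (\<Sum>k\<le>n. of_real ((r' / 2) ^ k / fact k) * (of_real (\<bar>\<xi>\<bar> ^ k) * ind (- real n) (real n) \<xi> * ?h \<xi>))" for n :: nat and \<xi>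
  have t: "(\<lambda>\<xi>. of_real (\<bar>\<xi>\<bar> ^ k) * ind (- real n) (real n) \<xi> * ?h \<xi>) \<in> L2" (is "?t k n \<in> L2") for k n
    by (rule L2I_mult[OF bmul_L2[OF bmul_band[of "real n" k] rep_L2[of "Fop v"]], where C=1]) (auto simp: norm_mult norm_power band_def)
  have tn: "norm (abs_l2 (?t k n)) \<le> sqrt (2 * pi) * norm (dN (real n) k v)" for k n
  proof -
    have "norm (abs_l2 (?t k n)) \<le> 1 * norm (abs_l2 (\<lambda>\<xi>. band (real n) k \<xi> * ?h \<xi>))"
      by (intro norm_abs_le t bmul_L2 bmul_band rep_L2) (auto simp: norm_mult norm_power band_def)
    then show ?thesis by (simp add: abs_band norm_Fop)
  qed
  have gL: "g n \<in> L2" for n unfolding g_def by (intro L2_sum L2_cmult t)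
  have gn: "norm (abs_l2 (g n)) \<le> 2 * sqrt (2 * pi) * sqrt Mb" for n
  proof -
    have "abs_l2 (g n) = (\<Sum>k\<le>n. ((r' / 2) ^ k / fact k) *\<^sub>R abs_l2 (?t k n))"
      unfolding g_def by (simp only: abs_sum[OF L2_cmult[OF t]] abs_scaleR[OF t, symmetric] scaleR_conv_of_real)
    also have "norm \<dots> \<le> (\<Sum>k\<le>n. (1/2) ^ k * (sqrt (2 * pi) * sqrt Mb))"
    proof (rule sum_norm_le)
      fix k
      have w: "r' ^ k / fact k \<le> wt r k"
      proof -
        have "r' ^ k \<le> r' ^ (k - 2)" using r' by (intro power_decreasing) auto
        also have "\<dots> \<le> r ^ (k - 2) * 1" using r' by (simp add: power_mono)
        also have "\<dots> \<le> r ^ (k - 2) * (real k + 1) ^ 3" using r by (intro mult_left_mono one_le_power) auto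
        finally show ?thesis by (simp add: wt_def divide_right_mono)
      qed
      have "Yg (real n) r (max 3 k) v \<le> Mb" by (intro Y) auto
      then have d: "norm (dN (real n) k v) \<le> sqrt Mb / wt r k" by (rule norm_le_Yg) simp
      have "norm (((r' / 2) ^ k / fact k) *\<^sub>R abs_l2 (?t k n)) = (1/2) ^ k * (r' ^ k / fact k * norm (abs_l2 (?t k n)))"
        using r' by (simp add: power_divide)
      also have "\<dots> \<le> (1/2) ^ k * (wt r k * (sqrt (2 * pi) * (sqrt Mb / wt r k)))"
        using r' wt_pos[OF r, of k] by (intro mult_left_mono mult_mono w order_trans[OF tn] d) auto
      also have "\<dots> = (1/2) ^ k * (sqrt (2 * pi) * sqrt Mb)" using wt_pos[OF r, of k] by simp
      finally show "norm (((r' / 2) ^ k / fact k) *\<^sub>R abs_l2 (?t k n)) \<le> (1/2) ^ k * (sqrt (2 * pi) * sqrt Mb)" .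
    qed
    also have "\<dots> = (\<Sum>k\<le>n. (1/2) ^ k) * (sqrt (2 * pi) * sqrt Mb)" by (rule sum_distrib_right[symmetric])
    also have "\<dots> \<le> 2 * (sqrt (2 * pi) * sqrt Mb)"
    proof (rule mult_right_mono)
      have "(\<Sum>k\<le>n. (1/2) ^ k) \<le> (\<Sum>k. (1/2 :: real) ^ k)" by (intro sum_le_suminf) auto
      then show "(\<Sum>k\<le>n. (1/2 :: real) ^ k) \<le> 2" by (simp add: suminf_geometric)
    qed (use Mb_nonneg in simp)
    finally show ?thesis by simp
  qed
  let ?C = "2 * sqrt (2 * pi) * sqrt Mb"
  let ?e = "\<lambda>\<xi>. complex_of_real (exp (r' / 2 * \<bar>\<xi>\<bar>)) * ?h \<xi>"
  have C0: "?C \<ge> 0" using Mb_nonneg by simp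
  have lim: "AE \<xi> in lborel. (\<lambda>n. g n \<xi>) \<longlonglongrightarrow> ?e \<xi>"
  proof (intro AE_I2)
    fix \<xi> :: real
    have "(\<lambda>n. \<Sum>k\<le>n. (r' / 2 * \<bar>\<xi>\<bar>) ^ k /\<^sub>R fact k) \<longlonglongrightarrow> exp (r' / 2 * \<bar>\<xi>\<bar>)"
      using exp_converges[of "r' / 2 * \<bar>\<xi>\<bar>"] by (simp add: sums_def_le)
    then have l: "(\<lambda>n. complex_of_real (\<Sum>k\<le>n. (r' / 2 * \<bar>\<xi>\<bar>) ^ k /\<^sub>R fact k) * ?h \<xi>) \<longlonglongrightarrow> ?e \<xi>"
      by (intro tendsto_intros)
    have "\<forall>\<^sub>F n in sequentially. complex_of_real (\<Sum>k\<le>n. (r' / 2 * \<bar>\<xi>\<bar>) ^ k /\<^sub>R fact k) * ?h \<xi> = g n \<xi>"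
      using eventually_ge_at_top[of "nat \<lceil>\<bar>\<xi>\<bar>\<rceil>"]
    proof eventually_elim
      case (elim n)
      then have "\<bar>\<xi>\<bar> \<le> real n" by linarith
      then have "ind (- real n) (real n) \<xi> = 1" by (auto simp: ind_def indicator_def)
      then show ?case
        unfolding g_def of_real_sum sum_distrib_right
        by (intro sum.cong refl) (simp add: power_mult_distrib field_simps)
    qed
    from Lim_transform_eventually[OF l this] show "(\<lambda>n. g n \<xi>) \<longlonglongrightarrow> ?e \<xi>" .
  qed
  have m: "?e \<in> borel_measurable borel" by measurable
  have "(LINT x|lborel. (norm (g n x))\<^sup>2) \<le> ?C\<^sup>2" for n
    unfolding norm_abs_sq[OF gL, symmetric] by (intro power_mono gn) simp
  then have b: "\<forall>\<^sub>F n in sequentially. (LINT x|lborel. (norm (g n x))\<^sup>2) \<le> ?C\<^sup>2" by simp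
  note F = L2_fatou[OF gL m lim b]
  have "norm (abs_l2 ?e) \<le> ?C"
  proof (rule power2_le_imp_le[OF _ C0])
    show "(norm (abs_l2 ?e))\<^sup>2 \<le> ?C\<^sup>2" unfolding norm_abs_sq[OF F(1)] by (rule F(2))
  qed
  then show ?thesis using F(1) by (simp add: gev_def)
qed

lemma V_real: "t \<ge> 0 \<Longrightarrow> cj (V2 t) = V2 t" "t \<ge> 0 \<Longrightarrow> cj (V3 t) = V3 t"
proof -
  have *: "cj v = v" if l: "(\<lambda>n. cl (g n)) \<longlonglongrightarrow> v" and r: "\<And>n. rl2 (g n)" for g v
    using LIMSEQ_unique[OF bounded_linear.tendsto[OF bounded_linear_cj l]] l by (simp add: r)
  show "t \<ge> 0 \<Longrightarrow> cj (V2 t) = V2 t" by (rule *[OF V_lim(1)], assumption) (intro jet_rl2 jet_mult jet_Fn)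
  show "t \<ge> 0 \<Longrightarrow> cj (V3 t) = V3 t" by (rule *[OF V_lim(2)], assumption) (intro jet_rl2 jet_mult jet_Fn)
qed

definition us :: "real \<Rightarrow> real \<Rightarrow> complex" where "us t x = of_real (fl t x)"

lemma us_L2: "t \<ge> 0 \<Longrightarrow> us t \<in> L2" and abs_us: "t \<ge> 0 \<Longrightarrow> abs_l2 (us t) = U t"
  using fl_cl[of t] by (simp_all add: us_def[abs_def] rl2_def cl_def)

lemma partial_us:
  assumes t: "t \<ge> 0"
  shows "partial_x (\<lambda>y. (us t y)\<^sup>2) \<in> L2" "abs_l2 (partial_x (\<lambda>y. (us t y)\<^sup>2)) = V2 t"
    "partial_x (\<lambda>y. (us t y) ^ 3) \<in> L2" "abs_l2 (partial_x (\<lambda>y. (us t y) ^ 3)) = V3 t"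
proof -
  have e: "(\<lambda>y. (us t y)\<^sup>2) = (\<lambda>y. of_real ((fl t y)\<^sup>2))" "(\<lambda>y. (us t y) ^ 3) = (\<lambda>y. of_real ((fl t y) ^ 3))"
    by (simp_all add: us_def)
  note w = weak_derivatives[OF t test_facts(1) test_facts(2) test_facts(3) test_facts(4)]
  show "partial_x (\<lambda>y. (us t y)\<^sup>2) \<in> L2" "abs_l2 (partial_x (\<lambda>y. (us t y)\<^sup>2)) = V2 t"
    unfolding e by (rule partial_x_cl[OF powers_lim(1)[OF t] V_real(1)[OF t] w(1)]; assumption)+
  show "partial_x (\<lambda>y. (us t y) ^ 3) \<in> L2" "abs_l2 (partial_x (\<lambda>y. (us t y) ^ 3)) = V3 t"
    unfolding e by (rule partial_x_cl[OF powers_lim(2)[OF t] V_real(2)[OF t] w(2)]; assumption)+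
qed

lemma forcing:
  assumes t: "t \<ge> 0"
  defines "g \<equiv> \<lambda>x. of_real \<mu> * partial_x (\<lambda>y. (us t y)\<^sup>2) x + of_real \<nu> * partial_x (\<lambda>y. (us t y)^3) x + of_real (aj 0 x) * us t x"
  shows "g \<in> L2" "abs_l2 g = W t"
proof -
  note p = partial_us[OF t]
  have a: "(\<lambda>x. of_real (aj 0 x) * us t x) \<in> L2" by (intro bmul_L2 bmul_a us_L2 t)
  have m: "(\<lambda>x. of_real \<mu> * partial_x (\<lambda>y. (us t y)\<^sup>2) x) \<in> L2" "(\<lambda>x. of_real \<nu> * partial_x (\<lambda>y. (us t y)^3) x) \<in> L2"
    by (intro L2_cmult p)+
  show "g \<in> L2" unfolding g_def by (intro L2_add m a)
  have "abs_l2 (\<lambda>x. of_real (aj 0 x) * us t x) = am (U t)"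
    by (simp add: am_def abs_us[OF t, symmetric] mul_abs bmul_a us_L2 t)
  then show "abs_l2 g = W t"
    unfolding g_def abs_add[OF L2_add[OF m] a] abs_add[OF m] W_def
    using abs_scaleR[OF p(1), of \<mu>] abs_scaleR[OF p(3), of \<nu>] by (simp add: scaleR_conv_of_real p)
qed

end

text \<open>The choice in \<open>S_op\<close> is determined up to null sets by injectivity of the
  transform.\<close>

lemma S_op_Sop:
  assumes f: "f \<in> L2"
  shows "S_op \<alpha> \<beta> t f \<in> L2" "abs_l2 (S_op \<alpha> \<beta> t f) = Sop \<alpha> \<beta> t (abs_l2 f)"
proof -
  let ?h = "\<lambda>\<xi>. phase \<alpha> \<beta> t \<xi> * fourier f \<xi>"
  have h: "?h \<in> L2" by (intro bmul_L2 bmul_phase fourier_L2 f)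
  have ah: "abs_l2 ?h = Fop (Sop \<alpha> \<beta> t (abs_l2 f))"
    by (simp add: Sop_def abs_fourier[OF f, symmetric] mul_abs bmul_phase fourier_L2 f)
  have "has_fourier (rep_l2 (Sop \<alpha> \<beta> t (abs_l2 f))) ?h" by (simp add: has_fourier_iff h ah)
  then have *: "has_fourier (S_op \<alpha> \<beta> t f) ?h" unfolding S_op_def phase_def[symmetric] by (rule someI[of "\<lambda>g. has_fourier g ?h"])
  then show L: "S_op \<alpha> \<beta> t f \<in> L2" by (simp add: has_fourier_def)
  with * show "abs_l2 (S_op \<alpha> \<beta> t f) = Sop \<alpha> \<beta> t (abs_l2 f)"
    by (simp add: has_fourier_iff h ah Fop_eq_iff)
qed

context kawahara_data
begin

text \<open>The final radius \<open>min r 1 / 4\<close> is half of what \<open>gev_bound\<close>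
  provides; the other half is spent on interpolation with the \<open>L2\<close> norm.\<close>

lemma us_gev: "t \<ge> 0 \<Longrightarrow> gev (2 * (min r 1 / 4)) (2 * sqrt (2 * pi) * sqrt Mb) (U t)"
  using gev_bound[of "U t"] U_facts(2)[of t] by simp

lemma us_C_G: "us \<in> C_G T (min r 1 / 4)"
proof -
  define \<sigma> where "\<sigma> = min r 1 / 4"
  define C where "C = 2 * sqrt (2 * pi) * sqrt Mb"
  note g = us_gev[folded \<sigma>_def C_def]
  have "((\<lambda>s. G_norm \<sigma> (\<lambda>x. us s x - us t x)) \<longlongrightarrow> 0) (at t within {0..T})" if t: "t \<in> {0..T}" for t
  proof -
    have "(U \<longlongrightarrow> U t) (at t within {0..T})" using U_cont[of T] t by (auto simp: continuous_on_def)
    then have "((\<lambda>s. sqrt (sqrt (2 * pi) * norm (U s - U t) * (C + C))) \<longlongrightarrow> sqrt (sqrt (2 * pi) * norm (U t - U t) * (C + C))) (at t within {0..T})"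
      by (intro tendsto_intros)
    then have z: "((\<lambda>s. sqrt (sqrt (2 * pi) * norm (U s - U t) * (C + C))) \<longlongrightarrow> 0) (at t within {0..T})" by simp
    have "norm (G_norm \<sigma> (\<lambda>x. us s x - us t x)) \<le> sqrt (sqrt (2 * pi) * norm (U s - U t) * (C + C))" if s: "s \<in> {0..T}" for s
    proof -
      have L: "us s \<in> L2" "us t \<in> L2" using s t by (auto intro: us_L2)
      have a: "abs_l2 (\<lambda>x. us s x - us t x) = U s - U t" using s t by (simp add: abs_diff[OF L] abs_us)
      have "gev (2 * \<sigma>) (C + C) (U s - U t)" using s t by (intro gev_diff g) auto
      then have "(G_norm \<sigma> (\<lambda>x. us s x - us t x))\<^sup>2 \<le> sqrt (2 * pi) * norm (U s - U t) * (C + C)"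
        using gev_G(2)[OF L2_diff[OF L], of \<sigma> "C + C"] by (simp only: a)
      then show ?thesis using G_norm_nonneg by (auto intro: real_le_rsqrt)
    qed
    then have "\<forall>\<^sub>F s in at t within {0..T}. norm (G_norm \<sigma> (\<lambda>x. us s x - us t x)) \<le> sqrt (sqrt (2 * pi) * norm (U s - U t) * (C + C))"
      unfolding eventually_at_filter by (intro always_eventually) auto
    from Lim_null_comparison[OF this z] show ?thesis .
  qed
  moreover have "us t \<in> G_space \<sigma>" if "t \<in> {0..T}" for t
    using that g[of t] by (intro gev_G(1)[where C=C] us_L2) (auto simp: abs_us)
  ultimately show ?thesis unfolding C_G_def \<sigma>_def[symmetric] by blast
qed

lemma us_decay: "\<exists>C>0. \<forall>t\<ge>0. G_norm (min r 1 / 4) (us t) \<le> C * exp (- \<gamma> * t / 2)"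
proof -
  define \<sigma> where "\<sigma> = min r 1 / 4"
  define C where "C = 2 * sqrt (2 * pi) * sqrt Mb"
  note g = us_gev[folded \<sigma>_def C_def]
  have C0: "C \<ge> 0" using Mb_nonneg by (simp add: C_def)
  define K where "K = sqrt (2 * pi) * norm u0 * C"
  have K0: "K \<ge> 0" using C0 by (simp add: K_def)
  have "G_norm \<sigma> (us t) \<le> (sqrt K + 1) * exp (- \<gamma> * t / 2)" if t: "t \<ge> 0" for t
  proof -
    have "(G_norm \<sigma> (us t))\<^sup>2 \<le> sqrt (2 * pi) * norm (U t) * C"
      using gev_G(2)[OF us_L2[OF t], of \<sigma> C] g[OF t] by (simp only: abs_us[OF t])
    also have "\<dots> \<le> sqrt (2 * pi) * (exp (- \<gamma> * t) * norm u0) * C"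
      using C0 by (intro mult_right_mono mult_left_mono U_facts t) auto
    also have "\<dots> = (sqrt K * exp (- \<gamma> * t / 2))\<^sup>2"
      using K0 by (simp add: power_mult_distrib exp_double[symmetric]) (simp add: K_def)
    finally have "G_norm \<sigma> (us t) \<le> sqrt K * exp (- \<gamma> * t / 2)" by (rule power2_le_imp_le) (use K0 in simp)
    \<comment> \<open>The added one keeps the constant positive for vanishing data.\<close>
    also have "\<dots> \<le> (sqrt K + 1) * exp (- \<gamma> * t / 2)" by (intro mult_right_mono) auto
    finally show ?thesis .
  qed
  moreover have "sqrt K + 1 > 0" using K0 by (simp add: add_nonneg_pos)
  ultimately show ?thesis unfolding \<sigma>_def[symmetric] by blast
qed

lemma us_solution:
  assumes v: "v \<in> L2" "abs_l2 v = u0"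
  shows "solution \<alpha> \<beta> \<mu> \<nu> (aj 0) v (min r 1 / 4) T us"
  unfolding solution_def
proof (intro conjI us_C_G ballI)
  fix t assume "t \<in> {0..T}"
  then have t: "t \<ge> 0" by simp
  define g where "g s x = of_real \<mu> * partial_x (\<lambda>y. (us s y)\<^sup>2) x + of_real \<nu> * partial_x (\<lambda>y. (us s y)^3) x + of_real (aj 0 x) * us s x" for s x
  have g: "g s \<in> L2" "abs_l2 (g s) = W s" if "s \<ge> 0" for s
    unfolding g_def using forcing[OF that] by simp_all
  define I where "I = rep_l2 (Sop \<alpha> \<beta> t u0 - U t)"
  have I: "I \<in> L2" "abs_l2 I = Sop \<alpha> \<beta> t u0 - U t" by (simp_all add: I_def)
  have "has_L2_integral (\<lambda>s. S_op \<alpha> \<beta> (t - s) (g s)) I 0 t"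
  proof (subst has_L2_integral_iff)
    show "((\<lambda>s. abs_l2 (S_op \<alpha> \<beta> (t - s) (g s))) has_integral abs_l2 I) {0..t}"
      by (rule has_integral_eq[OF _ duhamel[OF t, folded I(2)]]) (simp add: S_op_Sop g)
  qed (auto intro: S_op_Sop g I)
  moreover have "AE x in lborel. us t x = S_op \<alpha> \<beta> t v x - I x"
  proof (rule abs_eq_iff[THEN iffD1])
    show "abs_l2 (us t) = abs_l2 (\<lambda>x. S_op \<alpha> \<beta> t v x - I x)"
      by (simp add: abs_diff S_op_Sop v I abs_us[OF t])
  qed (auto intro!: us_L2 t L2_diff S_op_Sop v I)
  ultimately show "\<exists>I. has_L2_integral (\<lambda>t'. S_op \<alpha> \<beta> (t - t')
      (\<lambda>x. of_real \<mu> * partial_x (\<lambda>y. (us t' y)\<^sup>2) x + of_real \<nu> * partial_x (\<lambda>y. (us t' y) ^ 3) x + of_real (aj 0 x) * us t' x)) I 0 t \<and>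
      (AE x in lborel. us t x = S_op \<alpha> \<beta> t v x - I x)"
    unfolding g_def by blast
qed

end

section \<open>From the stated hypotheses to the setting of the proof\<close>

text \<open>For a continuous function the set where a value exceeds the essential supremum is open,
  and a nonempty open set is not a null set.\<close>

lemma Linf_bound:
  assumes c: "continuous_on UNIV f" and fin: "Linf_norm f < \<infinity>"
  shows "\<bar>f x\<bar> \<le> enn2real (Linf_norm f)"
proof (rule ccontr)
  let ?L = "enn2real (Linf_norm f)"
  assume "\<not> \<bar>f x\<bar> \<le> ?L"
  let ?S = "{x. ?L < \<bar>f x\<bar>}"
  have "open ?S" by (intro open_Collect_less continuous_intros c)
  moreover have "x \<in> ?S" using \<open>\<not> \<bar>f x\<bar> \<le> ?L\<close> by simp
  ultimately have nn: "\<not> negligible ?S" using open_not_negligible by blast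
  have "AE x in lborel. ennreal \<bar>f x\<bar> \<le> Linf_norm f" unfolding Linf_norm_def by (rule esssup_AE)
  moreover have "ennreal ?L = Linf_norm f" using fin by (simp add: less_top[symmetric])
  ultimately have "AE x in lborel. ennreal \<bar>f x\<bar> \<le> ennreal ?L" by (simp only:)
  then have "AE x in lborel. \<bar>f x\<bar> \<le> ?L" by eventually_elim (simp only: ennreal_le_iff enn2real_nonneg)
  then have "AE x in lborel. x \<notin> ?S" by eventually_elim auto
  then have "?S \<in> null_sets lborel"
    using \<open>open ?S\<close> by (subst AE_iff_null_sets) auto
  then have "negligible ?S" by (simp add: negligible_iff_null_sets null_sets_completionI)
  with nn show False by simp
qed

text \<open>Dependence on the norm alone is expressed by choosing \<open>\<sigma>1\<close> after
  \<open>R\<close> but before the data. One function \<open>u\<close> serves all \<open>T\<close>,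
  so \<open>C\<close> cannot depend on \<open>T\<close>.\<close>

theorem theorem1p3:
  fixes \<alpha> \<beta> \<mu> \<nu> \<sigma>0 \<gamma> R :: real and a :: "real \<Rightarrow> real"
  assumes "\<alpha> \<noteq> 0" and "\<sigma>0 > 0"
    and "smooth a"
    and A1: "\<gamma> > 0" "\<And>x. a x \<ge> \<gamma>"
    and A2: "(\<Sum>k. ennreal ((real k + 1) powr (1/4) * (\<sigma>0 ^ k / fact k)) * Linf_norm ((deriv ^^ k) a)) < \<infinity>"
  shows "\<exists>\<sigma>1>0. \<forall>u0. u0 \<in> G_space \<sigma>0 \<and> (AE x in lborel. u0 x \<in> \<real>) \<and> G_norm \<sigma>0 u0 = R \<longrightarrow>
    (\<exists>u. (\<forall>T>0. solution \<alpha> \<beta> \<mu> \<nu> a u0 \<sigma>1 T u) \<and>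
         (\<exists>C>0. \<forall>t\<ge>0. G_norm \<sigma>1 (u t) \<le> C * exp (- \<gamma> * t / 2)))"
proof -
  define aj where "aj k = (deriv ^^ k) a" for k
  define Ak where "Ak k = enn2real (Linf_norm (aj k))" for k
  have ch: "chain aj" unfolding aj_def using chain_smooth[OF \<open>smooth a\<close>] .
  \<comment> \<open>Each coefficient of the series is positive, so one infinite norm would make the
    sum infinite.\<close>
  have fin: "Linf_norm (aj k) < \<infinity>" for k
  proof (rule ccontr)
    let ?c = "\<lambda>k. (real k + 1) powr (1/4) * (\<sigma>0 ^ k / fact k)"
    assume "\<not> Linf_norm (aj k) < \<infinity>"
    then have "Linf_norm (aj k) = top" by (simp add: less_top[symmetric])
    then have "ennreal (?c k) * Linf_norm (aj k) = top"
      using \<open>\<sigma>0 > 0\<close> by (simp add: ennreal_mult_top)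
    moreover have "(\<Sum>k\<in>{k}. ennreal (?c k) * Linf_norm (aj k)) \<le> (\<Sum>k. ennreal (?c k) * Linf_norm (aj k))"
      by (intro sum_le_suminf summableI) auto
    ultimately show False using A2 by (simp add: aj_def top_unique)
  qed
  have L: "Linf_norm (aj k) = ennreal (Ak k)" for k using fin[of k] by (simp add: Ak_def less_top[symmetric])
  have Ak0: "Ak k \<ge> 0" for k by (simp add: Ak_def)
  have "(\<Sum>k. ennreal ((real k + 1) powr (1/4) * (\<sigma>0 ^ k / fact k) * Ak k)) \<noteq> top"
    using A2 \<open>\<sigma>0 > 0\<close> unfolding aj_def[symmetric] L by (simp add: ennreal_mult[symmetric] Ak0 less_top)
  then have "summable (\<lambda>k. (real k + 1) powr (1/4) * (\<sigma>0 ^ k / fact k) * Ak k)"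
    using \<open>\<sigma>0 > 0\<close> Ak0 by (intro summable_suminf_not_top) auto
  then have sm: "summable (\<lambda>k. \<sigma>0 ^ k / fact k * Ak k)"
  proof (rule summable_comparison_test')
    fix k :: nat
    have "1 \<le> (real k + 1) powr (1/4)" by (simp add: ge_one_powr_ge_zero)
    moreover have "0 \<le> \<sigma>0 ^ k / fact k * Ak k" using \<open>\<sigma>0 > 0\<close> Ak0 by simp
    ultimately show "norm (\<sigma>0 ^ k / fact k * Ak k) \<le> (real k + 1) powr (1/4) * (\<sigma>0 ^ k / fact k) * Ak k"
      using mult_right_mono by fastforce
  qed
  interpret kawahara \<alpha> \<beta> \<mu> \<nu> \<sigma>0 \<gamma> aj Ak
  proof
    show "aj 0 x \<ge> \<gamma>" for x using A1 by (simp add: aj_def)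
    show "\<bar>aj k x\<bar> \<le> Ak k" for k x
      unfolding Ak_def using chain_isCont[OF ch] by (intro Linf_bound fin) (simp add: continuous_on_eq_continuous_at)
  qed (use assms ch sm in auto)
  \<comment> \<open>\<open>R\<close> may be any real number; it equals \<open>R'\<close> as soon as
    some datum has norm \<open>R\<close>.\<close>
  define R' where "R' = max R 0"
  have R': "R' \<ge> 0" by (simp add: R'_def)
  \<comment> \<open>The radius is obtained here, before any datum is fixed.\<close>
  obtain r Mb where r: "r > 0" and Y: "\<And>u0 N K t. admissible R' u0 \<Longrightarrow> N \<ge> 0 \<Longrightarrow> K \<ge> 3 \<Longrightarrow> t \<ge> 0 \<Longrightarrow> Yg N r K (gal N u0 t) \<le> Mb"
    using gevrey_bound[OF R'] by blast
  show ?thesis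
  proof (intro exI[of _ "min r 1 / 4"] conjI allI impI, goal_cases)
    case 1
    show ?case using r by simp
  next
    case (2 u0)
    then have u0: "u0 \<in> G_space \<sigma>0" "AE x in lborel. u0 x \<in> \<real>" "G_norm \<sigma>0 u0 = R" by auto
    have RR: "G_norm \<sigma>0 u0 = R'" using G_norm_nonneg[of \<sigma>0 u0] u0(3) by (simp add: R'_def)
    note g = G_space_abs[OF u0(1), unfolded RR]
    have "cj (abs_l2 u0) = abs_l2 u0"
      unfolding cj_abs[OF g(1)] abs_eq_iff[OF L2_cnj[OF g(1)] g(1)] using u0(2) by eventually_elim (simp add: Reals_cnj_iff)
    then have adm: "admissible R' (abs_l2 u0)"
      unfolding admissible_def using gev_deriv[OF \<open>\<sigma>0 > 0\<close> g(2)] by blast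
    interpret D: kawahara_data \<alpha> \<beta> \<mu> \<nu> \<sigma>0 \<gamma> aj Ak R' r Mb "abs_l2 u0"
      by unfold_locales (use R' adm r Y[OF adm] in auto)
    have "aj 0 = a" by (simp add: aj_def)
    then have "\<forall>T>0. solution \<alpha> \<beta> \<mu> \<nu> a u0 (min r 1 / 4) T D.us" using D.us_solution[OF g(1) refl] by simp
    then show ?case using D.us_decay by blast
  qed
qed

end
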